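(* For any positive integer $n$, $$\Delta_{e_1} e_n = \mathrm{Rise}_{n,0}(x;q,t) + \mathrm{Rise}_{n,1}(x;q,t) = \sum_{m=0}^{\lfloor n/2\rfloor} s_{2^m,1^{n-2m}} \sum_{p=m}^{n-m} [p]_{q,t},$$ where $[p]_{q,t}=\sum_{i=0}^{p-1} q^i t^{p-i-1}$ with the convention that $[0]_{q,t}=1$. This verifies the $k=1$ case of the Rise Version of the Delta Conjecture, i.e. $\Delta'_{e_1}e_n=\mathrm{Rise}_{n,1}(x;q,t)$ for $n>1$.
   Context: $\Lambda$ is the ring of symmetric functions in $x_1,x_2,\ldots$ over $\mathbb{Q}(q,t)$; $e_n$, $s_\lambda$ are elementary and Schur functions; $(2^m,1^{n-2m})$ is the partition with $m$ parts equal to $2$ and $n-2m$ parts equal to $1$. $\tilde H_\mu$ are the modified Macdonald polynomials (a basis of $\Lambda$), characterized by: $\tilde H_\mu[X(1-q)]$ is in the span of $\{s_\lambda:\lambda\ge\mu\}$, $\tilde H_\mu[X(1-t)]$ is in the span of $\{s_\lambda:\lambda\ge\mu'\}$ (dominance order), and $\langle\tilde H_\mu,s_{(n)}\rangle=1$ for $\mu\vdash n$; for example $\tilde H_{(2)}=s_2+q s_{1,1}$, $\tilde H_{(1,1)}=s_2+t s_{1,1}$. For a cell $c$ of the Young diagram of $\mu$ (French notation), $a'(c)$ and $\ell'(c)$ are the numbers of cells of $\mu$ strictly to the left of $c$ (in its row) and strictly below $c$ (in its column). $B_\mu(q,t)=\sum_{c\in\mu}q^{a'(c)}t^{\ell'(c)}$.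 For $f\in\Lambda$, linear operators on $\Lambda$ are defined by $\Delta_f\tilde H_\mu=f[B_\mu(q,t)]\tilde H_\mu$ and $\Delta'_f\tilde H_\mu=f[B_\mu(q,t)-1]\tilde H_\mu$, where $f[A]$, for a sum $A$ of monomials, is the evaluation of $f$ at those monomials (remaining variables set to $0$). A Dyck path of order $n$ is a lattice path of north and east unit steps from $(0,0)$ to $(n,n)$ staying weakly above $y=x$. A labeled Dyck path $P\in\mathcal{LD}_n$ is a Dyck path of order $n$ whose north steps are labeled by positive integers (repetitions allowed) that strictly increase going up each column. Rows are numbered $1,\ldots,n$ from bottom to top; $\ell_i(P)$ is the label of row $i$; $a_i(P)$ is the number of full squares in row $i$ between the path and the diagonal (so $a_i=(i-1)-x_i$, where $x_i$ is the $x$-coordinate of the $i$th north step). $\mathrm{area}(P)=\sum_i a_i(P)$, $\mathrm{dinv}(P)=\sum_i d_i(P)$ with $$d_i(P)=|\{i<j\le n: a_i=a_j,\ \ell_i<\ell_j\}|+|\{i<j\le n: a_i=a_j+1,\ \ell_i>\ell_j\}|,$$ and $x^P=\prod_{i=1}^n x_{\ell_i(P)}$. Then $$\mathrm{Rise}_{n,k}(x;q,t)=\Big(\sum_{P\in\mathcal{LD}_n}q^{\mathrm{dinv}(P)}t^{\mathrm{area}(P)}\prod_{2\le i\le n:\ a_i(P)>a_{i-1}(P)}\big(1+z/t^{a_i(P)}\big)x^P\Big)\Big|_{z^{n-k-1}},$$ the coefficient of $z^{n-k-1}$ (which is $0$ if $n-k-1<0$). The Rise Version of the Delta Conjecture asserts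 $\Delta'_{e_k}e_n=\mathrm{Rise}_{n,k}(x;q,t)$ for integers $n>k\ge 0$.
   Formalization: The convention [0]_{q,t}=1 is replaced by [0]_{q,t}=0 (the empty sum), since with the value 1 the Schur expansion is false: for n=1 it would give 2s_1 instead of Δ_{e_1}e_1=s_1. *)

theory Defs
  imports
    "HOL-Computational_Algebra.Polynomial"
    "HOL-Computational_Algebra.Fraction_Field"
    "HOL-Library.Multiset"
begin

section \<open>The coefficient field\<close>

text \<open>The field \<open>\<rat>(q,t)\<close>, as the fraction field of \<open>\<rat>[q][t]\<close>.\<close>

type_synonym qt_field = "rat poly poly fract"

definition qv :: qt_field where
  "qv = Fract [:[:0, 1:]:] 1"

definition tv :: qt_field where
  "tv = Fract [:0, 1:] 1"


section \<open>Formal power series in countably many variables\<close>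

text \<open>
  The variables are \<open>x\<^sub>0, x\<^sub>1, x\<^sub>2, \<dots>\<close>, so the index \<open>i\<close> here is the index \<open>i + 1\<close> of the usual
  \<open>x\<^sub>1, x\<^sub>2, \<dots>\<close>. A monomial is the multiset of the indices of its variables, counted with their
  exponents; \<open>coef f M\<close> is the coefficient of the monomial \<open>M\<close> in \<open>f\<close>.
\<close>

typedef 'a series = "UNIV :: (nat multiset \<Rightarrow> 'a) set"
  morphisms coef Series ..

setup_lifting type_definition_series

lemma coef_Series [simp]: "coef (Series f) = f"
  by (simp add: Series_inverse)

lemma series_eqI: "(\<And>M. coef f M = coef g M) \<Longrightarrow> f = g"
  by (metis coef_inject ext)

lemma finite_submultisets [simp]: "finite {A. A \<subseteq># M}"
proof (induction M)
  case (add x M)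
  have "{A. A \<subseteq># add_mset x M} \<subseteq> {A. A \<subseteq># M} \<union> add_mset x ` {A. A \<subseteq># M}"
  proof
    fix A assume A: "A \<in> {A. A \<subseteq># add_mset x M}"
    show "A \<in> {A. A \<subseteq># M} \<union> add_mset x ` {A. A \<subseteq># M}"
    proof (cases "x \<in># A")
      case True
      then obtain B where "A = add_mset x B" by (metis multi_member_split)
      with A show ?thesis by auto
    next
      case False
      then have "A - {#x#} = A" by simp
      with A have "A \<subseteq># M" by (metis add_mset_add_single mem_Collect_eq subset_eq_diff_conv)
      then show ?thesis by simp
    qed
  qed
  with add.IH show ?case by (meson finite_UnI finite_imageI finite_subset)
qed simp

instantiation series :: (comm_ring_1) comm_ring_1
begin

definition "0 = Series (\<lambda>_. 0)"
definition "1 = Series (\<lambda>M. if M = {#} then 1 else 0)"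
definition "f + g = Series (\<lambda>M. coef f M + coef g M)"
definition "f - g = Series (\<lambda>M. coef f M - coef g M)"
definition "- f = Series (\<lambda>M. - coef f M)"
definition "f * g = Series (\<lambda>M. \<Sum>A | A \<subseteq># M. coef f A * coef g (M - A))"

lemma coef_zero [simp]: "coef 0 M = 0"
  and coef_one: "coef 1 M = (if M = {#} then 1 else 0)"
  and coef_add [simp]: "coef (f + g) M = coef f M + coef g M"
  and coef_minus [simp]: "coef (f - g) M = coef f M - coef g M"
  and coef_uminus [simp]: "coef (- f) M = - coef f M"
  and coef_times: "coef (f * g) M = (\<Sum>A | A \<subseteq># M. coef f A * coef g (M - A))"
  for f g :: "'a series"
  by (simp_all add: zero_series_def one_series_def plus_series_def minus_series_def
      uminus_series_def times_series_def)

instance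
proof
  fix f g h :: "'a series"
  show "f + g + h = f + (g + h)" "f + g = g + f" "0 + f = f" "- f + f = 0" "f - g = f + - g"
    by (auto intro!: series_eqI)
  show "(f + g) * h = f * h + g * h"
    by (auto intro!: series_eqI simp: coef_times ring_distribs sum.distrib)
  show "(0 :: 'a series) \<noteq> 1"
  proof
    assume "(0 :: 'a series) = 1"
    then have "coef (0 :: 'a series) {#} = coef 1 {#}" by simp
    then show False by (simp add: coef_one)
  qed
  show "f * g = g * f"
  proof (rule series_eqI)
    fix M
    show "coef (f * g) M = coef (g * f) M"
      unfolding coef_times
      by (rule sum.reindex_bij_witness[of _ "\<lambda>A. M - A" "\<lambda>A. M - A"])
        (auto simp: multiset_diff_union_assoc subset_mset.diff_diff_right mult.commute)
  qed
  show "1 * f = f"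
  proof (rule series_eqI)
    fix M
    have "coef (1 * f) M = (\<Sum>A | A \<subseteq># M. if A = {#} then coef f M else 0)"
      unfolding coef_times by (rule sum.cong) (auto simp: coef_one)
    also have "\<dots> = coef f M" by (simp add: sum.delta)
    finally show "coef (1 * f) M = coef f M" .
  qed
  show "f * g * h = f * (g * h)"
  proof (rule series_eqI)
    fix M
    have "coef (f * g * h) M =
        (\<Sum>(A, B)\<in>Sigma {A. A \<subseteq># M} (\<lambda>A. {B. B \<subseteq># A}). coef f B * coef g (A - B) * coef h (M - A))"
      by (simp add: coef_times sum_distrib_right sum.Sigma)
    also have "\<dots> =
        (\<Sum>(B, C)\<in>Sigma {B. B \<subseteq># M} (\<lambda>B. {C. C \<subseteq># M - B}). coef f B * (coef g C * coef h (M - B - C)))"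
      by (rule sum.reindex_bij_witness[of _ "\<lambda>(B, C). (B + C, B)" "\<lambda>(A, B). (B, A - B)"])
        (auto simp: mult.assoc diff_diff_add_mset subset_mset.le_diff_conv2 add.commute
          intro: subset_mset.order_trans)
    also have "\<dots> = coef (f * (g * h)) M"
      by (simp add: coef_times sum_distrib_left sum.Sigma)
    finally show "coef (f * g * h) M = coef (f * (g * h)) M" .
  qed
qed

end

definition scale :: "'a::comm_ring_1 \<Rightarrow> 'a series \<Rightarrow> 'a series" where
  "scale c f = Series (\<lambda>M. c * coef f M)"

lemma coef_scale [simp]: "coef (scale c f) M = c * coef f M"
  by (simp add: scale_def)

interpretation series: vector_space "scale :: 'a::field \<Rightarrow> 'a series \<Rightarrow> 'a series"
  by unfold_locales (auto intro!: series_eqI simp: algebra_simps)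


section \<open>Partitions\<close>

text \<open>A partition is the weakly decreasing list of its (positive) parts.\<close>

definition partitions :: "nat list set" where
  "partitions = {\<mu>. sorted_wrt (\<ge>) \<mu> \<and> 0 \<notin> set \<mu>}"

definition conjugate :: "nat list \<Rightarrow> nat list" where
  "conjugate \<mu> = map (\<lambda>j. length (filter (\<lambda>p. j < p) \<mu>)) [0..<Max (insert 0 (set \<mu>))]"

definition dominates :: "nat list \<Rightarrow> nat list \<Rightarrow> bool" where
  "dominates \<nu> \<mu> \<longleftrightarrow> sum_list \<nu> = sum_list \<mu> \<and> (\<forall>k. sum_list (take k \<mu>) \<le> sum_list (take k \<nu>))"

definition row_partition :: "nat \<Rightarrow> nat list" where
  "row_partition n = (if n = 0 then [] else [n])"


section \<open>Symmetric functions\<close>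

definition sym_funs :: "'a::comm_ring_1 series set" where
  "sym_funs = {f. (\<exists>d. \<forall>M. coef f M \<noteq> 0 \<longrightarrow> size M \<le> d) \<and>
                  (\<forall>\<pi> M. bij \<pi> \<longrightarrow> coef f (image_mset \<pi> M) = coef f M)}"

definition elem :: "nat \<Rightarrow> 'a::comm_ring_1 series" where
  "elem n = Series (\<lambda>M. if size M = n \<and> (\<forall>i. count M i \<le> 1) then 1 else 0)"

text \<open>\<open>power_sum k\<close> is only meant for \<open>k > 0\<close>.\<close>

definition power_sum :: "nat \<Rightarrow> 'a::comm_ring_1 series" where
  "power_sum k = Series (\<lambda>M. if \<exists>i. M = replicate_mset k i then 1 else 0)"

definition power_sum_prod :: "nat list \<Rightarrow> 'a::comm_ring_1 series" where
  "power_sum_prod \<nu> = prod_list (map power_sum \<nu>)"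

text \<open>
  A semistandard tableau is the list of its rows; in French notation the row \<open>T ! Suc i\<close> lies on
  top of the row \<open>T ! i\<close>.
\<close>

definition ssyt :: "nat list \<Rightarrow> nat list list set" where
  "ssyt \<nu> = {T. map length T = \<nu> \<and> (\<forall>r\<in>set T. sorted r) \<and>
     (\<forall>i j. Suc i < length T \<and> j < length (T ! Suc i) \<longrightarrow> T ! i ! j < T ! Suc i ! j)}"

definition schur :: "nat list \<Rightarrow> 'a::comm_ring_1 series" where
  "schur \<nu> = Series (\<lambda>M. of_nat (card {T \<in> ssyt \<nu>. mset (concat T) = M}))"

text \<open>
  For a basis \<open>(b \<nu>)\<close> of the symmetric functions indexed by partitions: the coordinates of \<open>f\<close>,
  and the linear operator with \<open>b \<nu> \<mapsto> ev \<nu> b \<nu>\<close> for all \<open>\<nu>\<close>.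
\<close>

definition coord :: "(nat list \<Rightarrow> 'a::field series) \<Rightarrow> 'a series \<Rightarrow> nat list \<Rightarrow> 'a" where
  "coord b f \<nu> = series.representation (b ` partitions) f (b \<nu>)"

definition diag_op ::
    "(nat list \<Rightarrow> 'a::field series) \<Rightarrow> (nat list \<Rightarrow> 'a) \<Rightarrow> 'a series \<Rightarrow> 'a series" where
  "diag_op b ev f = (\<Sum>\<nu> | \<nu> \<in> partitions \<and> coord b f \<nu> \<noteq> 0. scale (coord b f \<nu> * ev \<nu>) (b \<nu>))"

text \<open>The Hall scalar product: the bilinear form for which the Schur functions are orthonormal.\<close>

definition hall :: "'a::field series \<Rightarrow> 'a series \<Rightarrow> 'a" where
  "hall f g = (\<Sum>\<nu> | \<nu> \<in> partitions \<and> coord schur f \<nu> \<noteq> 0. coord schur f \<nu> * coord schur g \<nu>)"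

text \<open>
  The plethystic substitution \<open>f[X(1 - u)]\<close>, that is, the algebra endomorphism
  \<open>p\<^sub>k \<mapsto> (1 - u\<^sup>k) p\<^sub>k\<close>, on the basis of the products \<open>p\<^sub>\<nu>\<close> of power sums.
\<close>

definition pleth_one_minus :: "'a::field \<Rightarrow> 'a series \<Rightarrow> 'a series" where
  "pleth_one_minus u = diag_op power_sum_prod (\<lambda>\<nu>. prod_list (map (\<lambda>k. 1 - u ^ k) \<nu>))"

text \<open>
  \<open>f[A]\<close> for a symmetric function \<open>f\<close> and the sum \<open>A\<close> of the entries of a list: the first
  \<open>length A\<close> variables take these values and the other variables are \<open>0\<close>. The sum is finite as
  \<open>f\<close> has bounded degree.
\<close>

definition eval_at :: "'a::comm_ring_1 series \<Rightarrow> 'a list \<Rightarrow> 'a" where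
  "eval_at f A = (\<Sum>M | set_mset M \<subseteq> {..<length A} \<and> coef f M \<noteq> 0.
     coef f M * prod_mset (image_mset (\<lambda>i. A ! i) M))"


section \<open>Modified Macdonald polynomials and Delta operators\<close>

text \<open>
  \<open>H\<close> is the family of the modified Macdonald polynomials. That exactly one such family exists
  (up to its values outside \<open>partitions\<close>), and that it is a basis of the symmetric functions, is a
  theorem of Macdonald.
\<close>

definition modified_macdonald :: "(nat list \<Rightarrow> qt_field series) \<Rightarrow> bool" where
  "modified_macdonald H \<longleftrightarrow> (\<forall>\<mu>\<in>partitions.
     H \<mu> \<in> sym_funs \<and>
     pleth_one_minus qv (H \<mu>) \<in> series.span (schur ` {\<nu> \<in> partitions. dominates \<nu> \<mu>}) \<and>
     pleth_one_minus tv (H \<mu>) \<in> series.span (schur ` {\<nu> \<in> partitions. dominates \<nu> (conjugate \<mu>)}) \<and>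
     hall (H \<mu>) (schur (row_partition (sum_list \<mu>))) = 1)"

text \<open>
  The monomials of \<open>B\<^sub>\<mu>\<close>: the cell in column \<open>j\<close> and row \<open>i\<close> (counted from \<open>0\<close>, rows from the
  bottom) has \<open>j\<close> cells to its left and \<open>i\<close> cells below it.
\<close>

definition B_monomials :: "nat list \<Rightarrow> qt_field list" where
  "B_monomials \<mu> = [qv ^ j * tv ^ i. i \<leftarrow> [0..<length \<mu>], j \<leftarrow> [0..<\<mu> ! i]]"

definition Delta ::
    "(nat list \<Rightarrow> qt_field series) \<Rightarrow> qt_field series \<Rightarrow> qt_field series \<Rightarrow> qt_field series" where
  "Delta H f = diag_op H (\<lambda>\<mu>. eval_at f (B_monomials \<mu>))"

text \<open>
  \<open>B\<^sub>\<mu> - 1\<close> is the sum of the monomials other than that of the corner cell. For the empty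
  partition, where \<open>B\<^sub>\<mu> - 1 = -1\<close> is not a sum of monomials, the eigenvalue below is the value of \<open>f\<close> at \<open>0\<close>;
  this only concerns the constant term of the argument of the operator.
\<close>

definition Delta' ::
    "(nat list \<Rightarrow> qt_field series) \<Rightarrow> qt_field series \<Rightarrow> qt_field series \<Rightarrow> qt_field series" where
  "Delta' H f = diag_op H (\<lambda>\<mu>. eval_at f (remove1 1 (B_monomials \<mu>)))"


section \<open>Labeled Dyck paths\<close>

datatype step = North | East

definition dyck_path :: "nat \<Rightarrow> step list \<Rightarrow> bool" where
  "dyck_path n w \<longleftrightarrow> count_list w North = n \<and> count_list w East = n \<and>
     (\<forall>j\<le>length w. count_list (take j w) East \<le> count_list (take j w) North)"

text \<open>\<open>north_xs 0 w\<close> lists the \<open>x\<close>-coordinates of the north steps of \<open>w\<close>, from bottom to top.\<close>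

fun north_xs :: "nat \<Rightarrow> step list \<Rightarrow> nat list" where
  "north_xs x [] = []"
| "north_xs x (North # w) = x # north_xs x w"
| "north_xs x (East # w) = north_xs (Suc x) w"

text \<open>
  Rows are numbered \<open>0, \<dots>, n - 1\<close> from bottom to top. The label \<open>i\<close> stands for the positive integer
  \<open>i + 1\<close>, as for the variables. Two rows are in the same column if their north steps have the
  same \<open>x\<close>-coordinate.
\<close>

definition labeled_dyck :: "nat \<Rightarrow> (step list \<times> nat list) set" where
  "labeled_dyck n = {(w, l). dyck_path n w \<and> length l = n \<and>
     (\<forall>i j. i < j \<and> j < n \<and> north_xs 0 w ! i = north_xs 0 w ! j \<longrightarrow> l ! i < l ! j)}"

definition row_area :: "step list \<Rightarrow> nat \<Rightarrow> nat" where
  "row_area w i = i - north_xs 0 w ! i"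

definition area :: "nat \<Rightarrow> step list \<Rightarrow> nat" where
  "area n w = (\<Sum>i<n. row_area w i)"

definition row_dinv :: "nat \<Rightarrow> step list \<Rightarrow> nat list \<Rightarrow> nat \<Rightarrow> nat" where
  "row_dinv n w l i =
     card {j. i < j \<and> j < n \<and> row_area w i = row_area w j \<and> l ! i < l ! j} +
     card {j. i < j \<and> j < n \<and> row_area w i = row_area w j + 1 \<and> l ! i > l ! j}"

definition dinv :: "nat \<Rightarrow> step list \<Rightarrow> nat list \<Rightarrow> nat" where
  "dinv n w l = (\<Sum>i<n. row_dinv n w l i)"

text \<open>The product over the double rises, a polynomial in \<open>z\<close>.\<close>

definition rise_poly :: "nat \<Rightarrow> step list \<Rightarrow> qt_field poly" where
  "rise_poly n w =
     (\<Prod>i | 1 \<le> i \<and> i < n \<and> row_area w i > row_area w (i - 1). [:1, 1 / tv ^ row_area w i:])"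

definition Rise :: "nat \<Rightarrow> nat \<Rightarrow> qt_field series" where
  "Rise n k = Series (\<lambda>M. if k < n
     then \<Sum>(w, l) \<in> {(w, l) \<in> labeled_dyck n. mset l = M}.
            qv ^ dinv n w l * tv ^ area n w * coeff (rise_poly n w) (n - k - 1)
     else 0)"


section \<open>The \<open>(q,t)\<close>-integers\<close>

text \<open>
  \<open>[0]\<^sub>q\<^sub>,\<^sub>t\<close> is the empty sum \<open>0\<close>. It occurs as the summand \<open>m = p = 0\<close> of the Schur expansion of
  \<open>\<Delta>\<^bsub>e\<^sub>1\<^esub> e\<^sub>n\<close>; the value \<open>0\<close> is needed there, as \<open>\<Delta>\<^bsub>e\<^sub>1\<^esub> e\<^sub>1 = e\<^sub>1 = ([0] + [1]) s\<^sub>1\<close> shows.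
\<close>

definition qt_int :: "nat \<Rightarrow> qt_field" where
  "qt_int p = (\<Sum>i<p. qv ^ i * tv ^ (p - i - 1))"

end

theory Submission
  imports Defs "HOL-Computational_Algebra.Formal_Power_Series"
begin

text \<open>
  With \<open>M = (1 - q) (1 - t)\<close>, the identity minus \<open>M \<Delta>\<close> for \<open>e\<^sub>1\<close> is the operator taking \<open>F\<close> to the
  coefficient of \<open>z\<^sup>0\<close> in \<open>F[X + M / z] \<Sum>\<^sub>k (- z)\<^sup>k e\<^sub>k\<close>. Indeed, after the substitution
  \<open>X (1 - q)\<close> this operator is triangular with respect to dominance on the products of the \<open>h\<^sub>k\<close>, and
  likewise for \<open>X (1 - t)\<close>; by the Pieri rule these triangularities are those in the
  characterization of the modified Macdonald polynomials, which together determine an eigenline with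
  eigenvalue \<open>1 - M B\<^sub>\<mu>\<close>. Evaluated in this form, \<open>\<Delta>\<close> takes \<open>e\<^sub>n\<close> to the sum of
  \<open>[k]\<^bsub>q,t\<^esub> e\<^sub>k e\<^bsub>n-k\<^esub>\<close> over \<open>1 \<le> k \<le> n\<close>, and \<open>e\<^sub>k e\<^bsub>n-k\<^esub>\<close> is a sum of Schur functions of two-column shapes.

  On the combinatorial side only Dyck paths with at most two columns contribute. The dinv statistic
  of such a path counts crossings of a lattice path recording the column of each label, whose
  distribution follows from the reflection principle.
\<close>

text \<open>Plethysm is given by coordinates in the power sums, triangularity lives on products of
  the h_k, and Schur functions enter as tableau counts. This is why power sum products are shown to
  be a basis, generating functions are compared through Newton's identities, and the Pieri rule is
  derived from tableaux. The eigenvalue determines \<mu>, as B_\<mu> records the cells of the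
  diagram; this isolates the eigenline and also makes the H_\<mu> independent, which the
  characterization does not state. The coefficient of z^(n-k-1) with k \<le> 1 needs at least n - 2
  double rises, so at most one row above the bottom one starts a new column. Both sides are compared
  at a fixed monomial of degree n. With \<epsilon>_a its coefficient in e_a e_(n-a), the crossing
  generating function for a first column of length a is linear in \<epsilon>_a and later
  \<epsilon>_k, so the claim becomes a polynomial identity in q and t with unknowns \<epsilon>_k
  rather than a bijection.\<close>

section \<open>Scalars, and closure properties of the symmetric functions\<close>

lemma scale_conv_mult: "scale c f = scale c 1 * f"
proof (rule series_eqI)
  fix M
  have "coef (scale c 1 * f) M = (\<Sum>A | A \<subseteq># M. if A = {#} then c * coef f M else 0)"
    unfolding coef_times by (rule sum.cong) (auto simp: coef_one)
  also have "\<dots> = c * coef f M" by (simp add: sum.delta)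
  finally show "coef (scale c f) M = coef (scale c 1 * f) M" by simp
qed

lemma scale_mult_left: "scale c f * g = scale c (f * g)"
  by (metis scale_conv_mult mult.assoc)

lemma scale_mult_right: "f * scale c g = scale c (f * g)"
  by (metis scale_mult_left mult.commute)

lemma scale_scale_ring [simp]: "scale c (scale d f) = scale (c * d) f"
  by (rule series_eqI) (simp add: mult.assoc)

lemma scale_one_ring [simp]: "scale 1 f = f"
  by (rule series_eqI) simp

lemma scale_zero_ring [simp]: "scale 0 f = 0"
  by (rule series_eqI) simp

lemma coef_sum [simp]: "coef (sum f A) M = (\<Sum>x\<in>A. coef (f x) M)"
  by (induction A rule: infinite_finite_induct) auto

lemma subset_image_mset_inv:
  fixes \<pi> :: "'b \<Rightarrow> 'b"
  assumes "bij \<pi>"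
  shows "{A. A \<subseteq># image_mset \<pi> M} = image_mset \<pi> ` {A. A \<subseteq># M}"
proof -
  have inv: "image_mset (inv \<pi>) (image_mset \<pi> X) = X" "image_mset \<pi> (image_mset (inv \<pi>) X) = X" for X :: "'b multiset"
    using assms by (simp_all add: multiset.map_comp bij_is_inj bij_is_surj comp_def surj_f_inv_f)
  show ?thesis
  proof (intro set_eqI iffI)
    fix A assume "A \<in> {A. A \<subseteq># image_mset \<pi> M}"
    then have "image_mset (inv \<pi>) A \<subseteq># M"
      using image_mset_subseteq_mono[of A "image_mset \<pi> M" "inv \<pi>"] inv by simp
    then show "A \<in> image_mset \<pi> ` {A. A \<subseteq># M}" using inv(2)[of A] by (metis image_eqI mem_Collect_eq)
  qed (auto intro: image_mset_subseteq_mono)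
qed

lemma inj_image_mset: "inj \<pi> \<Longrightarrow> inj (image_mset \<pi>)"
  by (rule injI) (metis multiset.inj_map_strong injD)

lemma sym_funsI:
  assumes "\<And>M. coef f M \<noteq> 0 \<Longrightarrow> size M \<le> d"
    and "\<And>\<pi> M. bij \<pi> \<Longrightarrow> coef f (image_mset \<pi> M) = coef f M"
  shows "f \<in> sym_funs"
  using assms unfolding sym_funs_def by blast

lemma sym_funs_zero [simp]: "0 \<in> sym_funs"
  by (auto simp: sym_funs_def)

lemma sym_funs_one [simp]: "1 \<in> sym_funs"
  by (auto simp: sym_funs_def coef_one)

lemma sym_funs_scale [simp]: "f \<in> sym_funs \<Longrightarrow> scale c f \<in> sym_funs"
  unfolding sym_funs_def by (clarsimp, metis mult_zero_right)

lemma sym_funs_add: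
  assumes "f \<in> sym_funs" "g \<in> sym_funs"
  shows "f + g \<in> sym_funs"
proof -
  obtain d e where "\<And>M. coef f M \<noteq> 0 \<Longrightarrow> size M \<le> d" "\<And>M. coef g M \<noteq> 0 \<Longrightarrow> size M \<le> e"
    using assms unfolding sym_funs_def by blast
  then have "size M \<le> max d e" if "coef (f + g) M \<noteq> 0" for M
    using that by (cases "coef f M = 0") (fastforce simp: le_max_iff_disj)+
  moreover have "coef (f + g) (image_mset \<pi> M) = coef (f + g) M" if "bij \<pi>" for \<pi> M
    using assms that by (auto simp: sym_funs_def)
  ultimately show ?thesis by (rule sym_funsI)
qed

lemma sym_funs_sum: "(\<And>x. x \<in> A \<Longrightarrow> f x \<in> sym_funs) \<Longrightarrow> sum f A \<in> sym_funs"
  by (induction A rule: infinite_finite_induct) (auto intro: sym_funs_add)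

lemma coef_times_nonzeroE:
  assumes "coef (f * g) M \<noteq> 0"
  obtains A where "A \<subseteq># M" "coef f A \<noteq> 0" "coef g (M - A) \<noteq> 0"
proof -
  have "\<exists>A\<in>{A. A \<subseteq># M}. coef f A * coef g (M - A) \<noteq> 0"
    using assms unfolding coef_times by (meson sum.neutral)
  then show ?thesis using that by (metis mem_Collect_eq mult_zero_left mult_zero_right)
qed

text \<open>A bijection of the variables carries the divisors of a monomial to those of its image,
  so the convolution sum is only reindexed.\<close>

lemma sym_funs_mult:
  assumes "f \<in> sym_funs" "g \<in> sym_funs"
  shows "f * g \<in> sym_funs"
proof -
  obtain d e where de: "\<And>M. coef f M \<noteq> 0 \<Longrightarrow> size M \<le> d" "\<And>M. coef g M \<noteq> 0 \<Longrightarrow> size M \<le> e"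
    using assms unfolding sym_funs_def by blast
  have "size M \<le> d + e" if "coef (f * g) M \<noteq> 0" for M
    using that
  proof (rule coef_times_nonzeroE)
    fix A assume A: "A \<subseteq># M" "coef f A \<noteq> 0" "coef g (M - A) \<noteq> 0"
    then have "size M = size A + size (M - A)"
      by (metis size_union subset_mset.add_diff_inverse)
    then show ?thesis using de A by (simp add: add_mono)
  qed
  moreover have "coef (f * g) (image_mset \<pi> M) = coef (f * g) M" if "bij \<pi>" for \<pi> M
  proof -
    have "coef (f * g) (image_mset \<pi> M) =
        (\<Sum>A | A \<subseteq># M. coef f (image_mset \<pi> A) * coef g (image_mset \<pi> M - image_mset \<pi> A))"
      unfolding coef_times subset_image_mset_inv[OF that]
      by (rule sum.reindex[unfolded comp_def])
        (meson inj_image_mset inj_on_subset bij_is_inj subset_UNIV that)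
    also have "\<dots> = (\<Sum>A | A \<subseteq># M. coef f A * coef g (M - A))"
    proof (rule sum.cong)
      fix A assume "A \<in> {A. A \<subseteq># M}"
      then have "image_mset \<pi> M - image_mset \<pi> A = image_mset \<pi> (M - A)" by (simp add: image_mset_Diff)
      then show "coef f (image_mset \<pi> A) * coef g (image_mset \<pi> M - image_mset \<pi> A) = coef f A * coef g (M - A)"
        using assms that by (simp add: sym_funs_def)
    qed simp
    finally show ?thesis by (simp add: coef_times)
  qed
  ultimately show ?thesis by (rule sym_funsI)
qed

lemma subspace_sym_funs: "series.subspace (sym_funs :: 'a::field series set)"
  by (rule series.subspaceI) (auto intro: sym_funs_add)

definition homog :: "nat \<Rightarrow> 'a::comm_ring_1 series set" where
  "homog n = {f \<in> sym_funs. \<forall>M. coef f M \<noteq> 0 \<longrightarrow> size M = n}"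

lemma homog_sym_funs: "f \<in> homog n \<Longrightarrow> f \<in> sym_funs"
  by (simp add: homog_def)

lemma homog_add: "f \<in> homog n \<Longrightarrow> g \<in> homog n \<Longrightarrow> f + g \<in> homog n"
  by (simp add: homog_def sym_funs_add) (metis add.right_neutral)

lemma homog_scale: "f \<in> homog n \<Longrightarrow> scale c f \<in> homog n"
  by (simp add: homog_def) (metis mult_zero_right)

lemma homog_zero: "0 \<in> homog n"
  unfolding homog_def by auto

lemma subspace_homog: "series.subspace (homog n :: 'a::field series set)"
  by (rule series.subspaceI) (auto intro: homog_add homog_scale homog_zero)

lemma homog_one: "1 \<in> homog 0"
  by (auto simp: homog_def coef_one split: if_splits)

lemma homog_mult:
  assumes "f \<in> homog m" "g \<in> homog n"
  shows "f * g \<in> homog (m + n)"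
proof -
  have "size M = m + n" if "coef (f * g) M \<noteq> 0" for M
    using that
  proof (rule coef_times_nonzeroE)
    fix A assume A: "A \<subseteq># M" "coef f A \<noteq> 0" "coef g (M - A) \<noteq> 0"
    then have "size M = size A + size (M - A)"
      by (metis size_union subset_mset.add_diff_inverse)
    then show ?thesis using assms A by (simp add: homog_def)
  qed
  then show ?thesis using assms sym_funs_mult by (auto simp: homog_def)
qed

definition complete_sym :: "nat \<Rightarrow> 'a::comm_ring_1 series" where
  "complete_sym n = Series (\<lambda>M. if size M = n then 1 else 0)"

lemma homogI:
  assumes "\<And>M. coef f M \<noteq> 0 \<Longrightarrow> size M = n"
    and "\<And>\<pi> M. bij \<pi> \<Longrightarrow> coef f (image_mset \<pi> M) = coef f M"
  shows "f \<in> homog n"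
  unfolding homog_def using assms sym_funsI[of f n] by auto

lemma complete_sym_homog: "complete_sym n \<in> homog n"
  by (rule homogI) (auto simp: complete_sym_def split: if_splits)

lemma count_image_mset_bij: "bij \<pi> \<Longrightarrow> count (image_mset \<pi> M) (\<pi> i) = count M i"
  by (cases "i \<in># M") (simp_all add: count_image_mset bij_is_inj inj_vimage_image_eq[of \<pi> "{i}", simplified] not_in_iff)

lemma elem_homog: "elem n \<in> homog n"
proof (rule homogI)
  fix \<pi> :: "nat \<Rightarrow> nat" and M
  assume "bij \<pi>"
  then have "(\<forall>i. count (image_mset \<pi> M) i \<le> 1) \<longleftrightarrow> (\<forall>i. count M i \<le> 1)"
    by (metis count_image_mset_bij bij_pointE)
  then show "coef (elem n) (image_mset \<pi> M) = coef (elem n) M"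
    by (simp add: elem_def)
qed (auto simp: elem_def split: if_splits)

lemma power_sum_homog: "power_sum n \<in> homog n"
proof (rule homogI)
  fix \<pi> :: "nat \<Rightarrow> nat" and M
  assume "bij \<pi>"
  have "(\<exists>i. image_mset \<pi> M = replicate_mset n i) \<longleftrightarrow> (\<exists>i. M = replicate_mset n i)"
  proof
    assume "\<exists>i. image_mset \<pi> M = replicate_mset n i"
    then obtain i where "image_mset \<pi> M = replicate_mset n (\<pi> i)"
      using \<open>bij \<pi>\<close> by (metis bij_pointE)
    then have "image_mset \<pi> M = image_mset \<pi> (replicate_mset n i)" by simp
    then show "\<exists>i. M = replicate_mset n i"
      using \<open>bij \<pi>\<close> by (metis bij_is_inj inj_image_mset injD)
  qed auto
  then show "coef (power_sum n) (image_mset \<pi> M) = coef (power_sum n) M"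
    by (simp add: power_sum_def)
qed (auto simp: power_sum_def split: if_splits)

lemma prod_list_homog:
  assumes "\<And>k. F k \<in> homog k"
  shows "prod_list (map F \<nu>) \<in> homog (sum_list \<nu>)"
  using assms by (induction \<nu>) (auto intro: homog_mult homog_one)

lemma power_sum_prod_homog: "power_sum_prod \<nu> \<in> homog (sum_list \<nu>)"
  unfolding power_sum_prod_def by (intro prod_list_homog power_sum_homog)

section \<open>Monomial symmetric functions\<close>

text \<open>The nonzero exponents, forgetting the variables. The orbits of monomials under
  permutations of the variables are the fibres of \<open>shape\<close> and so correspond to
  partitions.\<close>

definition shape :: "nat multiset \<Rightarrow> nat multiset" where
  "shape M = image_mset (count M) (mset_set (set_mset M))"

lemma size_shape: "size (shape M) = card (set_mset M)"
  by (simp add: shape_def)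

lemma sum_mset_shape: "sum_mset (shape M) = size M"
  by (simp add: shape_def size_multiset_overloaded_eq sum_unfold_sum_mset)

lemma count_shape:
  assumes "c > 0"
  shows "count (shape M) c = card {i. count M i = c}"
proof -
  have "{i \<in> set_mset M. count M i = c} = {i. count M i = c}"
    using assms by (auto intro!: count_inI)
  moreover have "count (shape M) c = card {i \<in> set_mset M. count M i = c}"
    by (simp add: shape_def count_image_mset' eq_commute)
  ultimately show ?thesis by simp
qed

lemma zero_not_in_shape: "0 \<notin># shape M"
  by (auto simp: shape_def) (metis count_eq_zero_iff)

text \<open>The permutation only has to move the finite set \<open>C\<close> of variables involved:
  there the level sets of the two exponent functions are matched one by one, and outside
  \<open>C\<close> it is the identity.\<close>

lemma shape_eq_imp_bij:
  assumes "shape M = shape M'"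
  obtains \<pi> where "bij \<pi>" "image_mset \<pi> M = M'"
proof -
  define C where "C = set_mset M \<union> set_mset M'"
  define A where "A c = {i \<in> C. count M i = c}" for c
  define B where "B c = {i \<in> C. count M' i = c}" for c
  have fin: "finite C" by (simp add: C_def)
  then have finAB: "finite (A c)" "finite (B c)" for c by (auto simp: A_def B_def)
  have pos: "card (A c) = card (B c)" if "c > 0" for c
  proof -
    have "A c = {i. count M i = c}" "B c = {i. count M' i = c}"
      using that by (auto simp: A_def B_def C_def intro!: count_inI)
    then show ?thesis using count_shape[OF that] assms by metis
  qed
  \<comment> \<open>Exponent \<open>0\<close> is not seen by \<open>shape\<close>. Within
    \<open>C\<close> its level sets are the complements of the two supports, which are equally
    large.\<close>
  have zero: "card (A 0) = card (B 0)"
  proof -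
    have "A 0 = C - set_mset M" "B 0 = C - set_mset M'"
      by (auto simp: A_def B_def C_def) (metis count_eq_zero_iff)+
    moreover have "card (set_mset M) = card (set_mset M')" using assms by (metis size_shape)
    ultimately show ?thesis by (simp add: card_Diff_subset C_def)
  qed
  have "\<exists>\<tau>. bij_betw \<tau> (A c) (B c)" for c
    using pos zero finAB by (cases "c = 0") (auto intro: finite_same_card_bij)
  then obtain \<tau> where \<tau>: "\<And>c. bij_betw (\<tau> c) (A c) (B c)" by metis
  define \<pi> where "\<pi> i = (if i \<in> C then \<tau> (count M i) i else i)" for i
  have \<pi>B: "\<pi> i \<in> B (count M i)" if "i \<in> C" for i
    using \<tau>[of "count M i"] that by (auto simp: \<pi>_def A_def bij_betw_def)
  then have \<pi>C: "\<pi> i \<in> C" "count M' (\<pi> i) = count M i" if "i \<in> C" for i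
    using that by (auto simp: B_def)
  have "inj_on \<pi> C"
  proof (rule inj_onI)
    fix i j assume ij: "i \<in> C" "j \<in> C" "\<pi> i = \<pi> j"
    then have "count M i = count M j" using \<pi>C by metis
    then have "i \<in> A (count M i)" "j \<in> A (count M i)" "\<tau> (count M i) i = \<tau> (count M i) j"
      using ij by (auto simp: A_def \<pi>_def)
    then show "i = j" using \<tau>[of "count M i"] by (auto simp: bij_betw_def dest: inj_onD)
  qed
  moreover have "\<pi> ` C \<subseteq> C" using \<pi>C by auto
  ultimately have bC: "bij_betw \<pi> C C"
    using fin by (simp add: bij_betw_def endo_inj_surj)
  have bN: "bij_betw \<pi> (- C) (- C)"
    by (rule bij_betw_cong[THEN iffD1, OF _ bij_betw_id]) (simp add: \<pi>_def)
  have "bij_betw \<pi> (C \<union> - C) (C \<union> - C)" by (rule bij_betw_combine[OF bC bN]) auto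
  then have bij: "bij \<pi>" by simp
  have "image_mset \<pi> M = M'"
  proof (rule multiset_eqI)
    fix j
    obtain i where i: "j = \<pi> i" using bij by (metis bij_pointE)
    have "count M' (\<pi> i) = count M i"
    proof (cases "i \<in> C")
      case True then show ?thesis by (rule \<pi>C)
    next
      case False
      then have "\<pi> i = i" by (simp add: \<pi>_def)
      then show ?thesis using False by (simp add: C_def not_in_iff)
    qed
    then show "count (image_mset \<pi> M) j = count M' j"
      using i bij by (simp add: count_image_mset_bij)
  qed
  then show ?thesis using bij that by blast
qed

lemma sym_funs_shape_cong:
  assumes "f \<in> sym_funs" "shape M = shape M'"
  shows "coef f M = coef f M'"
proof -
  obtain \<pi> where "bij \<pi>" "image_mset \<pi> M = M'" using shape_eq_imp_bij[OF assms(2)] .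
  then show ?thesis using assms(1) by (auto simp: sym_funs_def)
qed

definition partitions_of :: "nat \<Rightarrow> nat list set" where
  "partitions_of n = {\<nu> \<in> partitions. sum_list \<nu> = n}"

lemma length_le_sum_list: "0 \<notin> set \<nu> \<Longrightarrow> length \<nu> \<le> sum_list (\<nu> :: nat list)"
  by (induction \<nu>) (auto simp: Suc_le_eq)

lemma finite_partitions_of [simp]: "finite (partitions_of n)"
proof -
  have "partitions_of n \<subseteq> {\<nu>. set \<nu> \<subseteq> {..n} \<and> length \<nu> \<le> n}"
    by (auto simp: partitions_of_def partitions_def length_le_sum_list member_le_sum_list)
  then show ?thesis by (rule finite_subset) (simp add: finite_lists_length_le)
qed

lemma partition_of_mset:
  assumes "0 \<notin># A"
  shows "rev (sorted_list_of_multiset A) \<in> partitions" "mset (rev (sorted_list_of_multiset A)) = A"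
  using assms by (auto simp: partitions_def sorted_wrt_rev)

lemma partitions_eqI:
  assumes "\<nu> \<in> partitions" "\<mu> \<in> partitions" "mset \<nu> = mset \<mu>"
  shows "\<nu> = \<mu>"
proof -
  have "sorted (rev \<nu>)" "sorted (rev \<mu>)" using assms by (auto simp: partitions_def sorted_wrt_rev)
  moreover have "mset (rev \<nu>) = mset (rev \<mu>)" using assms by simp
  ultimately have "rev \<nu> = rev \<mu>" by (metis properties_for_sort)
  then show ?thesis by simp
qed

lemma ex_shape:
  assumes "0 \<notin> set \<nu>"
  shows "\<exists>M. shape M = mset \<nu>"
  using assms
proof (induction \<nu>)
  case Nil
  have "shape {#} = mset []" by (simp add: shape_def)
  then show ?case by blast
next
  case (Cons k \<nu>)
  then obtain M where M: "shape M = mset \<nu>" by auto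
  obtain i where i: "i \<notin> set_mset M" by (meson ex_new_if_finite finite_set_mset infinite_UNIV_nat)
  have "set_mset (M + replicate_mset k i) = insert i (set_mset M)" using Cons.prems by auto
  then have "shape (M + replicate_mset k i) =
      add_mset k (image_mset (count (M + replicate_mset k i)) (mset_set (set_mset M)))"
    using i by (simp add: shape_def not_in_iff)
  also have "image_mset (count (M + replicate_mset k i)) (mset_set (set_mset M)) = shape M"
    unfolding shape_def by (rule image_mset_cong) (use i in auto)
  finally show ?case using M by auto
qed

text \<open>Any monomial of this shape serves, as the coefficients of a symmetric function are
  constant on shapes.\<close>

definition canon :: "nat list \<Rightarrow> nat multiset" where
  "canon \<nu> = (SOME M. shape M = mset \<nu>)"

lemma shape_canon: "0 \<notin> set \<nu> \<Longrightarrow> shape (canon \<nu>) = mset \<nu>"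
  unfolding canon_def using ex_shape by (rule someI_ex)

definition monom_sym :: "nat list \<Rightarrow> 'a::comm_ring_1 series" where
  "monom_sym \<nu> = Series (\<lambda>M. if shape M = mset \<nu> then 1 else 0)"

text \<open>Every monomial belongs to exactly one \<open>monom_sym \<nu>\<close>, the one of its
  sorted exponents.\<close>

lemma homog_monom_expansion:
  assumes "f \<in> homog n"
  shows "f = (\<Sum>\<nu>\<in>partitions_of n. scale (coef f (canon \<nu>)) (monom_sym \<nu>))"
proof (rule series_eqI)
  fix M
  define \<mu> where "\<mu> = rev (sorted_list_of_multiset (shape M))"
  have \<mu>: "\<mu> \<in> partitions" "mset \<mu> = shape M"
    using partition_of_mset[OF zero_not_in_shape] by (auto simp: \<mu>_def)
  have \<mu>n: "sum_list \<mu> = size M" by (metis \<mu>(2) sum_mset_shape sum_mset_sum_list)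
  have eq: "shape M = mset \<nu> \<longleftrightarrow> \<nu> = \<mu>" if "\<nu> \<in> partitions" for \<nu>
    using that \<mu> partitions_eqI by auto
  have "coef (\<Sum>\<nu>\<in>partitions_of n. scale (coef f (canon \<nu>)) (monom_sym \<nu>)) M =
      (\<Sum>\<nu>\<in>partitions_of n. if \<nu> = \<mu> then coef f (canon \<mu>) else 0)"
    unfolding coef_sum by (rule sum.cong) (auto simp: monom_sym_def partitions_of_def eq)
  also have "\<dots> = (if size M = n then coef f (canon \<mu>) else 0)"
    using \<mu> \<mu>n by (subst sum.delta[OF finite_partitions_of]) (auto simp: partitions_of_def)
  also have "coef f (canon \<mu>) = coef f M"
    by (rule sym_funs_shape_cong[OF homog_sym_funs[OF assms]])
      (use shape_canon[of \<mu>] \<mu> in \<open>simp add: partitions_def\<close>)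
  also have "(if size M = n then coef f M else 0) = coef f M"
    using assms by (auto simp: homog_def)
  finally show "coef f M = coef (\<Sum>\<nu>\<in>partitions_of n. scale (coef f (canon \<nu>)) (monom_sym \<nu>)) M" ..
qed

lemma homog_subset_span_monom:
  "(homog n :: 'a::field series set) \<subseteq> series.span (monom_sym ` partitions_of n)"
proof
  fix f :: "'a series" assume "f \<in> homog n"
  then show "f \<in> series.span (monom_sym ` partitions_of n)"
    by (subst homog_monom_expansion) (auto intro: series.span_sum series.span_scale series.span_base)
qed

section \<open>Products of power sums as a basis\<close>

lemma coef_power_sum_mult:
  assumes "k > 0"
  shows "coef (power_sum k * f) M =
    (\<Sum>i | replicate_mset k i \<subseteq># M. coef f (M - replicate_mset k i))"
proof -
  have inj: "inj_on (replicate_mset k) X" for X :: "nat set"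
    using assms by (auto intro!: inj_onI simp: multiset_eq_iff split: if_splits)
  have "coef (power_sum k * f) M =
      (\<Sum>A\<in>replicate_mset k ` {i. replicate_mset k i \<subseteq># M}. coef f (M - A))"
    unfolding coef_times
    by (rule sum.mono_neutral_cong_right) (auto simp: power_sum_def)
  also have "\<dots> = (\<Sum>i | replicate_mset k i \<subseteq># M. coef f (M - replicate_mset k i))"
    by (rule sum.reindex[OF inj, unfolded comp_def])
  finally show ?thesis .
qed

lemma finite_replicate_subset: "k > 0 \<Longrightarrow> finite {i. replicate_mset k i \<subseteq># M}"
  by (rule finite_subset[of _ "set_mset M"]) (auto dest!: mset_subset_eqD)

text \<open>Counts the ways to attach a variable to each part so that the parts at a variable add up
  to its exponent in \<open>M\<close>. Counting in \<open>nat\<close> leaves no room for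
  cancellation.\<close>

fun pcount :: "nat list \<Rightarrow> nat multiset \<Rightarrow> nat" where
  "pcount [] M = (if M = {#} then 1 else 0)"
| "pcount (k # \<nu>) M = (\<Sum>i | replicate_mset k i \<subseteq># M. pcount \<nu> (M - replicate_mset k i))"

lemma coef_power_sum_prod:
  "0 \<notin> set \<nu> \<Longrightarrow> coef (power_sum_prod \<nu>) M = of_nat (pcount \<nu> M)"
  by (induction \<nu> arbitrary: M) (auto simp: power_sum_prod_def coef_one coef_power_sum_mult)

lemma shape_add_replicate:
  assumes "k > 0" "i \<notin># M"
  shows "shape (M + replicate_mset k i) = add_mset k (shape M)"
proof -
  have "set_mset (M + replicate_mset k i) = insert i (set_mset M)" using assms by auto
  then have "shape (M + replicate_mset k i) =
      add_mset k (image_mset (count (M + replicate_mset k i)) (mset_set (set_mset M)))"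
    using assms by (simp add: shape_def not_in_iff)
  also have "image_mset (count (M + replicate_mset k i)) (mset_set (set_mset M)) = shape M"
    unfolding shape_def by (rule image_mset_cong) (use assms in auto)
  finally show ?thesis .
qed

text \<open>The products of power sums are unitriangular, up to nonzero factors, with respect to the
  number of parts.\<close>

lemma pcount_nonzero:
  assumes "0 \<notin> set \<nu>" "pcount \<nu> M \<noteq> 0"
  shows "card (set_mset M) \<le> length \<nu>" "card (set_mset M) = length \<nu> \<Longrightarrow> shape M = mset \<nu>"
proof -
  have "card (set_mset M) \<le> length \<nu> \<and> (card (set_mset M) = length \<nu> \<longrightarrow> shape M = mset \<nu>)"
    using assms
  proof (induction \<nu> arbitrary: M)
    case (Cons k \<nu>)
    have k: "k > 0" using Cons.prems by simp
    have "\<exists>i\<in>{i. replicate_mset k i \<subseteq># M}. pcount \<nu> (M - replicate_mset k i) \<noteq> 0"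
      using Cons.prems(2) by (auto intro: ccontr)
    then obtain i where i: "replicate_mset k i \<subseteq># M" "pcount \<nu> (M - replicate_mset k i) \<noteq> 0" by blast
    define L where "L = M - replicate_mset k i"
    have M: "M = L + replicate_mset k i" using i by (simp add: L_def)
    have IH: "card (set_mset L) \<le> length \<nu>" "card (set_mset L) = length \<nu> \<Longrightarrow> shape L = mset \<nu>"
      using Cons.IH[of L] Cons.prems i by (auto simp: L_def)
    have set: "set_mset M = insert i (set_mset L)" using k by (auto simp: M)
    show ?case
    proof (cases "i \<in># L")
      case True
      then have "set_mset M = set_mset L" using set by auto
      then show ?thesis using IH by simp
    next
      case False
      then show ?thesis using IH set shape_add_replicate[OF k False] by (simp add: M)
    qed
  qed (auto simp: shape_def split: if_splits)
  then show "card (set_mset M) \<le> length \<nu>" "card (set_mset M) = length \<nu> \<Longrightarrow> shape M = mset \<nu>" by auto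
qed

text \<open>Peeling off the part \<open>k\<close> at a variable with exponent exactly
  \<open>k\<close> leaves a monomial of shape \<open>\<nu>\<close>, so one summand is positive by
  induction.\<close>

lemma pcount_pos:
  assumes "0 \<notin> set \<nu>" "shape M = mset \<nu>"
  shows "pcount \<nu> M > 0"
  using assms
proof (induction \<nu> arbitrary: M)
  case Nil
  then have "size (shape M) = 0" by simp
  then show ?case by (simp add: size_shape)
next
  case (Cons k \<nu>)
  have k: "k > 0" using Cons.prems by simp
  have "k \<in># shape M" using Cons.prems by simp
  then obtain i where i: "i \<in># M" "count M i = k" by (auto simp: shape_def)
  define L where "L = M - replicate_mset k i"
  have sub: "replicate_mset k i \<subseteq># M" using i by (simp add: count_le_replicate_mset_subset_eq[symmetric])
  then have M: "M = L + replicate_mset k i" by (simp add: L_def)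
  have "i \<notin># L" using i by (simp add: L_def not_in_iff)
  then have "shape L = mset \<nu>" using shape_add_replicate[OF k] Cons.prems by (simp add: M)
  then have "pcount \<nu> (M - replicate_mset k i) > 0" using Cons by (simp add: L_def)
  then show ?case using sub finite_replicate_subset[OF k, of M]
    by (auto intro!: sum_pos2[of _ i])
qed

text \<open>Coordinates refer to the image set of a family, so injectivity is needed along with
  independence. It comes from the relation with coefficients \<open>1\<close> and \<open>- 1\<close>
  between two equal members.\<close>

lemma independent_familyI:
  fixes b :: "'i \<Rightarrow> 'a::field series"
  assumes "\<And>F c \<nu>. finite F \<Longrightarrow> F \<subseteq> S \<Longrightarrow> (\<Sum>\<nu>\<in>F. scale (c \<nu>) (b \<nu>)) = 0 \<Longrightarrow> \<nu> \<in> F \<Longrightarrow> c \<nu> = 0"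
  shows "inj_on b S" "series.independent (b ` S)"
proof -
  show inj: "inj_on b S"
  proof (rule inj_onI, rule ccontr)
    fix \<mu> \<nu> assume *: "\<mu> \<in> S" "\<nu> \<in> S" "b \<mu> = b \<nu>" "\<mu> \<noteq> \<nu>"
    have "(\<Sum>\<kappa>\<in>{\<mu>, \<nu>}. scale (if \<kappa> = \<mu> then 1 else - 1) (b \<kappa>)) = 0"
      using * by (auto intro!: series_eqI)
    then have "(if \<mu> = \<mu> then 1 else - 1 :: 'a) = 0" using * by (intro assms[of "{\<mu>, \<nu>}"]) auto
    then show False by simp
  qed
  show "series.independent (b ` S)"
    unfolding series.dependent_explicit
  proof clarsimp
    fix t u and x :: "'a series"
    assume *: "finite t" "t \<subseteq> b ` S" "(\<Sum>v\<in>t. scale (u v) v) = 0" "x \<in> t"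
    obtain F where F: "F \<subseteq> S" "t = b ` F" using *(2) by (meson subset_imageE)
    have injF: "inj_on b F" using inj F inj_on_subset by blast
    then have "finite F" using * F finite_imageD by blast
    moreover have "(\<Sum>\<nu>\<in>F. scale (u (b \<nu>)) (b \<nu>)) = 0"
      using *(3) injF by (simp add: F sum.reindex)
    ultimately show "u x = 0" using assms[of F "u \<circ> b"] F * by auto
  qed
qed

text \<open>Among the partitions with nonzero coefficient take \<open>\<mu>\<close> with the most
  parts and read off the coefficient of its monomial: another \<open>\<kappa>\<close> contributing
  there would have as many parts, hence the same parts.\<close>

lemma power_sum_prod_family:
  fixes c :: "nat list \<Rightarrow> 'a::field_char_0"
  assumes "finite F" "F \<subseteq> partitions" "(\<Sum>\<nu>\<in>F. scale (c \<nu>) (power_sum_prod \<nu>)) = 0" "\<nu> \<in> F"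
  shows "c \<nu> = 0"
proof (rule ccontr)
  assume "c \<nu> \<noteq> 0"
  define G where "G = {\<nu> \<in> F. c \<nu> \<noteq> 0}"
  have "finite G" "G \<noteq> {}" using assms \<open>c \<nu> \<noteq> 0\<close> by (auto simp: G_def)
  then have "Max (length ` G) \<in> length ` G" by simp
  then obtain \<mu> where "\<mu> \<in> G" "length \<mu> = Max (length ` G)" by auto
  with \<open>finite G\<close> have \<mu>: "\<mu> \<in> G" "\<And>\<kappa>. \<kappa> \<in> G \<Longrightarrow> length \<kappa> \<le> length \<mu>" by auto
  have pos: "0 \<notin> set \<kappa>" if "\<kappa> \<in> G" for \<kappa> using that assms by (auto simp: G_def partitions_def)
  define M where "M = canon \<mu>"
  have M: "shape M = mset \<mu>" using shape_canon pos \<mu> by (simp add: M_def)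
  then have card: "card (set_mset M) = length \<mu>" by (metis size_mset size_shape)
  have other: "coef (power_sum_prod \<kappa>) M = (0 :: 'a)" if "\<kappa> \<in> G" "\<kappa> \<noteq> \<mu>" for \<kappa>
  proof (rule ccontr)
    assume "coef (power_sum_prod \<kappa>) M \<noteq> (0 :: 'a)"
    then have nz: "pcount \<kappa> M \<noteq> 0"
      using coef_power_sum_prod[OF pos[OF that(1)], of M] by (metis of_nat_0)
    then have "card (set_mset M) = length \<kappa>"
      using pcount_nonzero(1)[OF pos[OF that(1)] nz] \<mu>(2)[OF that(1)] card by simp
    then have "mset \<kappa> = mset \<mu>" using pcount_nonzero(2)[OF pos[OF that(1)] nz] M by simp
    then show False using partitions_eqI[of \<kappa> \<mu>] that \<mu> assms by (auto simp: G_def)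
  qed
  have "0 = coef (\<Sum>\<nu>\<in>F. scale (c \<nu>) (power_sum_prod \<nu>)) M" using assms by simp
  also have "\<dots> = (\<Sum>\<nu>\<in>F. c \<nu> * coef (power_sum_prod \<nu>) M)" by simp
  also have "\<dots> = (\<Sum>\<nu>\<in>{\<mu>}. c \<nu> * coef (power_sum_prod \<nu>) M)"
    using \<mu> other assms by (intro sum.mono_neutral_right) (auto simp: G_def)
  also have "\<dots> = c \<mu> * of_nat (pcount \<mu> M)" by (simp add: coef_power_sum_prod[OF pos[OF \<mu>(1)]])
  finally show False using \<mu> pcount_pos[OF pos[OF \<mu>(1)] M] by (simp add: G_def)
qed

lemma power_sum_prod_inj: "inj_on (power_sum_prod :: _ \<Rightarrow> 'a::field_char_0 series) partitions"
  and power_sum_prod_independent: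
    "series.independent ((power_sum_prod :: _ \<Rightarrow> 'a::field_char_0 series) ` partitions)"
  using independent_familyI[of partitions "power_sum_prod :: _ \<Rightarrow> 'a series"] power_sum_prod_family
  by blast+

text \<open>Exchange argument: an element of \<open>span T\<close> outside \<open>span S\<close>
  would enlarge \<open>S\<close> to an independent subset of \<open>span T\<close> with more than
  \<open>card T\<close> elements.\<close>

lemma span_subset_of_card:
  assumes "finite T" "series.independent S" "S \<subseteq> series.span T" "card T \<le> card S"
  shows "series.span T \<subseteq> series.span S"
proof -
  have "x \<in> series.span S" if x: "x \<in> series.span T" for x
  proof (rule ccontr)
    assume n: "x \<notin> series.span S"
    then have xS: "x \<notin> S" using series.span_base by blast
    have "series.independent (insert x S)" using n assms(2) by (rule series.independent_insertI)
    then have "finite (insert x S) \<and> card (insert x S) \<le> card T"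
      by (rule series.independent_span_bound[OF assms(1)]) (use assms(3) x in simp)
    then have "finite S" "Suc (card S) \<le> card T" using xS by auto
    then show False using assms(4) by simp
  qed
  then show ?thesis by blast
qed

text \<open>The monomial symmetric functions bound the dimension.\<close>

lemma homog_subset_span:
  fixes b :: "nat list \<Rightarrow> 'a::field series"
  assumes "inj_on b (partitions_of n)" "series.independent (b ` partitions_of n)"
    and "\<And>\<nu>. \<nu> \<in> partitions_of n \<Longrightarrow> b \<nu> \<in> homog n"
  shows "homog n \<subseteq> series.span (b ` partitions_of n)"
proof -
  have "series.span (monom_sym ` partitions_of n) \<subseteq> series.span (b ` partitions_of n)"
  proof (rule span_subset_of_card)
    show "b ` partitions_of n \<subseteq> series.span (monom_sym ` partitions_of n)"
      using assms(3) homog_subset_span_monom by blast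
    show "card (monom_sym ` partitions_of n :: 'a series set) \<le> card (b ` partitions_of n)"
      by (simp add: card_image assms(1) card_image_le)
  qed (use assms in auto)
  then show ?thesis using homog_subset_span_monom by blast
qed

lemma homog_span_power_sum_prod:
  "(homog n :: 'a::field_char_0 series set) \<subseteq> series.span (power_sum_prod ` partitions_of n)"
proof (rule homog_subset_span)
  have "partitions_of n \<subseteq> partitions" by (auto simp: partitions_of_def)
  then show "inj_on (power_sum_prod :: _ \<Rightarrow> 'a series) (partitions_of n)"
    and "series.independent ((power_sum_prod :: _ \<Rightarrow> 'a series) ` partitions_of n)"
    using inj_on_subset[OF power_sum_prod_inj] series.independent_mono[OF power_sum_prod_independent]
    by (metis, metis image_mono)
qed (use power_sum_prod_homog in \<open>auto simp: partitions_of_def\<close>)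

text \<open>Bounded degree makes a symmetric function the finite sum of its homogeneous
  parts.\<close>

lemma sym_funs_span_power_sum_prod:
  "(sym_funs :: 'a::field_char_0 series set) = series.span (power_sum_prod ` partitions)"
proof
  show "sym_funs \<subseteq> series.span (power_sum_prod ` partitions :: 'a series set)"
  proof
    fix f :: "'a series" assume f: "f \<in> sym_funs"
    then obtain d where d: "\<And>M. coef f M \<noteq> 0 \<Longrightarrow> size M \<le> d" by (auto simp: sym_funs_def)
    define part where "part k = Series (\<lambda>M. if size M = k then coef f M else 0)" for k
    have "part k \<in> homog k" for k
      by (rule homogI) (use f in \<open>auto simp: part_def sym_funs_def split: if_splits\<close>)
    then have "part k \<in> series.span (power_sum_prod ` partitions)" for k
      using homog_span_power_sum_prod[of k] series.span_mono[of "power_sum_prod ` partitions_of k" "power_sum_prod ` partitions"]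
      by (fastforce simp: partitions_of_def)
    moreover have "f = (\<Sum>k\<le>d. part k)"
      by (rule series_eqI) (use d in \<open>auto simp: part_def\<close>)
    ultimately show "f \<in> series.span (power_sum_prod ` partitions)"
      by (metis series.span_sum)
  qed
  show "series.span (power_sum_prod ` partitions) \<subseteq> (sym_funs :: 'a series set)"
    by (rule series.span_minimal) (auto intro: homog_sym_funs power_sum_prod_homog subspace_sym_funs)
qed

section \<open>Constant series and absence of torsion\<close>

text \<open>As a ring homomorphism it turns scaling into multiplication, so that scaled series can
  be treated by ring arithmetic.\<close>

definition const :: "'a::comm_ring_1 \<Rightarrow> 'a series" where
  "const c = scale c 1"

lemma const_simps [simp]:
  "const 0 = 0" "const 1 = 1" "const (c + d) = const c + const d" "const (c - d) = const c - const d"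
  "const (c * d) = const c * const d" "const (- c) = - const c"
  by (auto intro!: series_eqI simp: const_def ring_distribs scale_mult_left)

lemma scale_const: "scale c f = const c * f"
  unfolding const_def by (rule scale_conv_mult)

lemma const_power [simp]: "const (c ^ n) = const c ^ n"
  by (induction n) auto

lemma const_sym_funs [simp]: "const c \<in> sym_funs"
  by (simp add: const_def)

lemma coef_const_mult [simp]: "coef (const c * f) M = c * coef f M"
  by (simp flip: scale_const)

lemma const_of_nat [simp]: "const (of_nat n) = of_nat n"
  by (induction n) auto

lemma const_sum: "const (sum f A) = (\<Sum>x\<in>A. const (f x))"
  by (induction A rule: infinite_finite_induct) auto

text \<open>Absence of torsion replaces division by \<open>n\<close> in
  \<open>newton_unique\<close>, where the coefficient ring is not a field.\<close>

lemma of_nat_mult_series_eq_0: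
  fixes f :: "'a::field_char_0 series"
  assumes "n > 0" "of_nat n * f = 0"
  shows "f = 0"
proof (rule series_eqI)
  fix M
  have "coef (const (of_nat n) * f) M = 0" using assms by simp
  then show "coef f M = coef 0 M" using assms(1) by (simp del: const_of_nat)
qed

lemma of_nat_mult_series_poly_eq_0:
  fixes p :: "'a::field_char_0 series poly"
  assumes "n > 0" "of_nat n * p = 0"
  shows "p = 0"
proof (rule poly_eqI)
  fix i
  have "of_nat n * coeff p i = coeff (of_nat n * p) i" by (simp add: of_nat_poly)
  then show "coeff p i = coeff 0 i" using assms of_nat_mult_series_eq_0[of n "coeff p i"] by simp
qed

section \<open>Newton's identities\<close>

text \<open>\<open>newton p f\<close> says that \<open>f = exp (\<Sum>\<^sub>k p\<^sub>k z\<^sup>k / k)\<close>, without division.\<close>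

definition newton :: "'a::comm_ring_1 fps \<Rightarrow> 'a fps \<Rightarrow> bool" where
  "newton p f \<longleftrightarrow> fps_nth f 0 = 1 \<and> fps_X * fps_deriv f = p * f"

lemma fps_nth_X_deriv: "fps_nth (fps_X * fps_deriv f) n = of_nat n * fps_nth f n"
  by (cases n) auto

lemma newton_iff:
  "newton p f \<longleftrightarrow> fps_nth f 0 = 1 \<and>
     (\<forall>n. of_nat n * fps_nth f n = (\<Sum>k=0..n. fps_nth p k * fps_nth f (n - k)))"
  unfolding newton_def fps_eq_iff fps_nth_X_deriv by (simp add: fps_mult_nth)

lemma newton_mult:
  assumes "newton p f" "newton p' g"
  shows "newton (p + p') (f * g)"
proof -
  have "fps_X * fps_deriv (f * g) = (fps_X * fps_deriv f) * g + f * (fps_X * fps_deriv g)"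
    by (simp add: algebra_simps)
  also have "\<dots> = (p + p') * (f * g)"
    using assms by (simp only: newton_def) (simp add: algebra_simps)
  finally show ?thesis using assms by (simp add: newton_def)
qed

text \<open>The logarithmic derivative of the constant \<open>f * g\<close> vanishes, so those of
  \<open>f\<close> and \<open>g\<close> are opposite.\<close>

lemma newton_inverse:
  assumes "newton p f" "f * g = 1"
  shows "newton (- p) g"
proof -
  have g0: "fps_nth g 0 = 1"
    using assms by (metis fps_mult_nth_0 fps_one_nth mult_1 newton_def)
  have "0 = g * (fps_X * fps_deriv (f * g))" using assms by simp
  also have "\<dots> = (f * g) * (fps_X * fps_deriv g) + g * ((fps_X * fps_deriv f) * g)"
    by (simp add: algebra_simps)
  also have "fps_X * fps_deriv f = p * f" using assms by (simp add: newton_def)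
  also have "g * (p * f * g) = (f * g) * (p * g)" by (simp add: mult_ac)
  finally have "fps_X * fps_deriv g + p * g = 0" using assms(2) by simp
  then show ?thesis using g0 by (simp add: newton_def eq_neg_iff_add_eq_0)
qed

text \<open>As \<open>p\<close> has no constant term, Newton's identity expresses \<open>n\<close>
  times the coefficient \<open>n\<close> by earlier coefficients.\<close>

lemma newton_unique:
  fixes f g :: "'a::comm_ring_1 fps"
  assumes "newton p f" "newton p g" "fps_nth p 0 = 0"
    and torsion_free: "\<And>n (x :: 'a). n > 0 \<Longrightarrow> of_nat n * x = 0 \<Longrightarrow> x = 0"
  shows "f = g"
proof (rule fps_ext)
  fix n
  show "fps_nth f n = fps_nth g n"
  proof (induction n rule: less_induct)
    case (less n)
    show ?case
    proof (cases "n = 0")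
      case True
      then show ?thesis using assms by (simp add: newton_def)
    next
      case False
      have "(\<Sum>k=0..n. fps_nth p k * fps_nth f (n - k)) = (\<Sum>k=0..n. fps_nth p k * fps_nth g (n - k))"
      proof (rule sum.cong)
        fix k assume "k \<in> {0..n}"
        then show "fps_nth p k * fps_nth f (n - k) = fps_nth p k * fps_nth g (n - k)"
          using less[of "n - k"] assms(3) False by (cases "k = 0") auto
      qed simp
      then have "of_nat n * fps_nth f n = of_nat n * fps_nth g n"
        using assms(1,2) by (simp add: newton_iff)
      then have "of_nat n * (fps_nth f n - fps_nth g n) = 0" by (simp add: algebra_simps)
      then show ?thesis using torsion_free[of n] False by fastforce
    qed
  qed
qed

text \<open>Only symmetric arguments are constrained: the maps of interest are defined by
  coordinates in the power sums and mean nothing elsewhere.\<close>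

definition hom_on_sym :: "('a::comm_ring_1 series \<Rightarrow> 'b::comm_ring_1) \<Rightarrow> bool" where
  "hom_on_sym \<phi> \<longleftrightarrow> \<phi> 1 = 1 \<and>
     (\<forall>f\<in>sym_funs. \<forall>g\<in>sym_funs. \<phi> (f + g) = \<phi> f + \<phi> g \<and> \<phi> (f * g) = \<phi> f * \<phi> g)"

lemma hom_on_sym_0: "hom_on_sym \<phi> \<Longrightarrow> \<phi> 0 = 0"
  unfolding hom_on_sym_def by (metis add_0 add_cancel_right_right sym_funs_zero)

lemma hom_on_sym_sum:
  assumes "hom_on_sym \<phi>" "\<And>x. x \<in> A \<Longrightarrow> f x \<in> sym_funs"
  shows "\<phi> (sum f A) = (\<Sum>x\<in>A. \<phi> (f x))"
  using assms(2)
proof (induction A rule: infinite_finite_induct)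
  case (insert x A)
  then have "\<phi> (f x + sum f A) = \<phi> (f x) + \<phi> (sum f A)"
    using assms(1) by (simp add: hom_on_sym_def sym_funs_sum)
  then show ?case using insert by simp
qed (simp_all add: hom_on_sym_0[OF assms(1)])

lemma sym_funs_of_nat [simp]: "of_nat n \<in> sym_funs"
  by (metis const_of_nat const_sym_funs)

lemma hom_on_sym_of_nat: "hom_on_sym \<phi> \<Longrightarrow> \<phi> (of_nat n) = of_nat n"
  by (induction n) (simp_all add: hom_on_sym_0, simp add: hom_on_sym_def)

lemma hom_on_sym_uminus: "hom_on_sym \<phi> \<Longrightarrow> f \<in> sym_funs \<Longrightarrow> \<phi> (- f) = - \<phi> f"
proof -
  assume *: "hom_on_sym \<phi>" "f \<in> sym_funs"
  have "- f = const (- 1) * f" by simp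
  then have "- f \<in> sym_funs" using * by (metis sym_funs_mult const_sym_funs)
  then have "\<phi> (f + - f) = \<phi> f + \<phi> (- f)" using * unfolding hom_on_sym_def by blast
  then show ?thesis using hom_on_sym_0[OF *(1)] by (simp add: eq_neg_iff_add_eq_0 add.commute)
qed

text \<open>With \<open>newton_unique\<close>, a homomorphism known on the power sums alone becomes
  known on the whole series \<open>f\<close>.\<close>

lemma newton_hom:
  assumes "newton p f" "hom_on_sym \<phi>" "\<And>n. fps_nth p n \<in> sym_funs" "\<And>n. fps_nth f n \<in> sym_funs"
  shows "newton (Abs_fps (\<lambda>n. \<phi> (fps_nth p n))) (Abs_fps (\<lambda>n. \<phi> (fps_nth f n)))"
proof -
  have "of_nat n * \<phi> (fps_nth f n) = (\<Sum>k=0..n. \<phi> (fps_nth p k) * \<phi> (fps_nth f (n - k)))" for n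
  proof -
    have "of_nat n * \<phi> (fps_nth f n) = \<phi> (of_nat n * fps_nth f n)"
      using assms(2,4) sym_funs_of_nat unfolding hom_on_sym_def
      by (simp add: hom_on_sym_of_nat[OF assms(2)])
    also have "\<dots> = \<phi> (\<Sum>k=0..n. fps_nth p k * fps_nth f (n - k))" using assms(1) by (simp add: newton_iff)
    also have "\<dots> = (\<Sum>k=0..n. \<phi> (fps_nth p k * fps_nth f (n - k)))"
      using assms by (intro hom_on_sym_sum) (auto intro: sym_funs_mult)
    also have "\<dots> = (\<Sum>k=0..n. \<phi> (fps_nth p k) * \<phi> (fps_nth f (n - k)))"
      using assms by (simp add: hom_on_sym_def)
    finally show ?thesis .
  qed
  moreover have "\<phi> (fps_nth f 0) = 1" using assms by (simp add: newton_def hom_on_sym_def)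
  ultimately show ?thesis by (simp add: newton_iff)
qed

text \<open>\<open>power_sum 0\<close> equals \<open>1\<close>, hence the explicit \<open>0\<close>,
  on which the recursion behind \<open>newton_unique\<close> depends.\<close>

definition power_fps :: "'a::comm_ring_1 series fps" where
  "power_fps = Abs_fps (\<lambda>k. if k = 0 then 0 else power_sum k)"

definition complete_fps :: "'a::comm_ring_1 series fps" where
  "complete_fps = Abs_fps complete_sym"

definition elem_fps :: "'a::comm_ring_1 series fps" where
  "elem_fps = Abs_fps (\<lambda>n. (- 1) ^ n * elem n)"

lemma complete_sym_0 [simp]: "complete_sym 0 = 1"
  by (rule series_eqI) (simp add: complete_sym_def coef_one)

lemma elem_0 [simp]: "elem 0 = 1"
  by (rule series_eqI) (auto simp: elem_def coef_one)

text \<open>At a monomial of degree \<open>n\<close> the right side counts the pairs of a variable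
  and a \<open>k\<close> between \<open>1\<close> and its exponent; there are \<open>n\<close> of
  them.\<close>

lemma newton_complete: "newton power_fps complete_fps"
proof -
  have "of_nat n * complete_sym n =
      (\<Sum>k=0..n. (if k = 0 then 0 else power_sum k) * (complete_sym (n - k) :: 'a series))" for n
  proof (rule series_eqI)
    fix M
    have "coef (\<Sum>k=0..n. (if k = 0 then 0 else power_sum k) * (complete_sym (n - k) :: 'a series)) M
        = (\<Sum>k=1..n. coef (power_sum k * complete_sym (n - k)) M)"
      unfolding coef_sum by (rule sum.mono_neutral_cong_right) (auto split: if_splits)
    also have "\<dots> = (\<Sum>k=1..n. \<Sum>i\<in>{i \<in> set_mset M. k \<le> count M i}. if size M = n then 1 else 0)"
    proof (rule sum.cong)
      fix k assume k: "k \<in> {1..n}"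
      then have "coef (power_sum k * complete_sym (n - k)) M =
          (\<Sum>i | replicate_mset k i \<subseteq># M. coef (complete_sym (n - k) :: 'a series) (M - replicate_mset k i))"
        by (intro coef_power_sum_mult) auto
      also have "\<dots> = (\<Sum>i\<in>{i \<in> set_mset M. k \<le> count M i}. if size M = n then 1 else 0)"
      proof (rule sum.cong)
        have "i \<in># M" if "k \<le> count M i" for i using k that by (intro count_inI) auto
        then show "{i. replicate_mset k i \<subseteq># M} = {i \<in> set_mset M. k \<le> count M i}"
          by (auto simp: count_le_replicate_mset_subset_eq)
        fix i assume "i \<in> {i \<in> set_mset M. k \<le> count M i}"
        then have "replicate_mset k i \<subseteq># M" by (simp add: count_le_replicate_mset_subset_eq)
        then have "size (M - replicate_mset k i) = size M - k" "k \<le> size M"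
          by (auto simp: size_Diff_submset dest: size_mset_mono)
        then show "coef (complete_sym (n - k)) (M - replicate_mset k i) = (if size M = n then 1 else (0 :: 'a))"
          using k by (auto simp: complete_sym_def)
      qed
      finally show "coef (power_sum k * complete_sym (n - k)) M =
          (\<Sum>i\<in>{i \<in> set_mset M. k \<le> count M i}. if size M = n then 1 else (0 :: 'a))" .
    qed simp
    also have "\<dots> = (\<Sum>k=1..n. \<Sum>i\<in>set_mset M. if k \<le> count M i then if size M = n then 1 else 0 else 0)"
      by (rule sum.cong) (simp_all only: sum.inter_filter finite_set_mset refl)
    also have "\<dots> = (\<Sum>i\<in>set_mset M. \<Sum>k=1..n. if k \<le> count M i then if size M = n then 1 else 0 else 0)"
      by (rule sum.swap)
    also have "\<dots> = (\<Sum>i\<in>set_mset M. if size M = n then of_nat (count M i) else 0)"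
    proof (rule sum.cong)
      fix i
      have "(\<Sum>k=1..n. if k \<le> count M i then 1 else (0 :: 'a)) = of_nat (count M i)" if "size M = n"
      proof -
        have "count M i \<le> n" using that by (metis count_le_size)
        have "(\<Sum>k=1..n. if k \<le> count M i then 1 else (0 :: 'a)) = (\<Sum>k=1..count M i. 1)"
          using \<open>count M i \<le> n\<close> by (intro sum.mono_neutral_cong_right) auto
        then show ?thesis by simp
      qed
      then show "(\<Sum>k=1..n. if k \<le> count M i then if size M = n then 1 else 0 else 0) =
          (if size M = n then of_nat (count M i) else (0 :: 'a))" by (simp cong: if_cong)
    qed simp
    also have "\<dots> = (if size M = n then of_nat (size M) else 0)"
      by (auto simp: size_multiset_overloaded_eq simp flip: of_nat_sum)
    also have "\<dots> = coef (of_nat n * complete_sym n) M"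
      using coef_const_mult[of "of_nat n" "complete_sym n :: 'a series" M] by (simp add: complete_sym_def)
    finally show "coef (of_nat n * complete_sym n) M =
        coef (\<Sum>k=0..n. (if k = 0 then 0 else power_sum k) * (complete_sym (n - k) :: 'a series)) M" ..
  qed
  then show ?thesis by (simp add: newton_iff power_fps_def complete_fps_def)
qed

lemma sum_alternating_Pow:
  assumes "finite S"
  shows "(\<Sum>B\<in>Pow S. (- 1) ^ card B :: 'a::comm_ring_1) = (if S = {} then 1 else 0)"
  using assms
proof (induction S)
  case (insert x S)
  have "(\<Sum>B\<in>Pow (insert x S). (- 1) ^ card B :: 'a) =
      (\<Sum>B\<in>Pow S. (- 1) ^ card B) + (\<Sum>B\<in>insert x ` Pow S. (- 1) ^ card B)"
    unfolding Pow_insert using insert by (intro sum.union_disjoint) auto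
  also have "(\<Sum>B\<in>insert x ` Pow S. (- 1) ^ card B :: 'a) = (\<Sum>B\<in>Pow S. (- 1) ^ card (insert x B))"
    using insert by (subst sum.reindex) (auto intro!: inj_onI simp: insert_ident)
  also have "\<dots> = (\<Sum>B\<in>Pow S. - ((- 1) ^ card B))"
  proof (rule sum.cong)
    fix B assume "B \<in> Pow S"
    then have "x \<notin> B" "finite B" using insert by (auto intro: finite_subset)
    then show "(- 1) ^ card (insert x B) = - ((- 1 :: 'a) ^ card B)" by simp
  qed simp
  finally show ?case by (simp add: sum_negf)
qed simp

lemma set_mset_squarefree:
  assumes "\<And>i. count A i \<le> 1"
  shows "mset_set (set_mset A) = A"
proof (rule multiset_eqI)
  fix i
  have "count A i = (if i \<in># A then 1 else 0)"
    using assms[of i] by (metis One_nat_def count_eq_zero_iff le_SucE le_zero_eq)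
  then show "count (mset_set (set_mset A)) i = count A i" by (simp add: count_mset_set')
qed

text \<open>The coefficient at a monomial of degree \<open>n\<close> is the signed count of its
  squarefree divisors, that is, of the subsets of its support. It vanishes unless the support is
  empty.\<close>

lemma elem_mult_complete: "elem_fps * complete_fps = 1"
proof (rule fps_ext, rule series_eqI)
  fix n and M :: "nat multiset"
  define X where "X = {A. A \<subseteq># M \<and> (\<forall>i. count A i \<le> 1)}"
  have finX: "finite X" unfolding X_def by (rule finite_subset[OF _ finite_submultisets[of M]]) auto
  have bij: "X = mset_set ` Pow (set_mset M)"
  proof (intro set_eqI iffI)
    fix A assume "A \<in> X"
    then show "A \<in> mset_set ` Pow (set_mset M)"
      using set_mset_squarefree[of A] by (auto simp: X_def dest: mset_subset_eqD intro!: image_eqI[of _ _ "set_mset A"])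
  next
    fix A assume "A \<in> mset_set ` Pow (set_mset M)"
    then obtain B where B: "A = mset_set B" "B \<subseteq> set_mset M" by auto
    then have "finite B" using finite_subset by blast
    then show "A \<in> X" using B by (auto simp: X_def count_mset_set' subseteq_mset_def Suc_le_eq)
  qed
  have inj: "inj_on mset_set (Pow (set_mset M))"
    by (rule inj_onI) (metis PowD finite_set_mset finite_set_mset_mset_set finite_subset)
  have "coef (fps_nth (elem_fps * complete_fps) n :: 'a series) M =
      (\<Sum>k=0..n. coef (const ((- 1) ^ k) * (elem k * complete_sym (n - k))) M)"
    by (simp add: fps_mult_nth elem_fps_def complete_fps_def mult.assoc)
  also have "\<dots> = (\<Sum>k=0..n. (- 1) ^ k * coef (elem k * complete_sym (n - k)) M)"
    by (simp del: const_power)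
  also have "\<dots> = (\<Sum>k=0..n. \<Sum>A\<in>X. if size A = k \<and> size M = n then (- 1) ^ size A else 0)"
  proof (rule sum.cong)
    fix k assume k: "k \<in> {0..n}"
    have "coef (elem k * complete_sym (n - k) :: 'a series) M =
        (\<Sum>A\<in>X. if size A = k \<and> size M = n then 1 else 0)"
      unfolding coef_times
    proof (rule sum.mono_neutral_cong_right)
      fix A assume "A \<in> X"
      then have "A \<subseteq># M" "\<forall>i. count A i \<le> 1" by (auto simp: X_def)
      moreover have "size (M - A) = size M - size A" "size A \<le> size M"
        using \<open>A \<subseteq># M\<close> by (auto simp: size_Diff_submset size_mset_mono)
      ultimately show "coef (elem k) A * coef (complete_sym (n - k)) (M - A) =
          (if size A = k \<and> size M = n then 1 else (0 :: 'a))"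
        using k by (auto simp: elem_def complete_sym_def)
    qed (auto simp: X_def elem_def)
    then show "(- 1) ^ k * coef (elem k * complete_sym (n - k)) M =
        (\<Sum>A\<in>X. if size A = k \<and> size M = n then (- 1) ^ size A else (0 :: 'a))"
      by (simp add: sum_distrib_left if_distrib cong: if_cong)
  qed simp
  also have "\<dots> = (\<Sum>A\<in>X. \<Sum>k=0..n. if k = size A then if size M = n then (- 1) ^ size A else 0 else 0)"
    by (subst sum.swap) (auto intro!: sum.cong)
  also have "\<dots> = (\<Sum>A\<in>X. if size M = n then (- 1) ^ size A else 0)"
    by (rule sum.cong) (auto simp: X_def dest: size_mset_mono)
  also have "\<dots> = (if size M = n then \<Sum>B\<in>Pow (set_mset M). (- 1) ^ card B else 0)"
    using inj by (simp add: bij sum.reindex)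
  also have "\<dots> = coef (fps_nth 1 n :: 'a series) M"
    by (auto simp: sum_alternating_Pow coef_one)
  finally show "coef (fps_nth (elem_fps * complete_fps) n :: 'a series) M = coef (fps_nth 1 n) M" .
qed

lemma newton_elem: "newton (- power_fps) elem_fps"
  using newton_inverse[OF newton_complete] elem_mult_complete by (metis mult.commute)

section \<open>Linear extensions from the power sum basis\<close>

text \<open>The linear extension of the assignment of \<open>g \<nu>\<close> to
  \<open>b \<nu>\<close>, with scalars transported by \<open>\<iota>\<close>. An arbitrary target
  ring covers diagonal operators as well as substitutions with values in polynomials over the
  series.\<close>

definition linext :: "(nat list \<Rightarrow> 'a::field series) \<Rightarrow> ('a \<Rightarrow> 'b::comm_ring_1) \<Rightarrow> (nat list \<Rightarrow> 'b) \<Rightarrow> 'a series \<Rightarrow> 'b" where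
  "linext b \<iota> g f = (\<Sum>\<nu> | \<nu> \<in> partitions \<and> coord b f \<nu> \<noteq> 0. \<iota> (coord b f \<nu>) * g \<nu>)"

lemma diag_op_linext: "diag_op b ev = linext b const (\<lambda>\<nu>. scale (ev \<nu>) (b \<nu>))"
  by (rule ext) (simp add: diag_op_def linext_def flip: scale_const)

locale indexed_basis =
  fixes b :: "nat list \<Rightarrow> 'a::field series"
  assumes inj: "inj_on b partitions" and indep: "series.independent (b ` partitions)"
begin

abbreviation V where "V \<equiv> series.span (b ` partitions)"

lemma coord_add: "f \<in> V \<Longrightarrow> g \<in> V \<Longrightarrow> coord b (f + g) \<nu> = coord b f \<nu> + coord b g \<nu>"
  by (simp add: coord_def series.representation_add[OF indep])

lemma coord_scale: "f \<in> V \<Longrightarrow> coord b (scale c f) \<nu> = c * coord b f \<nu>"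
  by (simp add: coord_def series.representation_scale[OF indep])

lemma coord_basis: "\<mu> \<in> partitions \<Longrightarrow> \<nu> \<in> partitions \<Longrightarrow> coord b (b \<mu>) \<nu> = (if \<nu> = \<mu> then 1 else 0)"
  using inj by (auto simp: coord_def series.representation_basis[OF indep] dest: inj_onD)

lemma finite_coord: "finite {\<nu>. \<nu> \<in> partitions \<and> coord b f \<nu> \<noteq> 0}"
proof (rule inj_on_finite)
  show "inj_on b {\<nu>. \<nu> \<in> partitions \<and> coord b f \<nu> \<noteq> 0}" using inj by (rule inj_on_subset) auto
  show "b ` {\<nu>. \<nu> \<in> partitions \<and> coord b f \<nu> \<noteq> 0} \<subseteq> {v. series.representation (b ` partitions) f v \<noteq> 0}"
    by (auto simp: coord_def)
qed (rule series.finite_representation)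

lemma linext_superset:
  assumes "\<iota> 0 = 0" "finite F" "F \<subseteq> partitions" "{\<nu>. \<nu> \<in> partitions \<and> coord b f \<nu> \<noteq> 0} \<subseteq> F"
  shows "linext b \<iota> g f = (\<Sum>\<nu>\<in>F. \<iota> (coord b f \<nu>) * g \<nu>)"
  unfolding linext_def using assms by (intro sum.mono_neutral_left) auto

lemma linext_add:
  assumes "\<And>x y. \<iota> (x + y) = \<iota> x + \<iota> y" "f \<in> V" "f' \<in> V"
  shows "linext b \<iota> g (f + f') = linext b \<iota> g f + linext b \<iota> g f'"
proof -
  have 0: "\<iota> 0 = 0" using assms(1)[of 0 0] by simp
  define F where "F = {\<nu>. \<nu> \<in> partitions \<and> coord b f \<nu> \<noteq> 0} \<union> {\<nu>. \<nu> \<in> partitions \<and> coord b f' \<nu> \<noteq> 0}"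
  have F: "finite F" "F \<subseteq> partitions" using finite_coord by (auto simp: F_def)
  have "linext b \<iota> g x = (\<Sum>\<nu>\<in>F. \<iota> (coord b x \<nu>) * g \<nu>)" if "x \<in> {f, f', f + f'}" for x
    using that coord_add[OF assms(2,3)] 0 F by (intro linext_superset) (auto simp: F_def)
  then show ?thesis by (simp add: coord_add[OF assms(2,3)] assms(1) ring_distribs sum.distrib)
qed

lemma linext_scale:
  assumes "\<iota> 0 = 0" "\<And>x y. \<iota> (x * y) = \<iota> x * \<iota> y" "f \<in> V"
  shows "linext b \<iota> g (scale c f) = \<iota> c * linext b \<iota> g f"
proof -
  define F where "F = {\<nu>. \<nu> \<in> partitions \<and> coord b f \<nu> \<noteq> 0}"
  have F: "finite F" "F \<subseteq> partitions" using finite_coord by (auto simp: F_def)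
  have "linext b \<iota> g x = (\<Sum>\<nu>\<in>F. \<iota> (coord b x \<nu>) * g \<nu>)" if "x \<in> {f, scale c f}" for x
    using that coord_scale[OF assms(3)] by (intro linext_superset assms F) (auto simp: F_def)
  then show ?thesis by (simp add: coord_scale[OF assms(3)] assms(2) sum_distrib_left mult.assoc)
qed

lemma linext_basis:
  assumes "\<iota> 0 = 0" "\<iota> 1 = 1" "\<mu> \<in> partitions"
  shows "linext b \<iota> g (b \<mu>) = g \<mu>"
proof -
  have "linext b \<iota> g (b \<mu>) = (\<Sum>\<nu>\<in>{\<mu>}. \<iota> (coord b (b \<mu>) \<nu>) * g \<nu>)"
    using assms by (intro linext_superset) (auto simp: coord_basis split: if_splits)
  then show ?thesis using assms by (simp add: coord_basis)
qed

text \<open>Eigenvalues are compared only on an index set \<open>S\<close> whose members span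
  \<open>f\<close>. For a function of degree \<open>n\<close> this is the set of partitions of
  \<open>n\<close>, on which, for \<open>n > 0\<close>, the eigenvalues of \<open>Delta'\<close> are
  the values at B - 1.\<close>

lemma diag_op_eqI:
  assumes "S \<subseteq> partitions" "f \<in> series.span (b ` S)"
    and "\<And>\<mu>. \<mu> \<in> S \<Longrightarrow> D (b \<mu>) = scale (ev \<mu>) (b \<mu>)"
    and "D 0 = 0" "\<And>f g. f \<in> V \<Longrightarrow> g \<in> V \<Longrightarrow> D (f + g) = D f + D g"
    and "\<And>c f. f \<in> V \<Longrightarrow> D (scale c f) = scale c (D f)"
  shows "diag_op b ev f = D f"
proof -
  have "f \<in> V \<and> diag_op b ev f = D f"
    using assms(2)
  proof (induction rule: series.span_induct_alt)
    case base
    have "coord b 0 \<nu> = 0" for \<nu> by (simp add: coord_def series.representation_zero)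
    then show ?case using assms(4) by (simp add: diag_op_def series.span_zero)
  next
    case (step c x y)
    then obtain \<mu> where \<mu>: "\<mu> \<in> partitions" "\<mu> \<in> S" "x = b \<mu>" using assms(1) by auto
    have x: "x \<in> V" "scale c x \<in> V" using \<mu> by (auto intro: series.span_base series.span_scale)
    have "diag_op b ev (scale c x + y) = scale c (diag_op b ev x) + diag_op b ev y"
      unfolding scale_const[of c "diag_op b ev x"]
      using step x by (simp add: diag_op_linext linext_add linext_scale)
    also have "diag_op b ev x = D x"
      using \<mu> assms(3) by (simp add: diag_op_linext linext_basis)
    finally show ?case using step x assms(5,6) by (simp add: series.span_add)
  qed
  then show ?thesis ..
qed

end

section \<open>Homomorphisms prescribed on the power sums\<close>

interpretation psp: indexed_basis "power_sum_prod :: nat list \<Rightarrow> 'a::field_char_0 series"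
  by unfold_locales (fact power_sum_prod_inj power_sum_prod_independent)+

lemmas sym_funs_span = sym_funs_span_power_sum_prod[symmetric]

text \<open>The homomorphism taking each p_k to \<open>P k\<close>. It is defined linearly on the
  basis of products; multiplicativity is proved in \<open>peval_mult\<close>.\<close>

definition peval :: "('a::field_char_0 \<Rightarrow> 'b::comm_ring_1) \<Rightarrow> (nat \<Rightarrow> 'b) \<Rightarrow> 'a series \<Rightarrow> 'b" where
  "peval \<iota> P = linext power_sum_prod \<iota> (\<lambda>\<nu>. prod_list (map P \<nu>))"

lemma partitions_sort_append:
  assumes "\<mu> \<in> partitions" "\<nu> \<in> partitions"
  obtains \<kappa> where "\<kappa> \<in> partitions" "mset \<kappa> = mset \<mu> + mset \<nu>"
proof (rule that)
  have "0 \<notin># mset \<mu> + mset \<nu>" using assms by (auto simp: partitions_def)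
  then show "rev (sorted_list_of_multiset (mset \<mu> + mset \<nu>)) \<in> partitions"
    "mset (rev (sorted_list_of_multiset (mset \<mu> + mset \<nu>))) = mset \<mu> + mset \<nu>"
    using partition_of_mset by blast+
qed

lemma prod_list_map_mset_cong:
  fixes F :: "'i \<Rightarrow> 'b::comm_monoid_mult"
  shows "mset \<mu> = mset \<nu> \<Longrightarrow> prod_list (map F \<mu>) = prod_list (map F \<nu>)"
  by (metis mset_map prod_mset_prod_list)

lemma sym_funs_induct [consumes 1, case_names zero step]:
  fixes f :: "'a::field_char_0 series"
  assumes "f \<in> sym_funs" "P 0"
    and "\<And>c \<nu> g. \<nu> \<in> partitions \<Longrightarrow> g \<in> sym_funs \<Longrightarrow> P g \<Longrightarrow> P (scale c (power_sum_prod \<nu>) + g)"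
  shows "P f"
proof -
  have "f \<in> series.span (power_sum_prod ` partitions)" using assms(1) by (simp add: sym_funs_span)
  then have "f \<in> sym_funs \<and> P f"
  proof (induction rule: series.span_induct_alt)
    case (step c x y)
    then show ?case using assms(3)
      by (auto intro!: sym_funs_add sym_funs_scale homog_sym_funs[OF power_sum_prod_homog])
  qed (use assms in auto)
  then show ?thesis ..
qed

locale coeff_hom =
  fixes \<iota> :: "'a::field_char_0 \<Rightarrow> 'b::comm_ring_1"
  assumes \<iota>: "\<iota> 0 = 0" "\<iota> 1 = 1" "\<iota> (x + y) = \<iota> x + \<iota> y" "\<iota> (x * y) = \<iota> x * \<iota> y"
begin

lemma peval_zero [simp]: "peval \<iota> P 0 = 0"
  by (simp add: peval_def linext_def coord_def series.representation_zero)

lemma peval_add: "f \<in> sym_funs \<Longrightarrow> g \<in> sym_funs \<Longrightarrow> peval \<iota> P (f + g) = peval \<iota> P f + peval \<iota> P g"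
  by (simp add: peval_def psp.linext_add \<iota> sym_funs_span)

lemma peval_scale: "f \<in> sym_funs \<Longrightarrow> peval \<iota> P (scale c f) = \<iota> c * peval \<iota> P f"
  by (simp add: peval_def psp.linext_scale \<iota> sym_funs_span)

lemma peval_power_sum_prod: "\<nu> \<in> partitions \<Longrightarrow> peval \<iota> P (power_sum_prod \<nu>) = prod_list (map P \<nu>)"
  by (simp add: peval_def psp.linext_basis \<iota>)

lemma peval_power_sum: "k > 0 \<Longrightarrow> peval \<iota> P (power_sum k) = P k"
  using peval_power_sum_prod[of "[k]" P] by (simp add: power_sum_prod_def partitions_def)

lemma peval_one: "peval \<iota> P 1 = 1"
  using peval_power_sum_prod[of "[]" P] by (simp add: power_sum_prod_def partitions_def)

text \<open>The product of two basis elements is the basis element of the merged partition;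
  bilinearity does the rest, by one induction in each factor.\<close>

lemma peval_mult:
  assumes "f \<in> sym_funs" "g \<in> sym_funs"
  shows "peval \<iota> P (f * g) = peval \<iota> P f * peval \<iota> P g"
  using assms(1)
proof (induction f rule: sym_funs_induct)
  case (step c \<mu> f)
  have \<mu>: "(power_sum_prod \<mu> :: 'a series) \<in> sym_funs" by (rule homog_sym_funs[OF power_sum_prod_homog])
  have "peval \<iota> P (power_sum_prod \<mu> * g) = peval \<iota> P (power_sum_prod \<mu>) * peval \<iota> P g"
    using assms(2)
  proof (induction g rule: sym_funs_induct)
    case (step d \<nu> g)
    have \<nu>: "(power_sum_prod \<nu> :: 'a series) \<in> sym_funs" by (rule homog_sym_funs[OF power_sum_prod_homog])
    obtain \<kappa> where \<kappa>: "\<kappa> \<in> partitions" "mset \<kappa> = mset (\<mu> @ \<nu>)"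
      using partitions_sort_append[OF \<open>\<mu> \<in> partitions\<close> step(1)] by auto
    have "power_sum_prod \<mu> * power_sum_prod \<nu> = (power_sum_prod \<kappa> :: 'a series)"
      using prod_list_map_mset_cong[OF \<kappa>(2), of "power_sum :: _ \<Rightarrow> 'a series"] by (simp add: power_sum_prod_def)
    then have "peval \<iota> P (power_sum_prod \<mu> * power_sum_prod \<nu>) =
        peval \<iota> P (power_sum_prod \<mu>) * peval \<iota> P (power_sum_prod \<nu>)"
      using prod_list_map_mset_cong[OF \<kappa>(2)] \<kappa>(1) step(1) \<open>\<mu> \<in> partitions\<close>
      by (simp add: peval_power_sum_prod)
    then show ?case using \<mu> \<nu> step
      by (simp add: ring_distribs scale_mult_right peval_add peval_scale sym_funs_mult mult.left_commute)
  qed simp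
  then show ?case using \<mu> step assms(2)
    by (simp add: ring_distribs scale_mult_left peval_add peval_scale sym_funs_mult mult.assoc)
qed simp

lemma hom_on_sym_peval: "hom_on_sym (peval \<iota> P)"
  by (simp add: hom_on_sym_def peval_one peval_add peval_mult)

end

interpretation const: coeff_hom "const :: 'a::field_char_0 \<Rightarrow> 'a series"
  by unfold_locales auto

interpretation const_poly: coeff_hom "\<lambda>c :: 'a::field_char_0. [:const c:]"
  by unfold_locales auto

lemma psp_sym: "power_sum_prod \<nu> \<in> sym_funs"
  by (rule homog_sym_funs[OF power_sum_prod_homog])

text \<open>Besides the substitution of X(1 - u) this covers its inverse, with factors
  \<open>1 / (1 - u ^ k)\<close>.\<close>

definition dilate :: "(nat \<Rightarrow> 'a) \<Rightarrow> 'a::field_char_0 series \<Rightarrow> 'a series" where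
  "dilate b = peval const (\<lambda>k. scale (b k) (power_sum k))"

lemma prod_scale_power_sum:
  "prod_list (map (\<lambda>k. scale (b k) (power_sum k)) \<nu>) = scale (prod_list (map b \<nu>)) (power_sum_prod \<nu>)"
proof (induction \<nu>)
  case (Cons k \<nu>)
  then show ?case by (simp add: power_sum_prod_def scale_mult_left scale_mult_right mult.commute)
qed (simp add: power_sum_prod_def)

lemma pleth_one_minus_dilate:
  "(pleth_one_minus u :: 'a::field_char_0 series \<Rightarrow> _) = dilate (\<lambda>k. 1 - u ^ k)"
  by (simp add: pleth_one_minus_def dilate_def peval_def diag_op_linext prod_scale_power_sum)

lemma pleth_one_minus_peval:
  "pleth_one_minus u = peval const (\<lambda>k. scale (1 - u ^ k) (power_sum k) :: 'a::field_char_0 series)"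
  by (simp add: pleth_one_minus_dilate dilate_def)

lemma dilate_psp:
  "\<nu> \<in> partitions \<Longrightarrow> dilate b (power_sum_prod \<nu>) = scale (prod_list (map b \<nu>)) (power_sum_prod \<nu>)"
  by (simp add: dilate_def const.peval_power_sum_prod prod_scale_power_sum)

lemma dilate_zero [simp]: "dilate b 0 = 0"
  by (simp add: dilate_def)

lemma dilate_add: "f \<in> sym_funs \<Longrightarrow> g \<in> sym_funs \<Longrightarrow> dilate b (f + g) = dilate b f + dilate b g"
  by (simp add: dilate_def const.peval_add)

lemma dilate_scale: "f \<in> sym_funs \<Longrightarrow> dilate b (scale c f) = scale c (dilate b f)"
  by (simp add: dilate_def const.peval_scale flip: scale_const)

lemma hom_on_sym_pleth: "hom_on_sym (pleth_one_minus u :: 'a::field_char_0 series \<Rightarrow> _)"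
  by (simp add: pleth_one_minus_peval const.hom_on_sym_peval)

lemma dilate_homog:
  assumes "f \<in> homog n"
  shows "dilate b f \<in> homog n"
proof -
  have "f \<in> series.span (power_sum_prod ` partitions_of n)"
    using assms homog_span_power_sum_prod by blast
  then have "f \<in> sym_funs \<and> dilate b f \<in> homog n"
  proof (induction rule: series.span_induct_alt)
    case base
    then show ?case by (simp add: homog_zero)
  next
    case (step c x y)
    then obtain \<nu> where \<nu>: "x = power_sum_prod \<nu>" "\<nu> \<in> partitions" "sum_list \<nu> = n"
      by (auto simp: partitions_of_def)
    have "x \<in> sym_funs" by (simp add: \<nu> psp_sym)
    moreover have "dilate b x \<in> homog n"
      using \<nu> power_sum_prod_homog[of \<nu>] by (auto simp: dilate_psp intro: homog_scale)
    ultimately show ?case using step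
      by (simp add: dilate_add dilate_scale sym_funs_add homog_add homog_scale)
  qed
  then show ?thesis ..
qed

lemma dilate_sym: "f \<in> sym_funs \<Longrightarrow> dilate b f \<in> sym_funs"
  by (induction f rule: sym_funs_induct) (simp_all add: dilate_add dilate_scale dilate_psp psp_sym sym_funs_add)

lemma dilate_inverse:
  assumes "\<And>k. k > 0 \<Longrightarrow> c k * b k = 1" "f \<in> sym_funs"
  shows "dilate c (dilate b f) = f"
  using assms(2)
proof (induction f rule: sym_funs_induct)
  case (step d \<nu> g)
  have "prod_list (map b \<nu>) * prod_list (map c \<nu>) = 1" if "0 \<notin> set \<nu>"
    using that assms(1) by (induction \<nu>) (auto simp: algebra_simps)
  then have "prod_list (map b \<nu>) * prod_list (map c \<nu>) = 1" using step(1) by (simp add: partitions_def)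
  then show ?case using step
    by (simp add: dilate_add dilate_scale dilate_psp psp_sym dilate_sym sym_funs_add mult.assoc)
qed simp

section \<open>Vertex operators\<close>

definition geom_fps :: "'a::comm_ring_1 \<Rightarrow> 'a fps" where
  "geom_fps x = Abs_fps (\<lambda>k. x ^ k)"

definition pow_fps :: "'a::comm_ring_1 \<Rightarrow> 'a fps" where
  "pow_fps x = Abs_fps (\<lambda>k. if k = 0 then 0 else x ^ k)"

lemma geom_fps_inverse: "geom_fps x * (1 - fps_const x * fps_X) = 1"
proof (rule fps_ext)
  fix n
  have "geom_fps x * (1 - fps_const x * fps_X) = geom_fps x - fps_const x * (geom_fps x * fps_X)"
    by (simp add: algebra_simps)
  then show "fps_nth (geom_fps x * (1 - fps_const x * fps_X)) n = fps_nth 1 n"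
    by (cases n) (simp_all add: geom_fps_def)
qed

text \<open>The case of a single variable \<open>x\<close>, where h_k and p_k are both
  \<open>x ^ k\<close>.\<close>

lemma newton_geom: "newton (pow_fps x) (geom_fps x)"
proof -
  have "of_nat n * x ^ n = (\<Sum>k=0..n. (if k = 0 then 0 else x ^ k) * x ^ (n - k))" for n
  proof -
    have "(\<Sum>k=0..n. (if k = 0 then 0 else x ^ k) * x ^ (n - k)) = (\<Sum>k=1..n. x ^ n)"
      by (intro sum.mono_neutral_cong_right) (auto simp flip: power_add)
    then show ?thesis by simp
  qed
  then show ?thesis by (simp add: newton_iff pow_fps_def geom_fps_def)
qed

lemma newton_inverse_geom: "newton (- pow_fps x) (1 - fps_const x * fps_X)"
  by (rule newton_inverse[OF newton_geom geom_fps_inverse])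

text \<open>\<open>add_var a\<close> is the plethystic substitution \<open>f[X + A w]\<close> into polynomials in \<open>w\<close>, where
  \<open>a k\<close> is \<open>p\<^sub>k[A]\<close>; \<open>vertex_op a g f\<close> is then the coefficient of \<open>w\<^sup>0\<close> in
  \<open>f[X + A w] \<Sum>\<^sub>k g\<^sub>k w\<^sup>-\<^sup>k\<close>.\<close>

definition add_var :: "(nat \<Rightarrow> 'a) \<Rightarrow> 'a::field_char_0 series \<Rightarrow> 'a series poly" where
  "add_var a = peval (\<lambda>c. [:const c:]) (\<lambda>k. [:power_sum k:] + monom (const (a k)) k)"

definition vertex_op :: "(nat \<Rightarrow> 'a) \<Rightarrow> (nat \<Rightarrow> 'a series) \<Rightarrow> 'a::field_char_0 series \<Rightarrow> 'a series" where
  "vertex_op a g f = (\<Sum>k\<le>degree (add_var a f). coeff (add_var a f) k * g k)"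

lemma vertex_op_degree:
  assumes "degree (add_var a f) \<le> N"
  shows "vertex_op a g f = (\<Sum>k\<le>N. coeff (add_var a f) k * g k)"
  unfolding vertex_op_def using assms
  by (intro sum.mono_neutral_left) (auto simp: coeff_eq_0)

lemma vertex_op_add:
  assumes "f \<in> sym_funs" "f' \<in> sym_funs"
  shows "vertex_op a g (f + f') = vertex_op a g f + vertex_op a g f'"
proof -
  define N where "N = max (degree (add_var a f)) (degree (add_var a f'))"
  have eq: "add_var a (f + f') = add_var a f + add_var a f'"
    using assms by (simp add: add_var_def const_poly.peval_add)
  have "degree (add_var a (f + f')) \<le> N" unfolding eq N_def by (rule degree_add_le_max)
  then show ?thesis
    by (simp add: vertex_op_degree[of _ _ N] N_def eq ring_distribs sum.distrib)
qed

lemma vertex_op_scale: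
  assumes "f \<in> sym_funs"
  shows "vertex_op a g (scale c f) = scale c (vertex_op a g f)"
proof -
  have eq: "add_var a (scale c f) = smult (const c) (add_var a f)"
    using assms by (simp add: add_var_def const_poly.peval_scale)
  have deg: "degree (add_var a (scale c f)) \<le> degree (add_var a f)" unfolding eq by (rule degree_smult_le)
  show ?thesis
    unfolding vertex_op_degree[OF deg] eq
    by (simp add: vertex_op_def scale_const sum_distrib_left mult.assoc)
qed

text \<open>As generating functions, f[X + A w] is the product of the series \<open>f\<close> and
  the series \<open>c\<close> attached to the alphabet A, with w recording the degree in A. Both
  sides solve the same Newton equation over polynomials in w, which has only one solution.\<close>

lemma add_var_newton:
  fixes f p :: "'a::field_char_0 series fps"
  assumes "newton p f" "fps_nth p 0 = 0" "\<And>n. fps_nth p n \<in> sym_funs" "\<And>n. fps_nth f n \<in> sym_funs"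
    and "newton \<alpha> c" "fps_nth \<alpha> 0 = 0"
    and a: "\<And>k. k > 0 \<Longrightarrow> add_var a (fps_nth p k) = [:fps_nth p k:] + monom (const (fps_nth \<alpha> k)) k"
  shows "add_var a (fps_nth f n) = (\<Sum>j\<le>n. monom (const (fps_nth c j) * fps_nth f (n - j)) j)"
proof -
  define P where "P = Abs_fps (\<lambda>n. [:fps_nth p n:])"
  define F where "F = Abs_fps (\<lambda>n. [:fps_nth f n:])"
  define A where "A = Abs_fps (\<lambda>n. monom (const (fps_nth \<alpha> n)) n)"
  define C where "C = Abs_fps (\<lambda>n. monom (const (fps_nth c n)) n)"
  have pCsum: "[:sum g X:] = (\<Sum>x\<in>X. [:g x:])" for g :: "nat \<Rightarrow> 'a series" and X
  proof (induction X rule: infinite_finite_induct)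
    case (insert x X)
    have "[:g x + sum g X:] = [:g x:] + [:sum g X:]" by simp
    then show ?case using insert by simp
  qed auto
  have msum: "monom (sum g X) m = (\<Sum>x\<in>X. monom (g x) m)" for g :: "nat \<Rightarrow> 'a series" and X m
    by (induction X rule: infinite_finite_induct) (auto simp: add_monom[symmetric])
  have "newton P F"
    unfolding newton_iff
  proof safe
    show "fps_nth F 0 = 1" using assms(1) by (simp add: F_def newton_def)
    fix n
    have "of_nat n * [:fps_nth f n:] = [:of_nat n * fps_nth f n:]" by (simp add: of_nat_poly)
    also have "\<dots> = [:\<Sum>k=0..n. fps_nth p k * fps_nth f (n - k):]" using assms(1) by (simp add: newton_iff)
    finally show "of_nat n * fps_nth F n = (\<Sum>k=0..n. fps_nth P k * fps_nth F (n - k))"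
      by (simp add: F_def P_def pCsum mult.commute)
  qed
  moreover have "newton A C"
    unfolding newton_iff
  proof safe
    show "fps_nth C 0 = 1" using assms(5) by (simp add: C_def newton_def)
    fix n
    have "of_nat n * monom (const (fps_nth c n)) n = monom (const (of_nat n * fps_nth c n)) n"
      by (simp add: of_nat_poly smult_monom)
    also have "of_nat n * fps_nth c n = (\<Sum>k=0..n. fps_nth \<alpha> k * fps_nth c (n - k))"
      using assms(5) by (simp add: newton_iff)
    also have "monom (const \<dots>) n = (\<Sum>k=0..n. monom (const (fps_nth \<alpha> k)) k * monom (const (fps_nth c (n - k))) (n - k))"
      by (simp add: const_sum msum mult_monom)
    finally show "of_nat n * fps_nth C n = (\<Sum>k=0..n. fps_nth A k * fps_nth C (n - k))"
      by (simp add: A_def C_def)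
  qed
  ultimately have prod: "newton (P + A) (F * C)" by (rule newton_mult)
  have "newton (Abs_fps (\<lambda>n. add_var a (fps_nth p n))) (Abs_fps (\<lambda>n. add_var a (fps_nth f n)))"
    using assms(1-4) const_poly.hom_on_sym_peval unfolding add_var_def by (intro newton_hom)
  moreover have "Abs_fps (\<lambda>n. add_var a (fps_nth p n)) = P + A"
  proof (rule fps_ext)
    fix n show "fps_nth (Abs_fps (\<lambda>n. add_var a (fps_nth p n))) n = fps_nth (P + A) n"
      using a[of n] assms(2,6) by (cases "n = 0") (auto simp: P_def A_def add_var_def)
  qed
  ultimately have "newton (P + A) (Abs_fps (\<lambda>n. add_var a (fps_nth f n)))" by simp
  then have "Abs_fps (\<lambda>n. add_var a (fps_nth f n)) = F * C"
    by (rule newton_unique[OF _ prod])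
      (auto simp: P_def A_def assms intro: of_nat_mult_series_poly_eq_0)
  then have "add_var a (fps_nth f n) = fps_nth (C * F) n" by (metis fps_nth_Abs_fps mult.commute)
  also have "\<dots> = (\<Sum>j=0..n. monom (const (fps_nth c j)) j * [:fps_nth f (n - j):])"
    by (simp add: fps_mult_nth F_def C_def)
  also have "\<dots> = (\<Sum>j\<le>n. monom (const (fps_nth c j) * fps_nth f (n - j)) j)"
    by (rule sum.cong) (auto simp: smult_monom mult.commute)
  finally show ?thesis .
qed

lemma power_sum_sym: "power_sum n \<in> sym_funs"
  and complete_sym_sym: "complete_sym n \<in> sym_funs"
  and elem_sym: "elem n \<in> sym_funs"
  by (rule homog_sym_funs[OF power_sum_homog] homog_sym_funs[OF complete_sym_homog]
      homog_sym_funs[OF elem_homog])+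

lemma sign_elem_sym: "(- 1) ^ n * elem n \<in> sym_funs"
  by (metis const_power const_simps(2,6) const_sym_funs elem_sym sym_funs_mult)

lemma add_var_power_sum:
  "k > 0 \<Longrightarrow> add_var a (power_sum k) = [:power_sum k:] + monom (const (a k)) k"
  by (simp add: add_var_def const_poly.peval_power_sum)

text \<open>\<open>c\<close> is the expansion of (1 - v z) / (1 - z), the generating function of the
  h_j[1 - v], with coefficients 1, 1 - v, 1 - v, and so on.\<close>

lemma add_var_complete:
  fixes v :: "'a::field_char_0"
  shows "add_var (\<lambda>k. 1 - v ^ k) (complete_sym n) =
    (\<Sum>j\<le>n. monom (const (if j = 0 then 1 else 1 - v) * complete_sym (n - j)) j)"
proof -
  define c where "c = geom_fps 1 * (1 - fps_const v * fps_X)"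
  have newt: "newton (pow_fps 1 + - pow_fps v) c"
    unfolding c_def by (rule newton_mult newton_geom newton_inverse_geom)+
  have c: "fps_nth c j = (if j = 0 then 1 else 1 - v)" for j
  proof -
    have "c = geom_fps 1 - fps_const v * (geom_fps 1 * fps_X)" by (simp add: c_def algebra_simps)
    then show ?thesis by (cases j) (auto simp: geom_fps_def)
  qed
  have "add_var (\<lambda>k. 1 - v ^ k) (fps_nth complete_fps n) =
      (\<Sum>j\<le>n. monom (const (fps_nth c j) * fps_nth complete_fps (n - j)) j)"
    by (rule add_var_newton[OF newton_complete _ _ _ newt])
      (auto simp: power_fps_def complete_fps_def pow_fps_def power_sum_sym complete_sym_sym add_var_power_sum)
  then show ?thesis by (simp add: c complete_fps_def)
qed

text \<open>With M = (1 - q)(1 - t), p_k[M] is 1 - q^k - t^k + (q t)^k, so the signed elementary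
  series of M is (1 - z)(1 - q t z) / ((1 - q z)(1 - t z)). This equals 1 - M z / ((1 - q z)(1 - t
  z)), the origin of the (q,t)-integers.\<close>

lemma add_var_elem:
  fixes q t :: "'a::field_char_0"
  shows "add_var (\<lambda>k. (1 - q ^ k) * (1 - t ^ k)) ((- 1) ^ n * elem n) =
    (\<Sum>j\<le>n. monom (const (if j = 0 then 1 else - ((1 - q) * (1 - t)) * (\<Sum>i<j. q ^ i * t ^ (j - i - 1))) *
       ((- 1) ^ (n - j) * elem (n - j))) j)"
proof -
  define c where "c = (geom_fps q * geom_fps t) * ((1 - fps_const 1 * fps_X) * (1 - fps_const (q * t) * fps_X))"
  have newt: "newton ((pow_fps q + pow_fps t) + (- pow_fps 1 + - pow_fps (q * t))) c"
    unfolding c_def by (intro newton_mult newton_geom newton_inverse_geom)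
  have "(1 - fps_const 1 * fps_X) * (1 - fps_const (q * t) * fps_X) =
      (1 - fps_const q * fps_X) * (1 - fps_const t * fps_X) - fps_const ((1 - q) * (1 - t)) * fps_X"
    by (simp add: algebra_simps flip: fps_const_mult fps_const_add fps_const_sub)
  then have "c = (geom_fps q * geom_fps t) * ((1 - fps_const q * fps_X) * (1 - fps_const t * fps_X)) -
      (geom_fps q * geom_fps t) * (fps_const ((1 - q) * (1 - t)) * fps_X)"
    by (simp only: c_def right_diff_distrib)
  then have "c = (geom_fps q * (1 - fps_const q * fps_X)) * (geom_fps t * (1 - fps_const t * fps_X)) -
      fps_const ((1 - q) * (1 - t)) * (geom_fps q * geom_fps t * fps_X)"
    by (simp only: mult_ac)
  then have ceq: "c = 1 - fps_const ((1 - q) * (1 - t)) * (geom_fps q * geom_fps t * fps_X)"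
    by (simp add: geom_fps_inverse)
  have c: "fps_nth c j = (if j = 0 then 1 else - ((1 - q) * (1 - t)) * (\<Sum>i<j. q ^ i * t ^ (j - i - 1)))" for j
  proof (cases j)
    case (Suc k)
    have "fps_nth (geom_fps q * geom_fps t) k = (\<Sum>i<j. q ^ i * t ^ (j - i - 1))"
      unfolding fps_mult_nth geom_fps_def Suc by (rule sum.cong) auto
    then show ?thesis unfolding ceq using Suc by simp
  qed (simp add: ceq)
  have "add_var (\<lambda>k. (1 - q ^ k) * (1 - t ^ k)) (fps_nth elem_fps n) =
      (\<Sum>j\<le>n. monom (const (fps_nth c j) * fps_nth elem_fps (n - j)) j)"
  proof (rule add_var_newton[OF newton_elem _ _ _ newt])
    fix k :: nat assume k: "k > 0"
    have "add_var a (- power_sum k) = - add_var a (power_sum k)" for a :: "nat \<Rightarrow> 'a"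
      unfolding add_var_def by (rule hom_on_sym_uminus[OF const_poly.hom_on_sym_peval power_sum_sym])
    moreover have "fps_nth (pow_fps q + pow_fps t + (- pow_fps 1 + - pow_fps (q * t))) k =
        - ((1 - q ^ k) * (1 - t ^ k))"
      using k by (simp add: pow_fps_def algebra_simps power_mult_distrib)
    ultimately show "add_var (\<lambda>k. (1 - q ^ k) * (1 - t ^ k)) (fps_nth (- power_fps) k) =
        [:fps_nth (- power_fps) k:] +
        monom (const (fps_nth (pow_fps q + pow_fps t + (- pow_fps 1 + - pow_fps (q * t))) k)) k"
      using k by (simp add: power_fps_def add_var_power_sum minus_monom del: const_simps) (simp add: minus_monom)
  next
    fix n :: nat
    have "- power_sum n = const (- 1) * (power_sum n :: 'a series)" by simp
    then have "- power_sum n \<in> (sym_funs :: 'a series set)"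
      by (metis const_sym_funs power_sum_sym sym_funs_mult)
    then show "fps_nth (- power_fps) n \<in> (sym_funs :: 'a series set)" by (simp add: power_fps_def)
  qed (auto simp: elem_fps_def sign_elem_sym power_fps_def pow_fps_def)
  then show ?thesis by (simp add: c elem_fps_def)
qed

section \<open>The Macdonald operator and its conjugate by plethysm\<close>

text \<open>The operator usually denoted D_0, for general parameters.\<close>

definition macdonald_op :: "'a \<Rightarrow> 'a \<Rightarrow> 'a::field_char_0 series \<Rightarrow> 'a series" where
  "macdonald_op q t = vertex_op (\<lambda>k. (1 - q ^ k) * (1 - t ^ k)) (\<lambda>k. (- 1) ^ k * elem k)"

lemma macdonald_op_commute: "macdonald_op q t = macdonald_op t q"
  by (simp add: macdonald_op_def mult.commute)

lemma degree_sum_monom: "degree (\<Sum>j\<le>n. monom (c j) j) \<le> n"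
  by (rule degree_sum_le) (auto intro: order.trans[OF degree_monom_le])

lemma coeff_sum_monom: "coeff (\<Sum>j\<le>n. monom (c j) j) k = (if k \<le> n then c k else 0)"
  by (simp add: coeff_sum coeff_monom eq_commute)

text \<open>The elementary series carries signs, so the operator is computed on (-1)^n e_n and the
  sign is cancelled at the end. The summand k = 0 is \<open>elem n\<close> itself; the others have
  the coefficients found in \<open>add_var_elem\<close>.\<close>

lemma macdonald_op_elem:
  fixes q t :: "'a::field_char_0"
  shows "macdonald_op q t (elem n) = elem n -
    scale ((1 - q) * (1 - t)) (\<Sum>k=1..n. scale (\<Sum>i<k. q ^ i * t ^ (k - i - 1)) (elem k * elem (n - k)))"
proof -
  define a where "a = (\<lambda>k. (1 - q ^ k) * (1 - t ^ k))"
  define \<epsilon> where "\<epsilon> j = (if j = 0 then 1 else - ((1 - q) * (1 - t)) * (\<Sum>i<j. q ^ i * t ^ (j - i - 1)))" for j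
  have sign: "(- 1) ^ k * elem k = scale ((- 1) ^ k) (elem k :: 'a series)" for k
    by (simp add: scale_const)
  define E where "E = scale ((- 1) ^ n) (elem n :: 'a series)"
  have add: "add_var a E = (\<Sum>j\<le>n. monom (const (\<epsilon> j) * ((- 1) ^ (n - j) * elem (n - j))) j)"
    using add_var_elem[of q t n] by (simp add: sign a_def \<epsilon>_def E_def)
  have "degree (add_var a E) \<le> n" unfolding add by (rule degree_sum_monom)
  then have "macdonald_op q t E = (\<Sum>k\<le>n. coeff (add_var a E) k * ((- 1) ^ k * elem k))"
    unfolding macdonald_op_def a_def[symmetric] by (rule vertex_op_degree)
  also have "\<dots> = (\<Sum>k\<le>n. scale ((- 1) ^ n) (scale (\<epsilon> k) (elem k * elem (n - k))))"
  proof (rule sum.cong)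
    fix k assume "k \<in> {..n}"
    then have "(- 1) ^ n = (- 1) ^ (n - k) * (- 1 :: 'a series) ^ k" by (simp flip: power_add)
    then show "coeff (add_var a E) k * ((- 1) ^ k * elem k) = scale ((- 1) ^ n) (scale (\<epsilon> k) (elem k * elem (n - k)))"
      using \<open>k \<in> {..n}\<close> unfolding add coeff_sum_monom
      by (simp add: scale_const mult_ac)
  qed simp
  finally have "scale ((- 1) ^ n) (macdonald_op q t (elem n)) = scale ((- 1) ^ n) (\<Sum>k\<le>n. scale (\<epsilon> k) (elem k * elem (n - k)))"
    by (simp add: E_def macdonald_op_def vertex_op_scale elem_sym series.scale_sum_right)
  then have "macdonald_op q t (elem n) = (\<Sum>k\<le>n. scale (\<epsilon> k) (elem k * elem (n - k)))"
    by (rule series.scale_left_imp_eq[rotated]) simp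
  also have "{..n} = insert 0 {1..n}" by auto
  also have "(\<Sum>k\<in>insert 0 {1..n}. scale (\<epsilon> k) (elem k * elem (n - k))) =
      elem n + (\<Sum>k=1..n. scale (\<epsilon> k) (elem k * elem (n - k)))"
    by (simp add: \<epsilon>_def)
  also have "(\<Sum>k=1..n. scale (\<epsilon> k) (elem k * elem (n - k))) =
      - scale ((1 - q) * (1 - t)) (\<Sum>k=1..n. scale (\<Sum>i<k. q ^ i * t ^ (k - i - 1)) (elem k * elem (n - k)))"
    unfolding series.scale_sum_right sum_negf[symmetric]
    by (rule sum.cong) (auto simp: \<epsilon>_def)
  finally show ?thesis by simp
qed

text \<open>On p_x both orders of substitution give (1 - u^x) (p_x + a'_x w^x), as the factor 1 -
  u^x of a_x is the one that the plethysm produces on X. Induction over the factors extends this to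
  products.\<close>

lemma coeff_add_var_pleth:
  fixes u :: "'a::field_char_0"
  assumes "\<And>k. a k = (1 - u ^ k) * a' k" "f \<in> sym_funs"
  shows "coeff (add_var a f) k \<in> sym_funs \<and>
    pleth_one_minus u (coeff (add_var a f) k) = coeff (add_var a' (pleth_one_minus u f)) k"
  using assms(2)
proof (induction f arbitrary: k rule: sym_funs_induct)
  case zero
  then show ?case by (simp add: add_var_def pleth_one_minus_peval)
next
  case (step c \<nu> g)
  let ?Q = "pleth_one_minus u :: 'a series \<Rightarrow> _"
  have Q: "?Q (f + g) = ?Q f + ?Q g" "?Q (f * g) = ?Q f * ?Q g" "?Q (scale c f) = scale c (?Q f)"
    "?Q (const c) = const c" "?Q 0 = 0"
    if "f \<in> sym_funs" "g \<in> sym_funs" for f g c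
    using that const.peval_scale[of 1 _ c]
    by (simp_all add: pleth_one_minus_peval const.peval_add const.peval_mult const.peval_scale
        const.peval_one scale_const)
  have Qsym: "?Q f \<in> sym_funs" if "f \<in> sym_funs" for f
    using that by (simp add: pleth_one_minus_dilate dilate_sym)
  have "coeff (add_var a (power_sum_prod \<nu>)) k \<in> sym_funs \<and>
    ?Q (coeff (add_var a (power_sum_prod \<nu>)) k) = coeff (add_var a' (?Q (power_sum_prod \<nu>))) k" for k
    using step(1)
  proof (induction \<nu> arbitrary: k)
    case Nil
    then show ?case
      by (auto simp: power_sum_prod_def add_var_def pleth_one_minus_peval const.peval_one const_poly.peval_one
          coeff_1)
  next
    case (Cons x \<nu>)
    have \<nu>: "\<nu> \<in> partitions" and x: "x > 0" using Cons.prems by (auto simp: partitions_def)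
    define G where "G = add_var a (power_sum_prod \<nu>)"
    define G' where "G' = add_var a' (?Q (power_sum_prod \<nu>))"
    have GG: "coeff G k \<in> sym_funs" "?Q (coeff G k) = coeff G' k" for k
      using Cons.IH[OF \<nu>] by (auto simp: G_def G'_def)
    have sym: "(power_sum_prod \<nu> :: 'a series) \<in> sym_funs" "(power_sum x :: 'a series) \<in> sym_funs"
      by (rule psp_sym power_sum_sym)+
    have eq: "power_sum_prod (x # \<nu>) = power_sum x * power_sum_prod \<nu>" by (simp add: power_sum_prod_def)
    have L: "add_var a (power_sum_prod (x # \<nu>)) = ([:power_sum x:] + monom (const (a x)) x) * G"
      using sym x by (simp add: eq G_def add_var_def const_poly.peval_mult const_poly.peval_power_sum)
    have Lk: "coeff (add_var a (power_sum_prod (x # \<nu>))) k =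
        power_sum x * coeff G k + (if x \<le> k then const (a x) * coeff G (k - x) else 0)"
      by (simp add: L ring_distribs coeff_monom_mult)
    have Qx: "?Q (power_sum x) = scale (1 - u ^ x) (power_sum x)"
      using x by (simp add: pleth_one_minus_peval const.peval_power_sum)
    have R: "add_var a' (?Q (power_sum_prod (x # \<nu>))) =
        [:const (1 - u ^ x):] * ([:power_sum x:] + monom (const (a' x)) x) * G'"
      using sym x Qsym by (simp add: eq Q Qx G'_def add_var_def const_poly.peval_mult const_poly.peval_scale
          const_poly.peval_power_sum del: const_simps)
    have Rk: "coeff (add_var a' (?Q (power_sum_prod (x # \<nu>)))) k =
        const (1 - u ^ x) * power_sum x * coeff G' k + (if x \<le> k then const (a x) * coeff G' (k - x) else 0)"
      by (simp add: R assms(1) ring_distribs smult_monom coeff_monom_mult mult.assoc del: const_simps)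
        (simp add: ring_distribs coeff_monom_mult mult.assoc)
    have "?Q (coeff (add_var a (power_sum_prod (x # \<nu>))) k) = coeff (add_var a' (?Q (power_sum_prod (x # \<nu>)))) k"
      using GG sym by (simp add: Lk Rk Q Qx sym_funs_mult scale_const del: const_simps)
    moreover have "coeff (add_var a (power_sum_prod (x # \<nu>))) k \<in> sym_funs"
      using GG sym by (simp add: Lk sym_funs_mult sym_funs_add)
    ultimately show ?case by blast
  qed
  moreover have "power_sum_prod \<nu> \<in> (sym_funs :: 'a series set)" by (rule psp_sym)
  ultimately show ?case using step Qsym
    by (simp add: add_var_def const_poly.peval_add const_poly.peval_scale sym_funs_add Q
        scale_const[symmetric])
qed

lemma pleth_vertex_op:
  fixes u :: "'a::field_char_0"
  assumes "\<And>k. a k = (1 - u ^ k) * a' k" "f \<in> sym_funs" "\<And>k. g k \<in> sym_funs"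
  shows "pleth_one_minus u (vertex_op a g f) =
    vertex_op a' (\<lambda>k. pleth_one_minus u (g k)) (pleth_one_minus u f)"
proof -
  note * = coeff_add_var_pleth[OF assms(1,2)]
  define N where "N = max (degree (add_var a f)) (degree (add_var a' (pleth_one_minus u f)))"
  have "pleth_one_minus u (vertex_op a g f) = (\<Sum>k\<le>N. pleth_one_minus u (coeff (add_var a f) k * g k))"
    using * assms(3)
    by (subst vertex_op_degree[of _ _ N], simp add: N_def,
        subst hom_on_sym_sum[OF hom_on_sym_pleth]) (auto intro: sym_funs_mult)
  also have "\<dots> = (\<Sum>k\<le>N. coeff (add_var a' (pleth_one_minus u f)) k * pleth_one_minus u (g k))"
    using * assms(3) hom_on_sym_pleth[of u] by (auto simp: hom_on_sym_def intro!: sum.cong)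
  also have "\<dots> = vertex_op a' (\<lambda>k. pleth_one_minus u (g k)) (pleth_one_minus u f)"
    by (subst vertex_op_degree[of _ _ N]) (auto simp: N_def)
  finally show ?thesis .
qed

definition pleth_elem :: "'a \<Rightarrow> nat \<Rightarrow> 'a::field_char_0 series" where
  "pleth_elem u k = pleth_one_minus u ((- 1) ^ k * elem k)"

text \<open>What \<open>macdonald_op\<close> becomes when X is replaced by X(1 - u): of the factors
  (1 - u^k)(1 - v^k) only the second survives in the added alphabet.\<close>

definition macdonald_op_conj :: "'a \<Rightarrow> 'a \<Rightarrow> 'a::field_char_0 series \<Rightarrow> 'a series" where
  "macdonald_op_conj u v = vertex_op (\<lambda>k. 1 - v ^ k) (pleth_elem u)"

lemma pleth_macdonald_op: "f \<in> sym_funs \<Longrightarrow> pleth_one_minus u (macdonald_op u v f) = macdonald_op_conj u v (pleth_one_minus u f)"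
  unfolding macdonald_op_def macdonald_op_conj_def pleth_elem_def by (rule pleth_vertex_op) (auto simp: sign_elem_sym)

text \<open>The series H(z) at X(1 - u) is H(z) / H(u z). The signed elementary series at X(1 - u)
  is its inverse, and multiplied by H(z) it leaves H(u z).\<close>

lemma complete_mult_pleth_elem:
  fixes u :: "'a::field_char_0"
  shows "(\<Sum>k=0..n. pleth_elem u k * complete_sym (n - k)) = scale (u ^ n) (complete_sym n)"
proof -
  let ?Q = "pleth_one_minus u :: 'a series \<Rightarrow> _"
  define QH where "QH = Abs_fps (\<lambda>n. ?Q (fps_nth complete_fps n))"
  define QE where "QE = Abs_fps (\<lambda>n. ?Q (fps_nth elem_fps n))"
  define QP where "QP = Abs_fps (\<lambda>n. ?Q (fps_nth power_fps n))"
  define HU where "HU = Abs_fps (\<lambda>n. scale (u ^ n) (complete_sym n :: 'a series))"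
  define PU where "PU = Abs_fps (\<lambda>n. if n = 0 then 0 else scale (u ^ n) (power_sum n :: 'a series))"
  have sym: "fps_nth complete_fps n \<in> (sym_funs :: 'a series set)"
    "fps_nth elem_fps n \<in> (sym_funs :: 'a series set)" "fps_nth power_fps n \<in> (sym_funs :: 'a series set)" for n
    by (simp_all add: complete_fps_def elem_fps_def power_fps_def complete_sym_sym power_sum_sym sign_elem_sym)
  have "newton QP QH" unfolding QP_def QH_def
    by (rule newton_hom[OF newton_complete hom_on_sym_pleth sym(3,1)])
  moreover have "newton PU HU"
    unfolding newton_iff
  proof safe
    show "fps_nth HU 0 = 1" by (simp add: HU_def)
    fix n
    have "of_nat n * complete_sym n = (\<Sum>k=0..n. fps_nth power_fps k * (complete_sym (n - k) :: 'a series))"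
      using newton_complete[where ?'a = 'a] by (simp add: newton_iff complete_fps_def)
    then have "of_nat n * fps_nth HU n = (\<Sum>k=0..n. scale (u ^ n) (fps_nth power_fps k * complete_sym (n - k)))"
      by (simp add: HU_def scale_mult_right series.scale_sum_right)
    also have "\<dots> = (\<Sum>k=0..n. fps_nth PU k * fps_nth HU (n - k))"
      by (rule sum.cong) (auto simp: PU_def HU_def power_fps_def scale_mult_left scale_mult_right simp flip: power_add)
    finally show "of_nat n * fps_nth HU n = (\<Sum>k=0..n. fps_nth PU k * fps_nth HU (n - k))" .
  qed
  ultimately have "newton (QP + PU) (QH * HU)" by (rule newton_mult)
  \<comment> \<open>The power sums split as (1 - u^k) p_k + u^k p_k.\<close>
  moreover have "QP + PU = power_fps"
  proof (rule fps_ext)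
    fix n show "fps_nth (QP + PU) n = fps_nth power_fps n"
      by (cases "n = 0") (auto simp: QP_def PU_def power_fps_def pleth_one_minus_peval const.peval_power_sum
          intro!: series_eqI simp: algebra_simps)
  qed
  ultimately have "newton power_fps (QH * HU)" by simp
  then have QHHU: "QH * HU = complete_fps"
    by (rule newton_unique[OF _ newton_complete])
      (auto simp: power_fps_def intro: of_nat_mult_series_eq_0)
  have "QE * QH = 1"
  proof (rule fps_ext)
    fix n
    have "fps_nth (QE * QH) n = ?Q (fps_nth (elem_fps * complete_fps) n)"
      unfolding fps_mult_nth using sym hom_on_sym_pleth[of u]
      by (subst hom_on_sym_sum[OF hom_on_sym_pleth]) (simp_all add: QE_def QH_def hom_on_sym_def sym_funs_mult)
    also have "\<dots> = fps_nth 1 n"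
      using hom_on_sym_pleth[of u] hom_on_sym_0[OF hom_on_sym_pleth[of u]]
      by (simp add: elem_mult_complete hom_on_sym_def)
    finally show "fps_nth (QE * QH) n = fps_nth 1 n" .
  qed
  then have "QE * complete_fps = HU" by (metis QHHU mult.assoc mult_1)
  then have "fps_nth (QE * complete_fps) n = scale (u ^ n) (complete_sym n)" by (simp add: HU_def)
  then show ?thesis by (simp add: fps_mult_nth QE_def complete_fps_def elem_fps_def pleth_elem_def)
qed

section \<open>Triangularity of the vertex operators\<close>

definition complete_prod :: "nat list \<Rightarrow> 'a::comm_ring_1 series" where
  "complete_prod \<alpha> = prod_list (map complete_sym \<alpha>)"

lemma complete_prod_simps [simp]:
  "complete_prod [] = 1" "complete_prod (a # \<alpha>) = complete_sym a * complete_prod \<alpha>"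
  by (simp_all add: complete_prod_def)

lemma complete_prod_homog: "complete_prod \<alpha> \<in> homog (sum_list \<alpha>)"
  unfolding complete_prod_def by (intro prod_list_homog complete_sym_homog)

lemma complete_prod_sym: "complete_prod \<alpha> \<in> sym_funs"
  by (rule homog_sym_funs[OF complete_prod_homog])

text \<open>The value at \<open>h\<^sub>\<alpha>\<close>, where \<open>k\<close> shifts the index of \<open>g\<close>: each factor \<open>h\<^sub>a\<close> becomes
  \<open>h\<^sub>a + (1 - v) \<Sum>\<^bsub>j>0\<^esub> h\<^bsub>a-j\<^esub> w\<^sup>j\<close>, which is \<open>v h\<^sub>a\<close> plus \<open>1 - v\<close> times the full sum.\<close>

fun vsum :: "'a::comm_ring_1 \<Rightarrow> (nat \<Rightarrow> 'a series) \<Rightarrow> nat list \<Rightarrow> nat \<Rightarrow> 'a series" where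
  "vsum v g [] k = g k"
| "vsum v g (a # \<alpha>) k = scale v (complete_sym a * vsum v g \<alpha> k) +
     scale (1 - v) (\<Sum>j\<le>a. complete_sym (a - j) * vsum v g \<alpha> (k + j))"

text \<open>The functional sending w^k to \<open>g (k + m)\<close>, linear over the series;
  \<open>vertex_op\<close> is the case \<open>m = 0\<close>. The shift \<open>m\<close> absorbs the
  powers of w coming from factors already expanded.\<close>

definition pairing :: "(nat \<Rightarrow> 'a::comm_ring_1 series) \<Rightarrow> nat \<Rightarrow> 'a series poly \<Rightarrow> 'a series" where
  "pairing g m P = (\<Sum>k\<le>degree P. coeff P k * g (k + m))"

lemma pairing_degree: "degree P \<le> N \<Longrightarrow> pairing g m P = (\<Sum>k\<le>N. coeff P k * g (k + m))"
  unfolding pairing_def by (intro sum.mono_neutral_left) (auto simp: coeff_eq_0)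

lemma pairing_add: "pairing g m (P + Q) = pairing g m P + pairing g m Q"
proof -
  define N where "N = max (degree P) (degree Q)"
  have "degree (P + Q) \<le> N" unfolding N_def by (rule degree_add_le_max)
  then show ?thesis
    by (simp add: pairing_degree[of _ N] N_def ring_distribs sum.distrib)
qed

lemma pairing_sum: "pairing g m (sum P A) = (\<Sum>x\<in>A. pairing g m (P x))"
  by (induction A rule: infinite_finite_induct) (simp_all add: pairing_add, simp_all add: pairing_def)

lemma pairing_monom_mult: "pairing g m (monom c j * P) = c * pairing g (m + j) P"
proof -
  have "degree (monom c j * P) \<le> degree P + j"
    by (rule order.trans[OF degree_mult_le]) (use degree_monom_le[of c j] in auto)
  then have "pairing g m (monom c j * P) = (\<Sum>k\<le>degree P + j. coeff (monom c j * P) k * g (k + m))"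
    by (rule pairing_degree)
  also have "\<dots> = (\<Sum>k\<in>(\<lambda>k. k + j) ` {..degree P}. c * coeff P (k - j) * g (k + m))"
  proof (rule sum.mono_neutral_cong_right)
    have "x \<in> (\<lambda>k. k + j) ` {..degree P}" if "x \<le> degree P + j" "j \<le> x" for x
      using that by (intro image_eqI[of _ _ "x - j"]) auto
    then show "\<forall>i\<in>{..degree P + j} - (\<lambda>k. k + j) ` {..degree P}. coeff (monom c j * P) i * g (i + m) = 0"
      by (auto simp: coeff_monom_mult)
  qed (auto simp: coeff_monom_mult)
  also have "\<dots> = c * pairing g (m + j) P"
    by (subst sum.reindex) (auto simp: inj_on_def pairing_def sum_distrib_left mult.assoc add_ac)
  finally show ?thesis .
qed

lemma pairing_complete_prod:
  fixes v :: "'a::field_char_0"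
  shows "pairing g m (add_var (\<lambda>k. 1 - v ^ k) (complete_prod \<alpha>)) = vsum v g \<alpha> m"
proof (induction \<alpha> arbitrary: m)
  case Nil
  then show ?case by (simp add: add_var_def const_poly.peval_one pairing_def)
next
  case (Cons a \<alpha>)
  define G where "G = add_var (\<lambda>k. 1 - v ^ k) (complete_prod \<alpha> :: 'a series)"
  have sym: "complete_sym a \<in> (sym_funs :: 'a series set)" "complete_prod \<alpha> \<in> (sym_funs :: 'a series set)"
    by (rule complete_sym_sym complete_prod_sym)+
  have "add_var (\<lambda>k. 1 - v ^ k) (complete_prod (a # \<alpha>)) =
      (\<Sum>j\<le>a. monom (const (if j = 0 then 1 else 1 - v) * complete_sym (a - j)) j * G)"
    using add_var_complete[of v a] sym
    by (simp add: add_var_def G_def const_poly.peval_mult sum_distrib_right)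
  then have "pairing g m (add_var (\<lambda>k. 1 - v ^ k) (complete_prod (a # \<alpha>))) =
      (\<Sum>j\<le>a. const (if j = 0 then 1 else 1 - v) * complete_sym (a - j) * vsum v g \<alpha> (m + j))"
    by (simp add: pairing_sum pairing_monom_mult Cons.IH G_def del: const_simps)
  \<comment> \<open>The coefficient at j = 0 is 1 = v + (1 - v). Splitting off \<open>v\<close>
    makes the sum with factor \<open>1 - v\<close> run over all j.\<close>
  also have "\<dots> = (\<Sum>j\<le>a. (if j = 0 then scale v (complete_sym a * vsum v g \<alpha> m) else 0) +
      scale (1 - v) (complete_sym (a - j) * vsum v g \<alpha> (m + j)))"
    by (rule sum.cong) (auto simp: scale_const algebra_simps)
  also have "\<dots> = vsum v g (a # \<alpha>) m"
    by (simp add: sum.distrib series.scale_sum_right)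
  finally show ?case .
qed

lemma macdonald_op_conj_complete_prod: "macdonald_op_conj u v (complete_prod \<alpha>) = vsum v (pleth_elem u) \<alpha> 0"
  using pairing_complete_prod[of "pleth_elem u" 0 v \<alpha>] by (simp add: macdonald_op_conj_def vertex_op_def pairing_def)

lemma take_Cons_le: "(\<And>k. sum_list (take k \<beta>) \<le> sum_list (take k \<gamma>)) \<Longrightarrow> x \<le> y \<Longrightarrow>
   sum_list (take k (x # \<beta>)) \<le> sum_list (take k (y # \<gamma>) :: nat list)"
  by (cases k) (auto intro: add_mono)

text \<open>Dominance on compositions of one fixed length, unsorted and with zeros allowed, so that
  products of h_k can be compared entry by entry. Sorting is postponed to
  \<open>sort_part\<close>.\<close>

definition raises :: "nat list \<Rightarrow> nat list \<Rightarrow> bool" where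
  "raises \<beta> \<alpha> \<longleftrightarrow> length \<beta> = length \<alpha> \<and> dominates \<beta> \<alpha>"

lemma raises_refl [simp]: "raises \<alpha> \<alpha>"
  by (simp add: raises_def dominates_def)

lemma raises_trans: "raises \<gamma> \<beta> \<Longrightarrow> raises \<beta> \<alpha> \<Longrightarrow> raises \<gamma> \<alpha>"
  by (auto simp: raises_def dominates_def intro: order_trans)

lemma raises_Cons: "raises \<beta> \<alpha> \<Longrightarrow> raises (a # \<beta>) (a # \<alpha>)"
  by (auto simp: raises_def dominates_def intro: take_Cons_le)

lemma psum_eq_imp_eq:
  assumes "length \<alpha> = length \<beta>" "\<And>k. sum_list (take k \<alpha>) = sum_list (take k \<beta> :: nat list)"
  shows "\<alpha> = \<beta>"
  using assms
proof (induction \<alpha> \<beta> rule: list_induct2)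
  case (Cons x xs y ys)
  have "x = y" using Cons.prems[of 1] by simp
  moreover have "sum_list (take k xs) = sum_list (take k ys)" for k
    using Cons.prems[of "Suc k"] \<open>x = y\<close> by simp
  ultimately show ?case using Cons.IH by blast
qed simp

lemma raises_antisym: "raises \<beta> \<alpha> \<Longrightarrow> raises \<alpha> \<beta> \<Longrightarrow> \<alpha> = \<beta>"
  by (rule psum_eq_imp_eq) (auto simp: raises_def dominates_def intro: antisym)

text \<open>In the recursion for \<open>ysum\<close> the fully summed entry stays in front and the
  next entry is inserted behind it.\<close>

lemma raises_insert:
  assumes "raises (c # \<beta>) (a # \<alpha>)"
  shows "raises (c # b # \<beta>) (a # b # \<alpha>)"
proof -
  have le: "sum_list (take k (a # \<alpha>)) \<le> sum_list (take k (c # \<beta>))" for k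
    using assms by (simp add: raises_def dominates_def)
  have "sum_list (take k (a # b # \<alpha>)) \<le> sum_list (take k (c # b # \<beta>))" for k
  proof (cases k)
    case (Suc m)
    then show ?thesis using le[of m] le[of 1] by (cases m) auto
  qed simp
  then show ?thesis using assms by (auto simp: raises_def dominates_def)
qed

lemma raises_raise:
  assumes "r \<le> b"
  shows "raises ((a + r) # (b - r) # \<alpha>) (a # b # \<alpha>)"
proof -
  have "sum_list (take k (a # b # \<alpha>)) \<le> sum_list (take k ((a + r) # (b - r) # \<alpha>))" for k
  proof (cases k)
    case (Suc m)
    then show ?thesis using assms by (cases m) auto
  qed simp
  then show ?thesis using assms by (auto simp: raises_def dominates_def)
qed

definition up :: "nat list \<Rightarrow> 'a::field series set" where
  "up \<alpha> = series.span (complete_prod ` {\<beta>. raises \<beta> \<alpha>})"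

definition strict_up :: "nat list \<Rightarrow> 'a::field series set" where
  "strict_up \<alpha> = series.span (complete_prod ` {\<beta>. raises \<beta> \<alpha> \<and> \<beta> \<noteq> \<alpha>})"

lemma strict_up_subset_up: "strict_up \<alpha> \<subseteq> up \<alpha>"
  unfolding strict_up_def up_def by (rule series.span_mono) auto

lemma up_subset_strict_up: "raises \<beta> \<alpha> \<Longrightarrow> \<beta> \<noteq> \<alpha> \<Longrightarrow> up \<beta> \<subseteq> strict_up \<alpha>"
  unfolding strict_up_def up_def
  by (rule series.span_mono) (use raises_trans raises_antisym in blast)

lemma span_image_mult:
  assumes "f \<in> series.span (complete_prod ` A)" "\<And>\<beta>. \<beta> \<in> A \<Longrightarrow> c * complete_prod \<beta> \<in> series.span S"
  shows "c * f \<in> series.span S"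
  using assms(1)
proof (induction rule: series.span_induct_alt)
  case base
  then show ?case by (simp add: series.span_zero)
next
  case (step d x y)
  then show ?case using assms(2)
    by (auto simp: ring_distribs scale_mult_right intro!: series.span_add series.span_scale)
qed

lemma complete_mult_up: "f \<in> up \<alpha> \<Longrightarrow> complete_sym a * f \<in> up (a # \<alpha>)"
  unfolding up_def
proof (erule span_image_mult)
  fix \<beta> assume "\<beta> \<in> {\<beta>. raises \<beta> \<alpha>}"
  then have "a # \<beta> \<in> {\<beta>. raises \<beta> (a # \<alpha>)}" by (simp add: raises_Cons)
  then have "complete_prod (a # \<beta>) \<in> series.span (complete_prod ` {\<beta>. raises \<beta> (a # \<alpha>)})"
    by (intro series.span_base imageI)
  then show "complete_sym a * complete_prod \<beta> \<in> series.span (complete_prod ` {\<beta>. raises \<beta> (a # \<alpha>)})" by simp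
qed

lemma complete_mult_strict_up: "f \<in> strict_up \<alpha> \<Longrightarrow> complete_sym a * f \<in> strict_up (a # \<alpha>)"
  unfolding strict_up_def
proof (erule span_image_mult)
  fix \<beta> assume "\<beta> \<in> {\<beta>. raises \<beta> \<alpha> \<and> \<beta> \<noteq> \<alpha>}"
  then have "a # \<beta> \<in> {\<beta>. raises \<beta> (a # \<alpha>) \<and> \<beta> \<noteq> a # \<alpha>}" by (simp add: raises_Cons)
  then have "complete_prod (a # \<beta>) \<in> series.span (complete_prod ` {\<beta>. raises \<beta> (a # \<alpha>) \<and> \<beta> \<noteq> a # \<alpha>})"
    by (intro series.span_base imageI)
  then show "complete_sym a * complete_prod \<beta> \<in> series.span (complete_prod ` {\<beta>. raises \<beta> (a # \<alpha>) \<and> \<beta> \<noteq> a # \<alpha>})" by simp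
qed

lemma complete_insert_strict_up: "f \<in> strict_up (a # \<alpha>) \<Longrightarrow> complete_sym b * f \<in> strict_up (a # b # \<alpha>)"
  unfolding strict_up_def
proof (erule span_image_mult)
  fix \<gamma> assume \<gamma>: "\<gamma> \<in> {\<beta>. raises \<beta> (a # \<alpha>) \<and> \<beta> \<noteq> a # \<alpha>}"
  then obtain c \<beta> where [simp]: "\<gamma> = c # \<beta>" by (cases \<gamma>) (auto simp: raises_def)
  have "c # b # \<beta> \<in> {\<beta>. raises \<beta> (a # b # \<alpha>) \<and> \<beta> \<noteq> a # b # \<alpha>}"
    using \<gamma> by (auto simp: raises_insert)
  then have "complete_prod (c # b # \<beta>) \<in> series.span (complete_prod ` {\<beta>. raises \<beta> (a # b # \<alpha>) \<and> \<beta> \<noteq> a # b # \<alpha>})"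
    by (intro series.span_base imageI)
  then show "complete_sym b * complete_prod \<gamma> \<in> series.span (complete_prod ` {\<beta>. raises \<beta> (a # b # \<alpha>) \<and> \<beta> \<noteq> a # b # \<alpha>})"
    by (simp add: mult.left_commute)
qed

lemma complete_prod_up: "complete_prod \<alpha> \<in> up \<alpha>"
  unfolding up_def by (intro series.span_base imageI) simp

text \<open>The first factor is summed in full. Comparing with the next fully summed factor and shifting
  one unit between the two leaves only boundary terms, so the vertex operator acts by raising.\<close>

definition ysum :: "'a::comm_ring_1 \<Rightarrow> (nat \<Rightarrow> 'a series) \<Rightarrow> nat \<Rightarrow> nat list \<Rightarrow> nat \<Rightarrow> 'a series" where
  "ysum v g a \<alpha> k = (\<Sum>j\<le>a. complete_sym (a - j) * vsum v g \<alpha> (k + j))"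

definition zsum :: "'a::comm_ring_1 \<Rightarrow> (nat \<Rightarrow> 'a series) \<Rightarrow> nat \<Rightarrow> nat \<Rightarrow> nat list \<Rightarrow> nat \<Rightarrow> 'a series" where
  "zsum v g a b \<alpha> k = (\<Sum>j\<le>a. \<Sum>i\<le>b. complete_sym (a - j) * complete_sym (b - i) * vsum v g \<alpha> (k + j + i))"

lemma ysum_Cons:
  "ysum v g a (b # \<alpha>) k = scale v (complete_sym b * ysum v g a \<alpha> k) + scale (1 - v) (zsum v g a b \<alpha> k)"
  for v :: "'a::field"
  by (simp add: ysum_def zsum_def ring_distribs sum.distrib sum_distrib_left scale_mult_right
      series.scale_sum_right mult.assoc mult.left_commute add.assoc)

lemma zsum_0: "zsum v g a 0 \<alpha> k = ysum v g a \<alpha> k"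
  by (simp add: ysum_def zsum_def)

text \<open>The summand (j, i + 1) of the left double sum is the summand (j + 1, i) of the right
  one. Only those with i = 0 on the left and j = 0 on the right have no partner.\<close>

lemma zsum_Suc:
  "zsum v g a (Suc b) \<alpha> k = zsum v g (Suc a) b \<alpha> k + complete_sym (Suc b) * ysum v g a \<alpha> k
     - complete_sym (Suc a) * ysum v g b \<alpha> k"
proof -
  define F where "F j i = complete_sym (a - j) * complete_sym (b - i) * vsum v g \<alpha> (k + j + Suc i)" for j i
  have "zsum v g a (Suc b) \<alpha> k = (\<Sum>j\<le>a. complete_sym (a - j) * complete_sym (Suc b) * vsum v g \<alpha> (k + j) + (\<Sum>i\<le>b. F j i))"
    unfolding zsum_def F_def
    by (rule sum.cong) (simp_all add: sum.atMost_Suc_shift sum_distrib_left mult.assoc del: sum.atMost_Suc)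
  also have "\<dots> = complete_sym (Suc b) * ysum v g a \<alpha> k + (\<Sum>j\<le>a. \<Sum>i\<le>b. F j i)"
    by (simp add: sum.distrib ysum_def sum_distrib_left mult_ac)
  also have "(\<Sum>j\<le>a. \<Sum>i\<le>b. F j i) = zsum v g (Suc a) b \<alpha> k - complete_sym (Suc a) * ysum v g b \<alpha> k"
    unfolding zsum_def by (subst sum.atMost_Suc_shift) (simp add: F_def ysum_def sum_distrib_left mult.assoc)
  finally show ?thesis by simp
qed

text \<open>For a single entry the sum is a coefficient of H(u z), hence the scalar u^a. With a
  further entry \<open>b\<close>, the parts \<open>v\<close> and \<open>1 - v\<close> of its
  expansion both have leading coefficient u^a, because moving units from \<open>b\<close> to
  \<open>a\<close> produces only raised products.\<close>

lemma ysum_triangular: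
  fixes u v :: "'a::field_char_0"
  shows "ysum v (pleth_elem u) a \<alpha> 0 - scale (u ^ a) (complete_prod (a # \<alpha>)) \<in> strict_up (a # \<alpha>)"
proof (induction \<alpha> arbitrary: a)
  case Nil
  have "ysum v (pleth_elem u) a [] 0 = scale (u ^ a) (complete_sym a)"
    using complete_mult_pleth_elem[of u a] by (simp add: ysum_def atMost_atLeast0 mult.commute)
  then show ?case by (simp add: strict_up_def series.span_zero)
next
  case (Cons b \<alpha>)
  let ?g = "pleth_elem u :: nat \<Rightarrow> 'a series"
  have y_up: "ysum v ?g a \<alpha> 0 \<in> up (a # \<alpha>)" for a
  proof -
    have "ysum v ?g a \<alpha> 0 - scale (u ^ a) (complete_prod (a # \<alpha>)) \<in> up (a # \<alpha>)"
      using Cons.IH strict_up_subset_up by blast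
    moreover have "scale (u ^ a) (complete_prod (a # \<alpha>)) \<in> up (a # \<alpha>)"
      using complete_prod_up[of "a # \<alpha>"] unfolding up_def by (rule series.span_scale)
    ultimately have "(ysum v ?g a \<alpha> 0 - scale (u ^ a) (complete_prod (a # \<alpha>))) + scale (u ^ a) (complete_prod (a # \<alpha>)) \<in> up (a # \<alpha>)"
      unfolding up_def by (rule series.span_add)
    then show ?thesis by simp
  qed
  have diag: "complete_sym b * ysum v ?g a \<alpha> 0 - scale (u ^ a) (complete_prod (a # b # \<alpha>)) \<in> strict_up (a # b # \<alpha>)" for a b
    using complete_insert_strict_up[OF Cons.IH[of a], of b]
    by (simp add: ring_distribs scale_mult_right mult.left_commute)
  \<comment> \<open>The leading term of this product already sits at a raised composition, since
    \<open>r\<close> units have moved to the front.\<close>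
  have off1: "complete_sym (c - r) * ysum v ?g (a + r) \<alpha> 0 \<in> strict_up (a # c # \<alpha>)" if "0 < r" "r \<le> c" for r c a
  proof -
    have "complete_sym (c - r) * ysum v ?g (a + r) \<alpha> 0 - scale (u ^ (a + r)) (complete_prod ((a + r) # (c - r) # \<alpha>))
        \<in> up ((a + r) # (c - r) # \<alpha>)"
      using diag strict_up_subset_up by blast
    then have "complete_sym (c - r) * ysum v ?g (a + r) \<alpha> 0 \<in> up ((a + r) # (c - r) # \<alpha>)"
      using complete_prod_up[of "(a + r) # (c - r) # \<alpha>", where ?'a = 'a] series.span_scale series.span_add
      unfolding up_def by (metis diff_add_cancel)
    then show ?thesis using up_subset_strict_up[OF raises_raise[of r c a \<alpha>]] that by auto
  qed
  \<comment> \<open>Here the unsummed factor has the enlarged index and becomes the front entry; the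
    full sum takes the second place.\<close>
  have off2: "complete_sym (a + Suc r) * ysum v ?g (c - Suc r) \<alpha> 0 \<in> strict_up (a # c # \<alpha>)" if "Suc r \<le> c" for r c a
    using complete_mult_up[OF y_up[of "c - Suc r"], of "a + Suc r"]
      up_subset_strict_up[OF raises_raise[of "Suc r" c a \<alpha>]] that by auto
  have z: "zsum v ?g a c \<alpha> 0 - complete_sym c * ysum v ?g a \<alpha> 0 \<in> up (a # c # \<alpha>) \<and>
      zsum v ?g a c \<alpha> 0 - complete_sym c * ysum v ?g a \<alpha> 0 \<in> strict_up (a # c # \<alpha>)" for a c
  proof (induction c arbitrary: a)
    case 0
    then show ?case by (simp add: zsum_0 up_def strict_up_def series.span_zero)
  next
    case (Suc c)
    have ab: "raises (Suc a # c # \<alpha>) (a # Suc c # \<alpha>)" using raises_raise[of 1 "Suc c" a \<alpha>] by simp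
    have "zsum v ?g (Suc a) c \<alpha> 0 - complete_sym c * ysum v ?g (Suc a) \<alpha> 0 \<in> strict_up (a # Suc c # \<alpha>)"
      using Suc.IH[of "Suc a"] up_subset_strict_up[OF ab] by auto
    moreover have "complete_sym c * ysum v ?g (Suc a) \<alpha> 0 \<in> strict_up (a # Suc c # \<alpha>)"
      using off1[of 1 "Suc c" a] by simp
    moreover have "complete_sym (Suc a) * ysum v ?g c \<alpha> 0 \<in> strict_up (a # Suc c # \<alpha>)"
      using off2[of 0 "Suc c" a] by simp
    ultimately have "(zsum v ?g (Suc a) c \<alpha> 0 - complete_sym c * ysum v ?g (Suc a) \<alpha> 0) +
        complete_sym c * ysum v ?g (Suc a) \<alpha> 0 - complete_sym (Suc a) * ysum v ?g c \<alpha> 0 \<in> strict_up (a # Suc c # \<alpha>)"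
      unfolding strict_up_def by (intro series.span_diff[OF series.span_add])
    then have "zsum v ?g a (Suc c) \<alpha> 0 - complete_sym (Suc c) * ysum v ?g a \<alpha> 0 \<in> strict_up (a # Suc c # \<alpha>)"
      by (simp add: zsum_Suc)
    then show ?case using strict_up_subset_up by blast
  qed
  have "ysum v ?g a (b # \<alpha>) 0 - scale (u ^ a) (complete_prod (a # b # \<alpha>)) =
      (complete_sym b * ysum v ?g a \<alpha> 0 - scale (u ^ a) (complete_prod (a # b # \<alpha>))) +
      scale (1 - v) (zsum v ?g a b \<alpha> 0 - complete_sym b * ysum v ?g a \<alpha> 0)"
    unfolding ysum_Cons by (rule series_eqI) (simp add: algebra_simps)
  also have "\<dots> \<in> strict_up (a # b # \<alpha>)"
    using diag z unfolding strict_up_def by (blast intro: series.span_add series.span_scale)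
  finally show ?case .
qed

text \<open>The diagonal entry of the conjugate operator at the h-product;
  \<open>eigval_B_sum\<close> gives the closed form.\<close>

fun eigval :: "'a::comm_ring_1 \<Rightarrow> 'a \<Rightarrow> nat list \<Rightarrow> 'a" where
  "eigval u v [] = 1"
| "eigval u v (a # \<alpha>) = v * eigval u v \<alpha> + (1 - v) * u ^ a"

lemma pleth_elem_0: "pleth_elem u 0 = 1"
  by (simp add: pleth_elem_def pleth_one_minus_peval const.peval_one)

text \<open>The first factor becomes \<open>v\<close> times h_a plus \<open>1 - v\<close> times its
  full sum. The former keeps the diagonal entry of the tail, the latter has diagonal entry
  u^a.\<close>

lemma macdonald_op_conj_triangular:
  fixes u v :: "'a::field_char_0"
  shows "macdonald_op_conj u v (complete_prod \<alpha>) - scale (eigval u v \<alpha>) (complete_prod \<alpha>) \<in> strict_up \<alpha>"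
  unfolding macdonald_op_conj_complete_prod
proof (induction \<alpha>)
  case Nil
  then show ?case by (simp add: pleth_elem_0 strict_up_def series.span_zero)
next
  case (Cons a \<alpha>)
  let ?g = "pleth_elem u :: nat \<Rightarrow> 'a series"
  have "vsum v ?g (a # \<alpha>) 0 - scale (eigval u v (a # \<alpha>)) (complete_prod (a # \<alpha>)) =
      scale v (complete_sym a * (vsum v ?g \<alpha> 0 - scale (eigval u v \<alpha>) (complete_prod \<alpha>))) +
      scale (1 - v) (ysum v ?g a \<alpha> 0 - scale (u ^ a) (complete_prod (a # \<alpha>)))"
    by (rule series_eqI) (simp add: ysum_def algebra_simps scale_mult_right)
  also have "\<dots> \<in> strict_up (a # \<alpha>)"
    using complete_mult_strict_up[OF Cons.IH, of a] ysum_triangular[of v u a \<alpha>]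
    unfolding strict_up_def by (blast intro: series.span_add series.span_scale)
  finally show ?case .
qed

section \<open>Pieri rule for Schur functions\<close>

text \<open>Shapes are functions from rows to row lengths here, and \<open>strip \<nu> \<kappa>\<close> says that \<open>\<nu> / \<kappa>\<close> is a
  horizontal strip.\<close>

definition strip :: "(nat \<Rightarrow> nat) \<Rightarrow> (nat \<Rightarrow> nat) \<Rightarrow> bool" where
  "strip \<nu> \<kappa> \<longleftrightarrow> (\<forall>i. \<nu> (Suc i) \<le> \<kappa> i \<and> \<kappa> i \<le> \<nu> i)"

definition fsize :: "(nat \<Rightarrow> nat) \<Rightarrow> nat" where
  "fsize f = sum f {i. f i \<noteq> 0}"

definition bounded_by :: "nat \<Rightarrow> (nat \<Rightarrow> nat) \<Rightarrow> bool" where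
  "bounded_by L f \<longleftrightarrow> (\<forall>i\<ge>L. f i = 0)"

lemma fsize_eq: "bounded_by L f \<Longrightarrow> fsize f = (\<Sum>i<L. f i)"
  unfolding fsize_def bounded_by_def by (rule sum.mono_neutral_left) (auto intro: leI)

lemma bounded_by_mono: "bounded_by L f \<Longrightarrow> L \<le> L' \<Longrightarrow> bounded_by L' f"
  by (auto simp: bounded_by_def)

lemma bounded_by_less: "bounded_by L f \<Longrightarrow> f i > 0 \<Longrightarrow> i < L"
  unfolding bounded_by_def by (metis leI less_irrefl)

lemma finite_support: "bounded_by L f \<Longrightarrow> finite {i. 0 < f i}"
  by (rule finite_subset[of _ "{..<L}"]) (auto dest: bounded_by_less)

lemma bounded_strip_down: "strip \<nu> \<kappa> \<Longrightarrow> bounded_by L \<nu> \<Longrightarrow> bounded_by L \<kappa>"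
  unfolding bounded_by_def strip_def by (metis le_zero_eq)

lemma bounded_strip_up:
  assumes "strip \<nu> \<kappa>" "bounded_by L \<kappa>"
  shows "bounded_by (Suc L) \<nu>"
  unfolding bounded_by_def
proof safe
  fix i assume "Suc L \<le> i"
  then obtain j where "i = Suc j" "L \<le> j" by (metis Suc_le_D Suc_le_mono)
  then show "\<nu> i = 0" using assms by (auto simp: bounded_by_def strip_def) (metis le_zero_eq)
qed

definition remove_strip :: "(nat \<Rightarrow> nat) \<Rightarrow> nat \<Rightarrow> (nat \<Rightarrow> nat) set" where
  "remove_strip \<nu> b = {\<kappa>. strip \<nu> \<kappa> \<and> fsize \<nu> = fsize \<kappa> + b}"

definition add_strip :: "(nat \<Rightarrow> nat) \<Rightarrow> nat \<Rightarrow> (nat \<Rightarrow> nat) set" where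
  "add_strip \<theta> a = {\<nu>. strip \<nu> \<theta> \<and> fsize \<nu> = fsize \<theta> + a}"

lemma finite_bounded_funs:
  "finite {f :: nat \<Rightarrow> nat. bounded_by L f \<and> (\<forall>i. f i \<le> B)}"
proof -
  have "{f. bounded_by L f \<and> (\<forall>i. f i \<le> B)} \<subseteq>
      {f. \<forall>x. (x \<in> {..<L} \<longrightarrow> f x \<in> {..B}) \<and> (x \<notin> {..<L} \<longrightarrow> f x = 0)}"
    by (auto simp: bounded_by_def)
  then show ?thesis by (rule finite_subset) (rule finite_set_of_finite_funs, auto)
qed

lemma fsize_ge: "bounded_by L f \<Longrightarrow> f i \<le> fsize f"
proof (cases "i < L")
  case True
  assume "bounded_by L f"
  then show ?thesis using True by (simp add: fsize_eq member_le_sum)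
qed (simp add: bounded_by_def)

lemma finite_remove_strip: "bounded_by L \<nu> \<Longrightarrow> finite (remove_strip \<nu> b)"
  by (rule finite_subset[OF _ finite_bounded_funs[of L "fsize \<nu>"]])
    (auto simp: remove_strip_def dest: bounded_strip_down intro: order_trans[OF fsize_ge])

lemma finite_add_strip: "bounded_by L \<theta> \<Longrightarrow> finite (add_strip \<theta> a)"
  by (rule finite_subset[OF _ finite_bounded_funs[of "Suc L" "fsize \<theta> + a"]])
    (auto simp: add_strip_def dest: bounded_strip_up intro: order_trans[OF fsize_ge])

text \<open>The Kostka number for letters below \<open>N\<close> with multiplicities
  \<open>c\<close>. The largest letter is stripped first, as its cells form a horizontal
  strip.\<close>

fun kostka :: "nat \<Rightarrow> (nat \<Rightarrow> nat) \<Rightarrow> (nat \<Rightarrow> nat) \<Rightarrow> nat" where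
  "kostka 0 c \<theta> = (if \<forall>i. \<theta> i = 0 then 1 else 0)"
| "kostka (Suc N) c \<theta> = (\<Sum>\<kappa>\<in>remove_strip \<theta> (c N). kostka N c \<kappa>)"

lemma kostka_cong: "(\<And>i. i < N \<Longrightarrow> c i = c' i) \<Longrightarrow> kostka N c \<theta> = kostka N c' \<theta>"
  by (induction N arbitrary: \<theta>) auto

definition subcontents :: "nat \<Rightarrow> (nat \<Rightarrow> nat) \<Rightarrow> nat \<Rightarrow> (nat \<Rightarrow> nat) set" where
  "subcontents N c a = {k. (\<forall>i<N. k i \<le> c i) \<and> bounded_by N k \<and> (\<Sum>i<N. k i) = a}"

lemma finite_subcontents: "finite (subcontents N c a)"
proof (rule finite_subset[OF _ finite_bounded_funs[of N a]])
  show "subcontents N c a \<subseteq> {f. bounded_by N f \<and> (\<forall>i. f i \<le> a)}"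
    unfolding subcontents_def using fsize_ge fsize_eq by fastforce
qed

lemma subcontents_Suc:
  "(\<Sum>k\<in>subcontents (Suc N) c a. F k) =
   (\<Sum>(j, k)\<in>Sigma {..min a (c N)} (\<lambda>j. subcontents N c (a - j)). F (k(N := j)))"
proof (rule sum.reindex_bij_witness[of _ "\<lambda>(j, k). k(N := j)" "\<lambda>k. (k N, k(N := 0))"])
  fix k assume k: "k \<in> subcontents (Suc N) c a"
  then have s: "(\<Sum>i<N. k i) + k N = a" by (simp add: subcontents_def)
  have "(\<Sum>i<N. (k(N := 0)) i) = (\<Sum>i<N. k i)" by (rule sum.cong) auto
  then show "(k N, k(N := 0)) \<in> Sigma {..min a (c N)} (\<lambda>j. subcontents N c (a - j))"
    using k s by (auto simp: subcontents_def bounded_by_def)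
next
  fix p assume "p \<in> Sigma {..min a (c N)} (\<lambda>j. subcontents N c (a - j))"
  then obtain j k where p: "p = (j, k)" "j \<le> a" "j \<le> c N" "k \<in> subcontents N c (a - j)" by auto
  have "(\<Sum>i<N. (k(N := j)) i) = (\<Sum>i<N. k i)" by (rule sum.cong) auto
  then show "(case p of (j, k) \<Rightarrow> k(N := j)) \<in> subcontents (Suc N) c a"
    using p by (auto simp: subcontents_def bounded_by_def less_Suc_eq)
  show "(\<lambda>k. (k N, k(N := 0))) (case p of (j, k) \<Rightarrow> k(N := j)) = p"
    using p by (auto simp: subcontents_def bounded_by_def)
qed auto

text \<open>Row \<open>i\<close> of a shape below both \<theta> and \<kappa> and row
  \<open>i + 1\<close> of a shape above both range over the same interval. The rule reflects this
  interval and so is its own inverse. In \<open>local_up\<close> the first row is bounded only from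
  below, which leaves its growth \<open>j\<close> free.\<close>

definition local_rule :: "(nat \<Rightarrow> nat) \<Rightarrow> (nat \<Rightarrow> nat) \<Rightarrow> (nat \<Rightarrow> nat) \<Rightarrow> nat \<Rightarrow> nat" where
  "local_rule \<theta> \<kappa> \<rho> i = max (\<theta> (Suc i)) (\<kappa> (Suc i)) + min (\<theta> i) (\<kappa> i) - \<rho> i"

definition local_up :: "(nat \<Rightarrow> nat) \<Rightarrow> (nat \<Rightarrow> nat) \<Rightarrow> nat \<Rightarrow> (nat \<Rightarrow> nat) \<Rightarrow> nat \<Rightarrow> nat" where
  "local_up \<theta> \<kappa> j \<rho> i = (case i of 0 \<Rightarrow> max (\<theta> 0) (\<kappa> 0) + j | Suc i \<Rightarrow> local_rule \<theta> \<kappa> \<rho> i)"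

lemma strip_max_min:
  assumes "strip \<nu> \<theta>" "strip \<nu> \<kappa>"
  shows "\<nu> (Suc i) \<le> min (\<theta> i) (\<kappa> i)" "max (\<theta> i) (\<kappa> i) \<le> \<nu> i"
  using assms by (auto simp: strip_def)

text \<open>Summed over the rows, the ends of the reflected intervals recombine to \<theta> and
  \<kappa>, as max x y + min x y = x + y.\<close>

lemma local_size:
  assumes "bounded_by L \<theta>" "bounded_by L \<kappa>" "bounded_by L \<rho>"
    and "\<And>i. \<rho> i \<le> min (\<theta> i) (\<kappa> i)"
  shows "fsize (local_up \<theta> \<kappa> j \<rho>) + fsize \<rho> = j + fsize \<theta> + fsize \<kappa>"
proof -
  have b: "bounded_by (Suc L) (local_up \<theta> \<kappa> j \<rho>)"
    using assms by (auto simp: bounded_by_def local_up_def local_rule_def split: nat.split)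
  have "fsize (local_up \<theta> \<kappa> j \<rho>) + fsize \<rho> =
      max (\<theta> 0) (\<kappa> 0) + j + (\<Sum>i<L. local_rule \<theta> \<kappa> \<rho> i + \<rho> i)"
    unfolding fsize_eq[OF b] fsize_eq[OF assms(3)]
    by (subst sum.lessThan_Suc_shift) (simp add: local_up_def sum.distrib)
  also have "(\<Sum>i<L. local_rule \<theta> \<kappa> \<rho> i + \<rho> i) = (\<Sum>i<L. max (\<theta> (Suc i)) (\<kappa> (Suc i)) + min (\<theta> i) (\<kappa> i))"
    by (rule sum.cong) (use assms(4) in \<open>auto simp: local_rule_def simp del: min.bounded_iff intro: le_add_diff_inverse2 trans_le_add2\<close>)
  also have "max (\<theta> 0) (\<kappa> 0) + j + \<dots> = j + (\<Sum>i<Suc L. max (\<theta> i) (\<kappa> i)) + (\<Sum>i<L. min (\<theta> i) (\<kappa> i))"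
    by (subst sum.lessThan_Suc_shift) (simp add: sum.distrib)
  also have "(\<Sum>i<Suc L. max (\<theta> i) (\<kappa> i)) = (\<Sum>i<L. max (\<theta> i) (\<kappa> i))"
    using assms by (simp add: bounded_by_def)
  also have "j + (\<Sum>i<L. max (\<theta> i) (\<kappa> i)) + (\<Sum>i<L. min (\<theta> i) (\<kappa> i)) = j + (\<Sum>i<L. \<theta> i + \<kappa> i)"
  proof -
    have "(\<Sum>i<L. max (\<theta> i) (\<kappa> i) + min (\<theta> i) (\<kappa> i)) = (\<Sum>i<L. \<theta> i + \<kappa> i)"
      by (rule sum.cong) (auto simp: max_def min_def)
    then show ?thesis by (simp only: add.assoc sum.distrib)
  qed
  finally show ?thesis by (simp add: sum.distrib fsize_eq[OF assms(1)] fsize_eq[OF assms(2)])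
qed

text \<open>The piecewise linear bijection behind the Robinson--Schensted--Knuth correspondence: shapes above both
  \<open>\<theta>\<close> and \<open>\<kappa>\<close> correspond to shapes below both, together with the growth \<open>j\<close> of the first row.\<close>

lemma sum_up_down:
  assumes "bounded_by L \<theta>"
  shows "(\<Sum>(\<nu>, \<kappa>)\<in>Sigma (add_strip \<theta> a) (\<lambda>\<nu>. remove_strip \<nu> b). F \<kappa>) =
    (\<Sum>(j, \<rho>, \<kappa>)\<in>Sigma {..min a b} (\<lambda>j. Sigma (remove_strip \<theta> (b - j)) (\<lambda>\<rho>. add_strip \<rho> (a - j))). F \<kappa>)"
proof (rule sum.reindex_bij_witness[of _
      "\<lambda>(j, \<rho>, \<kappa>). (local_up \<theta> \<kappa> j \<rho>, \<kappa>)"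
      "\<lambda>(\<nu>, \<kappa>). (\<nu> 0 - max (\<theta> 0) (\<kappa> 0), local_rule \<theta> \<kappa> (\<lambda>i. \<nu> (Suc i)), \<kappa>)"], goal_cases)
  case (1 p)
  then obtain \<nu> \<kappa> where p: "p = (\<nu>, \<kappa>)" "strip \<nu> \<theta>" "strip \<nu> \<kappa>" by (auto simp: add_strip_def remove_strip_def)
  have "local_up \<theta> \<kappa> (\<nu> 0 - max (\<theta> 0) (\<kappa> 0)) (local_rule \<theta> \<kappa> (\<lambda>i. \<nu> (Suc i))) i = \<nu> i" for i
    using strip_max_min[OF p(2,3)] by (cases i) (auto simp: local_up_def local_rule_def trans_le_add2)
  then show ?case by (simp add: p fun_eq_iff)
next
  case (2 p)
  then obtain \<nu> \<kappa> where p: "p = (\<nu>, \<kappa>)" "strip \<nu> \<theta>" "strip \<nu> \<kappa>"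
    "fsize \<nu> = fsize \<theta> + a" "fsize \<nu> = fsize \<kappa> + b" by (auto simp: add_strip_def remove_strip_def)
  define j where "j = \<nu> 0 - max (\<theta> 0) (\<kappa> 0)"
  define \<rho> where "\<rho> = local_rule \<theta> \<kappa> (\<lambda>i. \<nu> (Suc i))"
  note mm = strip_max_min[OF p(2,3)]
  have b: "bounded_by (Suc L) \<theta>" "bounded_by (Suc L) \<nu>" "bounded_by (Suc L) \<kappa>"
    using assms p bounded_by_mono[of L] bounded_strip_up bounded_strip_down le_SucI by blast+
  have \<rho>: "\<rho> i \<le> min (\<theta> i) (\<kappa> i)" "max (\<theta> (Suc i)) (\<kappa> (Suc i)) \<le> \<rho> i" for i
    using mm[of i] mm(2)[of "Suc i"] by (auto simp: \<rho>_def local_rule_def)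
  have s: "strip \<theta> \<rho>" "strip \<kappa> \<rho>" using \<rho> by (auto simp: strip_def)
  have b\<rho>: "bounded_by (Suc L) \<rho>" using bounded_strip_down[OF s(1) b(1)] .
  have "local_up \<theta> \<kappa> j \<rho> = \<nu>"
    using mm by (auto simp: fun_eq_iff j_def \<rho>_def local_up_def local_rule_def trans_le_add2 split: nat.split)
  then have "fsize \<nu> + fsize \<rho> = j + fsize \<theta> + fsize \<kappa>"
    using local_size[OF b(1,3) b\<rho>] \<rho>(1) by metis
  \<comment> \<open>These bounds turn the size relation into j \<le> a and j \<le> b, so that the
    differences \<open>a - j\<close> and \<open>b - j\<close> are exact.\<close>
  moreover have "fsize \<rho> \<le> fsize \<theta>" "fsize \<rho> \<le> fsize \<kappa>"
    unfolding fsize_eq[OF b(1)] fsize_eq[OF b(3)] fsize_eq[OF b\<rho>] by (rule sum_mono, use \<rho> in simp)+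
  ultimately have "j \<le> min a b" "fsize \<theta> = fsize \<rho> + (b - j)" "fsize \<kappa> = fsize \<rho> + (a - j)"
    using p(4,5) by auto
  then show ?case using s by (auto simp: p(1) j_def[symmetric] \<rho>_def[symmetric] remove_strip_def add_strip_def)
next
  case (3 p)
  then obtain j \<rho> \<kappa> where p: "p = (j, \<rho>, \<kappa>)" "strip \<theta> \<rho>" "strip \<kappa> \<rho>"
    by (auto simp: add_strip_def remove_strip_def)
  have "\<rho> i \<le> max (\<theta> (Suc i)) (\<kappa> (Suc i)) + min (\<theta> i) (\<kappa> i)" for i
    using p(2,3) by (simp add: strip_def trans_le_add2)
  then show ?case by (simp add: p local_up_def local_rule_def fun_eq_iff)
next
  case (4 p)
  then obtain j \<rho> \<kappa> where p: "p = (j, \<rho>, \<kappa>)" "j \<le> a" "j \<le> b" "strip \<theta> \<rho>" "strip \<kappa> \<rho>"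
    "fsize \<theta> = fsize \<rho> + (b - j)" "fsize \<kappa> = fsize \<rho> + (a - j)"
    by (auto simp: add_strip_def remove_strip_def)
  have \<rho>: "\<rho> i \<le> min (\<theta> i) (\<kappa> i)" "max (\<theta> (Suc i)) (\<kappa> (Suc i)) \<le> \<rho> i" for i
    using p(4,5) by (auto simp: strip_def)
  have "local_up \<theta> \<kappa> j \<rho> (Suc i) \<le> min (\<theta> i) (\<kappa> i)" for i
    using \<rho>[of i] by (auto simp: local_up_def local_rule_def)
  moreover have "max (\<theta> i) (\<kappa> i) \<le> local_up \<theta> \<kappa> j \<rho> i" for i
  proof (cases i)
    case (Suc m)
    have "max (\<theta> (Suc m)) (\<kappa> (Suc m)) \<le> max (\<theta> (Suc m)) (\<kappa> (Suc m)) + min (\<theta> m) (\<kappa> m) - \<rho> m"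
      using \<rho>(1)[of m] by linarith
    then show ?thesis by (simp only: Suc local_up_def local_rule_def nat.case)
  qed (simp add: local_up_def)
  ultimately have s: "strip (local_up \<theta> \<kappa> j \<rho>) \<theta>" "strip (local_up \<theta> \<kappa> j \<rho>) \<kappa>"
    by (auto simp: strip_def)
  have b: "bounded_by (Suc L) \<theta>" "bounded_by (Suc L) \<rho>" "bounded_by (Suc L) \<kappa>"
    using assms p bounded_by_mono[of L] bounded_strip_up bounded_strip_down le_SucI by blast+
  have "fsize (local_up \<theta> \<kappa> j \<rho>) + fsize \<rho> = j + fsize \<theta> + fsize \<kappa>"
    by (rule local_size[OF b(1,3,2) \<rho>(1)])
  then show ?case using s p by (auto simp: add_strip_def remove_strip_def)
qed auto

text \<open>Induction on the alphabet: \<open>sum_up_down\<close> commutes adding a strip past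
  removing the strip of the largest letter, and the growth \<open>j\<close> becomes the number of
  copies of this letter taken from h_a.\<close>

lemma kostka_pieri:
  assumes "bounded_by L \<theta>"
  shows "(\<Sum>\<nu>\<in>add_strip \<theta> a. kostka N c \<nu>) = (\<Sum>k\<in>subcontents N c a. kostka N (\<lambda>i. c i - k i) \<theta>)"
  using assms
proof (induction N arbitrary: \<theta> a L)
  case 0
  have "add_strip \<theta> a \<inter> {\<nu>. \<forall>i. \<nu> i = 0} = (if a = 0 \<and> (\<forall>i. \<theta> i = 0) then {\<theta>} else {})"
    using 0 by (auto simp: add_strip_def strip_def fsize_def fun_eq_iff)
  moreover have "subcontents 0 c a = (if a = 0 then {\<lambda>i. 0} else {})"
    by (auto simp: subcontents_def bounded_by_def)
  ultimately show ?case using finite_add_strip[OF 0]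
    by (simp add: sum.If_cases)
next
  case (Suc N)
  have fin: "finite (add_strip \<theta> a)" by (rule finite_add_strip[OF Suc.prems])
  have "(\<Sum>\<nu>\<in>add_strip \<theta> a. kostka (Suc N) c \<nu>) =
      (\<Sum>(\<nu>, \<kappa>)\<in>Sigma (add_strip \<theta> a) (\<lambda>\<nu>. remove_strip \<nu> (c N)). kostka N c \<kappa>)"
    using fin bounded_strip_up[OF _ Suc.prems] finite_remove_strip
    by (subst sum.Sigma[symmetric]) (auto simp: add_strip_def)
  also have "\<dots> = (\<Sum>(j, \<rho>, \<kappa>)\<in>Sigma {..min a (c N)} (\<lambda>j. Sigma (remove_strip \<theta> (c N - j)) (\<lambda>\<rho>. add_strip \<rho> (a - j))). kostka N c \<kappa>)"
    by (rule sum_up_down[OF Suc.prems])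
  also have "\<dots> = (\<Sum>j\<le>min a (c N). \<Sum>\<rho>\<in>remove_strip \<theta> (c N - j). \<Sum>\<kappa>\<in>add_strip \<rho> (a - j). kostka N c \<kappa>)"
  proof -
    have f: "finite (add_strip \<rho> (a - j))" if "\<rho> \<in> remove_strip \<theta> (c N - j)" for j \<rho>
      using that bounded_strip_down[OF _ Suc.prems] finite_add_strip by (auto simp: remove_strip_def)
    show ?thesis
      using f finite_remove_strip[OF Suc.prems]
      by (subst sum.Sigma[symmetric], simp, blast) (auto intro!: sum.cong simp: sum.Sigma[symmetric])
  qed
  also have "\<dots> = (\<Sum>j\<le>min a (c N). \<Sum>\<rho>\<in>remove_strip \<theta> (c N - j). \<Sum>k\<in>subcontents N c (a - j). kostka N (\<lambda>i. c i - k i) \<rho>)"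
  proof (rule sum.cong[OF refl], rule sum.cong[OF refl])
    fix j \<rho> assume "\<rho> \<in> remove_strip \<theta> (c N - j)"
    then have "bounded_by L \<rho>" using bounded_strip_down[OF _ Suc.prems] by (auto simp: remove_strip_def)
    then show "(\<Sum>\<kappa>\<in>add_strip \<rho> (a - j). kostka N c \<kappa>) = (\<Sum>k\<in>subcontents N c (a - j). kostka N (\<lambda>i. c i - k i) \<rho>)"
      by (rule Suc.IH)
  qed
  also have "\<dots> = (\<Sum>j\<le>min a (c N). \<Sum>k\<in>subcontents N c (a - j). kostka (Suc N) (\<lambda>i. c i - (k(N := j)) i) \<theta>)"
  proof (rule sum.cong[OF refl])
    fix j
    have "(\<Sum>\<rho>\<in>remove_strip \<theta> (c N - j). \<Sum>k\<in>subcontents N c (a - j). kostka N (\<lambda>i. c i - k i) \<rho>) =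
        (\<Sum>k\<in>subcontents N c (a - j). \<Sum>\<rho>\<in>remove_strip \<theta> (c N - j). kostka N (\<lambda>i. c i - k i) \<rho>)"
      by (rule sum.swap)
    also have "\<dots> = (\<Sum>k\<in>subcontents N c (a - j). \<Sum>\<rho>\<in>remove_strip \<theta> (c N - j). kostka N (\<lambda>i. c i - (k(N := j)) i) \<rho>)"
      by (intro sum.cong refl kostka_cong) auto
    finally show "(\<Sum>\<rho>\<in>remove_strip \<theta> (c N - j). \<Sum>k\<in>subcontents N c (a - j). kostka N (\<lambda>i. c i - k i) \<rho>) =
      (\<Sum>k\<in>subcontents N c (a - j). kostka (Suc N) (\<lambda>i. c i - (k(N := j)) i) \<theta>)" by simp
  qed
  also have "\<dots> = (\<Sum>k\<in>subcontents (Suc N) c a. kostka (Suc N) (\<lambda>i. c i - k i) \<theta>)"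
    unfolding subcontents_Suc by (subst sum.Sigma[symmetric]) (auto simp: finite_subcontents)
  finally show ?case .
qed


section \<open>Tableaux and Kostka numbers\<close>

definition row_fun :: "nat list \<Rightarrow> nat \<Rightarrow> nat" where
  "row_fun \<nu> i = (if i < length \<nu> then \<nu> ! i else 0)"

text \<open>Zero rows are kept up to length \<open>L\<close>, since stripping a letter may empty
  rows and comparison by \<open>raises\<close> needs equal lengths.\<close>

definition row_list :: "nat \<Rightarrow> (nat \<Rightarrow> nat) \<Rightarrow> nat list" where
  "row_list L f = map f [0..<L]"

lemma row_list_simps [simp]: "length (row_list L f) = L" "i < L \<Longrightarrow> row_list L f ! i = f i"
  by (simp_all add: row_list_def)

lemma row_fun_list: "bounded_by L f \<Longrightarrow> row_fun (row_list L f) = f"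
  by (auto simp: row_fun_def row_list_def bounded_by_def fun_eq_iff)

lemma row_list_fun [simp]: "row_list (length \<nu>) (row_fun \<nu>) = \<nu>"
  by (auto simp: row_fun_def row_list_def intro: nth_equalityI)

lemma bounded_row_fun: "bounded_by (length \<nu>) (row_fun \<nu>)"
  by (simp add: bounded_by_def row_fun_def)

lemma fsize_row_fun: "fsize (row_fun \<nu>) = sum_list \<nu>"
  by (simp add: fsize_eq[OF bounded_row_fun] row_fun_def sum_list_sum_nth atLeast0LessThan)

definition tableaux :: "nat list \<Rightarrow> nat multiset \<Rightarrow> nat list list set" where
  "tableaux \<nu> M = {T \<in> ssyt \<nu>. mset (concat T) = M}"

lemma tableaux_entry_less:
  assumes "T \<in> tableaux \<nu> M" "set_mset M \<subseteq> {..<N}" "i < length T" "j < length (T ! i)"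
  shows "T ! i ! j < N"
proof -
  have "T ! i ! j \<in> set (concat T)" using assms(3,4) by (auto intro!: bexI[of _ "T ! i"])
  moreover have "set (concat T) = set_mset M" using assms(1) by (metis (mono_tags) mem_Collect_eq set_mset_mset tableaux_def)
  ultimately show ?thesis using assms(2) by auto
qed

lemma sorted_split_max:
  assumes "sorted r" "\<forall>x\<in>set r. x \<le> N"
  shows "r = filter (\<lambda>x. x < N) r @ replicate (length r - length (filter (\<lambda>x. x < N) r)) (N :: nat)"
  using assms
proof (induction r)
  case (Cons x r)
  show ?case
  proof (cases "x < N")
    case True
    then show ?thesis using Cons by simp
  next
    case False
    then have x: "x = N" using Cons.prems by auto
    then have "\<forall>y\<in>set r. y = N" using Cons.prems by (auto intro: antisym)
    then have "filter (\<lambda>x. x < N) r = []" "r = replicate (length r) N"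
      by (auto simp: filter_empty_conv replicate_eqI)
    then show ?thesis using x by (metis False filter.simps(2) append_Nil length_Cons list.size(3) minus_nat.diff_0 replicate_Suc)
  qed
qed simp

lemma mset_split_max:
  assumes "set_mset M \<subseteq> {..<Suc N}"
  shows "M = filter_mset (\<lambda>x. x < N) M + replicate_mset (count M N) N"
proof (rule multiset_eqI)
  fix i
  show "count M i = count (filter_mset (\<lambda>x. x < N) M + replicate_mset (count M N) N) i"
    using assms by (cases "i < N"; cases "i = N") (auto simp: not_in_iff[symmetric])
qed

text \<open>Removing the largest entries \<open>N\<close> removes a horizontal strip.\<close>

lemma tableaux_branching:
  fixes \<nu> :: "nat list"
  assumes M: "set_mset M \<subseteq> {..<Suc N}" and anti: "\<And>i. Suc i < length \<nu> \<Longrightarrow> \<nu> ! Suc i \<le> \<nu> ! i"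
  defines "l \<equiv> length \<nu>"
  shows "bij_betw (\<lambda>T. (row_fun (map (\<lambda>r. length (filter (\<lambda>x. x < N) r)) T), map (filter (\<lambda>x. x < N)) T))
    (tableaux \<nu> M)
    (Sigma (remove_strip (row_fun \<nu>) (count M N)) (\<lambda>\<kappa>. tableaux (row_list l \<kappa>) (filter_mset (\<lambda>x. x < N) M)))"
    (is "bij_betw ?f ?A ?B")
proof (rule bij_betw_byWitness[where f' = "\<lambda>(\<kappa>, T). map (\<lambda>i. T ! i @ replicate (\<nu> ! i - \<kappa> i) N) [0..<l]"])
  let ?F = "filter (\<lambda>x. x < N)"
  let ?g = "\<lambda>(\<kappa>, T). map (\<lambda>i. T ! i @ replicate (\<nu> ! i - \<kappa> i) N) [0..<l]"
  have subN: "set_mset (filter_mset (\<lambda>x. x < N) M) \<subseteq> {..<N}" by auto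
  have rowlen: "length T = l" "\<And>i. i < l \<Longrightarrow> length (T ! i) = \<nu> ! i" if "map length T = \<nu>" for T :: "nat list list"
    using that by (auto simp: l_def)
  show "\<forall>T\<in>?A. ?g (?f T) = T"
  proof
    fix T assume T: "T \<in> ?A"
    then have ml: "map length T = \<nu>" and so: "\<And>i. i < l \<Longrightarrow> sorted (T ! i)"
      by (auto simp: tableaux_def ssyt_def l_def)
    note rl = rowlen[OF ml]
    show "?g (?f T) = T"
    proof (rule nth_equalityI)
      fix i assume "i < length (?g (?f T))"
      then have i: "i < l" by simp
      have "\<forall>x\<in>set (T ! i). x \<le> N"
        using tableaux_entry_less[OF T M, of i] i rl by (auto simp: in_set_conv_nth less_Suc_eq_le)
      then show "?g (?f T) ! i = T ! i"
        using sorted_split_max[OF so[OF i]] i rl by (simp add: row_fun_def)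
    qed (simp add: rl)
  qed
  show "\<forall>p\<in>?B. ?f (?g p) = p"
  proof (rule ballI)
    fix p assume "p \<in> ?B"
    then obtain \<kappa> T where p: "p = (\<kappa>, T)" and \<kappa>: "\<kappa> \<in> remove_strip (row_fun \<nu>) (count M N)"
      and T: "T \<in> tableaux (row_list l \<kappa>) (filter_mset (\<lambda>x. x < N) M)" by auto
    have ml: "map length T = row_list l \<kappa>" using T by (auto simp: tableaux_def ssyt_def)
    then have len: "length T = l" by (metis length_map row_list_simps(1))
    have lT: "length (T ! i) = \<kappa> i" if "i < l" for i
      using that len arg_cong[OF ml, of "\<lambda>x. x ! i"] by simp
    have "?F (T ! i) = T ! i" if "i < l" for i
      using tableaux_entry_less[OF T subN, of i] that len by (auto simp: filter_id_conv in_set_conv_nth)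
    then have m: "map ?F (?g (\<kappa>, T)) = T"
      using len by (auto intro!: nth_equalityI)
    have "map (\<lambda>r. length (?F r)) (?g (\<kappa>, T)) = map length (map ?F (?g (\<kappa>, T)))" by simp
    also have "\<dots> = row_list l \<kappa>" unfolding m by (rule ml)
    finally have "row_fun (map (\<lambda>r. length (?F r)) (?g (\<kappa>, T))) = \<kappa>"
      using \<kappa> bounded_strip_down[OF _ bounded_row_fun[of \<nu>]] row_fun_list[of l \<kappa>]
      by (simp add: remove_strip_def l_def)
    then show "?f (?g p) = p" using m by (simp add: p)
  qed
  show "?f ` ?A \<subseteq> ?B"
  proof (rule image_subsetI)
    fix T assume T: "T \<in> ?A"
    then have ml: "map length T = \<nu>" and so: "\<And>i. i < l \<Longrightarrow> sorted (T ! i)" and mM: "mset (concat T) = M"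
      and col: "\<And>i j. Suc i < l \<Longrightarrow> j < length (T ! Suc i) \<Longrightarrow> T ! i ! j < T ! Suc i ! j"
      by (auto simp: tableaux_def ssyt_def l_def)
    note rl = rowlen[OF ml]
    define \<kappa> where "\<kappa> = row_fun (map (\<lambda>r. length (?F r)) T)"
    define T' where "T' = map ?F T"
    have \<kappa>i: "\<kappa> i = (if i < l then length (?F (T ! i)) else 0)" for i
      by (simp add: \<kappa>_def row_fun_def rl)
    have split: "T ! i = ?F (T ! i) @ replicate (\<nu> ! i - \<kappa> i) N" if "i < l" for i
    proof -
      have "\<forall>x\<in>set (T ! i). x \<le> N"
        using tableaux_entry_less[OF T M, of i] that rl by (auto simp: in_set_conv_nth less_Suc_eq_le)
      then show ?thesis using sorted_split_max[OF so[OF that]] that rl by (simp add: \<kappa>i)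
    qed
    have le: "\<kappa> i \<le> \<nu> ! i" if "i < l" for i using that rl by (metis \<kappa>i length_filter_le)
    have entry: "T ! i ! j < N \<longleftrightarrow> j < \<kappa> i" if "i < l" "j < \<nu> ! i" for i j
    proof -
      have "T ! i ! j = (?F (T ! i) @ replicate (\<nu> ! i - \<kappa> i) N) ! j" using split[OF that(1)] by simp
      then show ?thesis using that nth_mem[of j "?F (T ! i)"] by (auto simp: nth_append \<kappa>i)
    qed
    have prefix: "T' ! i ! j = T ! i ! j" if "i < l" "j < \<kappa> i" for i j
    proof -
      have "T ! i ! j = (?F (T ! i) @ replicate (\<nu> ! i - \<kappa> i) N) ! j" using split[OF that(1)] by simp
      then show ?thesis using that by (simp add: nth_append \<kappa>i T'_def rl)
    qed
    have "strip (row_fun \<nu>) \<kappa>"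
      unfolding strip_def
    proof (intro allI conjI)
      fix i
      show "\<kappa> i \<le> row_fun \<nu> i" using le[of i] by (auto simp: row_fun_def l_def \<kappa>i)
      show "row_fun \<nu> (Suc i) \<le> \<kappa> i"
      proof (cases "Suc i < l")
        case True
        show ?thesis
        proof (rule ccontr)
          assume "\<not> row_fun \<nu> (Suc i) \<le> \<kappa> i"
          then have j: "\<kappa> i < \<nu> ! Suc i" using True by (simp add: row_fun_def l_def)
          then have c: "T ! i ! \<kappa> i < T ! Suc i ! \<kappa> i" using col[of i "\<kappa> i"] True rl by simp
          moreover have "T ! Suc i ! \<kappa> i < Suc N"
            using tableaux_entry_less[OF T M, of "Suc i" "\<kappa> i"] True j rl by simp
          ultimately have "T ! i ! \<kappa> i < N" by simp
          moreover have "\<kappa> i < \<nu> ! i \<or> \<kappa> i = \<nu> ! i" using le[of i] True by auto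
          ultimately show False
          proof (elim disjE)
            assume "\<kappa> i = \<nu> ! i"
            then show False using j anti[of i] True by (simp add: l_def)
          qed (use entry[of i "\<kappa> i"] True in simp)
        qed
      qed (simp add: row_fun_def l_def)
    qed
    have mT': "mset (concat T') = filter_mset (\<lambda>x. x < N) M"
      by (simp add: T'_def mM[symmetric] filter_concat[symmetric])
    have lT': "map length T' = row_list l \<kappa>"
      by (rule nth_equalityI) (simp_all add: T'_def rl \<kappa>i)
    have "size M = sum_list \<nu>" unfolding mM[symmetric] size_mset length_concat ml ..
    moreover have "size (filter_mset (\<lambda>x. x < N) M) = sum_list (row_list l \<kappa>)"
      unfolding mT'[symmetric] size_mset length_concat lT' ..
    moreover have "sum_list (row_list l \<kappa>) = fsize \<kappa>"
      by (subst fsize_eq[of l]) (auto simp: bounded_by_def \<kappa>i row_list_def interv_sum_list_conv_sum_set_nat atLeast0LessThan)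
    moreover have "size M = size (filter_mset (\<lambda>x. x < N) M) + count M N"
      by (subst mset_split_max[OF M]) (simp only: size_union size_replicate_mset)
    ultimately have "fsize (row_fun \<nu>) = fsize \<kappa> + count M N" by (simp add: fsize_row_fun)
    then have "\<kappa> \<in> remove_strip (row_fun \<nu>) (count M N)"
      using \<open>strip (row_fun \<nu>) \<kappa>\<close> by (simp add: remove_strip_def)
    moreover have "T' \<in> ssyt (row_list l \<kappa>)"
      unfolding ssyt_def
    proof (safe intro!: lT')
      fix r assume "r \<in> set T'"
      then obtain i where "i < l" "r = ?F (T ! i)" by (auto simp: T'_def in_set_conv_nth rl)
      then show "sorted r" using so[of i] by (simp add: sorted_wrt_filter)
    next
      fix i j assume ij: "Suc i < length T'" "j < length (T' ! Suc i)"
      then have i: "Suc i < l" and j: "j < \<kappa> (Suc i)" by (simp_all add: T'_def rl \<kappa>i)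
      have "j < \<nu> ! Suc i" using j le[of "Suc i"] i by simp
      moreover have "\<nu> ! Suc i \<le> \<kappa> i"
        using \<open>strip (row_fun \<nu>) \<kappa>\<close> i by (auto simp: strip_def row_fun_def l_def dest: spec[of _ i])
      ultimately show "T' ! i ! j < T' ! Suc i ! j"
        using prefix[of i j] prefix[of "Suc i" j] i j col[of i j] rl by simp
    qed
    ultimately show "?f T \<in> ?B"
      using mT' by (simp add: tableaux_def \<kappa>_def T'_def)
  qed
  show "?g ` ?B \<subseteq> ?A"
  proof (rule image_subsetI)
    fix p assume "p \<in> ?B"
    then obtain \<kappa> T where p: "p = (\<kappa>, T)" and \<kappa>: "\<kappa> \<in> remove_strip (row_fun \<nu>) (count M N)"
      and T: "T \<in> tableaux (row_list l \<kappa>) (filter_mset (\<lambda>x. x < N) M)" by auto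
    have ml: "map length T = row_list l \<kappa>" and mT: "mset (concat T) = filter_mset (\<lambda>x. x < N) M"
      using T by (auto simp: tableaux_def ssyt_def)
    then have len: "length T = l" by (metis length_map row_list_simps(1))
    have lT: "length (T ! i) = \<kappa> i" if "i < l" for i
      using that len arg_cong[OF ml, of "\<lambda>x. x ! i"] by simp
    have so: "sorted (T ! i)" if "i < l" for i using T that len by (auto simp: tableaux_def ssyt_def)
    have col: "T ! i ! j < T ! Suc i ! j" if "Suc i < l" "j < \<kappa> (Suc i)" for i j
      using T that len lT[of "Suc i"] by (auto simp: tableaux_def ssyt_def)
    have entry: "T ! i ! j < N" if "i < l" "j < \<kappa> i" for i j
      using tableaux_entry_less[OF T subN, of i j] that len lT by auto
    have st: "\<kappa> i \<le> \<nu> ! i" "Suc i < l \<Longrightarrow> \<nu> ! Suc i \<le> \<kappa> i" if "i < l" for i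
      using \<kappa> that by (auto simp: remove_strip_def strip_def row_fun_def l_def dest: spec[of _ i])
    define U where "U = map (\<lambda>i. T ! i @ replicate (\<nu> ! i - \<kappa> i) N) [0..<l]"
    have lU: "map length U = \<nu>"
      by (rule nth_equalityI) (use st lT in \<open>auto simp: U_def l_def\<close>)
    have "U \<in> ssyt \<nu>"
      unfolding ssyt_def
    proof (safe intro!: lU)
      fix r assume "r \<in> set U"
      then obtain i where i: "i < l" "r = T ! i @ replicate (\<nu> ! i - \<kappa> i) N" by (auto simp: U_def)
      have "x < N" if "x \<in> set (T ! i)" for x
        using that entry[OF i(1)] lT[OF i(1)] by (auto simp: in_set_conv_nth)
      then show "sorted r" using so[OF i(1)] i(2) by (fastforce simp: sorted_append)
    next
      fix i j assume ij: "Suc i < length U" "j < length (U ! Suc i)"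
      then have i: "Suc i < l" by (simp add: U_def)
      then have j: "j < \<nu> ! Suc i" using ij(2) st[of "Suc i"] lT[of "Suc i"] by (simp add: U_def)
      have j2: "j < \<kappa> i" using j st(2)[of i] i by simp
      then have "U ! i ! j = T ! i ! j" "T ! i ! j < N" using i lT[of i] entry[of i j] by (simp_all add: U_def nth_append)
      moreover have "U ! Suc i ! j = (if j < \<kappa> (Suc i) then T ! Suc i ! j else N)"
        using i lT[of "Suc i"] j st[of "Suc i"] by (simp add: U_def nth_append)
      ultimately show "U ! i ! j < U ! Suc i ! j" using col[OF i] by simp
    qed
    moreover have "mset (concat U) = M"
    proof -
      have "?F (T ! i) = T ! i" if "i < l" for i
        using entry[OF that] lT[OF that] by (auto simp: filter_id_conv in_set_conv_nth)
      then have m: "map ?F U = T" using len by (auto intro!: nth_equalityI simp: U_def)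
      have F: "filter_mset (\<lambda>x. x < N) (mset (concat U)) = filter_mset (\<lambda>x. x < N) M"
        unfolding mT[symmetric] by (simp flip: mset_filter add: filter_concat m)
      have "x < Suc N" if "x \<in> set (concat U)" for x
      proof -
        have "\<exists>i<l. x \<in> set (T ! i @ replicate (\<nu> ! i - \<kappa> i) N)" using that by (force simp: U_def)
        then obtain i where "i < l" "x \<in> set (T ! i @ replicate (\<nu> ! i - \<kappa> i) N)" by blast
        then show ?thesis using entry[of i] lT[of i] by (fastforce simp: in_set_conv_nth)
      qed
      then have sub: "set_mset (mset (concat U)) \<subseteq> {..<Suc N}" by auto
      have "size (mset (concat U)) = sum_list \<nu>" unfolding size_mset length_concat lU ..
      moreover have "size (filter_mset (\<lambda>x. x < N) M) = sum_list (row_list l \<kappa>)"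
        unfolding mT[symmetric] size_mset length_concat ml ..
      moreover have "bounded_by l \<kappa>"
        using \<kappa> bounded_strip_down[OF _ bounded_row_fun[of \<nu>]] by (auto simp: remove_strip_def l_def)
      then have "sum_list (row_list l \<kappa>) = fsize \<kappa>"
        by (simp add: fsize_eq row_list_def interv_sum_list_conv_sum_set_nat atLeast0LessThan)
      moreover have "size (mset (concat U)) = size (filter_mset (\<lambda>x. x < N) M) + count (mset (concat U)) N"
        by (subst mset_split_max[OF sub]) (simp only: size_union size_replicate_mset F)
      ultimately have "count (mset (concat U)) N = count M N"
        using \<kappa> by (simp add: remove_strip_def fsize_row_fun)
      then show ?thesis using mset_split_max[OF sub] mset_split_max[OF M] F by metis
    qed
    ultimately show "?g p \<in> ?A" by (simp add: p tableaux_def U_def)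
  qed
qed

definition antitone_list :: "nat list \<Rightarrow> bool" where
  "antitone_list \<nu> \<longleftrightarrow> (\<forall>i. Suc i < length \<nu> \<longrightarrow> \<nu> ! Suc i \<le> \<nu> ! i)"

lemma antitone_row_list_down:
  assumes "strip (row_fun \<nu>) \<kappa>" "l \<le> length \<nu>"
  shows "antitone_list (row_list l \<kappa>)"
  unfolding antitone_list_def
proof safe
  fix i assume i: "Suc i < length (row_list l \<kappa>)"
  have "\<kappa> (Suc i) \<le> row_fun \<nu> (Suc i)" "row_fun \<nu> (Suc i) \<le> \<kappa> i"
    using assms(1) by (auto simp: strip_def)
  then show "row_list l \<kappa> ! Suc i \<le> row_list l \<kappa> ! i" using i by simp
qed

lemma antitone_row_list_up:
  assumes "strip \<nu> \<kappa>"
  shows "antitone_list (row_list l \<nu>)"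
  unfolding antitone_list_def
proof safe
  fix i assume i: "Suc i < length (row_list l \<nu>)"
  have "\<nu> (Suc i) \<le> \<kappa> i" "\<kappa> i \<le> \<nu> i" using assms(1) by (auto simp: strip_def)
  then show "row_list l \<nu> ! Suc i \<le> row_list l \<nu> ! i" using i by simp
qed

text \<open>Each application of \<open>tableaux_branching\<close> mirrors one step of the recursion
  of \<open>kostka\<close>. Finiteness is carried along for the cardinality of the dependent
  sum.\<close>

lemma card_tableaux:
  assumes "antitone_list \<nu>" "set_mset M \<subseteq> {..<N}"
  shows "finite (tableaux \<nu> M) \<and> card (tableaux \<nu> M) = kostka N (count M) (row_fun \<nu>)"
  using assms
proof (induction N arbitrary: \<nu> M)
  case 0
  then have M: "M = {#}" by simp
  have "tableaux \<nu> M = (if \<forall>i. row_fun \<nu> i = 0 then {replicate (length \<nu>) []} else {})"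
  proof (cases "\<forall>i. row_fun \<nu> i = 0")
    case True
    have \<nu>: "\<nu> = replicate (length \<nu>) 0"
    proof (rule nth_equalityI)
      fix i assume "i < length \<nu>"
      then show "\<nu> ! i = replicate (length \<nu>) 0 ! i" using True by (simp add: row_fun_def split: if_splits)
    qed simp
    have "T \<in> tableaux \<nu> M \<longleftrightarrow> T = replicate (length \<nu>) []" for T
    proof
      assume "T \<in> tableaux \<nu> M"
      then have "map length T = \<nu>" "concat T = []" by (auto simp: tableaux_def ssyt_def M)
      then show "T = replicate (length \<nu>) []"
        by (metis concat_eq_Nil_conv length_map replicate_eqI)
    next
      assume T: "T = replicate (length \<nu>) []"
      then have "map length T = \<nu>" using \<nu> by (metis list.size(3) map_replicate)
      then show "T \<in> tableaux \<nu> M" using T by (auto simp: tableaux_def ssyt_def M)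
    qed
    then show ?thesis using True by auto
  next
    case False
    then obtain i where i: "i < length \<nu>" "\<nu> ! i \<noteq> 0" by (auto simp: row_fun_def split: if_splits)
    have "T \<notin> tableaux \<nu> M" for T
    proof
      assume "T \<in> tableaux \<nu> M"
      then have "map length T = \<nu>" "concat T = []" by (auto simp: tableaux_def ssyt_def M)
      then have "length (T ! i) = \<nu> ! i" "T ! i = []" using i by (auto simp: concat_eq_Nil_conv)
      then show False using i by simp
    qed
    then show ?thesis using False by auto
  qed
  then show ?case by simp
next
  case (Suc N)
  let ?l = "length \<nu>"
  let ?M = "filter_mset (\<lambda>x. x < N) M"
  let ?R = "remove_strip (row_fun \<nu>) (count M N)"
  have anti: "\<And>i. Suc i < length \<nu> \<Longrightarrow> \<nu> ! Suc i \<le> \<nu> ! i" using Suc.prems(1) by (simp add: antitone_list_def)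
  note bij = tableaux_branching[OF Suc.prems(2) anti]
  have finR: "finite ?R" by (rule finite_remove_strip[OF bounded_row_fun])
  have IH: "finite (tableaux (row_list ?l \<kappa>) ?M) \<and> card (tableaux (row_list ?l \<kappa>) ?M) = kostka N (count M) \<kappa>"
    if "\<kappa> \<in> ?R" for \<kappa>
  proof -
    have st: "strip (row_fun \<nu>) \<kappa>" using that by (simp add: remove_strip_def)
    have "row_fun (row_list ?l \<kappa>) = \<kappa>" by (rule row_fun_list[OF bounded_strip_down[OF st bounded_row_fun]])
    moreover have "kostka N (count ?M) \<kappa> = kostka N (count M) \<kappa>" by (rule kostka_cong) simp
    moreover have "set_mset ?M \<subseteq> {..<N}" by auto
    ultimately show ?thesis using Suc.IH[OF antitone_row_list_down[OF st], of ?l ?M] by (metis order_refl)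
  qed
  have finB: "finite (Sigma ?R (\<lambda>\<kappa>. tableaux (row_list ?l \<kappa>) ?M))"
    using finR IH by blast
  then have "finite (tableaux \<nu> M)" using bij bij_betw_finite by blast
  moreover have "card (tableaux \<nu> M) = kostka (Suc N) (count M) (row_fun \<nu>)"
    using bij_betw_same_card[OF bij] finR IH by (simp add: card_SigmaI)
  ultimately show ?case ..
qed

lemma coef_schur_kostka:
  assumes "antitone_list \<nu>" "set_mset M \<subseteq> {..<N}"
  shows "coef (schur \<nu>) M = of_nat (kostka N (count M) (row_fun \<nu>))"
  using card_tableaux[OF assms] by (simp add: schur_def tableaux_def)

lemma mset_bound:
  obtains N :: nat where "set_mset M \<subseteq> {..<N}"
  using finite_nat_set_iff_bounded[of "set_mset M"] that by auto

lemma sum_submultisets: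
  assumes "set_mset M \<subseteq> {..<N}"
  shows "(\<Sum>A | A \<subseteq># M \<and> size A = a. F (count A)) = (\<Sum>k\<in>subcontents N (count M) a. F k)"
proof (rule sum.reindex_bij_witness[where i = Abs_multiset and j = count], goal_cases)
  case (2 A)
  then have A: "A \<subseteq># M" "size A = a" by auto
  then have sub: "set_mset A \<subseteq> {..<N}" using assms by (auto dest: mset_subset_eqD)
  then have "bounded_by N (count A)" by (auto simp: bounded_by_def count_eq_zero_iff)
  moreover have "size A = (\<Sum>i<N. count A i)"
    unfolding size_multiset_overloaded_eq using sub by (intro sum.mono_neutral_left) (auto simp: count_eq_zero_iff)
  ultimately show ?case using A by (simp add: subcontents_def mset_subset_eq_count)
next
  case (3 k)
  then have "bounded_by N k" by (simp add: subcontents_def)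
  then have "finite {i. 0 < k i}" using finite_support by blast
  then show ?case by (simp add: count_Abs_multiset)
next
  case (4 k)
  then have k: "bounded_by N k" "\<And>i. i < N \<Longrightarrow> k i \<le> count M i" "(\<Sum>i<N. k i) = a" by (auto simp: subcontents_def)
  have "finite {i. 0 < k i}" using k(1) finite_support by blast
  then have c: "count (Abs_multiset k) = k" by (rule count_Abs_multiset)
  have "k i \<le> count M i" for i using k(1) k(2)[of i] by (cases "i < N") (auto simp: bounded_by_def)
  then have "Abs_multiset k \<subseteq># M" by (simp add: subseteq_mset_def c)
  moreover have "i \<in># Abs_multiset k \<longleftrightarrow> k i \<noteq> 0" for i by (metis c count_eq_zero_iff)
  then have "size (Abs_multiset k) = (\<Sum>i<N. k i)"
    unfolding size_multiset_overloaded_eq c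
    by (intro sum.mono_neutral_left) (use k(1) in \<open>auto dest: bounded_by_less\<close>)
  ultimately show ?case using k(3) by simp
qed (simp_all add: count_inverse)

text \<open>At a fixed monomial, taking a divisor of degree \<open>a\<close> from h_a leaves a
  Kostka number for the remaining content, so this is \<open>kostka_pieri\<close>. A horizontal
  strip adds at most one row, hence the one extra entry, possibly zero.\<close>

lemma pieri:
  assumes "antitone_list \<nu>"
  shows "complete_sym a * schur \<nu> =
    (\<Sum>\<kappa>\<in>add_strip (row_fun \<nu>) a. schur (row_list (Suc (length \<nu>)) \<kappa>))"
proof (rule series_eqI)
  fix M :: "nat multiset"
  obtain N where N: "set_mset M \<subseteq> {..<N}" by (rule mset_bound[of M])
  have "coef (complete_sym a * schur \<nu>) M = (\<Sum>A | A \<subseteq># M \<and> size A = a. coef (schur \<nu>) (M - A))"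
    unfolding coef_times by (rule sum.mono_neutral_cong_right) (auto simp: complete_sym_def)
  also have "\<dots> = (\<Sum>A | A \<subseteq># M \<and> size A = a. of_nat (kostka N (\<lambda>i. count M i - count A i) (row_fun \<nu>)))"
  proof (rule sum.cong)
    fix A assume "A \<in> {A. A \<subseteq># M \<and> size A = a}"
    have "set_mset (M - A) \<subseteq> {..<N}" using N by (meson in_diffD subset_iff)
    then show "coef (schur \<nu>) (M - A) = of_nat (kostka N (\<lambda>i. count M i - count A i) (row_fun \<nu>))"
      using coef_schur_kostka[OF assms, of "M - A" N] by (simp add: fun_eq_iff[symmetric] minus_multiset.rep_eq)
  qed simp
  also have "\<dots> = (\<Sum>k\<in>subcontents N (count M) a. of_nat (kostka N (\<lambda>i. count M i - k i) (row_fun \<nu>)))"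
    by (rule sum_submultisets[OF N])
  also have "\<dots> = of_nat (\<Sum>\<kappa>\<in>add_strip (row_fun \<nu>) a. kostka N (count M) \<kappa>)"
    unfolding kostka_pieri[OF bounded_row_fun] by simp
  also have "\<dots> = (\<Sum>\<kappa>\<in>add_strip (row_fun \<nu>) a. coef (schur (row_list (Suc (length \<nu>)) \<kappa>)) M)"
    unfolding of_nat_sum
  proof (rule sum.cong)
    fix \<kappa> assume "\<kappa> \<in> add_strip (row_fun \<nu>) a"
    then have st: "strip \<kappa> (row_fun \<nu>)" by (simp add: add_strip_def)
    have "row_fun (row_list (Suc (length \<nu>)) \<kappa>) = \<kappa>"
      by (rule row_fun_list[OF bounded_strip_up[OF st bounded_row_fun]])
    then show "of_nat (kostka N (count M) \<kappa>) = coef (schur (row_list (Suc (length \<nu>)) \<kappa>)) M"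
      by (simp add: coef_schur_kostka[OF antitone_row_list_up[OF st] N])
  qed simp
  also have "\<dots> = coef (\<Sum>\<kappa>\<in>add_strip (row_fun \<nu>) a. schur (row_list (Suc (length \<nu>)) \<kappa>)) M" by simp
  finally show "coef (complete_sym a * schur \<nu>) M =
      coef (\<Sum>\<kappa>\<in>add_strip (row_fun \<nu>) a. schur (row_list (Suc (length \<nu>)) \<kappa>)) M" .
qed

section \<open>Schur functions in terms of complete symmetric functions\<close>

lemma schur_Nil: "schur [] = 1"
proof (rule series_eqI)
  fix M
  have "{T \<in> ssyt []. mset (concat T) = M} = (if M = {#} then {[]} else {})"
    by (auto simp: ssyt_def)
  then show "coef (schur []) M = coef 1 M" by (simp add: schur_def coef_one)
qed

lemma sum_list_take_row_list: "k \<le> l \<Longrightarrow> sum_list (take k (row_list l f)) = (\<Sum>i<k. f i)"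
  by (simp add: row_list_def take_map interv_sum_list_conv_sum_set_nat atLeast0LessThan)

lemma complete_mult_up_snoc: "f \<in> up \<alpha> \<Longrightarrow> complete_sym a * f \<in> up (\<alpha> @ [a])"
  unfolding up_def
proof (erule span_image_mult)
  fix \<beta> assume \<beta>: "\<beta> \<in> {\<beta>. raises \<beta> \<alpha>}"
  have "sum_list (take k (\<alpha> @ [a])) \<le> sum_list (take k (\<beta> @ [a]))" for k
    using \<beta> by (auto simp: raises_def dominates_def)
  then have "\<beta> @ [a] \<in> {\<beta>. raises \<beta> (\<alpha> @ [a])}" using \<beta> by (auto simp: raises_def dominates_def)
  then have "complete_prod (\<beta> @ [a]) \<in> series.span (complete_prod ` {\<beta>. raises \<beta> (\<alpha> @ [a])})"
    by (intro series.span_base imageI)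
  then show "complete_sym a * complete_prod \<beta> \<in> series.span (complete_prod ` {\<beta>. raises \<beta> (\<alpha> @ [a])})"
    by (simp add: complete_prod_def mult.commute)
qed

text \<open>Among the shapes in the product of \<open>h\<^sub>a\<close> and \<open>s\<^sub>\<theta>\<close> at most one has a new row of length \<open>a\<close>.\<close>

lemma schur_up:
  assumes "antitone_list \<nu>"
  shows "(schur \<nu> :: 'a::field series) \<in> up \<nu>"
  using assms
proof (induction "length \<nu>" arbitrary: \<nu>)
  case 0
  then show ?case using complete_prod_up[of "[]"] by (simp add: schur_Nil)
next
  case (Suc l)
  \<comment> \<open>The outer induction is on the number of rows, the inner one on the last part
    \<open>a\<close>. Multiplying the Schur function of \<open>\<nu>\<close> without its last row by
    h_a gives \<open>\<nu>\<close> itself and shapes whose last row is shorter.\<close>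
  have "\<forall>\<nu>. length \<nu> = Suc l \<longrightarrow> antitone_list \<nu> \<longrightarrow> last \<nu> = a \<longrightarrow> (schur \<nu> :: 'a series) \<in> up \<nu>" for a
  proof (induction a rule: less_induct)
    case (less a)
    show ?case
    proof (intro allI impI)
      fix \<nu> assume \<nu>: "length \<nu> = Suc l" "antitone_list \<nu>" "last \<nu> = a"
      define \<theta> where "\<theta> = butlast \<nu>"
      have \<nu>\<theta>: "\<nu> = \<theta> @ [a]" using \<nu> by (metis \<theta>_def append_butlast_last_id list.size(3) nat.distinct(1))
      then have l\<theta>: "length \<theta> = l" using \<nu> by simp
      have nthth: "\<theta> ! i = \<nu> ! i" if "i < l" for i using that by (simp add: \<nu>\<theta> nth_append l\<theta>)
      have an\<theta>: "antitone_list \<theta>"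
        using \<nu>(2) nthth by (auto simp: antitone_list_def l\<theta> \<nu>(1))
      have st: "strip (row_fun \<nu>) (row_fun \<theta>)"
        unfolding strip_def row_fun_def l\<theta> \<nu>(1) using \<nu>(2) nthth
        by (auto simp: antitone_list_def \<nu>(1) less_Suc_eq)
      have mem: "row_fun \<nu> \<in> add_strip (row_fun \<theta>) a"
        using st by (simp add: add_strip_def fsize_row_fun \<nu>\<theta>)
      have other: "(schur (row_list (Suc l) \<kappa>) :: 'a series) \<in> up \<nu>"
        if \<kappa>: "\<kappa> \<in> add_strip (row_fun \<theta>) a" "\<kappa> \<noteq> row_fun \<nu>" for \<kappa>
      proof -
        have s\<kappa>: "strip \<kappa> (row_fun \<theta>)" and f\<kappa>: "fsize \<kappa> = sum_list \<theta> + a"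
          using \<kappa>(1) by (auto simp: add_strip_def fsize_row_fun)
        have b\<kappa>: "bounded_by (Suc l) \<kappa>" using bounded_strip_up[OF s\<kappa> bounded_row_fun] by (simp add: l\<theta>)
        have ge: "\<nu> ! i \<le> \<kappa> i" if "i < l" for i
          using s\<kappa> that by (auto simp: strip_def row_fun_def l\<theta> nthth dest: spec[of _ i])
        have sum\<kappa>: "(\<Sum>i<l. \<kappa> i) + \<kappa> l = (\<Sum>i<l. \<nu> ! i) + a"
          using f\<kappa> by (simp add: fsize_eq[OF b\<kappa>] sum_list_sum_nth l\<theta> nthth atLeast0LessThan)
        have \<nu>l: "\<nu> ! l = a" by (simp add: \<nu>\<theta> l\<theta> nth_append)
        \<comment> \<open>Only \<open>a\<close> boxes are added, so a last row with at least
          \<open>a\<close> of them leaves none for the other rows and forces \<open>\<kappa>\<close>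
          to be \<open>\<nu>\<close>.\<close>
        have "\<kappa> l < a"
        proof (rule ccontr)
          assume "\<not> \<kappa> l < a"
          moreover have "(\<Sum>i<l. \<nu> ! i) \<le> (\<Sum>i<l. \<kappa> i)" by (rule sum_mono) (use ge in auto)
          ultimately have eq: "(\<Sum>i<l. \<nu> ! i) = (\<Sum>i<l. \<kappa> i)" "\<kappa> l = a" using sum\<kappa> by linarith+
          have "\<kappa> i = \<nu> ! i" if "i < l" for i
            using sum_mono_inv[OF eq(1), of i] ge that by simp
          then have "\<kappa> = row_fun \<nu>"
            using eq(2) \<nu>l b\<kappa> by (auto simp: fun_eq_iff row_fun_def \<nu>(1) less_Suc_eq bounded_by_def)
          then show False using \<kappa>(2) by simp
        qed
        moreover have "last (row_list (Suc l) \<kappa>) = \<kappa> l" by (simp add: row_list_def)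
        ultimately have "(schur (row_list (Suc l) \<kappa>) :: 'a series) \<in> up (row_list (Suc l) \<kappa>)"
          using less.IH[of "\<kappa> l"] antitone_row_list_up[OF s\<kappa>] by simp
        moreover have "raises (row_list (Suc l) \<kappa>) \<nu>"
        proof -
          have tot: "sum_list (row_list (Suc l) \<kappa>) = sum_list \<nu>"
            using fsize_row_fun[of "row_list (Suc l) \<kappa>"] by (simp add: row_fun_list[OF b\<kappa>] f\<kappa> \<nu>\<theta>)
          have "sum_list (take k \<nu>) \<le> sum_list (take k (row_list (Suc l) \<kappa>))" for k
          proof (cases "k \<le> l")
            case True
            have "sum_list (take k \<nu>) = (\<Sum>i<k. \<nu> ! i)"
              using True \<nu>(1) by (simp add: sum_list_sum_nth atLeast0LessThan)
            also have "\<dots> \<le> (\<Sum>i<k. \<kappa> i)" by (rule sum_mono) (use ge True in auto)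
            finally show ?thesis using True by (simp add: sum_list_take_row_list)
          qed (use tot \<nu>(1) in simp)
          then show ?thesis using tot \<nu>(1) by (simp add: raises_def dominates_def)
        qed
        then have "up (row_list (Suc l) \<kappa>) \<subseteq> (up \<nu> :: 'a series set)"
          unfolding up_def by (intro series.span_mono) (auto intro: raises_trans)
        ultimately show ?thesis by blast
      qed
      have fin: "finite (add_strip (row_fun \<theta>) a)" by (rule finite_add_strip[OF bounded_row_fun])
      have "complete_sym a * (schur \<theta> :: 'a series) = (\<Sum>\<kappa>\<in>add_strip (row_fun \<theta>) a. schur (row_list (Suc l) \<kappa>))"
        using pieri[OF an\<theta>, of a] by (simp add: l\<theta>)
      also have "\<dots> = schur \<nu> + (\<Sum>\<kappa>\<in>add_strip (row_fun \<theta>) a - {row_fun \<nu>}. schur (row_list (Suc l) \<kappa>))"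
        using sum.remove[OF fin mem, of "\<lambda>\<kappa>. schur (row_list (Suc l) \<kappa>)"] \<nu>(1) row_list_fun[of \<nu>] by simp
      finally have "schur \<nu> = complete_sym a * (schur \<theta> :: 'a series) -
          (\<Sum>\<kappa>\<in>add_strip (row_fun \<theta>) a - {row_fun \<nu>}. schur (row_list (Suc l) \<kappa>))" by simp
      moreover have "complete_sym a * (schur \<theta> :: 'a series) \<in> up \<nu>"
        using complete_mult_up_snoc[OF Suc.hyps(1)[OF l\<theta>[symmetric] an\<theta>], of a] by (simp add: \<nu>\<theta>)
      ultimately show "(schur \<nu> :: 'a series) \<in> up \<nu>"
        using other unfolding up_def by (auto intro!: series.span_diff series.span_sum)
    qed
  qed
  then show ?case using Suc by simp
qed

section \<open>Conjugate partitions\<close>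

definition cells :: "nat list \<Rightarrow> (nat \<times> nat) set" where
  "cells \<mu> = {(i, j). i < length \<mu> \<and> j < \<mu> ! i}"

lemma cells_Sigma: "cells \<mu> = (SIGMA i:{..<length \<mu>}. {..<\<mu> ! i})"
  by (auto simp: cells_def)

lemma finite_cells [simp]: "finite (cells \<mu>)"
  by (simp add: cells_Sigma)

lemma cells_inject:
  assumes "0 \<notin> set \<mu>" "0 \<notin> set \<nu>" "cells \<mu> = cells \<nu>"
  shows "\<mu> = \<nu>"
proof (rule nth_equalityI)
  have "{..<length \<mu>} = {i. (i, 0) \<in> cells \<mu>}" if "0 \<notin> set \<mu>" for \<mu>
    using that by (auto simp: cells_def) (metis nth_mem neq0_conv)
  then show len: "length \<mu> = length \<nu>" using assms by (metis lessThan_eq_iff)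
  fix i assume i: "i < length \<mu>"
  have "{..<\<mu> ! i} = {j. (i, j) \<in> cells \<mu>}" "{..<\<nu> ! i} = {j. (i, j) \<in> cells \<nu>}"
    using i len by (auto simp: cells_def)
  then show "\<mu> ! i = \<nu> ! i" using assms(3) by (metis lessThan_eq_iff)
qed

lemma filter_less_iff:
  assumes "sorted_wrt (\<ge>) \<mu>"
  shows "i < length (filter (\<lambda>p. j < p) \<mu>) \<longleftrightarrow> i < length \<mu> \<and> j < (\<mu> ! i :: nat)"
  using assms
proof (induction \<mu> arbitrary: i)
  case (Cons x \<mu>)
  show ?case
  proof (cases "j < x")
    case True
    then show ?thesis using Cons by (cases i) auto
  next
    case False
    then have "filter (\<lambda>p. j < p) (x # \<mu>) = []" using Cons.prems by (auto simp: filter_empty_conv)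
    moreover have "\<not> j < (x # \<mu>) ! i" if "i < length (x # \<mu>)"
    proof -
      have "\<forall>p\<in>set (x # \<mu>). p \<le> x" using Cons.prems by auto
      then have "(x # \<mu>) ! i \<le> x" using nth_mem[OF that] by blast
      then show ?thesis using False by simp
    qed
    ultimately show ?thesis by auto
  qed
qed simp

lemma cells_conjugate:
  assumes "\<mu> \<in> partitions"
  shows "cells (conjugate \<mu>) = prod.swap ` cells \<mu>"
proof -
  have s: "sorted_wrt (\<ge>) \<mu>" using assms by (simp add: partitions_def)
  have "(j, i) \<in> cells (conjugate \<mu>) \<longleftrightarrow> (i, j) \<in> cells \<mu>" for i j
  proof -
    have "j < Max (insert 0 (set \<mu>))" if "i < length \<mu>" "j < \<mu> ! i"
    proof -
      have "\<mu> ! i \<le> Max (insert 0 (set \<mu>))" by (rule Max_ge) (use that in auto)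
      then show ?thesis using that(2) by linarith
    qed
    then show ?thesis using filter_less_iff[OF s] by (auto simp: cells_def conjugate_def)
  qed
  then show ?thesis by (force simp: image_iff)
qed

lemma conjugate_partitions:
  assumes "\<mu> \<in> partitions"
  shows "conjugate \<mu> \<in> partitions"
proof -
  have "length (filter (\<lambda>p. j < p) \<mu>) \<noteq> 0" if "j < Max (insert 0 (set \<mu>))" for j
  proof -
    have "Max (insert 0 (set \<mu>)) \<in> insert 0 (set \<mu>)" by (rule Max_in) auto
    then have "Max (insert 0 (set \<mu>)) \<in> set \<mu>" using that by auto
    then show ?thesis using that by (auto simp: filter_empty_conv)
  qed
  moreover have "length (filter (\<lambda>p. k < p) \<mu>) \<le> length (filter (\<lambda>p. j < p) \<mu>)" if "j \<le> k" for j k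
  proof -
    have "filter (\<lambda>p. k < p) \<mu> = filter (\<lambda>p. k < p) (filter (\<lambda>p. j < p) \<mu>)" using that by (auto intro!: filter_cong)
    then show ?thesis by (metis length_filter_le)
  qed
  ultimately show ?thesis
    by (fastforce simp: partitions_def conjugate_def sorted_wrt_iff_nth_less)
qed

lemma conjugate_conjugate: "\<mu> \<in> partitions \<Longrightarrow> conjugate (conjugate \<mu>) = \<mu>"
proof (rule cells_inject)
  assume "\<mu> \<in> partitions"
  then have c: "conjugate \<mu> \<in> partitions" "conjugate (conjugate \<mu>) \<in> partitions"
    by (simp_all add: conjugate_partitions)
  then show "0 \<notin> set (conjugate (conjugate \<mu>))" "0 \<notin> set \<mu>"
    using \<open>\<mu> \<in> partitions\<close> by (auto simp: partitions_def)
  show "cells (conjugate (conjugate \<mu>)) = cells \<mu>"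
    by (simp add: cells_conjugate c(1) \<open>\<mu> \<in> partitions\<close> image_image)
qed

lemma card_cells: "card (cells \<mu>) = sum_list \<mu>"
  by (simp add: cells_Sigma sum_list_sum_nth atLeast0LessThan)

lemma sum_list_conjugate: "\<mu> \<in> partitions \<Longrightarrow> sum_list (conjugate \<mu>) = sum_list \<mu>"
  unfolding card_cells[symmetric] by (simp add: cells_conjugate card_image)

lemma conjugate_partitions_of: "\<mu> \<in> partitions_of n \<Longrightarrow> conjugate \<mu> \<in> partitions_of n"
  by (simp add: partitions_of_def conjugate_partitions sum_list_conjugate)

text \<open>The first \<open>k\<close> columns hold all cells except the excess of each row beyond
  \<open>k\<close>, which is the truncated difference.\<close>

lemma sum_take_conjugate:
  assumes "\<mu> \<in> partitions"
  shows "sum_list (take k (conjugate \<mu>)) + sum_list (map (\<lambda>p. p - k) \<mu>) = sum_list \<mu>"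
proof -
  have "cells (take k (conjugate \<mu>)) = {c \<in> cells (conjugate \<mu>). fst c < k}"
    by (auto simp: cells_def)
  then have "sum_list (take k (conjugate \<mu>)) = card {c \<in> cells (conjugate \<mu>). fst c < k}"
    by (metis card_cells)
  also have "{c \<in> cells (conjugate \<mu>). fst c < k} = prod.swap ` (SIGMA i:{..<length \<mu>}. {..<min k (\<mu> ! i)})"
    unfolding cells_conjugate[OF assms] by (force simp: cells_def)
  also have "card \<dots> = (\<Sum>i<length \<mu>. min k (\<mu> ! i))" by (simp add: card_image)
  finally have "sum_list (take k (conjugate \<mu>)) + sum_list (map (\<lambda>p. p - k) \<mu>) =
      (\<Sum>i<length \<mu>. min k (\<mu> ! i)) + (\<Sum>i<length \<mu>. \<mu> ! i - k)"
    by (simp add: sum_list_sum_nth atLeast0LessThan)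
  also have "\<dots> = (\<Sum>i<length \<mu>. \<mu> ! i)"
    unfolding sum.distrib[symmetric] by (rule sum.cong) auto
  finally show ?thesis by (simp add: sum_list_sum_nth atLeast0LessThan)
qed

lemma psum_le_excess: "sum_list (take m \<mu>) \<le> sum_list (map (\<lambda>p. p - k) \<mu>) + m * (k :: nat)"
proof (induction \<mu> arbitrary: m)
  case (Cons x \<mu>)
  show ?case
  proof (cases m)
    case (Suc m')
    then show ?thesis using Cons.IH[of m'] by simp
  qed simp
qed simp

text \<open>Equality is attained when \<open>m\<close> is the number of parts exceeding
  \<open>k\<close>.\<close>

lemma psum_eq_excess:
  assumes "sorted_wrt (\<ge>) \<mu>"
  shows "\<exists>m. sum_list (take m \<mu>) = sum_list (map (\<lambda>p. p - k) \<mu>) + m * (k :: nat)"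
  using assms
proof (induction \<mu>)
  case (Cons x \<mu>)
  show ?case
  proof (cases "k < x")
    case True
    obtain m where "sum_list (take m \<mu>) = sum_list (map (\<lambda>p. p - k) \<mu>) + m * k" using Cons by auto
    then have "sum_list (take (Suc m) (x # \<mu>)) = sum_list (map (\<lambda>p. p - k) (x # \<mu>)) + Suc m * k"
      using True by simp
    then show ?thesis by blast
  next
    case False
    then have "\<forall>p\<in>set (x # \<mu>). p - k = 0" using Cons.prems by auto
    then have "sum_list (map (\<lambda>p. p - k) (x # \<mu>)) = 0" by auto
    then have "sum_list (take 0 (x # \<mu>)) = sum_list (map (\<lambda>p. p - k) (x # \<mu>)) + 0 * k" by simp
    then show ?thesis by blast
  qed
qed (auto intro: exI[of _ 0])

text \<open>Conjugation reverses the dominance order, as \<open>\<Sum>\<^sub>i max (\<mu>\<^sub>i - k) 0\<close> is the maximum over \<open>m\<close>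
  of \<open>\<mu>\<^sub>1 + \<dots> + \<mu>\<^sub>m - m k\<close>.\<close>

lemma dominates_conjugate:
  assumes "\<theta> \<in> partitions" "\<mu> \<in> partitions" "dominates \<theta> \<mu>"
  shows "dominates (conjugate \<mu>) (conjugate \<theta>)"
proof -
  have tot: "sum_list \<theta> = sum_list \<mu>" using assms(3) by (simp add: dominates_def)
  have "sum_list (take k (conjugate \<theta>)) \<le> sum_list (take k (conjugate \<mu>))" for k
  proof -
    obtain m where "sum_list (take m \<mu>) = sum_list (map (\<lambda>p. p - k) \<mu>) + m * k"
      using psum_eq_excess assms(2) by (auto simp: partitions_def)
    moreover have "sum_list (take m \<mu>) \<le> sum_list (take m \<theta>)" using assms(3) by (simp add: dominates_def)
    ultimately have "sum_list (map (\<lambda>p. p - k) \<mu>) \<le> sum_list (map (\<lambda>p. p - k) \<theta>)"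
      using psum_le_excess[of m \<theta> k] by simp
    then show ?thesis using sum_take_conjugate[OF assms(1), of k] sum_take_conjugate[OF assms(2), of k] tot by simp
  qed
  then show ?thesis using assms tot by (simp add: dominates_def sum_list_conjugate)
qed

text \<open>Without zeros the partial sums also determine the length, as they stop growing exactly
  at the end of the list.\<close>

lemma dominates_antisym:
  assumes "0 \<notin> set \<alpha>" "0 \<notin> set \<beta>" "dominates \<alpha> \<beta>" "dominates \<beta> \<alpha>"
  shows "\<alpha> = \<beta>"
proof -
  have "sum_list (take k \<alpha>) = sum_list (take k \<beta>)" for k
    using assms(3,4) by (simp add: dominates_def le_antisym)
  then show ?thesis using assms(1,2)
  proof (induction \<alpha> arbitrary: \<beta>)
    case Nil
    then show ?case using Nil(1)[of "length \<beta>"] by (cases \<beta>) auto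
  next
    case (Cons x \<alpha>)
    obtain y \<beta>' where \<beta>: "\<beta> = y # \<beta>'" using Cons.prems(1)[of "length (x # \<alpha>)"] Cons.prems(2) by (cases \<beta>) auto
    have "x = y" using Cons.prems(1)[of 1] \<beta> by simp
    moreover have "sum_list (take k \<alpha>) = sum_list (take k \<beta>')" for k
      using Cons.prems(1)[of "Suc k"] \<beta> \<open>x = y\<close> by simp
    ultimately show ?case using Cons.IH[of \<beta>'] Cons.prems \<beta> by simp
  qed
qed

lemma dominates_trans: "dominates \<gamma> \<beta> \<Longrightarrow> dominates \<beta> \<alpha> \<Longrightarrow> dominates \<gamma> \<alpha>"
  by (auto simp: dominates_def intro: order_trans)

section \<open>Sorting compositions into partitions\<close>

definition sort_part :: "nat list \<Rightarrow> nat list" where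
  "sort_part \<beta> = rev (sorted_list_of_multiset (filter_mset (\<lambda>x. x \<noteq> 0) (mset \<beta>)))"

lemma sort_part_partitions: "sort_part \<beta> \<in> partitions"
  unfolding sort_part_def by (rule partition_of_mset) simp

lemma mset_sort_part: "mset (sort_part \<beta>) = filter_mset (\<lambda>x. x \<noteq> 0) (mset \<beta>)"
  unfolding sort_part_def by simp

lemma sum_mset_filter_nonzero: "sum_mset (filter_mset (\<lambda>x. x \<noteq> 0) A) = (sum_mset A :: nat)"
  by (induction A) auto

lemma sum_sort_part: "sum_list (sort_part \<beta>) = sum_list \<beta>"
  by (metis mset_sort_part sum_mset_filter_nonzero sum_mset_sum_list)

lemma sum_submultiset_le:
  assumes "sorted_wrt (\<ge>) \<mu>" "A \<subseteq># mset \<mu>" "size A \<le> k"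
  shows "sum_mset A \<le> sum_list (take k \<mu> :: nat list)"
  using assms
proof (induction \<mu> arbitrary: A k)
  case (Cons x \<mu>)
  show ?case
  proof (cases "A = {#}")
    case False
    \<comment> \<open>Choosing \<open>x\<close> itself whenever it occurs in \<open>A\<close> keeps
      the rest of \<open>A\<close> inside the tail. Otherwise any element is at most
      \<open>x\<close>, and all of \<open>A\<close> lies in the tail.\<close>
    define y where "y = (if x \<in># A then x else (SOME y. y \<in># A))"
    have "\<exists>y. y \<in># A" using False by blast
    then have y: "y \<in># A" by (auto simp: y_def intro: someI_ex)
    define B where "B = A - {#y#}"
    have A: "A = add_mset y B" using y by (simp add: B_def)
    have "y \<le> x" using mset_subset_eqD[OF Cons.prems(2) y] Cons.prems(1) by auto
    moreover have "B \<subseteq># mset \<mu>"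
    proof (cases "x \<in># A")
      case True
      then have "y = x" by (simp add: y_def)
      then have "add_mset x B \<subseteq># add_mset x (mset \<mu>)" using Cons.prems(2) A by simp
      then show ?thesis by simp
    next
      case False
      have "A - {#x#} \<subseteq># mset \<mu>"
        by (rule subset_eq_diff_conv[THEN iffD2]) (use Cons.prems(2) in simp)
      moreover have "A - {#x#} = A" using False by simp
      ultimately have "A \<subseteq># mset \<mu>" by metis
      moreover have "B \<subseteq># A" unfolding B_def by (rule diff_subset_eq_self)
      ultimately show ?thesis by (metis subset_mset.order_trans)
    qed
    moreover obtain k' where "k = Suc k'" using Cons.prems(3) A by (cases k) auto
    ultimately show ?thesis using Cons.IH[of B k'] Cons.prems A by (simp add: add_mono)
  qed simp
qed simp

lemma sort_part_dominates: "dominates (sort_part \<beta>) \<beta>"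
proof -
  have "sum_list (take k \<beta>) \<le> sum_list (take k (sort_part \<beta>))" for k
  proof -
    define A where "A = filter_mset (\<lambda>x. x \<noteq> 0) (mset (take k \<beta>))"
    have "sum_list (take k \<beta>) = sum_mset A"
      unfolding A_def sum_mset_filter_nonzero by (simp add: sum_mset_sum_list)
    also have "\<dots> \<le> sum_list (take k (sort_part \<beta>))"
    proof (rule sum_submultiset_le)
      show "sorted_wrt (\<ge>) (sort_part \<beta>)" using sort_part_partitions[of \<beta>] by (simp add: partitions_def)
      have "mset (take k \<beta>) \<subseteq># mset \<beta>" by (metis append_take_drop_id mset_append mset_subset_eq_add_left)
      then show "A \<subseteq># mset (sort_part \<beta>)" by (simp add: A_def mset_sort_part multiset_filter_mono)
      have "size A \<le> size (mset (take k \<beta>))" unfolding A_def by (rule size_filter_mset_lesseq)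
      then show "size A \<le> k" by simp
    qed
    finally show ?thesis .
  qed
  then show ?thesis by (simp add: dominates_def sum_sort_part)
qed

lemma complete_prod_sort_part: "complete_prod (sort_part \<beta>) = complete_prod \<beta>"
proof -
  have "prod_mset (image_mset complete_sym (filter_mset (\<lambda>x. x \<noteq> 0) A)) = (prod_mset (image_mset complete_sym A) :: 'a series)" for A
    by (induction A) auto
  then show ?thesis
    unfolding complete_prod_def prod_mset_prod_list[symmetric] mset_map mset_sort_part .
qed

text \<open>If sorting led back to \<open>\<mu>\<close>, then \<mu> and \<beta> would dominate each
  other at equal length and coincide.\<close>

lemma sort_part_strict:
  assumes "raises \<beta> \<mu>" "\<beta> \<noteq> \<mu>" "\<mu> \<in> partitions"
  shows "dominates (sort_part \<beta>) \<mu>" "sort_part \<beta> \<noteq> \<mu>"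
proof -
  have d: "dominates \<beta> \<mu>" "length \<beta> = length \<mu>" using assms(1) by (auto simp: raises_def)
  show "dominates (sort_part \<beta>) \<mu>" using sort_part_dominates d(1) by (rule dominates_trans)
  show "sort_part \<beta> \<noteq> \<mu>"
  proof
    assume "sort_part \<beta> = \<mu>"
    then have "raises \<mu> \<beta>" using sort_part_dominates[of \<beta>] d(2) by (simp add: raises_def)
    then show False using raises_antisym[OF assms(1)] assms(2) by simp
  qed
qed

section \<open>Eigenvectors\<close>

definition linear_on_sym :: "('a::field series \<Rightarrow> 'a series) \<Rightarrow> bool" where
  "linear_on_sym D \<longleftrightarrow> (\<forall>f\<in>sym_funs. \<forall>g\<in>sym_funs. D (f + g) = D f + D g) \<and>
     (\<forall>f\<in>sym_funs. \<forall>c. D (scale c f) = scale c (D f))"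

lemma linear_on_symD:
  assumes "linear_on_sym D"
  shows "f \<in> sym_funs \<Longrightarrow> g \<in> sym_funs \<Longrightarrow> D (f + g) = D f + D g"
    "f \<in> sym_funs \<Longrightarrow> D (scale c f) = scale c (D f)" "D 0 = 0"
proof -
  show "D 0 = 0" using assms unfolding linear_on_sym_def by (metis scale_zero_ring sym_funs_zero)
qed (use assms in \<open>auto simp: linear_on_sym_def\<close>)

lemma linear_on_sym_sum:
  assumes "linear_on_sym D" "\<And>x. x \<in> A \<Longrightarrow> f x \<in> sym_funs"
  shows "D (sum f A) = (\<Sum>x\<in>A. D (f x))"
  using assms(2)
  by (induction A rule: infinite_finite_induct)
    (simp_all add: linear_on_symD[OF assms(1)] sym_funs_sum)

lemma linear_on_sym_vertex_op: "linear_on_sym (vertex_op a g)"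
  by (simp add: linear_on_sym_def vertex_op_add vertex_op_scale)

definition eigvec :: "('a::field series \<Rightarrow> 'a series) \<Rightarrow> 'a \<Rightarrow> 'a series \<Rightarrow> bool" where
  "eigvec D c f \<longleftrightarrow> f \<in> sym_funs \<and> D f = scale c f"

lemma eigvec_zero: "linear_on_sym D \<Longrightarrow> eigvec D c 0"
  by (simp add: eigvec_def linear_on_symD)

lemma eigvec_add: "linear_on_sym D \<Longrightarrow> eigvec D c f \<Longrightarrow> eigvec D c g \<Longrightarrow> eigvec D c (f + g)"
  by (simp add: eigvec_def linear_on_symD sym_funs_add series.scale_right_distrib)

lemma eigvec_scale: "linear_on_sym D \<Longrightarrow> eigvec D c f \<Longrightarrow> eigvec D c (scale d f)"
  by (simp add: eigvec_def linear_on_symD mult.commute)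

text \<open>Subtracting \<open>ev m\<close> times the relation from its image under \<open>D\<close>
  removes the vector at \<open>m\<close> and rescales the others by the nonzero
  \<open>ev s - ev m\<close>.\<close>

lemma eigvec_independent:
  assumes D: "linear_on_sym D" and "finite S" "inj_on ev S"
    and "\<And>s. s \<in> S \<Longrightarrow> eigvec D (ev s) (x s)" "(\<Sum>s\<in>S. x s) = 0"
  shows "\<forall>s\<in>S. x s = 0"
  using assms(2-)
proof (induction S arbitrary: x)
  case (insert m S)
  have sym: "x s \<in> sym_funs" and Dx: "D (x s) = scale (ev s) (x s)" if "s \<in> insert m S" for s
    using insert.prems(2)[OF that] by (auto simp: eigvec_def)
  have "0 = D (\<Sum>s\<in>insert m S. x s)" using insert.prems(3) linear_on_symD(3)[OF D] by metis
  also have "\<dots> = (\<Sum>s\<in>insert m S. scale (ev s) (x s))"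
    using linear_on_sym_sum[OF D, of "insert m S" x] sym Dx by simp
  finally have "0 = (\<Sum>s\<in>insert m S. scale (ev s) (x s)) - scale (ev m) (\<Sum>s\<in>insert m S. x s)"
    using insert.prems(3) by (metis diff_zero series.scale_zero_right)
  also have "\<dots> = (\<Sum>s\<in>insert m S. scale (ev s - ev m) (x s))"
    unfolding series.scale_sum_right sum_subtractf[symmetric] by (simp add: series.scale_left_diff_distrib)
  also have "\<dots> = (\<Sum>s\<in>S. scale (ev s - ev m) (x s))" using insert.hyps by simp
  finally have "(\<Sum>s\<in>S. scale (ev s - ev m) (x s)) = 0" by simp
  moreover have "inj_on ev S" using insert.prems(1) by (simp add: inj_on_def)
  moreover have "eigvec D (ev s) (scale (ev s - ev m) (x s))" if "s \<in> S" for s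
    using insert.prems(2) that eigvec_scale[OF D] by blast
  ultimately have "\<forall>s\<in>S. scale (ev s - ev m) (x s) = 0" by (intro insert.IH)
  moreover have "ev s - ev m \<noteq> 0" if "s \<in> S" for s
    using insert.prems(1) insert.hyps(2) that by (auto simp: inj_on_def)
  ultimately have z: "\<forall>s\<in>S. x s = 0" by simp
  then have "x m = 0" using insert.prems(3) insert.hyps by simp
  then show ?case using z by simp
qed simp

definition eigsum :: "('a::field series \<Rightarrow> 'a series) \<Rightarrow> ('i \<Rightarrow> 'a) \<Rightarrow> 'i set \<Rightarrow> 'a series set" where
  "eigsum D ev S = {f. \<exists>x. (\<forall>s\<in>S. eigvec D (ev s) (x s)) \<and> f = (\<Sum>s\<in>S. x s)}"

lemma subspace_eigsum:
  assumes D: "linear_on_sym D"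
  shows "series.subspace (eigsum D ev S)"
proof (rule series.subspaceI)
  show "0 \<in> eigsum D ev S"
    using eigvec_zero[OF D] by (auto simp: eigsum_def intro!: exI[of _ "\<lambda>_. 0"])
next
  fix f g assume "f \<in> eigsum D ev S" "g \<in> eigsum D ev S"
  then obtain x y where "\<forall>s\<in>S. eigvec D (ev s) (x s)" "f = (\<Sum>s\<in>S. x s)"
    "\<forall>s\<in>S. eigvec D (ev s) (y s)" "g = (\<Sum>s\<in>S. y s)" by (auto simp: eigsum_def)
  then show "f + g \<in> eigsum D ev S"
    using eigvec_add[OF D] by (auto simp: eigsum_def sum.distrib intro!: exI[of _ "\<lambda>s. x s + y s"])
next
  fix c f assume "f \<in> eigsum D ev S"
  then obtain x where "\<forall>s\<in>S. eigvec D (ev s) (x s)" "f = (\<Sum>s\<in>S. x s)" by (auto simp: eigsum_def)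
  then show "scale c f \<in> eigsum D ev S"
    using eigvec_scale[OF D] by (auto simp: eigsum_def series.scale_sum_right intro!: exI[of _ "\<lambda>s. scale c (x s)"])
qed

lemma eigsum_mono:
  assumes D: "linear_on_sym D" and "finite T" "S \<subseteq> T"
  shows "eigsum D ev S \<subseteq> eigsum D ev T"
proof
  fix f assume "f \<in> eigsum D ev S"
  then obtain x where x: "\<forall>s\<in>S. eigvec D (ev s) (x s)" "f = (\<Sum>s\<in>S. x s)" by (auto simp: eigsum_def)
  have "f = (\<Sum>s\<in>T. if s \<in> S then x s else 0)"
    using assms(2,3) x(2) by (simp add: sum.If_cases Int_absorb1)
  then show "f \<in> eigsum D ev T"
    using x(1) eigvec_zero[OF D] by (auto simp: eigsum_def intro!: exI[of _ "\<lambda>s. if s \<in> S then x s else 0"])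
qed

lemma linear_on_sym_macdonald_op_conj: "linear_on_sym (macdonald_op_conj u v)"
  unfolding macdonald_op_conj_def by (rule linear_on_sym_vertex_op)

lemma linear_on_sym_macdonald_op: "linear_on_sym (macdonald_op u v)"
  unfolding macdonald_op_def by (rule linear_on_sym_vertex_op)

text \<open>The excess of \<open>D f\<close> over \<open>ev m\<close> times \<open>f\<close> lies in
  other eigenspaces, where \<open>D\<close> minus \<open>ev m\<close> can be inverted. Subtracting
  the preimage from \<open>f\<close> leaves an eigenvector for \<open>ev m\<close>.\<close>

lemma eigsum_extend:
  assumes D: "linear_on_sym D" and "finite S" "m \<notin> S" "\<And>s. s \<in> S \<Longrightarrow> ev s \<noteq> ev m"
    and f: "f \<in> sym_funs" "D f - scale (ev m) f \<in> eigsum D ev S"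
  shows "f \<in> eigsum D ev (insert m S)"
proof -
  obtain y where y: "\<And>s. s \<in> S \<Longrightarrow> eigvec D (ev s) (y s)" "D f - scale (ev m) f = (\<Sum>s\<in>S. y s)"
    using f(2) by (auto simp: eigsum_def)
  define x where "x s = scale (1 / (ev s - ev m)) (y s)" for s
  have x: "eigvec D (ev s) (x s)" if "s \<in> S" for s
    unfolding x_def using y(1)[OF that] by (rule eigvec_scale[OF D])
  then have xs: "x s \<in> sym_funs" "D (x s) = scale (ev s) (x s)" if "s \<in> S" for s
    using that by (auto simp: eigvec_def)
  have y_eq: "y s = scale (ev s - ev m) (x s)" if "s \<in> S" for s
    using assms(4)[OF that] by (simp add: x_def)
  define w where "w = f - (\<Sum>s\<in>S. x s)"
  have sx: "(\<Sum>s\<in>S. x s) \<in> sym_funs" using xs by (intro sym_funs_sum)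
  have weq: "w = f + scale (- 1) (\<Sum>s\<in>S. x s)" by (simp add: w_def)
  have "w \<in> sym_funs" using f sx by (simp only: weq sym_funs_add sym_funs_scale)
  moreover have "D w = scale (ev m) w"
  proof -
    have "D w = D f - D (\<Sum>s\<in>S. x s)"
      unfolding weq
      using linear_on_symD(1)[OF D f(1) sym_funs_scale[OF sx, of "- 1"]] linear_on_symD(2)[OF D sx, of "- 1"] by simp
    also have "D (\<Sum>s\<in>S. x s) = (\<Sum>s\<in>S. scale (ev s) (x s))"
      using linear_on_sym_sum[OF D, of S x] xs by simp
    also have "D f = scale (ev m) f + (\<Sum>s\<in>S. scale (ev s - ev m) (x s))"
      using y(2) y_eq by (simp add: algebra_simps)
    also have "\<dots> - (\<Sum>s\<in>S. scale (ev s) (x s)) = scale (ev m) f - scale (ev m) (\<Sum>s\<in>S. x s)"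
      by (simp add: series.scale_left_diff_distrib sum_subtractf series.scale_sum_right)
    finally show ?thesis by (simp add: w_def series.scale_right_diff_distrib)
  qed
  ultimately have "eigvec D (ev m) w" by (simp add: eigvec_def)
  moreover have "f = (\<Sum>s\<in>insert m S. if s = m then w else x s)"
  proof -
    have "(\<Sum>s\<in>S. if s = m then w else x s) = (\<Sum>s\<in>S. x s)"
      using assms(3) by (intro sum.cong) auto
    then show ?thesis using assms(2,3) by (simp add: w_def)
  qed
  ultimately show ?thesis
    using x by (auto simp: eigsum_def intro!: exI[of _ "\<lambda>s. if s = m then w else x s"])
qed

text \<open>Induction on the number of partitions dominating \<mu>. Sorting a strictly raised
  composition does not change its h-product and gives a partition strictly above \<mu>; as
  eigenvalues are distinct, \<open>eigsum_extend\<close> applies.\<close>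

lemma complete_prod_eigsum:
  fixes u v :: "'a::field_char_0"
  assumes inj: "inj_on (eigval u v) (partitions_of n)" and "\<mu> \<in> partitions_of n"
  shows "complete_prod \<mu> \<in> eigsum (macdonald_op_conj u v) (eigval u v) {\<kappa> \<in> partitions_of n. dominates \<kappa> \<mu>}"
  using assms(2)
proof (induction "card {\<kappa> \<in> partitions_of n. dominates \<kappa> \<mu>}" arbitrary: \<mu> rule: less_induct)
  case less
  let ?up = "\<lambda>\<mu>. {\<kappa> \<in> partitions_of n. dominates \<kappa> \<mu>}"
  let ?D = "macdonald_op_conj u v :: 'a series \<Rightarrow> _"
  have \<mu>: "\<mu> \<in> partitions" "0 \<notin> set \<mu>" "sum_list \<mu> = n" using less.prems by (auto simp: partitions_of_def partitions_def)
  define S where "S = ?up \<mu> - {\<mu>}"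
  have finS: "finite S" by (simp add: S_def)
  have "strict_up \<mu> \<subseteq> eigsum ?D (eigval u v) S"
    unfolding strict_up_def
  proof (rule series.span_minimal[OF _ subspace_eigsum[OF linear_on_sym_macdonald_op_conj]], safe)
    fix \<beta> assume \<beta>: "raises \<beta> \<mu>" "\<beta> \<noteq> \<mu>"
    define \<kappa> where "\<kappa> = sort_part \<beta>"
    have \<kappa>: "dominates \<kappa> \<mu>" "\<kappa> \<noteq> \<mu>" unfolding \<kappa>_def using sort_part_strict[OF \<beta> \<mu>(1)] by auto
    have \<kappa>n: "\<kappa> \<in> partitions_of n"
      using \<kappa>(1) \<mu>(3) sort_part_partitions by (auto simp: partitions_of_def dominates_def \<kappa>_def)
    have nd: "\<not> dominates \<mu> \<kappa>"
      using dominates_antisym[of \<mu> \<kappa>] \<kappa> \<mu>(2) \<kappa>n by (auto simp: partitions_of_def partitions_def)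
    then have sub: "?up \<kappa> \<subseteq> S" using \<kappa>(1) dominates_trans by (auto simp: S_def)
    have "\<mu> \<in> ?up \<mu>" using less.prems by (simp add: dominates_def)
    then have "?up \<kappa> \<subset> ?up \<mu>" using sub by (auto simp: S_def)
    then have "card (?up \<kappa>) < card (?up \<mu>)" by (intro psubset_card_mono) simp_all
    then have "complete_prod \<kappa> \<in> eigsum ?D (eigval u v) (?up \<kappa>)" using less.hyps \<kappa>n by blast
    then show "complete_prod \<beta> \<in> eigsum ?D (eigval u v) S"
      using eigsum_mono[OF linear_on_sym_macdonald_op_conj finS sub] by (auto simp: \<kappa>_def complete_prod_sort_part)
  qed
  then have "?D (complete_prod \<mu>) - scale (eigval u v \<mu>) (complete_prod \<mu>) \<in> eigsum ?D (eigval u v) S"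
    using macdonald_op_conj_triangular by blast
  moreover have "eigval u v s \<noteq> eigval u v \<mu>" if "s \<in> S" for s
    using inj less.prems that by (auto simp: S_def inj_on_def)
  ultimately have "complete_prod \<mu> \<in> eigsum ?D (eigval u v) (insert \<mu> S)"
    using complete_prod_sym finS by (intro eigsum_extend[OF linear_on_sym_macdonald_op_conj]) (auto simp: S_def)
  moreover have "insert \<mu> S = ?up \<mu>" using less.prems by (auto simp: S_def dominates_def)
  ultimately show ?case by simp
qed

lemma macdonald_op_sym:
  assumes "f \<in> sym_funs"
  shows "macdonald_op u v f \<in> sym_funs"
  unfolding macdonald_op_def vertex_op_def
  using coeff_add_var_pleth[of "\<lambda>k. (1 - u ^ k) * (1 - v ^ k)" u "\<lambda>k. 1 - v ^ k" f] assms
  by (auto intro!: sym_funs_sum sym_funs_mult sign_elem_sym)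

text \<open>When \<open>u\<close> is not a root of unity the substitution of X(1 - u) is invertible
  on symmetric functions, so eigenvectors of the conjugate operator pull back.\<close>

lemma eigsum_macdonald_op:
  fixes u v :: "'a::field_char_0"
  assumes u: "\<And>k. k > 0 \<Longrightarrow> u ^ k \<noteq> 1" and f: "f \<in> sym_funs"
    and "pleth_one_minus u f \<in> eigsum (macdonald_op_conj u v) ev S"
  shows "f \<in> eigsum (macdonald_op u v) ev S"
proof -
  let ?Q = "pleth_one_minus u :: 'a series \<Rightarrow> _"
  let ?R = "dilate (\<lambda>k. 1 / (1 - u ^ k)) :: 'a series \<Rightarrow> _"
  have RQ: "?R (?Q g) = g" and QR: "?Q (?R g) = g" if "g \<in> sym_funs" for g
    unfolding pleth_one_minus_dilate using that u by (auto intro!: dilate_inverse)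
  obtain x where x: "\<And>s. s \<in> S \<Longrightarrow> eigvec (macdonald_op_conj u v) (ev s) (x s)" "?Q f = (\<Sum>s\<in>S. x s)"
    using assms(3) by (auto simp: eigsum_def)
  have lin: "linear_on_sym ?R" by (simp add: linear_on_sym_def dilate_add dilate_scale)
  have "f = (\<Sum>s\<in>S. ?R (x s))"
    using RQ[OF f] linear_on_sym_sum[OF lin, of S x] x by (simp add: eigvec_def)
  moreover have "eigvec (macdonald_op u v) (ev s) (?R (x s))" if "s \<in> S" for s
  proof -
    have xs: "x s \<in> sym_funs" "macdonald_op_conj u v (x s) = scale (ev s) (x s)" using x(1)[OF that] by (auto simp: eigvec_def)
    have Rx: "?R (x s) \<in> sym_funs" by (rule dilate_sym[OF xs(1)])
    have "macdonald_op u v (?R (x s)) = ?R (?Q (macdonald_op u v (?R (x s))))" using RQ macdonald_op_sym[OF Rx] by simp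
    also have "?Q (macdonald_op u v (?R (x s))) = scale (ev s) (x s)" using pleth_macdonald_op[OF Rx] QR[OF xs(1)] xs(2) by simp
    finally show ?thesis using Rx xs(1) by (simp add: eigvec_def dilate_scale)
  qed
  ultimately show ?thesis unfolding eigsum_def by (intro CollectI exI[of _ "\<lambda>s. ?R (x s)"]) simp
qed

lemma pleth_inverse_homog:
  fixes u :: "'a::field_char_0"
  assumes "\<And>k. k > 0 \<Longrightarrow> u ^ k \<noteq> 1" "f \<in> sym_funs" "pleth_one_minus u f \<in> homog n"
  shows "f \<in> homog n"
proof -
  have "dilate (\<lambda>k. 1 / (1 - u ^ k)) (pleth_one_minus u f) = f"
    unfolding pleth_one_minus_dilate using assms(1,2) by (auto intro!: dilate_inverse)
  then show ?thesis using dilate_homog[OF assms(3)] by metis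
qed

lemma antitone_partitions: "\<nu> \<in> partitions \<Longrightarrow> antitone_list \<nu>"
  by (auto simp: partitions_def antitone_list_def sorted_wrt_iff_nth_less)

text \<open>Translates the Schur spans of the characterization into eigenspaces: s_\<nu> is a
  combination of h-products raised from \<nu>, and each of these decomposes into eigenvectors
  indexed by partitions above \<mu>. Homogeneity is recorded to obtain the degree of
  H_\<mu>.\<close>

lemma schur_span_subset:
  fixes u v :: "'a::field_char_0"
  assumes "inj_on (eigval u v) (partitions_of n)" "sum_list \<mu> = n"
  shows "series.span (schur ` {\<nu> \<in> partitions. dominates \<nu> \<mu>}) \<subseteq>
    eigsum (macdonald_op_conj u v) (eigval u v) {\<kappa> \<in> partitions_of n. dominates \<kappa> \<mu>} \<inter> homog n"
proof (rule series.span_minimal, safe)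
  fix \<nu> assume \<nu>: "\<nu> \<in> partitions" "dominates \<nu> \<mu>"
  have "(schur \<nu> :: 'a series) \<in> up \<nu>" by (rule schur_up[OF antitone_partitions[OF \<nu>(1)]])
  moreover have "up \<nu> \<subseteq> eigsum (macdonald_op_conj u v) (eigval u v) {\<kappa> \<in> partitions_of n. dominates \<kappa> \<mu>} \<inter> homog n"
    unfolding up_def
  proof (rule series.span_minimal, safe)
    fix \<beta> assume "raises \<beta> \<nu>"
    then have "dominates \<beta> \<mu>" using \<nu>(2) dominates_trans by (auto simp: raises_def)
    then have sp: "sort_part \<beta> \<in> partitions_of n" "dominates (sort_part \<beta>) \<mu>"
      using assms(2) sort_part_partitions dominates_trans[OF sort_part_dominates \<open>dominates \<beta> \<mu>\<close>] \<open>dominates \<beta> \<mu>\<close>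
      by (simp_all add: partitions_of_def sum_sort_part dominates_def)
    have "complete_prod (sort_part \<beta>) \<in> eigsum (macdonald_op_conj u v) (eigval u v) {\<kappa> \<in> partitions_of n. dominates \<kappa> (sort_part \<beta>)}"
      by (rule complete_prod_eigsum[OF assms(1) sp(1)])
    moreover have "eigsum (macdonald_op_conj u v) (eigval u v) {\<kappa> \<in> partitions_of n. dominates \<kappa> (sort_part \<beta>)} \<subseteq>
        eigsum (macdonald_op_conj u v) (eigval u v) {\<kappa> \<in> partitions_of n. dominates \<kappa> \<mu>}"
      using sp(2) dominates_trans by (intro eigsum_mono linear_on_sym_macdonald_op_conj) auto
    ultimately show "complete_prod \<beta> \<in> eigsum (macdonald_op_conj u v) (eigval u v) {\<kappa> \<in> partitions_of n. dominates \<kappa> \<mu>}"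
      by (auto simp: complete_prod_sort_part)
    show "complete_prod \<beta> \<in> homog n"
      using complete_prod_homog[of \<beta>] \<open>dominates \<beta> \<mu>\<close> assms(2) by (simp add: dominates_def)
  qed (intro series.subspace_inter subspace_eigsum linear_on_sym_macdonald_op_conj subspace_homog)
  ultimately show "(schur \<nu> :: 'a series) \<in> eigsum (macdonald_op_conj u v) (eigval u v) {\<kappa> \<in> partitions_of n. dominates \<kappa> \<mu>}"
    "(schur \<nu> :: 'a series) \<in> homog n" by auto
qed (intro series.subspace_inter subspace_eigsum linear_on_sym_macdonald_op_conj subspace_homog)

section \<open>The eigenvalues as sums over cells\<close>

definition B_sum :: "'a::comm_ring_1 \<Rightarrow> 'a \<Rightarrow> nat list \<Rightarrow> 'a" where
  "B_sum u v \<mu> = (\<Sum>(i, j)\<in>cells \<mu>. u ^ j * v ^ i)"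

lemma B_sum_Cons: "B_sum u v (a # \<mu>) = (\<Sum>j<a. u ^ j) + v * B_sum u v \<mu>"
proof -
  have "B_sum u v \<mu> = (\<Sum>i<length \<mu>. \<Sum>j<\<mu> ! i. u ^ j * v ^ i)" for \<mu>
    unfolding B_sum_def cells_Sigma by (simp add: sum.Sigma)
  then show ?thesis
    by (simp add: sum.lessThan_Suc_shift sum_distrib_left mult_ac del: sum.lessThan_Suc)
qed

text \<open>In each row, 1 - u times the geometric sum over its cells is 1 - u^a.\<close>

lemma eigval_B_sum: "eigval u v \<mu> = 1 - (1 - u) * (1 - v) * B_sum u v \<mu>"
proof (induction \<mu>)
  case Nil
  then show ?case by (simp add: B_sum_def cells_def)
next
  case (Cons a \<mu>)
  have "(1 - u) * (1 - v) * B_sum u v (a # \<mu>) =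
      (1 - v) * ((1 - u) * (\<Sum>j<a. u ^ j)) + v * ((1 - u) * (1 - v) * B_sum u v \<mu>)"
    unfolding B_sum_Cons by (simp only: distrib_left mult_ac)
  also have "(1 - u) * (\<Sum>j<a. u ^ j) = 1 - u ^ a" by (simp add: one_diff_power_eq)
  also have "(1 - u) * (1 - v) * B_sum u v \<mu> = 1 - eigval u v \<mu>" using Cons.IH by simp
  finally have "(1 - u) * (1 - v) * B_sum u v (a # \<mu>) = (1 - v) * (1 - u ^ a) + v * (1 - eigval u v \<mu>)" .
  then show ?case by (simp only: eigval.simps) (simp add: algebra_simps)
qed

lemma B_sum_conjugate:
  assumes "\<mu> \<in> partitions"
  shows "B_sum u v (conjugate \<mu>) = B_sum v u \<mu>"
proof -
  have "B_sum u v (conjugate \<mu>) = (\<Sum>c\<in>cells \<mu>. u ^ fst c * v ^ snd c)"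
    unfolding B_sum_def cells_conjugate[OF assms]
    by (subst sum.reindex) (auto simp: case_prod_beta)
  then show ?thesis by (simp add: B_sum_def case_prod_beta mult.commute)
qed

section \<open>The modified Macdonald polynomials as eigenvectors\<close>

lemma Fract_one_mult: "Fract a 1 * Fract b 1 = Fract (a * b) (1 :: 'a::idom)"
  by simp

lemma Fract_one_power: "Fract a 1 ^ n = Fract (a ^ n) (1 :: 'a::idom)"
  by (induction n) (simp_all add: One_fract_def)

lemma Fract_one_sum: "(\<Sum>x\<in>A. Fract (f x) (1 :: 'a::idom)) = Fract (sum f A) 1"
  by (induction A rule: infinite_finite_induct) (simp_all add: Zero_fract_def)

lemma X_monom: "[:0, 1 :: 'a::comm_semiring_1:] = monom 1 (Suc 0)"
  by (simp add: monom_altdef)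

lemma qv_tv_power: "qv ^ j * tv ^ i = Fract (monom (monom 1 j) i) 1"
proof -
  have q: "qv = Fract (monom (monom 1 (Suc 0)) 0) 1" by (simp add: qv_def X_monom monom_0)
  have t: "tv = Fract (monom 1 (Suc 0)) 1" by (simp add: tv_def X_monom)
  show ?thesis
    unfolding q t Fract_one_power monom_power Fract_one_mult mult_monom by simp
qed

lemma Fract_monom_neq_1:
  assumes "j > 0 \<or> i > 0"
  shows "Fract (monom (monom 1 j) i :: rat poly poly) 1 \<noteq> 1"
proof
  assume "Fract (monom (monom 1 j) i :: rat poly poly) 1 = 1"
  then have "monom (monom 1 j) i = (1 :: rat poly poly)" by (simp add: One_fract_def eq_fract)
  then have "coeff (coeff (monom (monom 1 j) i :: rat poly poly) 0) 0 = coeff (coeff 1 0) 0" by simp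
  then show False using assms by (auto split: if_splits)
qed

lemma qv_power_neq_1: "k > 0 \<Longrightarrow> qv ^ k \<noteq> 1"
  using qv_tv_power[of k 0] Fract_monom_neq_1[of k 0] by simp

lemma tv_power_neq_1: "k > 0 \<Longrightarrow> tv ^ k \<noteq> 1"
  using qv_tv_power[of 0 k] Fract_monom_neq_1[of 0 k] by simp

text \<open>As a polynomial in q and t, B_\<mu> has coefficient 1 at q^j t^i exactly for the cells
  (i, j), so it determines the diagram.\<close>

lemma B_sum_inj: "inj_on (B_sum qv tv) partitions"
proof (rule inj_onI)
  fix \<mu> \<nu> assume *: "\<mu> \<in> partitions" "\<nu> \<in> partitions" "B_sum qv tv \<mu> = B_sum qv tv \<nu>"
  define P where "P \<mu> = (\<Sum>(i, j)\<in>cells \<mu>. monom (monom 1 j) i :: rat poly poly)" for \<mu>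
  have B: "B_sum qv tv \<mu> = Fract (P \<mu>) 1" for \<mu>
    unfolding B_sum_def P_def qv_tv_power by (simp add: case_prod_beta Fract_one_sum)
  then have "P \<mu> = P \<nu>" using *(3) by (simp add: eq_fract)
  have c: "coeff (coeff (P \<mu>) i) j = (if (i, j) \<in> cells \<mu> then 1 else 0)" for \<mu> i j
  proof -
    have "coeff (coeff (P \<mu>) i) j = (\<Sum>c\<in>cells \<mu>. if c = (i, j) then 1 else 0)"
      unfolding P_def case_prod_beta coeff_sum by (rule sum.cong) (auto simp: prod_eq_iff)
    then show ?thesis by simp
  qed
  have "(i, j) \<in> cells \<mu> \<longleftrightarrow> (i, j) \<in> cells \<nu>" for i j
    using c[of \<mu> i j] c[of \<nu> i j] \<open>P \<mu> = P \<nu>\<close> by (metis zero_neq_one)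
  then have "cells \<mu> = cells \<nu>" by auto
  then show "\<mu> = \<nu>" using * cells_inject by (auto simp: partitions_def)
qed

lemma M_nonzero: "(1 - qv) * (1 - tv) \<noteq> 0"
  using qv_power_neq_1[of 1] tv_power_neq_1[of 1] by simp

lemma eigval_inj: "inj_on (eigval qv tv) partitions"
  using B_sum_inj M_nonzero by (auto simp: inj_on_def eigval_B_sum)

text \<open>Transposing the diagram exchanges q and t. This lets both triangularities speak about
  the eigenvalues of one operator.\<close>

lemma eigval_swap: "\<mu> \<in> partitions \<Longrightarrow> eigval tv qv \<mu> = eigval qv tv (conjugate \<mu>)"
  by (simp add: eigval_B_sum B_sum_conjugate mult.commute mult.left_commute)

lemma eigval_inj_swap: "inj_on (eigval tv qv) partitions"
proof (rule inj_onI)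
  fix \<mu> \<nu> assume *: "\<mu> \<in> partitions" "\<nu> \<in> partitions" "eigval tv qv \<mu> = eigval tv qv \<nu>"
  then have "conjugate \<mu> = conjugate \<nu>"
    using eigval_inj conjugate_partitions by (auto simp: eigval_swap dest: inj_onD)
  then show "\<mu> = \<nu>" using * conjugate_conjugate by metis
qed

lemma partitions_of_subset: "partitions_of n \<subseteq> partitions"
  by (auto simp: partitions_of_def)

text \<open>The condition at q decomposes H_\<mu> into eigenvectors for \<kappa> above \<mu>. The
  condition at t does so for \<kappa> whose conjugate is above that of \<mu>, hence for \<kappa>
  below \<mu>, and with the same operator, which is symmetric in q and t. Eigencomponents for
  distinct eigenvalues are unique, so only \<mu> survives.\<close>

lemma macdonald_eigvec:
  assumes H: "modified_macdonald H" and \<mu>: "\<mu> \<in> partitions_of n"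
  shows "H \<mu> \<in> homog n" "eigvec (macdonald_op qv tv) (eigval qv tv \<mu>) (H \<mu>)" "H \<mu> \<noteq> 0"
proof -
  let ?P = "partitions_of n"
  let ?D = "macdonald_op qv tv" and ?ev = "eigval qv tv"
  have \<mu>p: "\<mu> \<in> partitions" "sum_list \<mu> = n" using \<mu> by (auto simp: partitions_of_def)
  have H\<mu>: "H \<mu> \<in> sym_funs"
    "pleth_one_minus qv (H \<mu>) \<in> series.span (schur ` {\<nu> \<in> partitions. dominates \<nu> \<mu>})"
    "pleth_one_minus tv (H \<mu>) \<in> series.span (schur ` {\<nu> \<in> partitions. dominates \<nu> (conjugate \<mu>)})"
    "hall (H \<mu>) (schur (row_partition (sum_list \<mu>))) = 1"
    using H \<mu>p(1) by (auto simp: modified_macdonald_def)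
  have injq: "inj_on ?ev ?P" using eigval_inj partitions_of_subset by (rule inj_on_subset)
  have injt: "inj_on (eigval tv qv) ?P" using eigval_inj_swap partitions_of_subset by (rule inj_on_subset)
  note q = schur_span_subset[OF injq \<mu>p(2)]
  note t = schur_span_subset[OF injt, of "conjugate \<mu>"]
  show "H \<mu> \<in> homog n"
    using pleth_inverse_homog[OF qv_power_neq_1 H\<mu>(1)] H\<mu>(2) q by blast
  \<comment> \<open>The normalization excludes zero, whose Schur coordinates all vanish.\<close>
  show "H \<mu> \<noteq> 0"
  proof
    assume "H \<mu> = 0"
    then have "coord schur (H \<mu>) \<nu> = 0" for \<nu> by (simp add: coord_def series.representation_zero)
    then show False using H\<mu>(4) by (simp add: hall_def)
  qed
  have "H \<mu> \<in> eigsum ?D ?ev {\<kappa> \<in> ?P. dominates \<kappa> \<mu>}"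
    by (rule eigsum_macdonald_op[OF qv_power_neq_1 H\<mu>(1)]) (use H\<mu>(2) q in auto)
  then obtain x where x: "\<And>\<kappa>. \<kappa> \<in> ?P \<Longrightarrow> dominates \<kappa> \<mu> \<Longrightarrow> eigvec ?D (?ev \<kappa>) (x \<kappa>)"
    "H \<mu> = (\<Sum>\<kappa> | \<kappa> \<in> ?P \<and> dominates \<kappa> \<mu>. x \<kappa>)" by (auto simp: eigsum_def)
  have "H \<mu> \<in> eigsum (macdonald_op tv qv) (eigval tv qv) {\<kappa> \<in> ?P. dominates \<kappa> (conjugate \<mu>)}"
    by (rule eigsum_macdonald_op[OF tv_power_neq_1 H\<mu>(1)])
      (use H\<mu>(3) t \<mu>p in \<open>auto simp: sum_list_conjugate\<close>)
  then obtain y where y: "\<And>\<kappa>. \<kappa> \<in> ?P \<Longrightarrow> dominates \<kappa> (conjugate \<mu>) \<Longrightarrow> eigvec ?D (?ev (conjugate \<kappa>)) (y \<kappa>)"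
    "H \<mu> = (\<Sum>\<kappa> | \<kappa> \<in> ?P \<and> dominates \<kappa> (conjugate \<mu>). y \<kappa>)"
    by (auto simp: eigsum_def macdonald_op_commute[of tv] eigval_swap partitions_of_def)
  \<comment> \<open>Both decompositions are padded with zeros to all partitions of \<open>n\<close>,
    the second one reindexed by conjugation, so that they can be subtracted term by term.\<close>
  define X where "X \<kappa> = (if dominates \<kappa> \<mu> then x \<kappa> else 0)" for \<kappa>
  define Y where "Y \<kappa> = (if dominates (conjugate \<kappa>) (conjugate \<mu>) then y (conjugate \<kappa>) else 0)" for \<kappa>
  have cc: "conjugate (conjugate \<kappa>) = \<kappa>" if "\<kappa> \<in> ?P" for \<kappa>
    using that by (simp add: partitions_of_def conjugate_conjugate)
  have HX: "H \<mu> = (\<Sum>\<kappa>\<in>?P. X \<kappa>)" by (simp add: x(2) X_def sum.inter_filter)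
  have "(\<Sum>\<kappa>\<in>?P. Y \<kappa>) = (\<Sum>\<kappa>\<in>?P. if dominates \<kappa> (conjugate \<mu>) then y \<kappa> else 0)"
    by (rule sum.reindex_bij_witness[of _ conjugate conjugate]) (auto simp: cc conjugate_partitions_of Y_def)
  then have HY: "H \<mu> = (\<Sum>\<kappa>\<in>?P. Y \<kappa>)" by (simp add: y(2) sum.inter_filter)
  have eX: "eigvec ?D (?ev \<kappa>) (X \<kappa>)" if "\<kappa> \<in> ?P" for \<kappa>
    using x(1)[OF that] eigvec_zero[OF linear_on_sym_macdonald_op] by (auto simp: X_def)
  have eY: "eigvec ?D (?ev \<kappa>) (Y \<kappa>)" if "\<kappa> \<in> ?P" for \<kappa>
    using y(1)[OF conjugate_partitions_of[OF that]] eigvec_zero[OF linear_on_sym_macdonald_op] by (auto simp: Y_def cc[OF that])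
  have eXY: "eigvec ?D (?ev \<kappa>) (X \<kappa> - Y \<kappa>)" if "\<kappa> \<in> ?P" for \<kappa>
    using eigvec_add[OF linear_on_sym_macdonald_op eX[OF that] eigvec_scale[OF linear_on_sym_macdonald_op eY[OF that], of "- 1"]] by simp
  have "(\<Sum>\<kappa>\<in>?P. X \<kappa> - Y \<kappa>) = 0" using HX HY by (simp add: sum_subtractf)
  then have XY: "\<forall>\<kappa>\<in>?P. X \<kappa> - Y \<kappa> = 0"
    by (intro eigvec_independent[OF linear_on_sym_macdonald_op finite_partitions_of injq eXY])
  have "X \<kappa> = 0" if "\<kappa> \<in> ?P" "\<kappa> \<noteq> \<mu>" for \<kappa>
  proof (rule ccontr)
    assume nz: "X \<kappa> \<noteq> 0"
    have \<kappa>p: "\<kappa> \<in> partitions" using that by (simp add: partitions_of_def)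
    have "Y \<kappa> \<noteq> 0" using XY that nz by auto
    then have "dominates (conjugate \<kappa>) (conjugate \<mu>)" by (auto simp: Y_def split: if_splits)
    then have "dominates (conjugate (conjugate \<mu>)) (conjugate (conjugate \<kappa>))"
      by (rule dominates_conjugate[OF conjugate_partitions[OF \<kappa>p] conjugate_partitions[OF \<mu>p(1)]])
    then have "dominates \<mu> \<kappa>" using cc that \<mu> by simp
    moreover have "dominates \<kappa> \<mu>" using nz by (auto simp: X_def split: if_splits)
    ultimately show False using dominates_antisym[of \<kappa> \<mu>] \<kappa>p \<mu>p that by (auto simp: partitions_def)
  qed
  then have "(\<Sum>\<kappa>\<in>?P. X \<kappa>) = (\<Sum>\<kappa>\<in>{\<mu>}. X \<kappa>)" using \<mu> by (intro sum.mono_neutral_right) auto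
  then have "H \<mu> = X \<mu>" using HX by simp
  then show "eigvec ?D (?ev \<mu>) (H \<mu>)" using eX[OF \<mu>] by simp
qed

text \<open>Nonzero eigenvectors with pairwise distinct eigenvalues are independent. This gives the
  coordinates used by \<open>Delta\<close> their meaning.\<close>

lemma macdonald_basis:
  assumes H: "modified_macdonald H"
  shows "indexed_basis H"
proof
  have *: "c \<nu> = 0" if F: "finite F" "F \<subseteq> partitions" "(\<Sum>\<nu>\<in>F. scale (c \<nu>) (H \<nu>)) = 0" "\<nu> \<in> F" for F c \<nu>
  proof -
    have e: "eigvec (macdonald_op qv tv) (eigval qv tv \<kappa>) (scale (c \<kappa>) (H \<kappa>))" "H \<kappa> \<noteq> 0" if "\<kappa> \<in> F" for \<kappa>
    proof -
      have "\<kappa> \<in> partitions_of (sum_list \<kappa>)" using that F(2) by (auto simp: partitions_of_def)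
      note ev = macdonald_eigvec(2,3)[OF H this]
      show "eigvec (macdonald_op qv tv) (eigval qv tv \<kappa>) (scale (c \<kappa>) (H \<kappa>))"
        by (rule eigvec_scale[OF linear_on_sym_macdonald_op ev(1)])
      show "H \<kappa> \<noteq> 0" by (rule ev(2))
    qed
    have "\<forall>\<kappa>\<in>F. scale (c \<kappa>) (H \<kappa>) = 0"
      using eigvec_independent[OF linear_on_sym_macdonald_op F(1) inj_on_subset[OF eigval_inj F(2)] e(1) F(3)] by blast
    then show ?thesis using e(2) F(4) by auto
  qed
  show "inj_on H partitions" "series.independent (H ` partitions)"
    using independent_familyI[of partitions H] * by blast+
qed

lemma sum_list_concat: "sum_list (concat xs) = (sum_list (map sum_list xs) :: 'a::comm_monoid_add)"
  by (induction xs) simp_all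

lemma sum_list_B_monomials: "sum_list (B_monomials \<mu>) = B_sum qv tv \<mu>"
proof -
  have "sum_list (B_monomials \<mu>) = (\<Sum>i<length \<mu>. \<Sum>j<\<mu> ! i. qv ^ j * tv ^ i)"
    by (simp add: B_monomials_def sum_list_concat comp_def interv_sum_list_conv_sum_set_nat atLeast0LessThan)
  then show ?thesis unfolding B_sum_def cells_Sigma by (simp add: sum.Sigma)
qed

lemma eval_at_elem_1: "eval_at (elem 1) A = sum_list A"
proof -
  have "{M. set_mset M \<subseteq> {..<length A} \<and> coef (elem 1 :: 'a series) M \<noteq> 0} = (\<lambda>i. {#i#}) ` {..<length A}"
  proof (intro set_eqI iffI)
    fix M assume M: "M \<in> {M. set_mset M \<subseteq> {..<length A} \<and> coef (elem 1 :: 'a series) M \<noteq> 0}"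
    then have "size M = 1" by (auto simp: elem_def split: if_splits)
    then obtain i where "M = {#i#}" using size_1_singleton_mset by blast
    then show "M \<in> (\<lambda>i. {#i#}) ` {..<length A}" using M by auto
  qed (auto simp: elem_def)
  then have "eval_at (elem 1) A = (\<Sum>i<length A. A ! i)"
    unfolding eval_at_def by (simp add: sum.reindex inj_on_def elem_def)
  then show ?thesis by (simp add: sum_list_sum_nth atLeast0LessThan)
qed

lemma Delta_elem:
  assumes H: "modified_macdonald H"
  shows "Delta H (elem 1) (elem n) = (\<Sum>k=1..n. scale (qt_int k) (elem k * elem (n - k)))"
    and "n > 0 \<Longrightarrow> Delta' H (elem 1) (elem n) = Delta H (elem 1) (elem n) - elem n"
proof -
  interpret H: indexed_basis H by (rule macdonald_basis[OF H])
  \<comment> \<open>The relation \<open>macdonald_op\<close> = 1 - M L, solved for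
    \<open>L\<close>.\<close>
  define L where "L f = scale (1 / ((1 - qv) * (1 - tv))) (f - macdonald_op qv tv f)" for f
  have sub: "partitions_of n \<subseteq> partitions" by (rule partitions_of_subset)
  have span: "homog n \<subseteq> series.span (H ` partitions_of n)"
    using macdonald_eigvec(1)[OF H] inj_on_subset[OF H.inj sub] series.independent_mono[OF H.indep image_mono[OF sub]]
    by (intro homog_subset_span) auto
  have V: "H.V \<subseteq> sym_funs"
    using H by (intro series.span_minimal subspace_sym_funs) (auto simp: modified_macdonald_def)
  have LH: "L (H \<mu>) = scale (B_sum qv tv \<mu>) (H \<mu>)" if "\<mu> \<in> partitions" for \<mu>
  proof -
    have "macdonald_op qv tv (H \<mu>) = scale (eigval qv tv \<mu>) (H \<mu>)"
      using macdonald_eigvec(2)[OF H, of \<mu> "sum_list \<mu>"] that by (simp add: eigvec_def partitions_of_def)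
    then have "H \<mu> - macdonald_op qv tv (H \<mu>) = scale ((1 - qv) * (1 - tv) * B_sum qv tv \<mu>) (H \<mu>)"
      by (simp add: eigval_B_sum series.scale_left_diff_distrib)
    then show ?thesis using M_nonzero by (simp add: L_def)
  qed
  have L_lin: "L (f + g) = L f + L g" "L (scale c f) = scale c (L f)" if "f \<in> H.V" "g \<in> H.V" for f g c
    using that V linear_on_symD(1,2)[OF linear_on_sym_macdonald_op[of qv tv]]
    by (auto simp: L_def subset_iff series.scale_right_diff_distrib series.scale_right_distrib
        mult.commute algebra_simps)
  have L0: "L 0 = 0" using linear_on_symD(3)[OF linear_on_sym_macdonald_op[of qv tv]] by (simp add: L_def)
  have mem: "elem n \<in> series.span (H ` partitions_of n)" using span elem_homog by blast
  have "Delta H (elem 1) (elem n) = L (elem n)"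
    unfolding Delta_def
    by (rule H.diag_op_eqI[OF sub mem]) (use LH sub L_lin L0 in \<open>auto simp: eval_at_elem_1[simplified] sum_list_B_monomials\<close>)
  also have "L (elem n) = (\<Sum>k=1..n. scale (qt_int k) (elem k * elem (n - k)))"
    using M_nonzero by (simp add: L_def macdonald_op_elem qt_int_def)
  finally show Delta: "Delta H (elem 1) (elem n) = (\<Sum>k=1..n. scale (qt_int k) (elem k * elem (n - k)))" .
  assume "n > 0"
  have "eval_at (elem 1) (remove1 1 (B_monomials \<mu>)) = B_sum qv tv \<mu> - 1" if in_n: "\<mu> \<in> partitions_of n" for \<mu>
  proof -
    obtain a \<nu> where \<mu>: "\<mu> = a # \<nu>" "a > 0"
      using in_n \<open>n > 0\<close> by (cases \<mu>) (auto simp: partitions_of_def partitions_def)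
    \<comment> \<open>The list starts with the monomial of the corner cell, and this is the entry
      that \<open>remove1 1\<close> takes away.\<close>
    have "B_monomials \<mu> \<noteq> [] \<and> hd (B_monomials \<mu>) = 1"
      by (simp add: B_monomials_def \<mu> upt_conv_Cons del: upt_Suc)
    then obtain A where A: "B_monomials \<mu> = 1 # A" by (cases "B_monomials \<mu>") auto
    then show ?thesis using sum_list_B_monomials[of \<mu>] by (simp add: eval_at_elem_1[simplified])
  qed
  then have ev: "L (H \<mu>) - H \<mu> = scale (eval_at (elem 1) (remove1 1 (B_monomials \<mu>))) (H \<mu>)" if "\<mu> \<in> partitions_of n" for \<mu>
    using that LH sub by (auto simp: series.scale_left_diff_distrib)
  have "Delta' H (elem 1) (elem n) = L (elem n) - elem n"
    unfolding Delta'_def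
    by (rule H.diag_op_eqI[OF sub mem]) (use ev L_lin L0 in \<open>auto simp: series.scale_right_diff_distrib\<close>)
  then show "Delta' H (elem 1) (elem n) = Delta H (elem 1) (elem n) - elem n"
    using \<open>Delta H (elem 1) (elem n) = L (elem n)\<close> by simp
qed

section \<open>Counting subsets by crossings\<close>

text \<open>Read the elements of \<open>S\<close> increasingly as the steps of a lattice path on the integers that starts
  at \<open>- s\<close>, going up at the elements of \<open>P\<close> and down at the others; \<open>crossings\<close> counts the down steps
  from \<open>1\<close> to \<open>0\<close>.\<close>

definition below :: "nat set \<Rightarrow> nat \<Rightarrow> nat" where
  "below A y = card {x \<in> A. x < y}"

definition crossings :: "nat \<Rightarrow> nat set \<Rightarrow> nat set \<Rightarrow> nat" where
  "crossings s P Q = card {y \<in> Q. below P y = s + 1 + below Q y}"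

definition choose_subsets :: "nat set \<Rightarrow> nat \<Rightarrow> nat set set" where
  "choose_subsets S p = {P. P \<subseteq> S \<and> card P = p}"

lemma finite_choose_subsets: "finite S \<Longrightarrow> finite (choose_subsets S p)"
  by (rule finite_subset[of _ "Pow S"]) (auto simp: choose_subsets_def)

lemma below_insert_ge: "b \<ge> y \<Longrightarrow> below (insert b A) y = below A y"
  unfolding below_def by (rule arg_cong[of _ _ card]) auto

lemma below_top: "(\<And>x. x \<in> A \<Longrightarrow> x < b) \<Longrightarrow> below A b = card A"
  unfolding below_def by (rule arg_cong[of _ _ card]) auto

text \<open>Used with \<open>b\<close> above all of \<open>S\<close>, this is the case distinction
  on the last step of the path, up or down.\<close>

lemma choose_subsets_insert:
  assumes "finite S" "b \<notin> S"
  shows "(\<Sum>P\<in>choose_subsets (insert b S) p. F P) =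
    (if p = 0 then 0 else \<Sum>P\<in>choose_subsets S (p - 1). F (insert b P)) + (\<Sum>P\<in>choose_subsets S p. F P)"
proof -
  have split: "choose_subsets (insert b S) p =
      (if p = 0 then {} else insert b ` choose_subsets S (p - 1)) \<union> choose_subsets S p"
  proof (intro set_eqI iffI)
    fix P assume P: "P \<in> choose_subsets (insert b S) p"
    show "P \<in> (if p = 0 then {} else insert b ` choose_subsets S (p - 1)) \<union> choose_subsets S p"
    proof (cases "b \<in> P")
      case True
      have fin: "finite P" using P assms(1) by (auto simp: choose_subsets_def intro: finite_subset)
      have "P - {b} \<in> choose_subsets S (p - 1)" "p \<noteq> 0"
        using P True fin by (auto simp: choose_subsets_def card_gt_0_iff)
      moreover have "P = insert b (P - {b})" using True by auto
      ultimately show ?thesis by (metis UnI1 image_eqI)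
    qed (use P in \<open>auto simp: choose_subsets_def\<close>)
  next
    fix P assume "P \<in> (if p = 0 then {} else insert b ` choose_subsets S (p - 1)) \<union> choose_subsets S p"
    then show "P \<in> choose_subsets (insert b S) p"
      using assms by (auto simp: choose_subsets_def card_insert_if finite_subset split: if_splits)
  qed
  have "(if p = 0 then {} else insert b ` choose_subsets S (p - 1)) \<inter> choose_subsets S p = {}"
    using assms(2) by (auto simp: choose_subsets_def)
  moreover have "inj_on (insert b) (choose_subsets S (p - 1))"
  proof (rule inj_onI)
    fix P Q assume "P \<in> choose_subsets S (p - 1)" "Q \<in> choose_subsets S (p - 1)" "insert b P = insert b Q"
    then show "P = Q" using assms(2) insert_ident[of b P Q] by (auto simp: choose_subsets_def)
  qed
  ultimately show ?thesis
    unfolding split using finite_choose_subsets[OF assms(1)]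
    by (subst sum.union_disjoint) (auto simp: sum.reindex)
qed

lemma card_choose_subsets: "finite S \<Longrightarrow> card (choose_subsets S p) = card S choose p"
  unfolding choose_subsets_def by (rule n_subsets)

lemma crossings_insert_up:
  assumes "finite S" "\<And>x. x \<in> S \<Longrightarrow> x < b" "P \<subseteq> S"
  shows "crossings s (insert b P) (insert b S - insert b P) = crossings s P (S - P)"
proof -
  have "insert b S - insert b P = S - P" using assms(2) by auto
  moreover have "below (insert b P) y = below P y" if "y \<in> S - P" for y
    using assms(2)[of y] that by (intro below_insert_ge) auto
  ultimately show ?thesis unfolding crossings_def by (intro arg_cong[of _ _ card]) auto
qed

text \<open>The appended down step starts at height \<open>card P - card (S - P) - s\<close>, and it
  is counted when this is \<open>1\<close>.\<close>

lemma crossings_insert_down: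
  assumes "finite S" "\<And>x. x \<in> S \<Longrightarrow> x < b" "P \<subseteq> S"
  shows "crossings s P (insert b S - P) = crossings s P (S - P) + (if card P = s + 1 + card (S - P) then 1 else 0)"
proof -
  have bS: "b \<notin> S" "b \<notin> P" using assms(2,3) by auto
  then have eq: "insert b S - P = insert b (S - P)" by auto
  have old: "below (insert b (S - P)) y = below (S - P) y" if "y \<in> insert b (S - P)" for y
    using assms(2)[of y] that by (intro below_insert_ge) auto
  have P: "below P b = card P" using assms(2,3) by (intro below_top) auto
  have Q: "below (S - P) b = card (S - P)" using assms(2) by (intro below_top) auto
  define X where "X = {y \<in> S - P. below P y = s + 1 + below (S - P) y}"
  have finX: "finite X" "b \<notin> X" using assms(1) bS by (auto simp: X_def)
  have "{y \<in> insert b S - P. below P y = s + 1 + below (insert b S - P) y} =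
      (if card P = s + 1 + card (S - P) then insert b X else X)"
    unfolding eq using old P Q by (auto simp: X_def)
  then show ?thesis using finX unfolding crossings_def X_def[symmetric] by simp
qed

definition cross_gen :: "'a::comm_ring_1 \<Rightarrow> nat \<Rightarrow> nat set \<Rightarrow> nat \<Rightarrow> 'a" where
  "cross_gen q s S p = (\<Sum>P\<in>choose_subsets S p. q ^ crossings s P (S - P))"

text \<open>From summation by parts: the sum of q^k over paths with k crossings is the number of
  paths plus the sum over c of q^(c+1) - q^c times the number of paths with more than c crossings.
  The binomials stand for the latter numbers; \<open>L\<close> is a cutoff.\<close>

definition tail :: "'a::comm_ring_1 \<Rightarrow> nat \<Rightarrow> nat \<Rightarrow> nat \<Rightarrow> 'a" where
  "tail q L N u = (\<Sum>c<L. (q ^ Suc c - q ^ c) * of_nat (N choose (u + Suc c)))"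

lemma tail_pascal: "tail q L (Suc N) (Suc u) = tail q L N (Suc u) + tail q L N u"
  by (simp add: tail_def sum.distrib[symmetric] ring_distribs add_ac)

text \<open>Splitting off the first summand. As \<open>N < L\<close>, the one additional summand at
  the far end is zero.\<close>

lemma tail_shift:
  assumes "N < L"
  shows "tail q L N u = (q - 1) * of_nat (N choose (Suc u)) + q * tail q L N (Suc u)"
proof -
  obtain L' where L: "L = Suc L'" using assms by (cases L) auto
  have "tail q L N u = (q - 1) * of_nat (N choose (Suc u)) +
      (\<Sum>c<L'. q * ((q ^ Suc c - q ^ c) * of_nat (N choose (Suc u + Suc c))))"
    unfolding tail_def L sum.lessThan_Suc_shift by (simp add: algebra_simps)
  also have "(\<Sum>c<L'. q * ((q ^ Suc c - q ^ c) * of_nat (N choose (Suc u + Suc c)))) = q * tail q L N (Suc u)"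
    using assms by (simp add: tail_def L binomial_eq_0 sum_distrib_left)
  finally show ?thesis .
qed

text \<open>By the reflection principle, the paths with at least \<open>c\<close> crossings are as many as the free paths
  to the height \<open>2 c + \<bar>f\<bar>\<close>, where \<open>f\<close> is the final height.\<close>

lemma cross_gen_formula:
  assumes "finite S" "card S < L" "p \<le> card S"
  shows "cross_gen q s S p = of_nat (card S choose p) + tail q L (card S) (max p (card S - p + s))"
  using assms
proof (induction S arbitrary: p rule: finite_linorder_max_induct)
  case empty
  have "choose_subsets {} 0 = {{}}" by (auto simp: choose_subsets_def)
  then show ?case using empty by (simp add: cross_gen_def crossings_def tail_def)
next
  case (insert b S)
  let ?N = "card S"
  have bS: "b \<notin> S" using insert.hyps(2) by auto
  have N: "card (insert b S) = Suc ?N" using insert.hyps bS by simp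
  have NL: "?N < L" using insert.prems N by simp
  have up: "(\<Sum>P\<in>choose_subsets S p. q ^ crossings s (insert b P) (insert b S - insert b P)) = cross_gen q s S p" for p
    unfolding cross_gen_def
    by (rule sum.cong) (use insert.hyps crossings_insert_up[of S b] in \<open>auto simp: choose_subsets_def\<close>)
  have down: "(\<Sum>P\<in>choose_subsets S p. q ^ crossings s P (insert b S - P)) =
      (if p = s + 1 + (?N - p) then q else 1) * cross_gen q s S p" for p
  proof -
    have "q ^ crossings s P (insert b S - P) = (if p = s + 1 + (?N - p) then q else 1) * q ^ crossings s P (S - P)"
      if "P \<in> choose_subsets S p" for P
    proof -
      have P: "P \<subseteq> S" "card P = p" "card (S - P) = ?N - p"
        using that card_Diff_subset[OF finite_subset[OF _ insert.hyps(1)], of P] by (auto simp: choose_subsets_def)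
      show ?thesis
        using crossings_insert_down[OF insert.hyps(1) _ P(1), of b s] insert.hyps(2) P by auto
    qed
    then show ?thesis by (simp add: cross_gen_def sum_distrib_left)
  qed
  have rec: "cross_gen q s (insert b S) p = (if p = 0 then 0 else cross_gen q s S (p - 1)) +
      (if p = s + 1 + (?N - p) then q else 1) * cross_gen q s S p"
    unfolding cross_gen_def[of q s "insert b S"] choose_subsets_insert[OF insert.hyps(1) bS] up down ..
  have IH: "cross_gen q s S p = of_nat (?N choose p) + tail q L ?N (max p (?N - p + s))" if "p \<le> ?N" for p
    using insert.IH NL that by blast
  have empty: "cross_gen q s S (Suc ?N) = 0"
  proof -
    have "choose_subsets S (Suc ?N) = {}"
      using card_choose_subsets[OF insert.hyps(1), of "Suc ?N"] finite_choose_subsets[OF insert.hyps(1), of "Suc ?N"]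
      by (metis binomial_eq_0 card_0_eq lessI)
    then show ?thesis by (simp add: cross_gen_def)
  qed
  show ?case
  proof (cases p)
    case 0
    have "max 0 (Suc ?N - 0 + s) = Suc (?N + s)" "max 0 (?N - 0 + s) = ?N + s" by auto
    moreover have "tail q L (Suc ?N) (Suc (?N + s)) = 0" "tail q L ?N (?N + s) = 0"
      by (simp_all add: tail_def binomial_eq_0)
    ultimately show ?thesis using 0 rec IH[of 0] N by simp
  next
    case (Suc p')
    have p': "p' \<le> ?N" using insert.prems Suc N by simp
    show ?thesis
    proof (cases "p' = ?N")
      case True
      have m: "max (Suc ?N) s = (if s \<le> ?N then Suc ?N else s)" by auto
      have t: "tail q L (Suc ?N) (max (Suc ?N) s) = 0"
        by (simp add: tail_def binomial_eq_0 le_max_iff_disj)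
      have t2: "tail q L ?N (max ?N s) = 0" by (simp add: tail_def binomial_eq_0)
      show ?thesis using Suc True rec IH[of p'] N empty t t2 by simp
    next
      case False
      then have lt: "p' < ?N" using p' by simp
      then have sN: "Suc ?N - p = Suc (?N - p)" "?N - p' = Suc (?N - p)" using Suc by auto
      have r: "cross_gen q s (insert b S) p = of_nat (?N choose p') + tail q L ?N (max p' (Suc (?N - p) + s)) +
          (if p = s + 1 + (?N - p) then q else 1) * (of_nat (?N choose p) + tail q L ?N (max p (?N - p + s)))"
        using rec IH[of p'] IH[of p] lt Suc sN by simp
      have binom: "of_nat (Suc ?N choose p) = of_nat (?N choose p') + (of_nat (?N choose p) :: 'a)" by (simp add: Suc)
      \<comment> \<open>A last down step starts at height p - (?N - p) - s, and the cases are that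
        this is equal to 1, larger or smaller. In the first one it is a crossing, and the factor
        \<open>q\<close> is absorbed by \<open>tail_shift\<close>.\<close>
      consider "p = s + 1 + (?N - p)" | "p > s + 1 + (?N - p)" | "p < s + 1 + (?N - p)" by linarith
      then show ?thesis
      proof cases
        case 1
        have m: "max p' (Suc (?N - p) + s) = p" "max p (?N - p + s) = p" "max p (Suc ?N - p + s) = p"
          using 1 Suc sN by auto
        show ?thesis unfolding r N m binom using tail_pascal[of q L ?N p'] tail_shift[OF NL, of q p'] 1 Suc
          by (simp add: algebra_simps)
      next
        case 2
        have m: "max p' (Suc (?N - p) + s) = p'" "max p (?N - p + s) = p" "max p (Suc ?N - p + s) = p"
          using 2 Suc sN by auto
        show ?thesis unfolding r N m binom using tail_pascal[of q L ?N p'] 2 Suc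
          by (simp add: algebra_simps)
      next
        case 3
        have m: "max p' (Suc (?N - p) + s) = Suc (?N - p + s)" "max p (?N - p + s) = (if p \<le> ?N - p + s then ?N - p + s else p)"
          "max p (Suc ?N - p + s) = Suc (?N - p + s)"
          using 3 Suc sN by auto
        have le: "p \<le> ?N - p + s" using 3 by simp
        show ?thesis unfolding r N m binom using tail_pascal[of q L ?N "?N - p + s"] 3 le
          by (simp add: algebra_simps)
      qed
    qed
  qed
qed

text \<open>The path started at height 0 never goes below it, as each down step starts at positive
  height.\<close>

definition ballot :: "nat set \<Rightarrow> nat set \<Rightarrow> bool" where
  "ballot P Q \<longleftrightarrow> (\<forall>y\<in>Q. below P y > below Q y)"

text \<open>The recursion on the last step appends a down step only at positive height. Its
  solutions are differences of adjacent binomials, as reflection predicts.\<close>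

lemma ballot_count:
  assumes "finite S"
  shows "(2 * p < card S \<longrightarrow> {P \<in> choose_subsets S p. ballot P (S - P)} = {}) \<and>
    (card S \<le> 2 * p \<longrightarrow> card {P \<in> choose_subsets S p. ballot P (S - P)} + (card S choose Suc p) = card S choose p)"
  using assms
proof (induction S arbitrary: p rule: finite_linorder_max_induct)
  case empty
  have "choose_subsets {} p = (if p = 0 then {{}} else {})" by (auto simp: choose_subsets_def)
  then show ?case by (cases p) (auto simp: ballot_def)
next
  case (insert b S)
  let ?N = "card S"
  define C where "C S p = card {P \<in> choose_subsets S p. ballot P (S - P)}" for S p
  have bS: "b \<notin> S" using insert.hyps(2) by auto
  have N: "card (insert b S) = Suc ?N" using insert.hyps bS by simp
  have Csum: "C S p = (\<Sum>P\<in>choose_subsets S p. if ballot P (S - P) then 1 else 0)" if "finite S" for S p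
    using finite_choose_subsets[OF that, of p] by (simp add: C_def sum.If_cases Int_def)
  have up: "ballot (insert b P) (insert b S - insert b P) \<longleftrightarrow> ballot P (S - P)" if "P \<subseteq> S" for P
  proof -
    have "insert b S - insert b P = S - P" using bS by auto
    moreover have "below (insert b P) y = below P y" if "y \<in> S - P" for y
      using insert.hyps(2) that by (intro below_insert_ge) (auto intro: less_imp_le)
    ultimately show ?thesis by (simp add: ballot_def)
  qed
  have down: "ballot P (insert b S - P) \<longleftrightarrow> ballot P (S - P) \<and> p > ?N - p" if "P \<in> choose_subsets S p" for P p
  proof -
    have P: "P \<subseteq> S" "card P = p" "card (S - P) = ?N - p"
      using that card_Diff_subset[OF finite_subset[OF _ insert.hyps(1)], of P] by (auto simp: choose_subsets_def)
    have eq: "insert b S - P = insert b (S - P)" using bS P(1) by auto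
    have old: "below (insert b (S - P)) y = below (S - P) y" if "y \<in> insert b (S - P)" for y
      using insert.hyps(2) that by (intro below_insert_ge) (auto intro: less_imp_le)
    have "below P b = p" using insert.hyps(2) P(1) P(2)[symmetric] by (simp add: below_top subset_iff)
    moreover have "below (S - P) b = ?N - p" unfolding P(3)[symmetric] using insert.hyps(2) by (intro below_top) auto
    ultimately show ?thesis unfolding ballot_def eq using old by auto
  qed
  have rec: "C (insert b S) p = (if p = 0 then 0 else C S (p - 1)) + (if p > ?N - p then C S p else 0)" for p
  proof -
    have "(\<Sum>P\<in>choose_subsets S p'. if ballot (insert b P) (insert b S - insert b P) then 1 else 0) = C S p'" for p'
      unfolding Csum[OF insert.hyps(1)] by (rule sum.cong) (use up in \<open>auto simp: choose_subsets_def\<close>)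
    moreover have "(\<Sum>P\<in>choose_subsets S p. if ballot P (insert b S - P) then 1 else 0) = (if p > ?N - p then C S p else 0)"
      unfolding Csum[OF insert.hyps(1)] using down by (auto intro!: sum.cong)
    ultimately show ?thesis
      unfolding Csum[OF finite.insertI[OF insert.hyps(1)]] choose_subsets_insert[OF insert.hyps(1) bS] by simp
  qed
  have IH0: "C S p = 0" if "2 * p < ?N" for p using insert.IH[of p] that unfolding C_def by (metis card.empty)
  have IH: "C S p + (?N choose Suc p) = ?N choose p" if "?N \<le> 2 * p" for p
    using insert.IH[of p] that by (simp add: C_def)
  have fin: "finite {P \<in> choose_subsets (insert b S) p. ballot P (insert b S - P)}"
    using finite_choose_subsets[of "insert b S" p] insert.hyps(1) by simp
  have "C (insert b S) p = 0" if "2 * p < Suc ?N"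
    using rec[of p] IH0[of "p - 1"] that by auto
  moreover have "C (insert b S) p + (Suc ?N choose Suc p) = Suc ?N choose p" if le: "Suc ?N \<le> 2 * p"
  proof -
    obtain p' where p: "p = Suc p'" using le by (cases p) auto
    have gt: "p > ?N - p" using le by simp
    have 1: "C S p' + (?N choose p) = ?N choose p'"
    proof (cases "?N \<le> 2 * p'")
      case True
      then show ?thesis using IH[of p'] p by simp
    next
      case False
      \<comment> \<open>The boundary case with one more down step than up steps: there is no such
        path, and the two binomials agree by symmetry.\<close>
      then have "?N = 2 * p' + 1" using le p by simp
      moreover have "(2 * p' + 1) choose p = (2 * p' + 1) choose p'"
        using binomial_symmetric[of p' "2 * p' + 1"] p by simp
      ultimately show ?thesis using IH0[of p'] by simp
    qed
    have 2: "C S p + (?N choose Suc p) = ?N choose p" using le by (intro IH) simp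
    show ?thesis using rec[of p] gt 1 2 by (simp add: p)
  qed
  ultimately show ?case using fin by (simp add: N C_def)
qed

section \<open>Pairs of columns\<close>

text \<open>Factorizations of the monomial \<open>M\<close> into two squarefree ones, the first of
  degree \<open>a\<close>. They describe the coefficient of e_a e_(n-a), the columns of a two-column
  tableau and the labels of a path with two columns.\<close>

definition col_pairs :: "nat multiset \<Rightarrow> nat \<Rightarrow> (nat set \<times> nat set) set" where
  "col_pairs M a = {(A, B). finite A \<and> finite B \<and> card A = a \<and> mset_set A + mset_set B = M}"

definition singles :: "nat multiset \<Rightarrow> nat set" where
  "singles M = {i. count M i = 1}"

definition doubles :: "nat multiset \<Rightarrow> nat set" where
  "doubles M = {i. count M i = 2}"

lemma finite_singles: "finite (singles M)" and finite_doubles: "finite (doubles M)"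
  by (rule finite_subset[of _ "set_mset M"]; auto simp: singles_def doubles_def intro!: count_inI)+

lemma singles_doubles_disjoint: "singles M \<inter> doubles M = {}"
  by (auto simp: singles_def doubles_def)

lemma count_mset_set_if: "finite A \<Longrightarrow> count (mset_set A) i = (if i \<in> A then 1 else 0)"
  by simp

text \<open>A variable with exponent 2 lies in both columns, so only the distribution of the
  variables with exponent 1 is free.\<close>

lemma col_pairs_bij:
  assumes "\<And>i. count M i \<le> 2" "card (doubles M) \<le> a"
  shows "bij_betw (\<lambda>P. (doubles M \<union> P, doubles M \<union> (singles M - P)))
    (choose_subsets (singles M) (a - card (doubles M))) (col_pairs M a)"
proof (rule bij_betw_byWitness[where f' = "\<lambda>(A, B). A - B"])
  show "\<forall>P\<in>choose_subsets (singles M) (a - card (doubles M)).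
      (\<lambda>(A, B). A - B) (doubles M \<union> P, doubles M \<union> (singles M - P)) = P"
    using singles_doubles_disjoint by (auto simp: choose_subsets_def)
  have AB: "count M i = (if i \<in> A then 1 else 0) + (if i \<in> B then 1 else 0)" if "(A, B) \<in> col_pairs M a" for A B i
    using that by (auto simp: col_pairs_def count_mset_set_if)
  then have D: "doubles M = A \<inter> B" "singles M = (A - B) \<union> (B - A)" if "(A, B) \<in> col_pairs M a" for A B
    using that by (auto simp: doubles_def singles_def split: if_splits)
  show "\<forall>p\<in>col_pairs M a. (\<lambda>P. (doubles M \<union> P, doubles M \<union> (singles M - P))) ((\<lambda>(A, B). A - B) p) = p"
    using D by auto
  show "(\<lambda>P. (doubles M \<union> P, doubles M \<union> (singles M - P))) ` choose_subsets (singles M) (a - card (doubles M)) \<subseteq> col_pairs M a"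
  proof (rule image_subsetI)
    fix P assume "P \<in> choose_subsets (singles M) (a - card (doubles M))"
    then have P: "P \<subseteq> singles M" "card P = a - card (doubles M)" by (auto simp: choose_subsets_def)
    have fin: "finite P" using P(1) finite_singles finite_subset by blast
    have "card (doubles M \<union> P) = card (doubles M) + card P"
      using P(1) singles_doubles_disjoint fin finite_doubles by (intro card_Un_disjoint) auto
    moreover have "count (mset_set (doubles M \<union> P) + mset_set (doubles M \<union> (singles M - P))) i = count M i" for i
    proof -
      have "count M i = 0 \<or> count M i = 1 \<or> count M i = 2" using assms(1)[of i] by linarith
      then show ?thesis
        using P(1) fin finite_singles[of M] finite_doubles[of M] by (auto simp: count_mset_set_if singles_def doubles_def)
    qed
    ultimately show "(doubles M \<union> P, doubles M \<union> (singles M - P)) \<in> col_pairs M a"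
      using fin finite_singles finite_doubles P(2) assms(2) by (auto simp: col_pairs_def intro: multiset_eqI)
  qed
  show "(\<lambda>(A, B). A - B) ` col_pairs M a \<subseteq> choose_subsets (singles M) (a - card (doubles M))"
  proof (rule image_subsetI)
    fix p assume p: "p \<in> col_pairs M a"
    obtain A B where AB: "p = (A, B)" by (cases p)
    have "finite A" "card A = a" using p AB by (auto simp: col_pairs_def)
    then have "card (A - B) = a - card (A \<inter> B)" by (simp add: card_Diff_subset_Int)
    then show "(\<lambda>(A, B). A - B) p \<in> choose_subsets (singles M) (a - card (doubles M))"
      using D[of A B] p AB by (auto simp: choose_subsets_def)
  qed
qed

lemma col_pairs_props:
  assumes "(A, B) \<in> col_pairs M a"
  shows "count M i \<le> 2" "doubles M = A \<inter> B" "card (doubles M) \<le> a" "a \<le> size M" "card B = size M - a"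
    "a + card (doubles M) \<le> size M"
proof -
  have AB: "finite A" "finite B" "card A = a" "mset_set A + mset_set B = M" using assms by (auto simp: col_pairs_def)
  then have c: "count M i = (if i \<in> A then 1 else 0) + (if i \<in> B then 1 else 0)" for i
    by (auto simp: count_mset_set_if)
  then show "count M i \<le> 2" by simp
  show D: "doubles M = A \<inter> B" using c by (auto simp: doubles_def split: if_splits)
  then show "card (doubles M) \<le> a" using AB by (auto intro: card_mono)
  have s: "size M = a + card B" using AB by (metis size_mset_set size_union)
  then show "a \<le> size M" "card B = size M - a" by auto
  have "card (doubles M) \<le> card B" using D AB by (auto intro: card_mono)
  then show "a + card (doubles M) \<le> size M" using s by simp
qed

lemma size_singles_doubles:
  assumes "\<And>i. count M i \<le> 2"
  shows "size M = card (singles M) + 2 * card (doubles M)"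
proof -
  have "M = mset_set (singles M) + mset_set (doubles M) + mset_set (doubles M)"
  proof (rule multiset_eqI)
    fix i
    have "count M i = 0 \<or> count M i = 1 \<or> count M i = 2" using assms[of i] by linarith
    then show "count M i = count (mset_set (singles M) + mset_set (doubles M) + mset_set (doubles M)) i"
      using finite_singles[of M] finite_doubles[of M] by (auto simp: count_mset_set_if singles_def doubles_def)
  qed
  then have "size M = size (mset_set (singles M) + mset_set (doubles M) + mset_set (doubles M))" by simp
  then show ?thesis by simp
qed

lemma card_col_pairs:
  assumes "\<And>i. count M i \<le> 2"
  shows "card (col_pairs M a) = (if card (doubles M) \<le> a then card (singles M) choose (a - card (doubles M)) else 0)"
proof (cases "card (doubles M) \<le> a")
  case True
  then show ?thesis
    using bij_betw_same_card[OF col_pairs_bij[OF assms True]] card_choose_subsets[OF finite_singles] by simp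
next
  case False
  then have "col_pairs M a = {}" using col_pairs_props(3) by fastforce
  then show ?thesis using False by simp
qed

definition col_crossings :: "nat \<Rightarrow> nat set \<Rightarrow> nat set \<Rightarrow> nat" where
  "col_crossings s A B = card {y \<in> B - A. below A y = s + 1 + below B y}"

lemma below_Un:
  assumes "finite A" "finite B" "A \<inter> B = {}"
  shows "below (A \<union> B) y = below A y + below B y"
proof -
  have "{x \<in> A \<union> B. x < y} = {x \<in> A. x < y} \<union> {x \<in> B. x < y}" by auto
  then show ?thesis using assms unfolding below_def by (simp add: card_Un_disjoint disjoint_iff)
qed

text \<open>Variables in both columns raise both ranks equally and are excluded as crossings, so
  they may be dropped.\<close>

lemma col_crossings_doubles:
  assumes "P \<subseteq> singles M"
  shows "col_crossings s (doubles M \<union> P) (doubles M \<union> (singles M - P)) = crossings s P (singles M - P)"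
proof -
  let ?Q = "singles M - P"
  have fin: "finite P" "finite ?Q" using assms finite_singles finite_subset by auto
  have "(doubles M \<union> ?Q) - (doubles M \<union> P) = ?Q" using singles_doubles_disjoint[of M] by auto
  moreover have "below (doubles M \<union> P) y = below (doubles M) y + below P y"
    "below (doubles M \<union> ?Q) y = below (doubles M) y + below ?Q y" for y
    using fin finite_doubles[of M] singles_doubles_disjoint[of M] assms by (auto intro!: below_Un)
  ultimately show ?thesis by (simp add: col_crossings_def crossings_def)
qed

text \<open>The binomials of \<open>cross_gen_formula\<close> are rewritten as numbers of column
  pairs with a longer first column. After this the monomial enters only through its coefficients in
  the products e_k e_(n-k).\<close>

lemma col_crossings_gen:
  fixes q :: "'a::comm_ring_1"
  assumes "size M = n" "n < L"
  shows "(\<Sum>(A, B)\<in>col_pairs M a. q ^ col_crossings s A B) =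
    of_nat (card (col_pairs M a)) + (\<Sum>c<L. (q ^ Suc c - q ^ c) * of_nat (card (col_pairs M (max a (n - a + s) + Suc c))))"
proof (cases "col_pairs M a = {}")
  case False
  then obtain A0 B0 where AB: "(A0, B0) \<in> col_pairs M a" by auto
  note pr = col_pairs_props[OF AB]
  let ?d = "card (doubles M)" and ?S = "singles M"
  define p where "p = a - ?d"
  have a: "a = p + ?d" using pr by (simp add: p_def)
  have n: "n = card ?S + 2 * ?d" using size_singles_doubles[OF pr(1)] assms(1) by simp
  have pN: "p \<le> card ?S" using pr(6) assms(1) a n by simp
  have "(\<Sum>(A, B)\<in>col_pairs M a. q ^ col_crossings s A B) =
      (\<Sum>P\<in>choose_subsets ?S p. q ^ col_crossings s (doubles M \<union> P) (doubles M \<union> (?S - P)))"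
    using sum.reindex_bij_betw[OF col_pairs_bij[OF pr(1,3)], of "\<lambda>(A, B). q ^ col_crossings s A B"]
    by (simp add: p_def)
  also have "\<dots> = cross_gen q s ?S p"
    unfolding cross_gen_def by (rule sum.cong) (auto simp: choose_subsets_def col_crossings_doubles)
  also have "\<dots> = of_nat (card ?S choose p) + tail q L (card ?S) (max p (card ?S - p + s))"
    by (rule cross_gen_formula[OF finite_singles _ pN]) (use n assms(2) in simp)
  also have "card ?S choose p = card (col_pairs M a)"
    using card_col_pairs[OF pr(1), of a] pr(3) by (simp add: p_def)
  also have "tail q L (card ?S) (max p (card ?S - p + s)) =
      (\<Sum>c<L. (q ^ Suc c - q ^ c) * of_nat (card (col_pairs M (max a (n - a + s) + Suc c))))"
  proof -
    have "card ?S choose (max p (card ?S - p + s) + Suc c) = card (col_pairs M (max a (n - a + s) + Suc c))" for c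
    proof -
      have "max a (n - a + s) = max p (card ?S - p + s) + ?d" using a n pN by simp
      then show ?thesis using card_col_pairs[OF pr(1), of "max a (n - a + s) + Suc c"] by simp
    qed
    then show ?thesis by (simp only: tail_def)
  qed
  finally show ?thesis .
next
  case True
  \<comment> \<open>If no first column of length \<open>a\<close> is possible, then neither is one
    longer than both \<open>a\<close> and \<open>n - a\<close>, so both sides vanish.\<close>
  have zero: "card (col_pairs M (max a (n - a + s) + Suc c)) = 0" for c
  proof (rule ccontr)
    define k where "k = max a (n - a + s) + Suc c"
    assume "card (col_pairs M (max a (n - a + s) + Suc c)) \<noteq> 0"
    then have "col_pairs M k \<noteq> {}" unfolding k_def by (metis card.empty)
    then obtain A B where AB: "(A, B) \<in> col_pairs M k" by auto
    note pr = col_pairs_props[OF AB]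
    let ?d = "card (doubles M)"
    have "k > a" "k > n - a" by (auto simp: k_def)
    then have "?d \<le> a" "a \<le> n - ?d" using pr(6) assms(1) by linarith+
    then have "card (col_pairs M a) = card (singles M) choose (a - ?d)" "a - ?d \<le> card (singles M)"
      using card_col_pairs[OF pr(1), of a] size_singles_doubles[OF pr(1)] assms(1) by auto
    then have "card (col_pairs M a) \<noteq> 0" by simp
    then show False using True by simp
  qed
  show ?thesis unfolding zero using True by simp
qed

lemma coef_elem_mult:
  assumes "size M = n" "a \<le> n"
  shows "coef (elem a * elem (n - a)) M = of_nat (card (col_pairs M a))"
proof -
  define X where "X = {A. A \<subseteq># M \<and> size A = a \<and> (\<forall>i. count A i \<le> 1) \<and> (\<forall>i. count (M - A) i \<le> 1)}"
  have finX: "finite X" by (rule finite_subset[OF _ finite_submultisets[of M]]) (auto simp: X_def)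
  have "coef (elem a * elem (n - a)) M = (\<Sum>A\<in>X. 1)"
    unfolding coef_times
    by (rule sum.mono_neutral_cong_right)
      (use assms in \<open>auto simp: X_def elem_def size_Diff_submset\<close>)
  also have "\<dots> = of_nat (card X)" by simp
  also have "card X = card (col_pairs M a)"
  proof (rule bij_betw_same_card)
    show "bij_betw (\<lambda>A. (set_mset A, set_mset (M - A))) X (col_pairs M a)"
    proof (rule bij_betw_byWitness[where f' = "\<lambda>(A, B). mset_set A"])
      show "\<forall>A\<in>X. (\<lambda>(A, B). mset_set A) (set_mset A, set_mset (M - A)) = A"
        by (auto simp: X_def set_mset_squarefree)
      show "\<forall>p\<in>col_pairs M a. (\<lambda>A. (set_mset A, set_mset (M - A))) ((\<lambda>(A, B). mset_set A) p) = p"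
        by (auto simp: col_pairs_def)
      show "(\<lambda>A. (set_mset A, set_mset (M - A))) ` X \<subseteq> col_pairs M a"
      proof (rule image_subsetI)
        fix A assume A: "A \<in> X"
        then have m: "mset_set (set_mset A) = A" "mset_set (set_mset (M - A)) = M - A"
          by (auto simp: X_def intro: set_mset_squarefree)
        then have "card (set_mset A) = a" using A by (metis (mono_tags) X_def mem_Collect_eq size_mset_set)
        then show "(set_mset A, set_mset (M - A)) \<in> col_pairs M a" using m A by (auto simp: col_pairs_def X_def)
      qed
      show "(\<lambda>(A, B). mset_set A) ` col_pairs M a \<subseteq> X"
        by (auto simp: col_pairs_def X_def count_mset_set')
    qed
  qed
  finally show ?thesis .
qed

section \<open>Two-column Schur functions\<close>

lemma nth_less_iff_below:
  assumes "sorted_wrt (<) xs" "i < length xs"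
  shows "xs ! i < y \<longleftrightarrow> i < below (set xs) y"
  using assms
proof (induction xs arbitrary: i)
  case (Cons x xs)
  show ?case
  proof (cases "x < y")
    case True
    have "{z \<in> set (x # xs). z < y} = insert x {z \<in> set xs. z < y}" using True by auto
    moreover have "x \<notin> set xs" using Cons.prems(1) by auto
    ultimately have "below (set (x # xs)) y = Suc (below (set xs) y)" by (simp add: below_def)
    then show ?thesis using Cons True by (cases i) auto
  next
    case False
    have "{z \<in> set (x # xs). z < y} = {}" using False Cons.prems(1) by auto
    then have "below (set (x # xs)) y = 0" by (simp only: below_def card.empty)
    moreover have "\<forall>z\<in>set (x # xs). x \<le> z" using Cons.prems(1) by auto
    then have "x \<le> (x # xs) ! i" using nth_mem[OF Cons.prems(2)] by blast
    ultimately show ?thesis using False by simp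
  qed
qed simp

lemma below_nth: "sorted_wrt (<) xs \<Longrightarrow> i < length xs \<Longrightarrow> below (set xs) (xs ! i) = i"
proof -
  assume *: "sorted_wrt (<) xs" "i < length xs"
  have "j < below (set xs) (xs ! i) \<longleftrightarrow> j < i" if "j < length xs" for j
  proof -
    have "xs ! j < xs ! i \<longleftrightarrow> j < i" using * that sorted_wrt_nth_less[OF *(1)] by (metis linorder_neqE_nat order.asym)
    then show ?thesis using nth_less_iff_below[OF *(1) that] by simp
  qed
  moreover have "below (set xs) (xs ! i) \<le> length xs"
    unfolding below_def by (rule order_trans[OF card_mono card_length]) auto
  ultimately show ?thesis using *(2) by (metis linorder_neqE_nat order.strict_trans2 less_irrefl)
qed

lemma below_Suc: "finite A \<Longrightarrow> below A (Suc y) = below A y + (if y \<in> A then 1 else 0)"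
proof -
  assume fin: "finite A"
  have "{x \<in> A. x < Suc y} = {x \<in> A. x < y} \<union> (if y \<in> A then {y} else {})" by (auto simp: less_Suc_eq)
  then show ?thesis using fin by (simp add: below_def)
qed

text \<open>The row condition of a two-column tableau in terms of ranks: the entry of
  \<open>A\<close> in the row of \<open>y\<close> is at most \<open>y\<close>. The
  \<open>Suc\<close> makes the comparison weak.\<close>

definition col_standard :: "nat set \<Rightarrow> nat set \<Rightarrow> bool" where
  "col_standard A B \<longleftrightarrow> (\<forall>y\<in>B. below B y < below A (Suc y))"

lemma col_standard_nth:
  assumes "sorted_wrt (<) xs" "sorted_wrt (<) ys" "length ys \<le> length xs"
  shows "col_standard (set xs) (set ys) \<longleftrightarrow> (\<forall>i<length ys. xs ! i \<le> ys ! i)"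
proof -
  have "col_standard (set xs) (set ys) \<longleftrightarrow> (\<forall>i<length ys. below (set ys) (ys ! i) < below (set xs) (Suc (ys ! i)))"
    unfolding col_standard_def by (metis in_set_conv_nth)
  also have "\<dots> \<longleftrightarrow> (\<forall>i<length ys. xs ! i \<le> ys ! i)"
    using nth_less_iff_below[OF assms(1)] below_nth[OF assms(2)] assms(3) by (auto simp flip: less_Suc_eq_le)
  finally show ?thesis .
qed

text \<open>\<open>ballot\<close> tests only elements of \<open>Q\<close>. For general
  \<open>y\<close> the bound comes from the largest element of \<open>Q\<close> below
  \<open>y\<close>.\<close>

lemma ballot_below_le:
  assumes "finite P" "finite Q" "ballot P Q"
  shows "below Q y \<le> below P y"
proof (cases "{x \<in> Q. x < y} = {}")
  case False
  define z where "z = Max {x \<in> Q. x < y}"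
  have fin: "finite {x \<in> Q. x < y}" using assms by simp
  have z: "z \<in> Q" "z < y" "\<And>x. x \<in> Q \<Longrightarrow> x < y \<Longrightarrow> x \<le> z"
    using Max_in[OF fin False] Max_ge[OF fin] by (auto simp: z_def)
  have "{x \<in> Q. x < y} \<subseteq> {x \<in> Q. x < Suc z}" using z(3) by (auto simp: less_Suc_eq_le)
  then have "below Q y \<le> below Q (Suc z)" unfolding below_def using assms by (intro card_mono) auto
  also have "\<dots> = below Q z + 1" using z(1) assms by (simp add: below_Suc)
  also have "\<dots> \<le> below P z" using assms(3) z(1) by (auto simp: ballot_def Suc_le_eq)
  also have "\<dots> \<le> below P y" unfolding below_def using assms z(2) by (intro card_mono) auto
  finally show ?thesis .
qed (simp only: below_def card.empty le0)

text \<open>Common elements contribute equally to both ranks. At such a \<open>y\<close> the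
  condition is a weak inequality, which \<open>ballot_below_le\<close> supplies.\<close>

lemma col_standard_ballot:
  assumes "P \<subseteq> singles M"
  shows "col_standard (doubles M \<union> P) (doubles M \<union> (singles M - P)) \<longleftrightarrow> ballot P (singles M - P)"
proof -
  let ?D = "doubles M" and ?Q = "singles M - P"
  have fin: "finite P" "finite ?Q" "finite ?D"
    using finite_subset[OF assms finite_singles] by (simp_all add: finite_singles finite_doubles)
  have dis: "?D \<inter> P = {}" "?D \<inter> ?Q = {}" using assms singles_doubles_disjoint by auto
  have b: "below (?D \<union> P) y = below ?D y + below P y" "below (?D \<union> ?Q) y = below ?D y + below ?Q y" for y
    using fin dis by (auto intro!: below_Un)
  have "y \<notin> ?D \<union> P" if "y \<in> ?Q" for y using that singles_doubles_disjoint by auto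
  then show ?thesis
    using ballot_below_le[OF fin(1,2)] fin dis
    by (auto simp: col_standard_def ballot_def b below_Suc less_Suc_eq_le)
qed

definition two_col :: "nat \<Rightarrow> nat \<Rightarrow> nat list" where
  "two_col n m = replicate m 2 @ replicate (n - 2 * m) 1"

lemma two_col_nth: "2 * m \<le> n \<Longrightarrow> i < n - m \<Longrightarrow> two_col n m ! i = (if i < m then 2 else 1)"
  by (auto simp: two_col_def nth_append)

lemma length_two_col: "2 * m \<le> n \<Longrightarrow> length (two_col n m) = n - m"
  by (simp add: two_col_def)

text \<open>Strictly increasing columns are determined by their sets of entries, and weakly
  increasing rows amount to \<open>col_standard\<close>.\<close>

lemma two_col_tableaux:
  assumes "2 * m \<le> n" "size M = n"
  shows "bij_betw (\<lambda>T. (set (map (\<lambda>r. r ! 0) T), set (map (\<lambda>r. r ! 1) (take m T))))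
    (tableaux (two_col n m) M) {(A, B) \<in> col_pairs M (n - m). col_standard A B}"
proof (rule bij_betw_byWitness[where f' = "\<lambda>(A, B). map (\<lambda>i. sorted_list_of_set A ! i #
      (if i < m then [sorted_list_of_set B ! i] else [])) [0..<n - m]"])
  let ?f = "\<lambda>T. (set (map (\<lambda>r. r ! 0) T), set (map (\<lambda>r. r ! 1) (take m T)))"
  let ?g = "\<lambda>(A, B). map (\<lambda>i. sorted_list_of_set A ! i # (if i < m then [sorted_list_of_set B ! i] else [])) [0..<n - m]"
  have mn: "m \<le> n - m" using assms(1) by simp
  have concat_rows: "mset (concat (map (\<lambda>i. xs ! i # (if i < m then [ys ! i] else [])) [0..<n - m])) = mset xs + mset ys"
    if "length xs = n - m" "length ys = m" for xs ys :: "nat list"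
  proof -
    have "mset (concat (map (\<lambda>i. xs ! i # (if i < m then [ys ! i] else [])) [0..<k])) =
        mset (take k xs) + mset (take k ys)" if "k \<le> n - m" for k
      using that \<open>length xs = n - m\<close> \<open>length ys = m\<close>
      by (induction k) (auto simp: take_Suc_conv_app_nth)
    from this[of "n - m"] show ?thesis using that mn by simp
  qed
  {
    fix T assume T: "T \<in> tableaux (two_col n m) M"
    define xs where "xs = map (\<lambda>r. r ! 0) T"
    define ys where "ys = map (\<lambda>r. r ! 1) (take m T)"
    have ml: "map length T = two_col n m" and so: "\<And>r. r \<in> set T \<Longrightarrow> sorted r" and mM: "mset (concat T) = M"
      and col: "\<And>i j. Suc i < length T \<Longrightarrow> j < length (T ! Suc i) \<Longrightarrow> T ! i ! j < T ! Suc i ! j"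
      using T by (auto simp: tableaux_def ssyt_def)
    have lT: "length T = n - m" using ml length_two_col[OF assms(1)] by (metis length_map)
    have lr: "length (T ! i) = (if i < m then 2 else 1)" if "i < n - m" for i
      using arg_cong[OF ml, of "\<lambda>x. x ! i"] that lT two_col_nth[OF assms(1) that] by simp
    have lx: "length xs = n - m" "length ys = m" using lT mn by (simp_all add: xs_def ys_def)
    have T_eq: "T = map (\<lambda>i. xs ! i # (if i < m then [ys ! i] else [])) [0..<n - m]"
    proof (rule nth_equalityI)
      fix i assume "i < length T"
      then have i: "i < n - m" using lT by simp
      show "T ! i = map (\<lambda>i. xs ! i # (if i < m then [ys ! i] else [])) [0..<n - m] ! i"
        using lr[OF i] i lT lx
        by (auto simp: xs_def ys_def length_Suc_conv numeral_2_eq_2 split: if_splits)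
    qed (simp add: lT)
    have sx: "sorted_wrt (<) xs"
      unfolding sorted_wrt_iff_nth_Suc_transp[OF transp_on_less]
      using col[of _ 0] lr lT lx by (auto simp: xs_def)
    have sy: "sorted_wrt (<) ys"
      unfolding sorted_wrt_iff_nth_Suc_transp[OF transp_on_less]
      using col[of _ 1] lr lT lx mn by (auto simp: ys_def)
    have "xs ! i \<le> ys ! i" if "i < m" for i
    proof -
      have i: "i < length T" using that lT mn by simp
      then have "sorted (T ! i)" using so by simp
      moreover have "T ! i = [xs ! i, ys ! i]" using arg_cong[OF T_eq, of "\<lambda>x. x ! i"] that i lT by simp
      ultimately show ?thesis by simp
    qed
    then have st: "col_standard (set xs) (set ys)" using col_standard_nth[OF sx sy] lx mn by simp
    have "mset_set (set xs) + mset_set (set ys) = M"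
      using concat_rows[OF lx] T_eq mM sx sy by (simp add: mset_set_set strict_sorted_iff)
    moreover have "card (set xs) = n - m" using sx lx by (simp add: distinct_card strict_sorted_iff)
    ultimately have "(set xs, set ys) \<in> col_pairs M (n - m)" by (simp add: col_pairs_def)
    moreover have "sorted_list_of_set (set xs) = xs" "sorted_list_of_set (set ys) = ys"
      using sx sy by (simp_all add: sorted_list_of_set.idem_if_sorted_distinct strict_sorted_iff)
    moreover have fT: "?f T = (set xs, set ys)" by (simp only: xs_def ys_def)
    ultimately have "?g (?f T) = T" "?f T \<in> {(A, B) \<in> col_pairs M (n - m). col_standard A B}"
      unfolding fT prod.case using st T_eq by (simp_all only: mem_Collect_eq prod.case)
  }
  then show "\<forall>T\<in>tableaux (two_col n m) M. ?g (?f T) = T"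
    and "?f ` tableaux (two_col n m) M \<subseteq> {(A, B) \<in> col_pairs M (n - m). col_standard A B}" by blast+
  {
    fix p assume "p \<in> {(A, B) \<in> col_pairs M (n - m). col_standard A B}"
    then obtain A B where p: "p = (A, B)" and AB: "(A, B) \<in> col_pairs M (n - m)" and st: "col_standard A B" by auto
    define xs where "xs = sorted_list_of_set A"
    define ys where "ys = sorted_list_of_set B"
    have fin: "finite A" "finite B" "card A = n - m" "mset_set A + mset_set B = M" using AB by (auto simp: col_pairs_def)
    have cB: "card B = m" using col_pairs_props(5)[OF AB] assms by simp
    have lx: "length xs = n - m" "length ys = m" using fin cB by (simp_all add: xs_def ys_def)
    have s: "sorted_wrt (<) xs" "sorted_wrt (<) ys" by (simp_all add: xs_def ys_def)
    have set: "set xs = A" "set ys = B" using fin by (simp_all add: xs_def ys_def)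
    have le: "xs ! i \<le> ys ! i" if "i < m" for i
      using col_standard_nth[OF s] st lx mn that by (simp add: set)
    define T where "T = map (\<lambda>i. xs ! i # (if i < m then [ys ! i] else [])) [0..<n - m]"
    have "map length T = two_col n m"
      by (rule nth_equalityI) (simp_all add: T_def length_two_col[OF assms(1)] two_col_nth[OF assms(1)])
    moreover have "sorted r" if "r \<in> set T" for r using that le by (auto simp: T_def)
    moreover have "T ! i ! j < T ! Suc i ! j" if "Suc i < length T" "j < length (T ! Suc i)" for i j
    proof -
      have "xs ! i < xs ! Suc i" using s(1) lx that(1) by (simp add: T_def sorted_wrt_nth_less)
      moreover have "ys ! i < ys ! Suc i" if "Suc i < m" using s(2) lx that by (simp add: sorted_wrt_nth_less)
      ultimately show ?thesis using that by (cases j) (auto simp: T_def split: if_splits)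
    qed
    moreover have "mset (concat T) = M"
      unfolding T_def concat_rows[OF lx] using fin(4) s set by (metis mset_set_set strict_sorted_iff)
    ultimately have "T \<in> tableaux (two_col n m) M" by (auto simp: tableaux_def ssyt_def)
    moreover have "?g p = T" by (simp add: p T_def xs_def ys_def)
    moreover have "map (\<lambda>r. r ! 0) T = xs" using lx by (auto simp: T_def intro: nth_equalityI)
    moreover have "map (\<lambda>r. r ! 1) (take m T) = ys"
      using lx mn by (auto simp: T_def intro!: nth_equalityI)
    ultimately have "?f (?g p) = p" "?g p \<in> tableaux (two_col n m) M" by (simp_all add: p set)
  }
  then show "\<forall>p\<in>{(A, B) \<in> col_pairs M (n - m). col_standard A B}. ?f (?g p) = p"
    and "?g ` {(A, B) \<in> col_pairs M (n - m). col_standard A B} \<subseteq> tableaux (two_col n m) M" by blast+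
qed

lemma image_filter_eq: "{x \<in> f ` A. P x} = f ` {a \<in> A. P (f a)}"
  by auto

lemma card_standard_pairs:
  assumes "2 * m \<le> n" "size M = n"
  shows "card {(A, B) \<in> col_pairs M (n - m). col_standard A B} + card (col_pairs M (Suc (n - m))) =
    card (col_pairs M (n - m))"
proof (cases "col_pairs M (n - m) = {}")
  case False
  then obtain A0 B0 where AB: "(A0, B0) \<in> col_pairs M (n - m)" by auto
  note pr = col_pairs_props[OF AB]
  let ?S = "singles M" and ?D = "doubles M"
  define p where "p = n - m - card ?D"
  let ?h = "\<lambda>P. (?D \<union> P, ?D \<union> (?S - P))"
  have bij: "bij_betw ?h (choose_subsets ?S p) (col_pairs M (n - m))"
    unfolding p_def by (rule col_pairs_bij[OF pr(1,3)])
  have std: "col_standard (?D \<union> P) (?D \<union> (?S - P)) \<longleftrightarrow> ballot P (?S - P)" if "P \<in> choose_subsets ?S p" for P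
    using that col_standard_ballot by (auto simp: choose_subsets_def)
  have "{(A, B) \<in> col_pairs M (n - m). col_standard A B} = {x \<in> ?h ` choose_subsets ?S p. case x of (A, B) \<Rightarrow> col_standard A B}"
    unfolding bij_betw_imp_surj_on[OF bij] by auto
  also have "\<dots> = ?h ` {P \<in> choose_subsets ?S p. case ?h P of (A, B) \<Rightarrow> col_standard A B}"
    by (rule image_filter_eq)
  also have "\<dots> = ?h ` {P \<in> choose_subsets ?S p. col_standard (?D \<union> P) (?D \<union> (?S - P))}" by simp
  also have "{P \<in> choose_subsets ?S p. col_standard (?D \<union> P) (?D \<union> (?S - P))} = {P \<in> choose_subsets ?S p. ballot P (?S - P)}"
    by (simp add: std cong: conj_cong)
  finally have img: "?h ` {P \<in> choose_subsets ?S p. ballot P (?S - P)} = {(A, B) \<in> col_pairs M (n - m). col_standard A B}" ..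
  have injB: "inj_on ?h {P \<in> choose_subsets ?S p. ballot P (?S - P)}"
    using bij_betw_imp_inj_on[OF bij] by (rule inj_on_subset) auto
  have "card {(A, B) \<in> col_pairs M (n - m). col_standard A B} = card {P \<in> choose_subsets ?S p. ballot P (?S - P)}"
    unfolding img[symmetric] by (rule card_image[OF injB])
  moreover have N: "n = card ?S + 2 * card ?D" using size_singles_doubles[OF pr(1)] assms(2) by simp
  then have "card ?S \<le> 2 * p" using assms(1) pr(3) by (simp add: p_def)
  then have "card {P \<in> choose_subsets ?S p. ballot P (?S - P)} + (card ?S choose Suc p) = card ?S choose p"
    using ballot_count[OF finite_singles] by blast
  moreover have "card (col_pairs M (Suc (n - m))) = card ?S choose Suc p" "card (col_pairs M (n - m)) = card ?S choose p"
    using card_col_pairs[OF pr(1)] pr(3) by (simp_all add: p_def Suc_diff_le)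
  ultimately show ?thesis by simp
next
  case True
  have "col_pairs M (Suc (n - m)) = {}"
  proof (rule ccontr)
    assume "col_pairs M (Suc (n - m)) \<noteq> {}"
    then obtain A B where AB: "(A, B) \<in> col_pairs M (Suc (n - m))" by auto
    note pr = col_pairs_props[OF AB]
    have le: "card (doubles M) \<le> n - m" "n - m - card (doubles M) \<le> card (singles M)"
      using pr(6) assms size_singles_doubles[OF pr(1)] by linarith+
    then show False using card_col_pairs[OF pr(1), of "n - m"] True by simp
  qed
  then show ?thesis using True by simp
qed

text \<open>The dual Jacobi-Trudi formula for two columns. The subtracted product accounts for the
  column pairs that fail \<open>col_standard\<close>.\<close>

lemma schur_two_col:
  assumes "2 * m \<le> n"
  shows "schur (two_col n m) = (elem m * elem (n - m) :: 'a::comm_ring_1 series) - (if m = 0 then 0 else elem (m - 1) * elem (n - (m - 1)))"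
proof (rule series_eqI)
  fix M :: "nat multiset"
  show "coef (schur (two_col n m)) M =
      coef ((elem m * elem (n - m) :: 'a series) - (if m = 0 then 0 else elem (m - 1) * elem (n - (m - 1)))) M"
  proof (cases "size M = n")
    case True
    have c1: "coef (elem m * elem (n - m) :: 'a series) M = of_nat (card (col_pairs M (n - m)))"
      using coef_elem_mult[OF True, of "n - m"] assms by (simp add: mult.commute)
    have c2: "coef (if m = 0 then 0 else elem (m - 1) * elem (n - (m - 1)) :: 'a series) M = of_nat (card (col_pairs M (Suc (n - m))))"
    proof (cases m)
      case 0
      have "col_pairs M (Suc n) = {}" using col_pairs_props(4)[of _ _ M "Suc n"] True by fastforce
      then show ?thesis using 0 by simp
    next
      case (Suc k)
      then have "Suc (n - m) = n - k" "n - (n - k) = k" using assms by auto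
      then show ?thesis using coef_elem_mult[OF True, of "n - k"] Suc by (simp add: mult.commute)
    qed
    have "card (tableaux (two_col n m) M) + card (col_pairs M (Suc (n - m))) = card (col_pairs M (n - m))"
      using bij_betw_same_card[OF two_col_tableaux[OF assms True]] card_standard_pairs[OF assms True] by simp
    then have "of_nat (card (tableaux (two_col n m) M)) + of_nat (card (col_pairs M (Suc (n - m)))) =
        (of_nat (card (col_pairs M (n - m))) :: 'a)" by (metis of_nat_add)
    then show ?thesis by (simp add: c1 c2 schur_def tableaux_def[symmetric] algebra_simps)
  next
    case False
    have "size M = sum_list (two_col n m)" if "T \<in> tableaux (two_col n m) M" for T
    proof -
      have "map length T = two_col n m" "mset (concat T) = M" using that by (auto simp: tableaux_def ssyt_def)
      then show ?thesis by (metis length_concat size_mset)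
    qed
    moreover have "sum_list (two_col n m) = n" using assms by (simp add: two_col_def sum_list_replicate)
    ultimately have "tableaux (two_col n m) M = {}" using False by auto
    moreover have "coef (elem k * elem (n - k) :: 'a series) M = 0" if "k \<le> n" for k
      using homog_mult[OF elem_homog[of k] elem_homog[of "n - k"]] that False by (auto simp: homog_def)
    from this[of m] this[of "m - 1"]
    have "coef (elem m * elem (n - m) :: 'a series) M = 0" "coef (elem (m - 1) * elem (n - (m - 1)) :: 'a series) M = 0"
      using assms by auto
    ultimately show ?thesis by (cases m) (simp_all add: schur_def tableaux_def[symmetric])
  qed
qed

lemma sum_telescope_pairing:
  fixes c :: "nat \<Rightarrow> 'a::field" and E :: "nat \<Rightarrow> 'a series"
  shows "(\<Sum>m=0..h. scale (c m) (E m - (if m = 0 then 0 else E (m - 1)))) =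
    (\<Sum>m=0..h. scale (c m - c (Suc m)) (E m)) + scale (c (Suc h)) (E h)"
proof (induction h)
  case 0
  then show ?case by (simp add: series.scale_left_diff_distrib)
next
  case (Suc h)
  have "(\<Sum>m=0..Suc h. scale (c m) (E m - (if m = 0 then 0 else E (m - 1)))) =
      (\<Sum>m=0..h. scale (c m - c (Suc m)) (E m)) + scale (c (Suc h)) (E h) + scale (c (Suc h)) (E (Suc h) - E h)"
    using Suc.IH by simp
  then show ?case by (simp add: series.scale_left_diff_distrib series.scale_right_diff_distrib)
qed

text \<open>Summation by parts turns the differences of products into differences of the inner sums.
  Passing from m to m + 1 these lose \<open>b m\<close> and \<open>b (n - m)\<close>, the
  coefficients of the equal products for k = m and k = n - m.\<close>

lemma schur_expansion:
  fixes b :: "nat \<Rightarrow> 'a::field"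
  assumes "b 0 = 0"
  shows "(\<Sum>m=0..n div 2. scale (\<Sum>p=m..n - m. b p) (schur (two_col n m))) =
    (\<Sum>k=1..n. scale (b k) (elem k * elem (n - k)))"
proof -
  define h where "h = n div 2"
  define E where "E m = (elem m * elem (n - m) :: 'a series)" for m
  define c where "c m = (\<Sum>p=m..n - m. b p)" for m
  have sym: "E (n - k) = E k" if "k \<le> n" for k using that by (simp add: E_def mult.commute)
  have "(\<Sum>m=0..h. scale (c m) (schur (two_col n m))) = (\<Sum>m=0..h. scale (c m) (E m - (if m = 0 then 0 else E (m - 1))))"
    by (rule sum.cong) (auto simp: h_def schur_two_col E_def)
  also have "\<dots> = (\<Sum>m=0..h. scale (c m - c (Suc m)) (E m)) + scale (c (Suc h)) (E h)"
    by (rule sum_telescope_pairing)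
  \<comment> \<open>Beyond the middle the range of the inner sum is empty.\<close>
  also have "c (Suc h) = 0" by (auto simp: c_def h_def intro!: sum.neutral)
  also have "(\<Sum>m=0..h. scale (c m - c (Suc m)) (E m)) =
      (\<Sum>m=0..h. scale (b m) (E m) + (if m < n - m then scale (b (n - m)) (E m) else 0))"
  proof (rule sum.cong)
    fix m assume "m \<in> {0..h}"
    then have m: "2 * m \<le> n" by (auto simp: h_def)
    \<comment> \<open>For \<open>n = 2 * m\<close> the two ends of the range coincide and count
      once.\<close>
    have "c m - c (Suc m) = b m + (if m < n - m then b (n - m) else 0)"
    proof (cases "m < n - m")
      case True
      then have "{m..n - m} = insert m (insert (n - m) {Suc m..n - Suc m})" by auto
      then show ?thesis using True by (simp add: c_def)
    next
      case False
      then have "n - m = m" using m by simp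
      then show ?thesis using m by (simp add: c_def)
    qed
    then show "scale (c m - c (Suc m)) (E m) = scale (b m) (E m) + (if m < n - m then scale (b (n - m)) (E m) else 0)"
      by (simp add: series.scale_left_distrib)
  qed simp
  also have "\<dots> = (\<Sum>m=0..h. scale (b m) (E m)) + (\<Sum>m\<in>{m \<in> {0..h}. m < n - m}. scale (b (n - m)) (E m))"
    unfolding sum.distrib by (simp only: sum.inter_filter finite_atLeastAtMost)
  also have "(\<Sum>m\<in>{m \<in> {0..h}. m < n - m}. scale (b (n - m)) (E m)) = (\<Sum>k=Suc h..n. scale (b k) (E k))"
    by (rule sum.reindex_bij_witness[of _ "\<lambda>k. n - k" "\<lambda>m. n - m"]) (auto simp: h_def sym)
  also have "(\<Sum>m=0..h. scale (b m) (E m)) + (\<Sum>k=Suc h..n. scale (b k) (E k)) = (\<Sum>k=0..n. scale (b k) (E k))"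
  proof -
    have "{0..n} = {0..h} \<union> {Suc h..n}" by (auto simp: h_def)
    then show ?thesis by (simp add: sum.union_disjoint)
  qed
  also have "\<dots> = (\<Sum>k=1..n. scale (b k) (E k))"
    using assms by (simp add: sum.atLeast_Suc_atMost)
  finally show ?thesis by (simp add: c_def h_def E_def)
qed

section \<open>The alternating sum over column lengths\<close>

definition geo_tail :: "'a::comm_ring_1 \<Rightarrow> nat \<Rightarrow> (nat \<Rightarrow> 'a) \<Rightarrow> nat \<Rightarrow> 'a" where
  "geo_tail q J \<epsilon> m = (\<Sum>j<J. q ^ j * \<epsilon> (m + j))"

lemma geo_tail_shift:
  assumes "\<And>k. J \<le> k \<Longrightarrow> \<epsilon> k = 0"
  shows "geo_tail q J \<epsilon> m = \<epsilon> m + q * geo_tail q J \<epsilon> (Suc m)"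
proof (cases J)
  case 0
  then show ?thesis using assms by (simp add: geo_tail_def)
next
  case (Suc J')
  have "geo_tail q J \<epsilon> m = \<epsilon> m + q * (\<Sum>j<J'. q ^ j * \<epsilon> (Suc m + j))"
    unfolding geo_tail_def Suc sum.lessThan_Suc_shift by (simp add: sum_distrib_left mult.assoc)
  also have "(\<Sum>j<J'. q ^ j * \<epsilon> (Suc m + j)) = geo_tail q J \<epsilon> (Suc m)"
    using assms by (simp add: geo_tail_def Suc)
  finally show ?thesis .
qed

text \<open>The contribution of one exponent \<open>s\<close> of t in
  \<open>column_identity\<close>, with \<open>m = n - s\<close> and \<open>i = a - s\<close>;
  \<open>J\<close> is a cutoff.\<close>

definition col_sum :: "'a::comm_ring_1 \<Rightarrow> nat \<Rightarrow> (nat \<Rightarrow> 'a) \<Rightarrow> nat \<Rightarrow> 'a" where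
  "col_sum q J \<epsilon> m = (\<Sum>i=1..m - 1. q ^ min (m - i) (i - 1) *
     (\<epsilon> i + (\<Sum>c<J. (q ^ Suc c - q ^ c) * \<epsilon> (max i (m - i) + Suc c))))"

lemma sum_first_last:
  "(\<Sum>i=1..Suc (Suc k). f i) = f 1 + (\<Sum>i=1..k. f (Suc i)) + (f (Suc (Suc k)) :: 'a::comm_monoid_add)"
proof (induction k)
  case (Suc k)
  have "(\<Sum>i=1..Suc (Suc (Suc k)). f i) = (\<Sum>i=1..Suc (Suc k). f i) + f (Suc (Suc (Suc k)))" by simp
  then show ?case unfolding Suc.IH by (simp add: add.assoc)
qed simp

text \<open>Splitting off the first and last summands relates \<open>m\<close> to \<open>m - 2\<close>.\<close>

lemma col_sum_formula:
  assumes "\<And>k. J \<le> k \<Longrightarrow> \<epsilon> k = 0" "m > 0"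
  shows "col_sum q J \<epsilon> m = (\<Sum>k=1..m - 1. q ^ (k - 1) * \<epsilon> k) + (q ^ (m - 1) - 1) * geo_tail q J \<epsilon> m"
  using assms
proof (induction m arbitrary: \<epsilon> rule: less_induct)
  case (less m)
  have K: "(\<Sum>c<J. (q ^ Suc c - q ^ c) * \<epsilon> (r + Suc c)) = (q - 1) * geo_tail q J \<epsilon> (Suc r)" for r and \<epsilon> :: "nat \<Rightarrow> 'a"
    unfolding geo_tail_def sum_distrib_left by (rule sum.cong) (simp_all add: algebra_simps)
  define F where "F \<epsilon> m i = q ^ min (m - i) (i - 1) * (\<epsilon> i + (q - 1) * geo_tail q J \<epsilon> (Suc (max i (m - i))))" for \<epsilon> :: "nat \<Rightarrow> 'a" and m i
  have cs: "col_sum q J \<epsilon> m = (\<Sum>i=1..m - 1. F \<epsilon> m i)" for \<epsilon> :: "nat \<Rightarrow> 'a" and m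
    unfolding col_sum_def K F_def ..
  consider "m = 1" | "m = 2" | k where "m = Suc (Suc (Suc k))"
    using less.prems(2) by (metis One_nat_def Suc_1 not0_implies_Suc neq0_conv)
  then show ?case
  proof cases
    case 1
    then show ?thesis by (simp add: cs)
  next
    case 2
    then show ?thesis by (simp add: cs F_def numeral_2_eq_2)
  next
    case 3
    define \<epsilon>' where "\<epsilon>' i = \<epsilon> (Suc i)" for i
    have z: "\<epsilon>' j = 0" if "J \<le> j" for j using less.prems(1) that by (simp add: \<epsilon>'_def)
    have gt: "geo_tail q J \<epsilon>' r = geo_tail q J \<epsilon> (Suc r)" for r by (simp add: geo_tail_def \<epsilon>'_def)
    \<comment> \<open>Passing to \<epsilon>' lowers \<open>m\<close> by 2 and the index by 1, hence
      the minimum in the exponent by 1, whence the factor \<open>q\<close>.\<close>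
    have F': "F \<epsilon> m (Suc i) = q * F \<epsilon>' (Suc k) i" if "i \<in> {1..k}" for i
    proof -
      have "min (m - Suc i) (Suc i - 1) = Suc (min (Suc k - i) (i - 1))" "max (Suc i) (m - Suc i) = Suc (max i (Suc k - i))"
        using that 3 by auto
      then show ?thesis by (simp add: F_def gt \<epsilon>'_def mult.assoc)
    qed
    have "col_sum q J \<epsilon> m = F \<epsilon> m 1 + (\<Sum>i=1..k. F \<epsilon> m (Suc i)) + F \<epsilon> m (Suc (Suc k))"
      unfolding cs 3 diff_Suc_1 by (rule sum_first_last)
    also have "(\<Sum>i=1..k. F \<epsilon> m (Suc i)) = q * col_sum q J \<epsilon>' (Suc k)"
      unfolding cs sum_distrib_left using F' by (intro sum.cong) auto
    also have "col_sum q J \<epsilon>' (Suc k) = (\<Sum>i=1..k. q ^ (i - 1) * \<epsilon>' i) + (q ^ k - 1) * geo_tail q J \<epsilon>' (Suc k)"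
      using less.IH[of "Suc k" \<epsilon>', OF _ z] 3 by simp
    also have "geo_tail q J \<epsilon>' (Suc k) = \<epsilon> (Suc (Suc k)) + q * geo_tail q J \<epsilon> m"
      unfolding gt 3 by (rule geo_tail_shift) (rule less.prems(1))
    also have "F \<epsilon> m 1 = \<epsilon> 1 + (q - 1) * geo_tail q J \<epsilon> m" by (simp add: F_def 3)
    also have "F \<epsilon> m (Suc (Suc k)) = q * (\<epsilon> (Suc (Suc k)) + (q - 1) * geo_tail q J \<epsilon> m)" by (simp add: F_def 3)
    finally have L: "col_sum q J \<epsilon> m = \<epsilon> 1 + q * (\<Sum>i=1..k. q ^ (i - 1) * \<epsilon>' i) + q ^ Suc k * \<epsilon> (Suc (Suc k)) +
        (q ^ (m - 1) - 1) * geo_tail q J \<epsilon> m"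
      by (simp add: 3 algebra_simps)
    have "(\<Sum>i=1..m - 1. q ^ (i - 1) * \<epsilon> i) = \<epsilon> 1 + (\<Sum>i=1..k. q ^ (Suc i - 1) * \<epsilon> (Suc i)) + q ^ Suc k * \<epsilon> (Suc (Suc k))"
      unfolding 3 diff_Suc_1 by (subst sum_first_last) simp
    also have "(\<Sum>i=1..k. q ^ (Suc i - 1) * \<epsilon> (Suc i)) = q * (\<Sum>i=1..k. q ^ (i - 1) * \<epsilon>' i)"
      unfolding sum_distrib_left
    proof (rule sum.cong)
      fix i assume "i \<in> {1..k}"
      then show "q ^ (Suc i - 1) * \<epsilon> (Suc i) = q * (q ^ (i - 1) * \<epsilon>' i)" by (cases i) (auto simp: \<epsilon>'_def)
    qed simp
    finally show ?thesis unfolding L by simp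
  qed
qed

text \<open>Compared power by power in t: for fixed \<open>s\<close> the inner sum on the right is a
  \<open>col_sum\<close> in shifted unknowns, and its closed form reproduces the geometric weights
  on the left. The unknown at \<open>n\<close> stands apart, as it belongs to the path with one
  column.\<close>

lemma column_identity:
  fixes q t :: "'a::comm_ring_1"
  assumes "\<And>k. n < k \<Longrightarrow> \<epsilon> k = 0"
  shows "(\<Sum>k=1..n. (\<Sum>i<k. q ^ i * t ^ (k - i - 1)) * \<epsilon> k) =
    (\<Sum>s<n. t ^ s * \<epsilon> n) + (\<Sum>a=1..n - 1. \<Sum>s<a. t ^ s * q ^ min (n - a) (a - 1 - s) *
      (\<epsilon> a + (\<Sum>c<Suc n. (q ^ Suc c - q ^ c) * \<epsilon> (max a (n - a + s) + Suc c))))"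
proof -
  define G where "G a s = q ^ min (n - a) (a - 1 - s) *
      (\<epsilon> a + (\<Sum>c<Suc n. (q ^ Suc c - q ^ c) * \<epsilon> (max a (n - a + s) + Suc c)))" for a s
  have row: "(\<Sum>k=Suc s..n. q ^ (k - 1 - s) * \<epsilon> k) = \<epsilon> n + (\<Sum>a=Suc s..n - 1. G a s)" if s: "s < n" for s
  proof -
    define \<epsilon>' where "\<epsilon>' i = \<epsilon> (s + i)" for i
    define m where "m = n - s"
    have m: "m > 0" "n = s + m" using s by (auto simp: m_def)
    have "(\<Sum>a=Suc s..n - 1. G a s) = col_sum q (Suc n) \<epsilon>' m"
      unfolding col_sum_def
    proof (rule sum.reindex_bij_witness[of _ "\<lambda>i. s + i" "\<lambda>a. a - s"])
      fix a assume a: "a \<in> {Suc s..n - 1}"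
      then have "max a (n - a + s) = s + max (a - s) (m - (a - s))" using m by auto
      moreover have "min (n - a) (a - 1 - s) = min (m - (a - s)) (a - s - 1)" using a m by auto
      ultimately show "q ^ min (m - (a - s)) (a - s - 1) *
         (\<epsilon>' (a - s) + (\<Sum>c<Suc n. (q ^ Suc c - q ^ c) * \<epsilon>' (max (a - s) (m - (a - s)) + Suc c))) = G a s"
        using a by (simp add: G_def \<epsilon>'_def add.assoc)
    qed (use m in auto)
    also have "\<dots> = (\<Sum>k=1..m - 1. q ^ (k - 1) * \<epsilon>' k) + (q ^ (m - 1) - 1) * geo_tail q (Suc n) \<epsilon>' m"
      using assms m by (intro col_sum_formula) (auto simp: \<epsilon>'_def)
    \<comment> \<open>The geometric tail starts at the last unknown, since \<epsilon> vanishes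
      beyond \<open>n\<close>.\<close>
    also have "geo_tail q (Suc n) \<epsilon>' m = \<epsilon> n"
    proof -
      have "geo_tail q (Suc n) \<epsilon>' m = (\<Sum>j\<in>{0}. q ^ j * \<epsilon>' (m + j))"
        unfolding geo_tail_def using assms m by (intro sum.mono_neutral_right) (auto simp: \<epsilon>'_def)
      then show ?thesis by (simp add: \<epsilon>'_def m)
    qed
    also have "(\<Sum>k=1..m - 1. q ^ (k - 1) * \<epsilon>' k) + (q ^ (m - 1) - 1) * \<epsilon> n = (\<Sum>k=1..m. q ^ (k - 1) * \<epsilon>' k) - \<epsilon> n"
    proof -
      obtain m' where "m = Suc m'" using m(1) by (cases m) auto
      then show ?thesis by (simp add: \<epsilon>'_def m(2) algebra_simps)
    qed
    also have "(\<Sum>k=1..m. q ^ (k - 1) * \<epsilon>' k) = (\<Sum>k=Suc s..n. q ^ (k - 1 - s) * \<epsilon> k)"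
      by (rule sum.reindex_bij_witness[of _ "\<lambda>k. k - s" "\<lambda>i. s + i"]) (auto simp: \<epsilon>'_def m)
    finally show ?thesis by simp
  qed
  have "(\<Sum>k=1..n. (\<Sum>i<k. q ^ i * t ^ (k - i - 1)) * \<epsilon> k) = (\<Sum>k=1..n. \<Sum>s<k. t ^ s * (q ^ (k - 1 - s) * \<epsilon> k))"
  proof (rule sum.cong)
    fix k
    have "(\<Sum>i<k. q ^ i * t ^ (k - i - 1)) = (\<Sum>s<k. t ^ s * q ^ (k - 1 - s))"
      by (rule sum.reindex_bij_witness[of _ "\<lambda>s. k - 1 - s" "\<lambda>i. k - 1 - i"]) (auto simp: mult.commute)
    then show "(\<Sum>i<k. q ^ i * t ^ (k - i - 1)) * \<epsilon> k = (\<Sum>s<k. t ^ s * (q ^ (k - 1 - s) * \<epsilon> k))"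
      by (simp add: sum_distrib_right mult.assoc)
  qed simp
  also have "\<dots> = (\<Sum>(k, s)\<in>Sigma {1..n} (\<lambda>k. {..<k}). t ^ s * (q ^ (k - 1 - s) * \<epsilon> k))"
    by (simp add: sum.Sigma)
  also have "\<dots> = (\<Sum>(s, k)\<in>Sigma {..<n} (\<lambda>s. {Suc s..n}). t ^ s * (q ^ (k - 1 - s) * \<epsilon> k))"
    by (rule sum.reindex_bij_witness[of _ "\<lambda>(s, k). (k, s)" "\<lambda>(k, s). (s, k)"]) auto
  also have "\<dots> = (\<Sum>s<n. t ^ s * (\<Sum>k=Suc s..n. q ^ (k - 1 - s) * \<epsilon> k))"
    by (simp add: sum.Sigma[symmetric] sum_distrib_left)
  also have "\<dots> = (\<Sum>s<n. t ^ s * \<epsilon> n) + (\<Sum>s<n. \<Sum>a=Suc s..n - 1. t ^ s * G a s)"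
    using row by (simp add: ring_distribs sum.distrib sum_distrib_left)
  also have "(\<Sum>s<n. \<Sum>a=Suc s..n - 1. t ^ s * G a s) = (\<Sum>(s, a)\<in>Sigma {..<n} (\<lambda>s. {Suc s..n - 1}). t ^ s * G a s)"
    by (simp add: sum.Sigma)
  also have "\<dots> = (\<Sum>(a, s)\<in>Sigma {1..n - 1} (\<lambda>a. {..<a}). t ^ s * G a s)"
    by (rule sum.reindex_bij_witness[of _ "\<lambda>(s, k). (k, s)" "\<lambda>(k, s). (s, k)"]) auto
  also have "\<dots> = (\<Sum>a=1..n - 1. \<Sum>s<a. t ^ s * G a s)" by (simp add: sum.Sigma)
  finally show ?thesis by (simp add: G_def mult.assoc)
qed

section \<open>Dyck paths with at most two columns\<close>

lemma count_list_replicate: "count_list (replicate k x) y = (if x = y then k else 0)"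
  by (induction k) auto

lemma length_count_list: "length w = count_list w North + count_list w East"
proof (induction w)
  case (Cons x w)
  then show ?case by (cases x) auto
qed simp

lemma length_north_xs: "length (north_xs x w) = count_list w North"
  by (induction x w rule: north_xs.induct) auto

lemma north_xs_ge: "y \<in> set (north_xs x w) \<Longrightarrow> x \<le> y"
  by (induction x w rule: north_xs.induct) auto

lemma sorted_north_xs: "sorted (north_xs x w)"
  by (induction x w rule: north_xs.induct) (auto dest: north_xs_ge)

lemma north_xs_prefix:
  "i < length (north_xs x w) \<Longrightarrow>
    \<exists>j\<le>length w. count_list (take j w) North = i \<and> x + count_list (take j w) East = north_xs x w ! i"
proof (induction x w arbitrary: i rule: north_xs.induct)
  case (2 x w)
  show ?case
  proof (cases i)
    case 0
    then show ?thesis by (intro exI[of _ 0]) simp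
  next
    case (Suc i')
    then obtain j where "j \<le> length w" "count_list (take j w) North = i'" "x + count_list (take j w) East = north_xs x w ! i'"
      using 2 by auto
    then show ?thesis using Suc by (intro exI[of _ "Suc j"]) simp
  qed
next
  case (3 x w)
  then obtain j where "j \<le> length w" "count_list (take j w) North = i" "Suc x + count_list (take j w) East = north_xs (Suc x) w ! i"
    by auto
  then show ?case by (intro exI[of _ "Suc j"]) simp
qed simp

text \<open>A north step of one path against an east step of the other would make the next
  coordinates differ. The number of east steps fixes those at the end.\<close>

lemma north_xs_inject:
  assumes "north_xs x w = north_xs x w'" "count_list w East = count_list w' East"
  shows "w = w'"
  using assms
proof (induction x w arbitrary: w' rule: north_xs.induct)
  case (1 x)
  have "count_list w' North = 0" using 1(1) length_north_xs[of x w'] by simp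
  moreover have "count_list w' East = 0" using 1(2) by simp
  ultimately show ?case using length_count_list[of w'] by simp
next
  case (2 x w)
  show ?case
  proof (cases w')
    case Nil
    then show ?thesis using 2 by simp
  next
    case (Cons d v)
    show ?thesis
    proof (cases d)
      case North
      then show ?thesis using 2 Cons by simp
    next
      case East
      then have "x \<in> set (north_xs (Suc x) v)" using 2 Cons by (metis list.set_intros(1) north_xs.simps(2,3))
      then show ?thesis using north_xs_ge by fastforce
    qed
  qed
next
  case (3 x w)
  show ?case
  proof (cases w')
    case Nil
    then show ?thesis using 3 by simp
  next
    case (Cons d v)
    show ?thesis
    proof (cases d)
      case North
      then have "x \<in> set (north_xs (Suc x) w)" using 3 Cons by (metis list.set_intros(1) north_xs.simps(2,3))
      then show ?thesis using north_xs_ge by fastforce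
    next
      case East
      then show ?thesis using 3 Cons by simp
    qed
  qed
qed

lemma dyck_xs_le:
  assumes "dyck_path n w" "i < n"
  shows "north_xs 0 w ! i \<le> i"
proof -
  have "i < length (north_xs 0 w)" using assms by (simp add: length_north_xs dyck_path_def)
  then obtain j where "j \<le> length w" "count_list (take j w) North = i" "count_list (take j w) East = north_xs 0 w ! i"
    using north_xs_prefix[of i 0 w] by auto
  then show ?thesis using assms(1) by (metis dyck_path_def)
qed

text \<open>Columns of heights \<open>a\<close> and \<open>n - a\<close> at the x-coordinates
  \<open>0\<close> and \<open>x\<close>; \<open>step_path n n 0\<close> is the path with one
  column.\<close>

definition step_path :: "nat \<Rightarrow> nat \<Rightarrow> nat \<Rightarrow> step list" where
  "step_path n a x = replicate a North @ replicate x East @ replicate (n - a) North @ replicate (n - x) East"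

lemma north_xs_replicate:
  "north_xs x (replicate a North @ w) = replicate a x @ north_xs x w"
  "north_xs x (replicate a East @ w) = north_xs (x + a) w"
  by (induction a arbitrary: x) auto

lemma north_xs_step_path: "north_xs 0 (step_path n a x) = replicate a 0 @ replicate (n - a) x"
  using north_xs_replicate(2)[of "x" "n - x" "[]"] by (simp add: step_path_def north_xs_replicate)

lemma dyck_step_path:
  assumes "x \<le> a" "a \<le> n"
  shows "dyck_path n (step_path n a x)"
proof -
  have "count_list (take j (step_path n a x)) East \<le> count_list (take j (step_path n a x)) North" for j
    using assms by (simp add: step_path_def take_append count_list_append count_list_replicate min_def) linarith
  then show ?thesis using assms by (simp add: dyck_path_def) (simp add: step_path_def count_list_append count_list_replicate)
qed

lemma dyck_path_eqI:
  assumes "dyck_path n w" "dyck_path n w'" "north_xs 0 w = north_xs 0 w'"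
  shows "w = w'"
  using assms by (intro north_xs_inject) (auto simp: dyck_path_def)

lemma row_area_step_path:
  "i < n \<Longrightarrow> row_area (step_path n a x) i = (if i < a then i else i - x)"
  by (auto simp: row_area_def north_xs_step_path nth_append)

definition rises :: "nat \<Rightarrow> step list \<Rightarrow> nat set" where
  "rises n w = {i. 1 \<le> i \<and> i < n \<and> row_area w i > row_area w (i - 1)}"

lemma rises_subset: "rises n w \<subseteq> {1..<n}"
  by (auto simp: rises_def)

text \<open>The area grows from one row to the next exactly when no east step intervenes. The bounds
  on the coordinates make the truncated differences exact.\<close>

lemma rise_iff:
  assumes "dyck_path n w" "1 \<le> i" "i < n"
  shows "i \<in> rises n w \<longleftrightarrow> north_xs 0 w ! i = north_xs 0 w ! (i - 1)"
proof -
  let ?x = "north_xs 0 w"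
  have "?x ! (i - 1) \<le> ?x ! i"
    using assms by (intro sorted_nth_mono[OF sorted_north_xs]) (auto simp: length_north_xs dyck_path_def)
  moreover have "?x ! i \<le> i" "?x ! (i - 1) \<le> i - 1" using assms by (auto intro: dyck_xs_le)
  ultimately show ?thesis using assms by (auto simp: rises_def row_area_def)
qed

lemma constant_run:
  assumes "\<And>i. l < i \<Longrightarrow> i < h \<Longrightarrow> f i = f (i - 1)" "l \<le> i" "i < h"
  shows "f i = f (l :: nat)"
  using assms(2,3)
proof (induction i rule: dec_induct)
  case (step i)
  then show ?case using assms(1)[of "Suc i"] by simp
qed simp

text \<open>Rises keep the x-coordinate, so it is constant below row \<open>a\<close> and from row
  \<open>a\<close> on. If both constants are \<open>0\<close>, the two runs merge into one
  column.\<close>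

lemma dyck_runs:
  assumes w: "dyck_path n w" and sub: "{1..<n} - {a} \<subseteq> rises n w" and a: "0 < a" "a \<le> n"
  shows "w = step_path n n 0 \<or> (a < n \<and> (\<exists>x. 0 < x \<and> x \<le> a \<and> w = step_path n a x))"
proof -
  define xs where "xs = north_xs 0 w"
  have len: "length xs = n" using w by (simp add: xs_def length_north_xs dyck_path_def)
  have eq: "xs ! i = xs ! (i - 1)" if "0 < i" "i < n" "i \<noteq> a" for i
  proof -
    have "i \<in> {1..<n} - {a}" using that by simp
    then show ?thesis using rise_iff[OF w, of i] sub that unfolding xs_def by fastforce
  qed
  have n: "0 < n" using a by simp
  have zero: "xs ! 0 = 0" using dyck_xs_le[OF w n] by (simp add: xs_def)
  have low: "xs ! i = 0" if "i < a" for i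
    using constant_run[of 0 a "\<lambda>i. xs ! i" i] eq a that zero by simp
  define x where "x = (if a < n then xs ! a else 0)"
  have high: "xs ! i = x" if "a \<le> i" "i < n" for i
    using constant_run[of a n "\<lambda>i. xs ! i" i] eq that by (simp add: x_def)
  have xa: "x \<le> a" using dyck_xs_le[OF w, of a] by (simp add: x_def xs_def)
  have "xs = replicate a 0 @ replicate (n - a) x"
    by (rule nth_equalityI) (use low high len a in \<open>auto simp: nth_append\<close>)
  then have w_eq: "w = step_path n a x"
    by (intro dyck_path_eqI[OF w dyck_step_path[OF xa a(2)]]) (simp add: north_xs_step_path xs_def)
  show ?thesis
  proof (cases "x = 0")
    case True
    have "replicate a (0 :: nat) @ replicate (n - a) 0 = replicate n 0" using a by (simp flip: replicate_add)
    then have "w = step_path n n 0"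
      unfolding w_eq using True
      by (intro dyck_path_eqI[OF dyck_step_path[OF xa a(2)] dyck_step_path]) (simp_all add: north_xs_step_path)
    then show ?thesis ..
  next
    case False
    then have "a < n" by (auto simp: x_def split: if_splits)
    then show ?thesis using False w_eq xa by auto
  qed
qed

lemma dyck_many_rises:
  assumes w: "dyck_path n w" and n: "0 < n" and card: "n - 2 \<le> card (rises n w)"
  shows "w = step_path n n 0 \<or> (\<exists>a x. 0 < a \<and> a < n \<and> 0 < x \<and> x \<le> a \<and> w = step_path n a x)"
proof -
  have fin: "finite (rises n w)" using rises_subset finite_subset by blast
  have "card ({1..<n} - rises n w) = (n - 1) - card (rises n w)"
    using rises_subset[of n w] fin by (simp add: card_Diff_subset)
  then have "card ({1..<n} - rises n w) \<le> 1" using card n by simp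
  then consider "{1..<n} - rises n w = {}" | a where "{1..<n} - rises n w = {a}"
    by (metis card_1_singletonE card_eq_0_iff finite_Diff finite_atLeastLessThan le_SucE le_zero_eq One_nat_def)
  then show ?thesis
  proof cases
    case 1
    then have "{1..<n} - {n} \<subseteq> rises n w" by auto
    from dyck_runs[OF w this n order_refl] show ?thesis by blast
  next
    case 2
    then have "a \<in> {1..<n} - rises n w" by simp
    moreover have "{1..<n} - {a} \<subseteq> rises n w" using 2 by blast
    ultimately have a: "{1..<n} - {a} \<subseteq> rises n w" "0 < a" "a \<le> n" by simp_all
    have "w = step_path n n 0 \<or> (a < n \<and> (\<exists>x. 0 < x \<and> x \<le> a \<and> w = step_path n a x))"
      by (rule dyck_runs[OF w a])
    then show ?thesis using a(2) by auto
  qed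
qed

lemma dyck_all_rises:
  assumes w: "dyck_path n w" and n: "0 < n" and card: "n - 1 \<le> card (rises n w)"
  shows "w = step_path n n 0"
proof -
  have "rises n w = {1..<n}"
    using rises_subset[of n w] card by (intro card_seteq) auto
  then have "{1..<n} - {n} \<subseteq> rises n w" by auto
  from dyck_runs[OF w this n order_refl] show ?thesis by blast
qed

section \<open>Coefficients of the rise polynomial and cancellation of areas\<close>

text \<open>With all n - 1 rises present, \<open>Rise n 0\<close> uses the top coefficient and
  \<open>Rise n 1\<close> the one below it. With n - 2 rises, the top coefficient contributes to
  \<open>Rise n 1\<close>.\<close>

lemma coeff_prod_linear:
  fixes c :: "'i \<Rightarrow> 'a::comm_ring_1"
  assumes "finite R"
  shows "k > card R \<Longrightarrow> coeff (\<Prod>i\<in>R. [:1, c i:]) k = 0"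
    and "coeff (\<Prod>i\<in>R. [:1, c i:]) (card R) = (\<Prod>i\<in>R. c i)"
    and "Suc j = card R \<Longrightarrow> coeff (\<Prod>i\<in>R. [:1, c i:]) j = (\<Sum>b\<in>R. \<Prod>i\<in>R - {b}. c i)"
proof -
  have "(\<forall>k > card R. coeff (\<Prod>i\<in>R. [:1, c i:]) k = 0) \<and>
     coeff (\<Prod>i\<in>R. [:1, c i:]) (card R) = (\<Prod>i\<in>R. c i) \<and>
     (\<forall>j. Suc j = card R \<longrightarrow> coeff (\<Prod>i\<in>R. [:1, c i:]) j = (\<Sum>b\<in>R. \<Prod>i\<in>R - {b}. c i))"
    using assms
  proof (induction R)
    case empty
    then show ?case by (simp add: coeff_1)
  next
    case (insert b R)
    let ?p = "\<Prod>i\<in>R. [:1, c i:]"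
    have c0: "coeff ([:1, c b:] * ?p) (Suc k) = coeff ?p (Suc k) + c b * coeff ?p k" for k by simp
    have IH: "\<And>k. k > card R \<Longrightarrow> coeff ?p k = 0" "coeff ?p (card R) = (\<Prod>i\<in>R. c i)"
      "\<And>j. Suc j = card R \<Longrightarrow> coeff ?p j = (\<Sum>b\<in>R. \<Prod>i\<in>R - {b}. c i)" using insert.IH by auto
    have sub: "(\<Sum>d\<in>insert b R. \<Prod>i\<in>insert b R - {d}. c i) = (\<Prod>i\<in>R. c i) + c b * (\<Sum>d\<in>R. \<Prod>i\<in>R - {d}. c i)"
    proof -
      have "insert b R - {b} = R" using insert.hyps by auto
      moreover have "(\<Prod>i\<in>insert b R - {d}. c i) = c b * (\<Prod>i\<in>R - {d}. c i)" if "d \<in> R" for d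
      proof -
        have "insert b R - {d} = insert b (R - {d})" using insert.hyps that by auto
        then show ?thesis using insert.hyps by simp
      qed
      ultimately show ?thesis using insert.hyps by (simp add: sum_distrib_left)
    qed
    show ?case
      unfolding prod.insert[OF insert.hyps] card_insert_disjoint[OF insert.hyps]
    proof (intro conjI allI impI)
      fix k assume "Suc (card R) < k"
      then obtain k' where "k = Suc k'" "card R < k'" by (cases k) auto
      then show "coeff ([:1, c b:] * ?p) k = 0" using c0[of k'] IH(1)[of k'] IH(1)[of "Suc k'"] by simp
    next
      show "coeff ([:1, c b:] * ?p) (Suc (card R)) = c b * (\<Prod>i\<in>R. c i)"
        using c0[of "card R"] IH(1)[of "Suc (card R)"] IH(2) by simp
    next
      fix j assume j: "Suc j = Suc (card R)"
      show "coeff ([:1, c b:] * ?p) j = (\<Sum>d\<in>insert b R. \<Prod>i\<in>insert b R - {d}. c i)"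
      proof (cases j)
        case 0
        then have "R = {}" using j insert.hyps by simp
        then show ?thesis using 0 by simp
      next
        case (Suc j')
        then show ?thesis unfolding sub using j c0[of j'] IH(2) IH(3)[of j'] by simp
      qed
    qed
  qed
  then show "k > card R \<Longrightarrow> coeff (\<Prod>i\<in>R. [:1, c i:]) k = 0"
    and "coeff (\<Prod>i\<in>R. [:1, c i:]) (card R) = (\<Prod>i\<in>R. c i)"
    and "Suc j = card R \<Longrightarrow> coeff (\<Prod>i\<in>R. [:1, c i:]) j = (\<Sum>b\<in>R. \<Prod>i\<in>R - {b}. c i)" by auto
qed

lemma rise_poly_rises: "rise_poly n w = (\<Prod>i\<in>rises n w. [:1, 1 / tv ^ row_area w i:])"
  by (simp add: rise_poly_def rises_def)

lemma rises_full: "rises n (step_path n n 0) = {1..<n}"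
  by (auto simp: rises_def row_area_step_path)

lemma rises_step_path:
  assumes "0 < a" "a < n" "0 < x" "x \<le> a"
  shows "rises n (step_path n a x) = {1..<n} - {a}"
  using assms by (auto simp: rises_def row_area_step_path split: if_splits)

lemma tv_nonzero: "tv \<noteq> 0"
  by (simp add: tv_def Zero_fract_def eq_fract)

text \<open>A rise selected in the product cancels the area of its row, so the weight is that of the
  rows not selected.\<close>

lemma area_cancel:
  assumes "S \<subseteq> {..<n}"
  shows "tv ^ area n w * (\<Prod>i\<in>S. 1 / tv ^ row_area w i) = (\<Prod>i\<in>{..<n} - S. tv ^ row_area w i)"
proof -
  have "tv ^ area n w = (\<Prod>i\<in>S. tv ^ row_area w i) * (\<Prod>i\<in>{..<n} - S. tv ^ row_area w i)"
    unfolding area_def power_sum using prod.subset_diff[OF assms, of "\<lambda>i. tv ^ row_area w i"] by (simp add: mult.commute)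
  moreover have "(\<Prod>i\<in>S. tv ^ row_area w i) * (\<Prod>i\<in>S. 1 / tv ^ row_area w i) = 1"
    unfolding prod.distrib[symmetric] using tv_nonzero by simp
  ultimately show ?thesis by (simp add: mult_ac)
qed

lemma sum_card_image_fibres:
  assumes "finite X" "f ` X \<subseteq> T" "finite T"
  shows "(\<Sum>i\<in>T. card {x \<in> X. f x = i}) = card X"
proof -
  have "card X = (\<Sum>x\<in>X. \<Sum>i\<in>T. if i = f x then 1 else 0)"
    using assms by (simp add: image_subset_iff)
  also have "\<dots> = (\<Sum>i\<in>T. \<Sum>x\<in>X. if i = f x then 1 else 0)" by (rule sum.swap)
  also have "\<dots> = (\<Sum>i\<in>T. card {x \<in> X. f x = i})"
    using assms by (intro sum.cong) (auto simp: sum.If_cases Int_def eq_commute)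
  finally show ?thesis ..
qed

section \<open>Labels and dinv of paths with two columns\<close>

text \<open>Labels are read from bottom to top; the columns are the initial segment of length
  \<open>a\<close> and the rest.\<close>

definition column_words :: "nat \<Rightarrow> nat \<Rightarrow> nat multiset \<Rightarrow> nat list set" where
  "column_words n a M = {l. length l = n \<and> sorted_wrt (<) (take a l) \<and> sorted_wrt (<) (drop a l) \<and> mset l = M}"

lemma below_le_length: "below (set xs) y \<le> length xs"
  unfolding below_def by (rule order_trans[OF card_mono card_length]) auto

lemma column_words_bij:
  assumes "a \<le> n" "size M = n"
  shows "bij_betw (\<lambda>l. (set (take a l), set (drop a l))) (column_words n a M) (col_pairs M a)"
proof (rule bij_betw_byWitness[where f' = "\<lambda>(A, B). sorted_list_of_set A @ sorted_list_of_set B"])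
  show "\<forall>l\<in>column_words n a M. (\<lambda>(A, B). sorted_list_of_set A @ sorted_list_of_set B) (set (take a l), set (drop a l)) = l"
  proof
    fix l assume "l \<in> column_words n a M"
    then have "sorted_list_of_set (set (take a l)) = take a l" "sorted_list_of_set (set (drop a l)) = drop a l"
      by (simp_all add: column_words_def sorted_list_of_set.idem_if_sorted_distinct strict_sorted_iff)
    then show "(\<lambda>(A, B). sorted_list_of_set A @ sorted_list_of_set B) (set (take a l), set (drop a l)) = l" by simp
  qed
  show "\<forall>p\<in>col_pairs M a. (\<lambda>l. (set (take a l), set (drop a l))) ((\<lambda>(A, B). sorted_list_of_set A @ sorted_list_of_set B) p) = p"
    by (auto simp: col_pairs_def)
  show "(\<lambda>l. (set (take a l), set (drop a l))) ` column_words n a M \<subseteq> col_pairs M a"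
  proof (rule image_subsetI)
    fix l assume l: "l \<in> column_words n a M"
    then have d: "distinct (take a l)" "distinct (drop a l)" "length l = n" "mset l = M"
      by (simp_all add: column_words_def strict_sorted_iff)
    have "mset_set (set (take a l)) + mset_set (set (drop a l)) = mset (take a l @ drop a l)"
      using d by (simp only: mset_set_set mset_append)
    then show "(set (take a l), set (drop a l)) \<in> col_pairs M a"
      using d assms by (simp add: col_pairs_def distinct_card)
  qed
  show "(\<lambda>(A, B). sorted_list_of_set A @ sorted_list_of_set B) ` col_pairs M a \<subseteq> column_words n a M"
  proof (rule image_subsetI)
    fix p assume p: "p \<in> col_pairs M a"
    obtain A B where AB: "p = (A, B)" by (cases p)
    then have f: "finite A" "finite B" "card A = a" "mset_set A + mset_set B = M" "card B = n - a"
      using p col_pairs_props(5)[of A B M a] assms by (auto simp: col_pairs_def)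
    have "mset (sorted_list_of_set A) = mset_set A" "mset (sorted_list_of_set B) = mset_set B"
      using f(1,2) mset_set_set[of "sorted_list_of_set A"] mset_set_set[of "sorted_list_of_set B"] by simp_all
    then show "(\<lambda>(A, B). sorted_list_of_set A @ sorted_list_of_set B) p \<in> column_words n a M"
      using f assms by (simp add: AB column_words_def)
  qed
qed

lemma labels_step_path:
  assumes "a = n \<or> (a < n \<and> 0 < x)" "x \<le> a"
  shows "{l. (step_path n a x, l) \<in> labeled_dyck n \<and> mset l = M} = column_words n a M"
proof -
  have dyck: "dyck_path n (step_path n a x)" using assms by (intro dyck_step_path) auto
  have same: "north_xs 0 (step_path n a x) ! i = north_xs 0 (step_path n a x) ! j \<longleftrightarrow> (j < a \<or> a \<le> i)" if "i < j" "j < n" for i j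
    using that assms by (auto simp: north_xs_step_path nth_append)
  have "(\<forall>i j. i < j \<and> j < n \<and> north_xs 0 (step_path n a x) ! i = north_xs 0 (step_path n a x) ! j \<longrightarrow> l ! i < l ! j) \<longleftrightarrow>
      sorted_wrt (<) (take a l) \<and> sorted_wrt (<) (drop a l)" (is "?L \<longleftrightarrow> ?R") if len: "length l = n" for l :: "nat list"
  proof
    assume ?L
    then have L: "l ! i < l ! j" if "i < j" "j < n" "j < a \<or> a \<le> i" for i j using same that by blast
    show ?R
      unfolding sorted_wrt_iff_nth_less using L len assms by (auto simp: less_diff_conv add.commute)
  next
    assume R: ?R
    show ?L
    proof (intro allI impI)
      fix i j assume ij: "i < j \<and> j < n \<and> north_xs 0 (step_path n a x) ! i = north_xs 0 (step_path n a x) ! j"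
      then have "j < a \<or> a \<le> i" using same by blast
      then show "l ! i < l ! j"
      proof
        assume "j < a"
        then show ?thesis using R ij len sorted_wrt_nth_less[of "(<)" "take a l" i j] by simp
      next
        assume "a \<le> i"
        then have "i - a < j - a" "j - a < n - a" using ij by auto
        then show ?thesis
          using R ij len \<open>a \<le> i\<close> sorted_wrt_nth_less[of "(<)" "drop a l" "i - a" "j - a"] by simp
      qed
    qed
  qed
  then show ?thesis using dyck by (auto simp: labeled_dyck_def column_words_def)
qed

text \<open>In a single column the row areas increase strictly, so neither kind of inversion
  occurs.\<close>

lemma dinv_full: "dinv n (step_path n n 0) l = 0"
proof -
  have 1: "{j. i < j \<and> j < n \<and> row_area (step_path n n 0) i = row_area (step_path n n 0) j \<and> l ! i < l ! j} = {}" if "i < n" for i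
    using that by (auto simp: row_area_step_path)
  have 2: "{j. i < j \<and> j < n \<and> row_area (step_path n n 0) i = row_area (step_path n n 0) j + 1 \<and> l ! i > l ! j} = {}" if "i < n" for i
    using that by (auto simp: row_area_step_path)
  show ?thesis
    unfolding dinv_def row_dinv_def using 1 2 by (simp del: One_nat_def Collect_empty_eq)
qed

text \<open>Each label of the second column is compared with the labels of the first column in its row and one
  row above. At least one of the two comparisons is a diagonal inversion, and both are exactly
  at a crossing.\<close>

lemma dinv_step_path:
  assumes "0 < a" "a < n" "s < a" "l \<in> column_words n a M"
  shows "dinv n (step_path n a (a - s)) l =
    min (n - a) (a - 1 - s) + col_crossings s (set (take a l)) (set (drop a l))"
proof -
  let ?w = "step_path n a (a - s)"
  define xs where "xs = take a l"
  define ys where "ys = drop a l"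
  have l: "length l = n" "sorted_wrt (<) xs" "sorted_wrt (<) ys" using assms(4) by (auto simp: column_words_def xs_def ys_def)
  have len: "length xs = a" "length ys = n - a" using l(1) assms by (simp_all add: xs_def ys_def)
  have lx: "l ! i = xs ! i" if "i < a" for i using that by (simp add: xs_def)
  have ly: "l ! (a + j) = ys ! j" if "j < n - a" for j using that l(1) by (simp add: ys_def)
  have ra: "row_area ?w i = (if i < a then i else s + (i - a))" if "i < n" for i
    using that assms by (auto simp: row_area_step_path)
  \<comment> \<open>Row \<open>a + j\<close> has area \<open>s + j\<close>, so \<open>X\<close>
    compares it with the row of the first column at the same area and \<open>Y\<close> with the one
    whose area is larger by one.\<close>
  define X where "X = {j. j < n - a \<and> s + j < a \<and> xs ! (s + j) < ys ! j}"
  define Y where "Y = {j. j < n - a \<and> Suc (s + j) < a \<and> ys ! j < xs ! Suc (s + j)}"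
  have finXY: "finite X" "finite Y" by (auto simp: X_def Y_def)
  have set1: "{j. i < j \<and> j < n \<and> row_area ?w i = row_area ?w j \<and> l ! i < l ! j} =
      (if i < a then (\<lambda>j. a + j) ` {j \<in> X. s + j = i} else {})" if i: "i < n" for i
  proof (rule set_eqI)
    fix j
    show "j \<in> {j. i < j \<and> j < n \<and> row_area ?w i = row_area ?w j \<and> l ! i < l ! j} \<longleftrightarrow>
        j \<in> (if i < a then (\<lambda>j. a + j) ` {j \<in> X. s + j = i} else {})"
    proof (cases "j < a \<or> n \<le> j")
      case True
      then show ?thesis using ra i by (auto simp: X_def)
    next
      case False
      then obtain j' where j: "j = a + j'" "j' < n - a" by (metis add_diff_inverse_nat diff_less_mono not_le_imp_less not_less)
      then show ?thesis using ra[of i] ra[of j] i lx[of i] ly[of j'] by (auto simp: X_def image_iff)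
    qed
  qed
  have set2: "{j. i < j \<and> j < n \<and> row_area ?w i = row_area ?w j + 1 \<and> l ! i > l ! j} =
      (if i < a then (\<lambda>j. a + j) ` {j \<in> Y. Suc (s + j) = i} else {})" if i: "i < n" for i
  proof (rule set_eqI)
    fix j
    show "j \<in> {j. i < j \<and> j < n \<and> row_area ?w i = row_area ?w j + 1 \<and> l ! i > l ! j} \<longleftrightarrow>
        j \<in> (if i < a then (\<lambda>j. a + j) ` {j \<in> Y. Suc (s + j) = i} else {})"
    proof (cases "j < a \<or> n \<le> j")
      case True
      then show ?thesis using ra i by (auto simp: Y_def)
    next
      case False
      then obtain j' where j: "j = a + j'" "j' < n - a" by (metis add_diff_inverse_nat diff_less_mono not_le_imp_less not_less)
      then show ?thesis using ra[of i] ra[of j] i lx[of i] ly[of j'] by (auto simp: Y_def image_iff)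
    qed
  qed
  have "dinv n ?w l = (\<Sum>i<a. card {j \<in> X. s + j = i} + card {j \<in> Y. Suc (s + j) = i})"
  proof -
    have "row_dinv n ?w l i = (if i < a then card {j \<in> X. s + j = i} + card {j \<in> Y. Suc (s + j) = i} else 0)" if "i < n" for i
      unfolding row_dinv_def set1[OF that] set2[OF that] by (simp add: card_image)
    then have "dinv n ?w l = (\<Sum>i<n. if i < a then card {j \<in> X. s + j = i} + card {j \<in> Y. Suc (s + j) = i} else 0)"
      unfolding dinv_def by (intro sum.cong) auto
    also have "\<dots> = (\<Sum>i<a. card {j \<in> X. s + j = i} + card {j \<in> Y. Suc (s + j) = i})"
      by (rule sum.mono_neutral_cong_right) (use assms in auto)
    finally show ?thesis .
  qed
  also have "\<dots> = card X + card Y"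
  proof -
    have "(\<Sum>i<a. card {j \<in> X. s + j = i}) = card X"
      using sum_card_image_fibres[of X "\<lambda>j. s + j" "{..<a}"] finXY by (auto simp: X_def)
    moreover have "(\<Sum>i<a. card {j \<in> Y. Suc (s + j) = i}) = card Y"
      using sum_card_image_fibres[of Y "\<lambda>j. Suc (s + j)" "{..<a}"] finXY by (auto simp: Y_def)
    ultimately show ?thesis by (simp add: sum.distrib)
  qed
  also have "card X + card Y = card (X \<union> Y) + card {j. j < n - a \<and> Suc (s + j) < a \<and> xs ! (s + j) < ys ! j \<and> ys ! j < xs ! Suc (s + j)}"
  proof -
    have "X \<inter> Y = {j. j < n - a \<and> Suc (s + j) < a \<and> xs ! (s + j) < ys ! j \<and> ys ! j < xs ! Suc (s + j)}"
      by (auto simp: X_def Y_def)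
    then show ?thesis using card_Un_Int[OF finXY] by simp
  qed
  \<comment> \<open>Labels of the first column increase, so at least one comparison succeeds as long
    as a row of area \<open>s + j + 1\<close> exists there. Otherwise only the top row of the first
    column can contribute.\<close>
  also have "X \<union> Y = {..<min (n - a) (a - 1 - s)} \<union> {j. j < n - a \<and> Suc (s + j) = a \<and> xs ! (s + j) < ys ! j}"
  proof (rule set_eqI)
    fix j
    have "xs ! (s + j) < xs ! Suc (s + j)" if "Suc (s + j) < a"
      using l(2) len that by (simp add: sorted_wrt_nth_less)
    then have "Suc (s + j) < a \<Longrightarrow> xs ! (s + j) < ys ! j \<or> ys ! j < xs ! Suc (s + j)" by linarith
    then show "j \<in> X \<union> Y \<longleftrightarrow> j \<in> {..<min (n - a) (a - 1 - s)} \<union> {j. j < n - a \<and> Suc (s + j) = a \<and> xs ! (s + j) < ys ! j}"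
      unfolding X_def Y_def by (cases "Suc (s + j) < a"; cases "Suc (s + j) = a") auto
  qed
  also have "card \<dots> = min (n - a) (a - 1 - s) + card {j. j < n - a \<and> Suc (s + j) = a \<and> xs ! (s + j) < ys ! j}"
    by (subst card_Un_disjoint) auto
  \<comment> \<open>The surplus at the top row and the double successes combine into one condition,
    whose upper comparison is void at the top.\<close>
  also have "\<dots> + card {j. j < n - a \<and> Suc (s + j) < a \<and> xs ! (s + j) < ys ! j \<and> ys ! j < xs ! Suc (s + j)} =
      min (n - a) (a - 1 - s) + card {j. j < n - a \<and> s + j < a \<and> xs ! (s + j) < ys ! j \<and> (Suc (s + j) < a \<longrightarrow> ys ! j < xs ! Suc (s + j))}"
  proof -
    have "{j. j < n - a \<and> s + j < a \<and> xs ! (s + j) < ys ! j \<and> (Suc (s + j) < a \<longrightarrow> ys ! j < xs ! Suc (s + j))} =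
        {j. j < n - a \<and> Suc (s + j) = a \<and> xs ! (s + j) < ys ! j} \<union>
        {j. j < n - a \<and> Suc (s + j) < a \<and> xs ! (s + j) < ys ! j \<and> ys ! j < xs ! Suc (s + j)}" by auto
    moreover have "card ({j. j < n - a \<and> Suc (s + j) = a \<and> xs ! (s + j) < ys ! j} \<union>
        {j. j < n - a \<and> Suc (s + j) < a \<and> xs ! (s + j) < ys ! j \<and> ys ! j < xs ! Suc (s + j)}) =
        card {j. j < n - a \<and> Suc (s + j) = a \<and> xs ! (s + j) < ys ! j} +
        card {j. j < n - a \<and> Suc (s + j) < a \<and> xs ! (s + j) < ys ! j \<and> ys ! j < xs ! Suc (s + j)}"
      by (rule card_Un_disjoint) auto
    ultimately show ?thesis by simp
  qed
  also have "card {j. j < n - a \<and> s + j < a \<and> xs ! (s + j) < ys ! j \<and> (Suc (s + j) < a \<longrightarrow> ys ! j < xs ! Suc (s + j))} =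
      col_crossings s (set xs) (set ys)"
    unfolding col_crossings_def
  proof (rule bij_betw_same_card[of "\<lambda>j. ys ! j"], rule bij_betw_imageI)
    have inj: "inj_on (\<lambda>j. ys ! j) {..<n - a}"
      using l(3) len by (auto simp: inj_on_def nth_eq_iff_index_eq strict_sorted_iff)
    then show "inj_on (\<lambda>j. ys ! j) {j. j < n - a \<and> s + j < a \<and> xs ! (s + j) < ys ! j \<and> (Suc (s + j) < a \<longrightarrow> ys ! j < xs ! Suc (s + j))}"
      by (rule inj_on_subset) auto
    \<comment> \<open>The condition says that exactly \<open>s + j + 1\<close> labels of the first
      column are smaller than \<open>ys ! j\<close> and none equals it; \<open>j\<close> is the rank
      of this label in its own column.\<close>
    have key: "(s + j < a \<and> xs ! (s + j) < ys ! j \<and> (Suc (s + j) < a \<longrightarrow> ys ! j < xs ! Suc (s + j))) \<longleftrightarrow>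
        (ys ! j \<notin> set xs \<and> below (set xs) (ys ! j) = s + 1 + below (set ys) (ys ! j))" if j: "j < n - a" for j
    proof -
      let ?y = "ys ! j" and ?c = "below (set xs) (ys ! j)"
      have rank: "below (set ys) ?y = j" using below_nth[OF l(3)] j len by simp
      have lt: "xs ! i < ?y \<longleftrightarrow> i < ?c" if "i < a" for i using nth_less_iff_below[OF l(2)] that len by simp
      have ca: "?c \<le> a" using below_le_length[of xs ?y] len by simp
      have inx: "?c < a \<and> xs ! ?c = ?y" if y_in: "?y \<in> set xs"
      proof -
        obtain i where i: "i < a" "xs ! i = ?y" using y_in len by (auto simp: in_set_conv_nth)
        then have "?c = i" using below_nth[OF l(2), of i] len by simp
        then show ?thesis using i by simp
      qed
      show ?thesis
      proof
        assume L: "s + j < a \<and> xs ! (s + j) < ?y \<and> (Suc (s + j) < a \<longrightarrow> ?y < xs ! Suc (s + j))"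
        then have c1: "s + j < ?c" using lt by blast
        have c2: "?c \<le> Suc (s + j)"
        proof (cases "Suc (s + j) < a")
          case True
          then have "\<not> xs ! Suc (s + j) < ?y" using L by auto
          then show ?thesis using lt[OF True] by simp
        qed (use ca L in simp)
        then have c: "?c = Suc (s + j)" using c1 by simp
        moreover have "?y \<notin> set xs"
        proof
          assume "?y \<in> set xs"
          then have "Suc (s + j) < a" "xs ! Suc (s + j) = ?y" using inx c by auto
          then show False using L by simp
        qed
        ultimately show "?y \<notin> set xs \<and> ?c = s + 1 + below (set ys) ?y" by (simp add: rank)
      next
        assume R: "?y \<notin> set xs \<and> ?c = s + 1 + below (set ys) ?y"
        then have c: "?c = Suc (s + j)" by (simp add: rank)
        have "s + j < a" using c ca by simp
        moreover have "xs ! (s + j) < ?y" using lt[OF \<open>s + j < a\<close>] c by simp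
        moreover have "?y < xs ! Suc (s + j)" if "Suc (s + j) < a"
        proof -
          have "\<not> xs ! Suc (s + j) < ?y" using lt[OF that] c by simp
          moreover have "xs ! Suc (s + j) \<in> set xs" using that len by simp
          then have "xs ! Suc (s + j) \<noteq> ?y" using R by metis
          ultimately show ?thesis by simp
        qed
        ultimately show "s + j < a \<and> xs ! (s + j) < ?y \<and> (Suc (s + j) < a \<longrightarrow> ?y < xs ! Suc (s + j))" by simp
      qed
    qed
    have "(\<lambda>j. ys ! j) ` {j. j < n - a \<and> s + j < a \<and> xs ! (s + j) < ys ! j \<and> (Suc (s + j) < a \<longrightarrow> ys ! j < xs ! Suc (s + j))} =
        (\<lambda>j. ys ! j) ` {j. j < n - a \<and> (ys ! j \<notin> set xs \<and> below (set xs) (ys ! j) = s + 1 + below (set ys) (ys ! j))}"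
      by (rule arg_cong[of _ _ "image _"], rule Collect_cong, rule conj_cong[OF refl], rule key)
    also have "\<dots> = {y \<in> set ys - set xs. below (set xs) y = s + 1 + below (set ys) y}"
    proof -
      have "set ys = (\<lambda>j. ys ! j) ` {..<n - a}" using len by (auto simp: set_conv_nth)
      then show ?thesis by auto
    qed
    finally show "(\<lambda>j. ys ! j) ` {j. j < n - a \<and> s + j < a \<and> xs ! (s + j) < ys ! j \<and> (Suc (s + j) < a \<longrightarrow> ys ! j < xs ! Suc (s + j))} =
        {y \<in> set ys - set xs. below (set xs) y = s + 1 + below (set ys) y}" .
  qed
  finally show ?thesis by (simp add: xs_def ys_def)
qed

section \<open>The rise generating functions\<close>

definition word_set :: "nat \<Rightarrow> nat multiset \<Rightarrow> (step list \<times> nat list) set" where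
  "word_set n M = {(w, l) \<in> labeled_dyck n. mset l = M}"

lemma finite_word_set: "finite (word_set n M)"
proof -
  have fin: "finite {w :: step list. set w \<subseteq> {North, East} \<and> length w = 2 * n}"
    by (rule finite_lists_length_eq) simp
  have "word_set n M \<subseteq> {w. set w \<subseteq> {North, East} \<and> length w = 2 * n} \<times> {l. set l \<subseteq> set_mset M \<and> length l = n}"
  proof
    fix p assume p: "p \<in> word_set n M"
    obtain w l where [simp]: "p = (w, l)" by (cases p)
    have "set w \<subseteq> {North, East}" using step.exhaust by blast
    then show "p \<in> {w. set w \<subseteq> {North, East} \<and> length w = 2 * n} \<times> {l. set l \<subseteq> set_mset M \<and> length l = n}"
      using p length_count_list[of w] by (auto simp: word_set_def labeled_dyck_def dyck_path_def)
  qed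
  then show ?thesis by (rule finite_subset) (simp add: fin finite_lists_length_eq)
qed

definition rise_weight :: "nat \<Rightarrow> nat \<Rightarrow> step list \<Rightarrow> nat list \<Rightarrow> qt_field" where
  "rise_weight n k w l = qv ^ dinv n w l * tv ^ area n w * coeff (rise_poly n w) (n - k - 1)"

lemma coef_Rise: "k < n \<Longrightarrow> coef (Rise n k) M = (\<Sum>(w, l)\<in>word_set n M. rise_weight n k w l)"
  by (simp add: Rise_def word_set_def rise_weight_def)

text \<open>Reduces the sum to a parametrized family of paths outside which the weight vanishes; the
  labels then range over column words.\<close>

lemma sum_word_set:
  assumes "finite I" "inj_on W I" "\<And>i. i \<in> I \<Longrightarrow> {l. (W i, l) \<in> labeled_dyck n \<and> mset l = M} = column_words n (c i) M"
    and "\<And>w l. (w, l) \<in> word_set n M \<Longrightarrow> w \<notin> W ` I \<Longrightarrow> F w l = 0"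
  shows "(\<Sum>(w, l)\<in>word_set n M. F w l) = (\<Sum>i\<in>I. \<Sum>l\<in>column_words n (c i) M. F (W i) l)"
proof -
  have fin: "finite (column_words n (c i) M)" if "i \<in> I" for i
  proof -
    have "Pair (W i) ` column_words n (c i) M \<subseteq> word_set n M"
      using assms(3)[OF that] by (auto simp: word_set_def)
    then have "finite (Pair (W i) ` column_words n (c i) M)" using finite_word_set finite_subset by blast
    then show ?thesis by (rule finite_imageD) (simp add: inj_on_def)
  qed
  have "(\<Sum>(w, l)\<in>word_set n M. F w l) = (\<Sum>(w, l)\<in>{(w, l) \<in> word_set n M. w \<in> W ` I}. F w l)"
    using assms(4) finite_word_set by (intro sum.mono_neutral_right) auto
  also have "\<dots> = (\<Sum>(i, l)\<in>Sigma I (\<lambda>i. column_words n (c i) M). F (W i) l)"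
  proof (rule sum.reindex_bij_witness[of _ "\<lambda>(i, l). (W i, l)" "\<lambda>(w, l). (the_inv_into I W w, l)"])
    fix p assume "p \<in> {(w, l) \<in> word_set n M. w \<in> W ` I}"
    then obtain i l where p: "p = (W i, l)" "i \<in> I" "(W i, l) \<in> word_set n M" by auto
    have inv: "the_inv_into I W (W i) = i" using the_inv_into_f_f[OF assms(2) p(2)] .
    have "l \<in> column_words n (c i) M" using assms(3)[OF p(2)] p(3) by (auto simp: word_set_def)
    then show "(\<lambda>(i, l). (W i, l)) ((\<lambda>(w, l). (the_inv_into I W w, l)) p) = p"
      "(\<lambda>(w, l). (the_inv_into I W w, l)) p \<in> Sigma I (\<lambda>i. column_words n (c i) M)"
      "(case (\<lambda>(w, l). (the_inv_into I W w, l)) p of (i, l) \<Rightarrow> F (W i) l) = (case p of (w, l) \<Rightarrow> F w l)"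
      using p inv by simp_all
  next
    fix p assume "p \<in> Sigma I (\<lambda>i. column_words n (c i) M)"
    then obtain i l where p: "p = (i, l)" "i \<in> I" "l \<in> column_words n (c i) M" by auto
    have "(W i, l) \<in> word_set n M" using assms(3)[OF p(2)] p(3) by (auto simp: word_set_def)
    then show "(\<lambda>(w, l). (the_inv_into I W w, l)) ((\<lambda>(i, l). (W i, l)) p) = p"
      "(\<lambda>(i, l). (W i, l)) p \<in> {(w, l) \<in> word_set n M. w \<in> W ` I}"
      using p the_inv_into_f_f[OF assms(2) p(2)] by auto
  qed
  also have "\<dots> = (\<Sum>i\<in>I. \<Sum>l\<in>column_words n (c i) M. F (W i) l)"
    using assms(1) fin by (simp add: sum.Sigma)
  finally show ?thesis .
qed

lemma rises_card_bound:
  assumes "coeff (rise_poly n w) k \<noteq> 0"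
  shows "k \<le> card (rises n w)"
proof (rule ccontr)
  assume "\<not> k \<le> card (rises n w)"
  then have k: "card (rises n w) < k" by simp
  have "finite (rises n w)" using rises_subset finite_subset by blast
  from coeff_prod_linear(1)[OF this k, of "\<lambda>i. 1 / tv ^ row_area w i"] show False
    using assms by (simp add: rise_poly_rises)
qed

lemma sum_column_words:
  assumes "a \<le> n" "size M = n"
  shows "(\<Sum>l\<in>column_words n a M. F (set (take a l)) (set (drop a l))) = (\<Sum>(A, B)\<in>col_pairs M a. F A B)"
  using sum.reindex_bij_betw[OF column_words_bij[OF assms], of "\<lambda>(A, B). F A B"] by simp

text \<open>Only the path with one column has \<open>n - 1\<close> rises. Their product cancels the
  whole area, leaving weight 1 for each column word.\<close>

lemma Rise_0_coef:
  assumes "0 < n" "size M = n"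
  shows "coef (Rise n 0) M = of_nat (card (col_pairs M n))"
proof -
  have "coef (Rise n 0) M = (\<Sum>i\<in>{()}. \<Sum>l\<in>column_words n n M. rise_weight n 0 (step_path n n 0) l)"
    unfolding coef_Rise[OF assms(1)]
  proof (rule sum_word_set)
    fix w l assume wl: "(w, l) \<in> word_set n M" "w \<notin> (\<lambda>_. step_path n n 0) ` {()}"
    then have "dyck_path n w" "w \<noteq> step_path n n 0" by (auto simp: word_set_def labeled_dyck_def)
    then have "\<not> n - 1 \<le> card (rises n w)" using dyck_all_rises[OF _ assms(1)] by blast
    then have "coeff (rise_poly n w) (n - 1) = 0" using rises_card_bound[of n w "n - 1"] by blast
    then show "rise_weight n 0 w l = 0" by (simp add: rise_weight_def)
  qed (auto intro!: labels_step_path simp: inj_on_def)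
  also have "\<dots> = of_nat (card (column_words n n M))"
  proof -
    have "coeff (rise_poly n (step_path n n 0)) (n - 1) = (\<Prod>i\<in>{1..<n}. 1 / tv ^ row_area (step_path n n 0) i)"
      unfolding rise_poly_rises rises_full using coeff_prod_linear(2)[of "{1..<n}" "\<lambda>i. 1 / tv ^ row_area (step_path n n 0) i"] by simp
    moreover have "tv ^ area n (step_path n n 0) * (\<Prod>i\<in>{1..<n}. 1 / tv ^ row_area (step_path n n 0) i) = 1"
    proof -
      have eq: "{..<n} - {1..<n} = {0}" using assms by auto
      have "{1..<n} \<subseteq> {..<n}" by auto
      from area_cancel[OF this] show ?thesis using assms by (simp only: eq) (simp add: row_area_step_path)
    qed
    ultimately show ?thesis by (simp add: rise_weight_def dinv_full)
  qed
  also have "card (column_words n n M) = card (col_pairs M n)"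
    by (rule bij_betw_same_card[OF column_words_bij[OF order_refl assms(2)]])
  finally show ?thesis .
qed

text \<open>The path with one column contributes \<open>tv ^ b\<close> for the rise \<open>b\<close>
  left out of the product. In a path with two columns all rises are selected, which leaves the area
  \<open>s\<close> of the bottom row of the second column.\<close>

lemma Rise_1_coef:
  assumes "1 < n" "size M = n"
  shows "coef (Rise n 1) M = (\<Sum>a=1..n - 1. tv ^ a) * of_nat (card (col_pairs M n)) +
    (\<Sum>a=1..n - 1. \<Sum>s<a. tv ^ s * qv ^ min (n - a) (a - 1 - s) *
       (\<Sum>(A, B)\<in>col_pairs M a. qv ^ col_crossings s A B))"
proof -
  have n: "0 < n" using assms by simp
  \<comment> \<open>The pair (a, s) stands for the path whose first column has height
    \<open>a\<close> and whose second one starts at area \<open>s\<close>, so at x-coordinate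
    \<open>a - s\<close>. The extra pair (n, n) in \<open>I\<close> encodes the path with one
    column, as \<open>n - n = 0\<close>.\<close>
  define J where "J = Sigma {1..n - 1} (\<lambda>a. {..<a})"
  define W where "W p = step_path n (fst p) (fst p - snd p)" for p
  define I where "I = insert (n, n) J"
  have WJ: "W p \<noteq> W (n, n)" if "p \<in> J" for p
  proof
    assume "W p = W (n, n)"
    then have "north_xs 0 (W p) ! fst p = north_xs 0 (W (n, n)) ! fst p" by simp
    then show False using that by (auto simp: W_def J_def north_xs_step_path nth_append)
  qed
  have injJ: "inj_on W J"
  proof (rule inj_onI)
    fix p p' assume p: "p \<in> J" "p' \<in> J" "W p = W p'"
    have bounds: "0 < fst p" "fst p < n" "snd p < fst p" "0 < fst p'" "fst p' < n" "snd p' < fst p'"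
      using p(1,2) by (auto simp: J_def)
    have eq: "north_xs 0 (W p) ! i = north_xs 0 (W p') ! i" for i using p(3) by simp
    have val: "north_xs 0 (W p) ! i = (if i < fst p then 0 else fst p - snd p)"
      "north_xs 0 (W p') ! i = (if i < fst p' then 0 else fst p' - snd p')" if "i < n" for i
      using that bounds by (auto simp: W_def north_xs_step_path nth_append)
    have "fst p = fst p'"
      using eq[of "fst p"] eq[of "fst p'"] val[OF bounds(2)] val[OF bounds(5)] bounds by (auto split: if_splits)
    moreover have "fst p - snd p = fst p' - snd p'"
      using eq[of "fst p"] val[OF bounds(2)] \<open>fst p = fst p'\<close> by simp
    ultimately show "p = p'" using bounds by (auto simp: prod_eq_iff)
  qed
  have injI: "inj_on W I" unfolding I_def inj_on_insert using injJ WJ by (metis DiffD1 imageE)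
  have finJ: "finite J" by (simp add: J_def)
  have nJ: "(n, n) \<notin> J" by (auto simp: J_def)
  have "coef (Rise n 1) M = (\<Sum>p\<in>I. \<Sum>l\<in>column_words n (fst p) M. rise_weight n 1 (W p) l)"
    unfolding coef_Rise[OF assms(1)]
  proof (rule sum_word_set[OF _ injI])
    show "finite I" using finJ by (simp add: I_def)
    show "{l. (W p, l) \<in> labeled_dyck n \<and> mset l = M} = column_words n (fst p) M" if "p \<in> I" for p
      unfolding W_def using that by (intro labels_step_path) (auto simp: I_def J_def)
    fix w l assume wl: "(w, l) \<in> word_set n M" "w \<notin> W ` I"
    then have w: "dyck_path n w" by (auto simp: word_set_def labeled_dyck_def)
    have "\<not> n - 2 \<le> card (rises n w)"
    proof
      assume "n - 2 \<le> card (rises n w)"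
      then consider "w = step_path n n 0" | a x where "0 < a" "a < n" "0 < x" "x \<le> a" "w = step_path n a x"
        using dyck_many_rises[OF w n] by blast
      then show False
      proof cases
        case 1
        then have "w = W (n, n)" by (simp add: W_def)
        then show ?thesis using wl(2) by (auto simp: I_def)
      next
        case 2
        then have "w = W (a, a - x)" "(a, a - x) \<in> J" by (auto simp: W_def J_def)
        then show ?thesis using wl(2) by (auto simp: I_def)
      qed
    qed
    then have "coeff (rise_poly n w) (n - 1 - 1) = 0" using rises_card_bound[of n w "n - 2"] by (auto simp: numeral_2_eq_2)
    then show "rise_weight n 1 w l = 0" by (simp add: rise_weight_def)
  qed
  also have "\<dots> = (\<Sum>l\<in>column_words n n M. rise_weight n 1 (step_path n n 0) l) +
      (\<Sum>p\<in>J. \<Sum>l\<in>column_words n (fst p) M. rise_weight n 1 (W p) l)"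
    using finJ nJ by (simp add: I_def W_def)
  also have "(\<Sum>l\<in>column_words n n M. rise_weight n 1 (step_path n n 0) l) =
      (\<Sum>a=1..n - 1. tv ^ a) * of_nat (card (col_pairs M n))"
  proof -
    let ?w = "step_path n n 0"
    have "coeff (rise_poly n ?w) (n - 1 - 1) = (\<Sum>b\<in>{1..<n}. \<Prod>i\<in>{1..<n} - {b}. 1 / tv ^ row_area ?w i)"
      unfolding rise_poly_rises rises_full by (rule coeff_prod_linear(3)) (use assms in auto)
    then have "tv ^ area n ?w * coeff (rise_poly n ?w) (n - 1 - 1) =
        (\<Sum>b\<in>{1..<n}. tv ^ area n ?w * (\<Prod>i\<in>{1..<n} - {b}. 1 / tv ^ row_area ?w i))"
      by (simp add: sum_distrib_left)
    also have "\<dots> = (\<Sum>b\<in>{1..<n}. tv ^ b)"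
    proof (rule sum.cong)
      fix b assume b: "b \<in> {1..<n}"
      have eq: "{..<n} - ({1..<n} - {b}) = {0, b}" using b by auto
      have "{1..<n} - {b} \<subseteq> {..<n}" by auto
      from area_cancel[OF this] show "tv ^ area n ?w * (\<Prod>i\<in>{1..<n} - {b}. 1 / tv ^ row_area ?w i) = tv ^ b"
        using b by (simp only: eq) (simp add: row_area_step_path)
    qed simp
    also have "{1..<n} = {1..n - 1}" by auto
    finally have "rise_weight n 1 ?w l = (\<Sum>a=1..n - 1. tv ^ a)" for l
      by (simp add: rise_weight_def dinv_full)
    then show ?thesis
      using bij_betw_same_card[OF column_words_bij[OF order_refl assms(2)]] by (simp add: mult.commute)
  qed
  also have "(\<Sum>p\<in>J. \<Sum>l\<in>column_words n (fst p) M. rise_weight n 1 (W p) l) =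
      (\<Sum>p\<in>J. tv ^ snd p * qv ^ min (n - fst p) (fst p - 1 - snd p) *
         (\<Sum>(A, B)\<in>col_pairs M (fst p). qv ^ col_crossings (snd p) A B))"
  proof (rule sum.cong)
    fix p assume "p \<in> J"
    then obtain a s where p: "p = (a, s)" "0 < a" "a < n" "s < a" by (auto simp: J_def)
    let ?w = "step_path n a (a - s)"
    have R: "rises n ?w = {1..<n} - {a}" using p by (intro rises_step_path) auto
    then have "n - 1 - 1 = card (rises n ?w)" using p by (simp add: card_Diff_singleton)
    then have "coeff (rise_poly n ?w) (n - 1 - 1) = (\<Prod>i\<in>{1..<n} - {a}. 1 / tv ^ row_area ?w i)"
      using coeff_prod_linear(2)[of "{1..<n} - {a}" "\<lambda>i. 1 / tv ^ row_area ?w i"] by (simp add: rise_poly_rises R)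
    moreover have "tv ^ area n ?w * (\<Prod>i\<in>{1..<n} - {a}. 1 / tv ^ row_area ?w i) = tv ^ s"
    proof -
      have eq: "{..<n} - ({1..<n} - {a}) = {0, a}" using p by auto
      have "{1..<n} - {a} \<subseteq> {..<n}" by auto
      from area_cancel[OF this] show ?thesis using p by (simp only: eq) (simp add: row_area_step_path)
    qed
    ultimately have ta: "tv ^ area n ?w * coeff (rise_poly n ?w) (n - 1 - 1) = tv ^ s" by simp
    have "rise_weight n 1 ?w l = tv ^ s * qv ^ min (n - a) (a - 1 - s) * qv ^ col_crossings s (set (take a l)) (set (drop a l))"
      if "l \<in> column_words n a M" for l
      using ta dinv_step_path[OF p(2,3,4) that] by (simp add: rise_weight_def power_add mult_ac)
    then have "(\<Sum>l\<in>column_words n a M. rise_weight n 1 ?w l) =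
        tv ^ s * qv ^ min (n - a) (a - 1 - s) * (\<Sum>l\<in>column_words n a M. qv ^ col_crossings s (set (take a l)) (set (drop a l)))"
      by (simp add: sum_distrib_left)
    then show "(\<Sum>l\<in>column_words n (fst p) M. rise_weight n 1 (W p) l) =
        tv ^ snd p * qv ^ min (n - fst p) (fst p - 1 - snd p) *
         (\<Sum>(A, B)\<in>col_pairs M (fst p). qv ^ col_crossings (snd p) A B)"
      using p sum_column_words[OF less_imp_le[OF p(3)] assms(2), of "\<lambda>A B. qv ^ col_crossings s A B"]
      by (simp add: W_def)
  qed simp
  also have "\<dots> = (\<Sum>a=1..n - 1. \<Sum>s<a. tv ^ s * qv ^ min (n - a) (a - 1 - s) *
       (\<Sum>(A, B)\<in>col_pairs M a. qv ^ col_crossings s A B))"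
    unfolding J_def by (subst sum.Sigma) (auto simp: case_prod_beta)
  finally show ?thesis .
qed

lemma Rise_degree:
  assumes "size M \<noteq> n"
  shows "coef (Rise n k) M = 0"
proof -
  have "{(w, l) \<in> labeled_dyck n. mset l = M} = {}" using assms by (auto simp: labeled_dyck_def)
  then show ?thesis unfolding Rise_def coef_Series by (simp only: sum.empty if_cancel)
qed

lemma Rise_0_elem:
  assumes "0 < n"
  shows "Rise n 0 = elem n"
proof (rule series_eqI)
  fix M
  show "coef (Rise n 0) M = coef (elem n) M"
  proof (cases "size M = n")
    case True
    have "coef (elem n * elem (n - n) :: qt_field series) M = of_nat (card (col_pairs M n))"
      by (rule coef_elem_mult[OF True order_refl])
    then show ?thesis using Rise_0_coef[OF assms True] by simp
  next
    case False
    then show ?thesis by (simp add: Rise_degree elem_def)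
  qed
qed

text \<open>At each monomial of degree \<open>n\<close> both sides are linear in the numbers of
  column pairs, and \<open>column_identity\<close> compares them with these numbers as its
  unknowns.\<close>

lemma Rise_sum:
  assumes "0 < n"
  shows "Rise n 0 + Rise n 1 = (\<Sum>k=1..n. scale (qt_int k) (elem k * elem (n - k)))"
proof (rule series_eqI)
  fix M
  show "coef (Rise n 0 + Rise n 1) M = coef (\<Sum>k=1..n. scale (qt_int k) (elem k * elem (n - k))) M"
  proof (cases "size M = n")
    case False
    have "coef (elem k * elem (n - k) :: qt_field series) M = 0" if "k \<in> {1..n}" for k
      using homog_mult[OF elem_homog[of k] elem_homog[of "n - k"]] that False by (auto simp: homog_def)
    then show ?thesis using False by (simp add: Rise_degree)
  next
    case True
    define \<epsilon> where "\<epsilon> k = (of_nat (card (col_pairs M k)) :: qt_field)" for k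
    have \<epsilon>0: "\<epsilon> k = 0" if "n < k" for k
    proof -
      have "col_pairs M k = {}" using col_pairs_props(4)[of _ _ M k] True that by fastforce
      then show ?thesis by (simp add: \<epsilon>_def)
    qed
    have gen: "(\<Sum>(A, B)\<in>col_pairs M a. qv ^ col_crossings s A B) =
        \<epsilon> a + (\<Sum>c<Suc n. (qv ^ Suc c - qv ^ c) * \<epsilon> (max a (n - a + s) + Suc c))" for a s
      unfolding \<epsilon>_def by (rule col_crossings_gen[OF True]) simp
    have R1: "coef (Rise n 1) M = (\<Sum>a=1..n - 1. tv ^ a) * \<epsilon> n +
        (\<Sum>a=1..n - 1. \<Sum>s<a. tv ^ s * qv ^ min (n - a) (a - 1 - s) *
          (\<epsilon> a + (\<Sum>c<Suc n. (qv ^ Suc c - qv ^ c) * \<epsilon> (max a (n - a + s) + Suc c))))"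
    proof (cases "n = 1")
      case True
      then show ?thesis by (simp add: Rise_def)
    next
      case False
      then have "1 < n" using assms by simp
      from Rise_1_coef[OF this True] show ?thesis unfolding gen \<epsilon>_def[symmetric] .
    qed
    \<comment> \<open>\<open>Rise n 0\<close> supplies the summand with exponent 0 that
      \<open>Rise n 1\<close> lacks.\<close>
    have "(\<Sum>s<n. tv ^ s * \<epsilon> n) = \<epsilon> n + (\<Sum>a=1..n - 1. tv ^ a) * \<epsilon> n"
    proof -
      have "{..<n} = insert 0 {1..n - 1}" using assms by auto
      then show ?thesis by (simp add: sum_distrib_right)
    qed
    then have "coef (Rise n 0 + Rise n 1) M = (\<Sum>s<n. tv ^ s * \<epsilon> n) + (\<Sum>a=1..n - 1. \<Sum>s<a. tv ^ s * qv ^ min (n - a) (a - 1 - s) *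
          (\<epsilon> a + (\<Sum>c<Suc n. (qv ^ Suc c - qv ^ c) * \<epsilon> (max a (n - a + s) + Suc c))))"
      unfolding coef_add R1 Rise_0_coef[OF assms True] by (simp add: \<epsilon>_def)
    also have "\<dots> = (\<Sum>k=1..n. (\<Sum>i<k. qv ^ i * tv ^ (k - i - 1)) * \<epsilon> k)"
      by (rule column_identity[symmetric]) (rule \<epsilon>0)
    also have "\<dots> = coef (\<Sum>k=1..n. scale (qt_int k) (elem k * elem (n - k))) M"
      unfolding coef_sum by (rule sum.cong) (simp_all add: qt_int_def \<epsilon>_def coef_elem_mult[OF True])
    finally show ?thesis .
  qed
qed

theorem theorem6p1:
  fixes n :: nat and H :: "nat list \<Rightarrow> qt_field series"
  assumes "n > 0" and "modified_macdonald H"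
  shows "Delta H (elem 1) (elem n) = Rise n 0 + Rise n 1 \<and>
    Rise n 0 + Rise n 1 =
      (\<Sum>m = 0..n div 2. scale (\<Sum>p = m..n - m. qt_int p) (schur (replicate m 2 @ replicate (n - 2 * m) 1))) \<and>
    (n > 1 \<longrightarrow> Delta' H (elem 1) (elem n) = Rise n 1)"
proof (intro conjI impI)
  show D: "Delta H (elem 1) (elem n) = Rise n 0 + Rise n 1"
    by (simp only: Delta_elem(1)[OF assms(2)] Rise_sum[OF assms(1)])
  have "qt_int 0 = 0" by (simp add: qt_int_def)
  from schur_expansion[of qt_int, OF this, of n]
  show "Rise n 0 + Rise n 1 =
      (\<Sum>m = 0..n div 2. scale (\<Sum>p = m..n - m. qt_int p) (schur (replicate m 2 @ replicate (n - 2 * m) 1)))"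
    unfolding Rise_sum[OF assms(1)] two_col_def by simp
  \<comment> \<open>Removing the corner cell subtracts the argument \<open>elem n\<close>, which is
    \<open>Rise n 0\<close>.\<close>
  show "Delta' H (elem 1) (elem n) = Rise n 1"
    using D by (simp only: Delta_elem(2)[OF assms(2,1)] Rise_0_elem[OF assms(1)]) simp
qed

end
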